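(* Let $\Omega$ be a Hausdorff locally compact space, let $\mathcal{U}=\{\Omega,A_t,\Theta\}$ be a locally trivial continuous field of Banach algebras such that every $A_t$ has an identity $e_{A_t}$, $t\in\Omega$, and $\sup_{t\in\Omega}\|e_{A_t}\|\le C$ for some constant $C$, and let the Banach algebra $\mathcal{A}$ be defined by $\mathcal{U}$. Then the following conditions are equivalent: (i) $\Omega$ is paracompact; (ii) $\mathcal{A}$ is left projective; (iii) $\mathcal{A}$ is left projective and $\mathcal{U}$ is a disjoint union of $\sigma$-locally trivial continuous fields of Banach algebras; (iv) $\mathcal{H}^2(\mathcal{A},X)=\{0\}$ for any right annihilator Banach $\mathcal{A}$-bimodule $X$.
   Context: Continuous fields. A continuous field of Banach algebras is a triple $\mathcal{U}=\{\Omega,A_t,\Theta\}$ where $\Omega$ is a locally compact Hausdorff space, $(A_t)_{t\in\Omega}$ is a family of Banach algebras, and $\Theta$ is a subalgebra of $\prod_{t\in\Omega}A_t$ such that: (i) for every $t\in\Omega$ the set $\{x(t):x\in\Theta\}$ is dense in $A_t$; (ii) for every $x\in\Theta$ the function $t\mapsto\|x(t)\|$ is continuous on $\Omega$; (iii) if $x\in\prod_{t}A_t$ and for every $t\in\Omega$ and every $\varepsilon>0$ there is $x'\in\Theta$ with $\|x(s)-x'(s)\|\le\varepsilon$ for all $s$ in some neighbourhood of $t$, then $x\in\Theta$. The Banach algebra $\mathcal{A}$ defined by $\mathcal{U}$ is the set of $x\in\Theta$ such that $t\mapsto\|x(t)\|$ vanishes at infinity on $\Omega$, with pointwise operations and norm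 $\|x\|=\sup_t\|x(t)\|$. For $Y\subseteq\Omega$, the induced field is $\mathcal{U}|_Y=\{Y,(A_t)_{t\in Y},\Theta|_Y\}$, where $\Theta|_Y$ is the set of $x\in\prod_{t\in Y}A_t$ such that for every $t_0\in Y$ and $\varepsilon>0$ there is $x'\in\Theta$ with $\|x(t)-x'(t)\|\le\varepsilon$ for all $t\in Y$ in some neighbourhood of $t_0$. An isomorphism of fields over the same space is a family of isometric algebra isomorphisms $\phi_t:A_t\to A'_t$ carrying $\Theta$ into $\Theta'$. The constant field over $\Omega$ defined by a Banach algebra $A$ has $A_t=A$ for all $t$ and $\Theta$ equal to the algebra of all continuous maps $\Omega\to A$. A field is trivial if it is isomorphic to a constant field, and locally trivial if every point of $\Omega$ has a neighbourhood $V$ such that $\mathcal{U}|_V$ is trivial. A continuous field $\mathcal{V}$ over a locally compact Hausdorff space $W$ is $\sigma$-locally trivial if there is an open cover $\{U_\alpha\}$ of $W$ such that each $\mathcal{V}|_{U_\alpha}$ is trivial and, in addition, there is a countable open cover $\{V_j\}$ of $W$ such that for each $j$ one has $\overline{V_j}\subset U_{\alpha(j)}$ for some index $\alpha(j)$. If $\Omega$ is a disjoint union of a family of open subsets $\{W_\mu\}_{\mu\in\mathcal{M}}$, then $\mathcal{U}$ is said to be a disjoint union of the fields $\mathcal{U}|_{W_\mu}$, $\mu\in\mathcal{M}$. Projectivity. A Banach algebra $B$ is left projective if it is projective as a left Banach module over itself, where a left Banach $B$-module $P$ is projective if every epimorphism of left Banach $B$-modules $\varphi:Y\to P$ that has a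 right inverse as a morphism of Banach spaces has a right inverse that is a module morphism. Equivalently for $P=B$: there is a morphism of left Banach $B$-modules $\rho:B\to B_+\widehat{\otimes}B$ with $\pi\circ\rho=\mathrm{id}_B$, where $B_+$ is $B$ with an identity adjoined, $\widehat{\otimes}$ is the projective tensor product, and $\pi(a\otimes b)=ab$. $\mathcal{H}^n(\mathcal{A},X)$ is the $n$th continuous Hochschild cohomology group of $\mathcal{A}$ with coefficients in a Banach $\mathcal{A}$-bimodule $X$, i.e. the cohomology of the complex of bounded $n$-linear maps $\mathcal{A}^n\to X$ with the usual Hochschild coboundary. $X$ is right annihilator if $x\cdot a=0$ for all $x\in X$, $a\in\mathcal{A}$. A Hausdorff topological space is paracompact if every open cover has an open locally finite refinement that is also a cover.
   Formalization: Each identity e_{A_t} is assumed nonzero (the fibres A_t are nonzero algebras); if all A_t = 0 were allowed, the algebra would be 0 and left projective over a non-paracompact Ω. *)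

theory Defs
  imports
    "HOL-Analysis.Analysis"
    "HOL-Algebra.Module"
    "HOL-Algebra.Elementary_Groups"
begin

section \<open>Banach spaces and Banach algebras on a carrier\<close>

definition complex_ring :: "complex ring" where
  "complex_ring = \<lparr>carrier = UNIV, monoid.mult = (*), one = 1, zero = 0, add = (+)\<rparr>"

text \<open>
  The fibres of a field vary with the point, so normed structures are given by a carrier set inside
  a type, on top of the modules of HOL-Algebra. The field \<open>one\<close> inherited from
  rings is never used (our algebras need not have an identity), and \<open>mult\<close> is used
  only for algebras, not for Banach spaces and modules.
\<close>

record 'a cnormed = "(complex, 'a) module" +
  vnorm :: "'a \<Rightarrow> real"

text \<open>
  The case distinction is there because the locale \<open>Metric_space\<close> requires distances
  to be symmetric and nonnegative also outside the carrier.
\<close>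

definition ndist :: "'a cnormed \<Rightarrow> 'a \<Rightarrow> 'a \<Rightarrow> real" where
  "ndist V x y = (if x \<in> carrier V \<and> y \<in> carrier V then vnorm V (x \<ominus>\<^bsub>V\<^esub> y) else 0)"

definition ntopology :: "'a cnormed \<Rightarrow> 'a topology" where
  "ntopology V = Metric_space.mtopology (carrier V) (ndist V)"

locale banach_space = module complex_ring V
  for V :: "'a cnormed" +
  assumes vnorm_nonneg: "x \<in> carrier V \<Longrightarrow> 0 \<le> vnorm V x"
    and vnorm_eq_0_iff: "x \<in> carrier V \<Longrightarrow> vnorm V x = 0 \<longleftrightarrow> x = \<zero>\<^bsub>V\<^esub>"
    and vnorm_triangle:
      "x \<in> carrier V \<Longrightarrow> y \<in> carrier V \<Longrightarrow> vnorm V (x \<oplus>\<^bsub>V\<^esub> y) \<le> vnorm V x + vnorm V y"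
    and vnorm_smult: "x \<in> carrier V \<Longrightarrow> vnorm V (c \<odot>\<^bsub>V\<^esub> x) = cmod c * vnorm V x"
    and complete: "Metric_space.mcomplete (carrier V) (ndist V)"

locale banach_algebra = banach_space A
  for A :: "'a cnormed" +
  assumes mult_closed:
      "a \<in> carrier A \<Longrightarrow> b \<in> carrier A \<Longrightarrow> a \<otimes>\<^bsub>A\<^esub> b \<in> carrier A"
    and mult_assoc:
      "a \<in> carrier A \<Longrightarrow> b \<in> carrier A \<Longrightarrow> c \<in> carrier A \<Longrightarrow>
        (a \<otimes>\<^bsub>A\<^esub> b) \<otimes>\<^bsub>A\<^esub> c = a \<otimes>\<^bsub>A\<^esub> (b \<otimes>\<^bsub>A\<^esub> c)"
    and mult_distrib_left:
      "a \<in> carrier A \<Longrightarrow> b \<in> carrier A \<Longrightarrow> c \<in> carrier A \<Longrightarrow>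
        a \<otimes>\<^bsub>A\<^esub> (b \<oplus>\<^bsub>A\<^esub> c) = a \<otimes>\<^bsub>A\<^esub> b \<oplus>\<^bsub>A\<^esub> a \<otimes>\<^bsub>A\<^esub> c"
    and mult_distrib_right:
      "a \<in> carrier A \<Longrightarrow> b \<in> carrier A \<Longrightarrow> c \<in> carrier A \<Longrightarrow>
        (a \<oplus>\<^bsub>A\<^esub> b) \<otimes>\<^bsub>A\<^esub> c = a \<otimes>\<^bsub>A\<^esub> c \<oplus>\<^bsub>A\<^esub> b \<otimes>\<^bsub>A\<^esub> c"
    and smult_mult_left:
      "a \<in> carrier A \<Longrightarrow> b \<in> carrier A \<Longrightarrow> (z \<odot>\<^bsub>A\<^esub> a) \<otimes>\<^bsub>A\<^esub> b = z \<odot>\<^bsub>A\<^esub> (a \<otimes>\<^bsub>A\<^esub> b)"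
    and smult_mult_right:
      "a \<in> carrier A \<Longrightarrow> b \<in> carrier A \<Longrightarrow> a \<otimes>\<^bsub>A\<^esub> (z \<odot>\<^bsub>A\<^esub> b) = z \<odot>\<^bsub>A\<^esub> (a \<otimes>\<^bsub>A\<^esub> b)"
    and vnorm_mult:
      "a \<in> carrier A \<Longrightarrow> b \<in> carrier A \<Longrightarrow> vnorm A (a \<otimes>\<^bsub>A\<^esub> b) \<le> vnorm A a * vnorm A b"

definition is_identity :: "'a cnormed \<Rightarrow> 'a \<Rightarrow> bool" where
  "is_identity A e \<longleftrightarrow>
     e \<in> carrier A \<and> (\<forall>a\<in>carrier A. e \<otimes>\<^bsub>A\<^esub> a = a \<and> a \<otimes>\<^bsub>A\<^esub> e = a)"

definition linear_map :: "'a cnormed \<Rightarrow> 'b cnormed \<Rightarrow> ('a \<Rightarrow> 'b) \<Rightarrow> bool" where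
  "linear_map V W f \<longleftrightarrow>
     f \<in> carrier V \<rightarrow> carrier W \<and>
     (\<forall>x\<in>carrier V. \<forall>y\<in>carrier V. f (x \<oplus>\<^bsub>V\<^esub> y) = f x \<oplus>\<^bsub>W\<^esub> f y) \<and>
     (\<forall>c. \<forall>x\<in>carrier V. f (c \<odot>\<^bsub>V\<^esub> x) = c \<odot>\<^bsub>W\<^esub> f x)"

definition bounded_linear_map :: "'a cnormed \<Rightarrow> 'b cnormed \<Rightarrow> ('a \<Rightarrow> 'b) \<Rightarrow> bool" where
  "bounded_linear_map V W f \<longleftrightarrow>
     linear_map V W f \<and> (\<exists>K. \<forall>x\<in>carrier V. vnorm W (f x) \<le> K * vnorm V x)"

definition isometric_algebra_iso :: "'a cnormed \<Rightarrow> 'b cnormed \<Rightarrow> ('a \<Rightarrow> 'b) \<Rightarrow> bool" where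
  "isometric_algebra_iso A B f \<longleftrightarrow>
     linear_map A B f \<and> bij_betw f (carrier A) (carrier B) \<and>
     (\<forall>x\<in>carrier A. \<forall>y\<in>carrier A. f (x \<otimes>\<^bsub>A\<^esub> y) = f x \<otimes>\<^bsub>B\<^esub> f y) \<and>
     (\<forall>x\<in>carrier A. vnorm B (f x) = vnorm A x)"


section \<open>Continuous fields\<close>

record ('t, 'a) alg_field =
  base :: "'t topology"
  fibre :: "'t \<Rightarrow> 'a cnormed"
  sections :: "('t \<Rightarrow> 'a) set"

text \<open>Elements of products over a set of points are functions that are \<open>undefined\<close> off that set.\<close>

abbreviation section_space :: "('t \<Rightarrow> 'a cnormed) \<Rightarrow> 't set \<Rightarrow> ('t \<Rightarrow> 'a) set" where
  "section_space A Y \<equiv> (\<Pi>\<^sub>E t\<in>Y. carrier (A t))"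

definition locally_approximated ::
    "'t topology \<Rightarrow> ('t \<Rightarrow> 'a cnormed) \<Rightarrow> ('t \<Rightarrow> 'a) set \<Rightarrow> 't set \<Rightarrow> ('t \<Rightarrow> 'a) set" where
  "locally_approximated \<Omega> A \<Theta> Y =
     {x \<in> section_space A Y.
        \<forall>t\<in>Y. \<forall>\<epsilon>>0. \<exists>x'\<in>\<Theta>. \<exists>N. openin (subtopology \<Omega> Y) N \<and> t \<in> N \<and>
          (\<forall>s\<in>N. vnorm (A s) (x s \<ominus>\<^bsub>A s\<^esub> x' s) \<le> \<epsilon>)}"

locale continuous_field =
  fixes U :: "('t, 'a) alg_field"
  assumes locally_compact: "locally_compact_space (base U)"
    and Hausdorff: "Hausdorff_space (base U)"
    and banach_fibre: "t \<in> topspace (base U) \<Longrightarrow> banach_algebra (fibre U t)"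
    and sections_subset: "sections U \<subseteq> section_space (fibre U) (topspace (base U))"
    and zero_section: "(\<lambda>t\<in>topspace (base U). \<zero>\<^bsub>fibre U t\<^esub>) \<in> sections U"
    and add_section: "x \<in> sections U \<Longrightarrow> y \<in> sections U \<Longrightarrow>
      (\<lambda>t\<in>topspace (base U). x t \<oplus>\<^bsub>fibre U t\<^esub> y t) \<in> sections U"
    and smult_section: "x \<in> sections U \<Longrightarrow>
      (\<lambda>t\<in>topspace (base U). c \<odot>\<^bsub>fibre U t\<^esub> x t) \<in> sections U"
    and mult_section: "x \<in> sections U \<Longrightarrow> y \<in> sections U \<Longrightarrow>
      (\<lambda>t\<in>topspace (base U). x t \<otimes>\<^bsub>fibre U t\<^esub> y t) \<in> sections U"
    and dense_values: "t \<in> topspace (base U) \<Longrightarrow>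
      ntopology (fibre U t) closure_of ((\<lambda>x. x t) ` sections U) = carrier (fibre U t)"
    and continuous_vnorm: "x \<in> sections U \<Longrightarrow>
      continuous_map (base U) euclideanreal (\<lambda>t. vnorm (fibre U t) (x t))"
    and approximated_section:
      "locally_approximated (base U) (fibre U) (sections U) (topspace (base U)) \<subseteq> sections U"

definition vanishes_at_infinity :: "'t topology \<Rightarrow> ('t \<Rightarrow> real) \<Rightarrow> bool" where
  "vanishes_at_infinity \<Omega> f \<longleftrightarrow>
     (\<forall>\<epsilon>>0. \<exists>K. compactin \<Omega> K \<and> (\<forall>t\<in>topspace \<Omega> - K. \<bar>f t\<bar> < \<epsilon>))"

text \<open>The inserted \<open>0\<close> matters only when the base is empty.\<close>

definition field_algebra :: "('t, 'a) alg_field \<Rightarrow> ('t \<Rightarrow> 'a) cnormed" where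
  "field_algebra U =
     \<lparr>carrier = {x \<in> sections U. vanishes_at_infinity (base U) (\<lambda>t. vnorm (fibre U t) (x t))},
      monoid.mult = (\<lambda>x y. \<lambda>t\<in>topspace (base U). x t \<otimes>\<^bsub>fibre U t\<^esub> y t),
      one = (\<lambda>t\<in>topspace (base U). \<one>\<^bsub>fibre U t\<^esub>),
      zero = (\<lambda>t\<in>topspace (base U). \<zero>\<^bsub>fibre U t\<^esub>),
      add = (\<lambda>x y. \<lambda>t\<in>topspace (base U). x t \<oplus>\<^bsub>fibre U t\<^esub> y t),
      smult = (\<lambda>c x. \<lambda>t\<in>topspace (base U). c \<odot>\<^bsub>fibre U t\<^esub> x t),
      vnorm = (\<lambda>x. Sup (insert 0 ((\<lambda>t. vnorm (fibre U t) (x t)) ` topspace (base U))))\<rparr>"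

definition induced_field :: "('t, 'a) alg_field \<Rightarrow> 't set \<Rightarrow> ('t, 'a) alg_field" where
  "induced_field U Y =
     \<lparr>base = subtopology (base U) Y,
      fibre = fibre U,
      sections = locally_approximated (base U) (fibre U) (sections U) Y\<rparr>"

definition isomorphic_fields :: "('t, 'a) alg_field \<Rightarrow> ('t, 'b) alg_field \<Rightarrow> bool" where
  "isomorphic_fields U U' \<longleftrightarrow>
     base U = base U' \<and>
     (\<exists>\<phi>. (\<forall>t\<in>topspace (base U). isometric_algebra_iso (fibre U t) (fibre U' t) (\<phi> t)) \<and>
          (\<forall>x\<in>sections U. (\<lambda>t\<in>topspace (base U). \<phi> t (x t)) \<in> sections U'))"

definition constant_field :: "'t topology \<Rightarrow> 'a cnormed \<Rightarrow> ('t, 'a) alg_field" where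
  "constant_field \<Omega> A =
     \<lparr>base = \<Omega>,
      fibre = (\<lambda>_. A),
      sections = {x \<in> extensional (topspace \<Omega>). continuous_map \<Omega> (ntopology A) x}\<rparr>"

text \<open>
  Taking \<open>A\<close> over the type of the fibres is no restriction: over a nonempty base,
  \<open>A\<close> is isometrically isomorphic to each fibre.
\<close>

definition trivial_field :: "('t, 'a) alg_field \<Rightarrow> bool" where
  "trivial_field U \<longleftrightarrow>
     (\<exists>A :: 'a cnormed. banach_algebra A \<and> isomorphic_fields U (constant_field (base U) A))"

definition locally_trivial_field :: "('t, 'a) alg_field \<Rightarrow> bool" where
  "locally_trivial_field U \<longleftrightarrow>
     (\<forall>t\<in>topspace (base U). \<exists>N V. openin (base U) N \<and> t \<in> N \<and> N \<subseteq> V \<and>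
        V \<subseteq> topspace (base U) \<and> trivial_field (induced_field U V))"

definition sigma_locally_trivial_field :: "('t, 'a) alg_field \<Rightarrow> bool" where
  "sigma_locally_trivial_field U \<longleftrightarrow>
     (\<exists>\<U>. (\<forall>W\<in>\<U>. openin (base U) W \<and> trivial_field (induced_field U W)) \<and>
          \<Union>\<U> = topspace (base U) \<and>
          (\<exists>\<V>. countable \<V> \<and> (\<forall>V\<in>\<V>. openin (base U) V) \<and> \<Union>\<V> = topspace (base U) \<and>
               (\<forall>V\<in>\<V>. \<exists>W\<in>\<U>. base U closure_of V \<subseteq> W)))"

definition disjoint_union_of_fields ::
    "(('t, 'a) alg_field \<Rightarrow> bool) \<Rightarrow> ('t, 'a) alg_field \<Rightarrow> bool" where
  "disjoint_union_of_fields P U \<longleftrightarrow>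
     (\<exists>\<W>. (\<forall>W\<in>\<W>. openin (base U) W) \<and> disjoint \<W> \<and> \<Union>\<W> = topspace (base U) \<and>
          (\<forall>W\<in>\<W>. P (induced_field U W)))"

definition paracompact_space :: "'t topology \<Rightarrow> bool" where
  "paracompact_space X \<longleftrightarrow>
     Hausdorff_space X \<and>
     (\<forall>\<U>. (\<forall>U\<in>\<U>. openin X U) \<and> \<Union>\<U> = topspace X \<longrightarrow>
        (\<exists>\<V>. (\<forall>V\<in>\<V>. openin X V) \<and> \<Union>\<V> = topspace X \<and>
             (\<forall>V\<in>\<V>. \<exists>U\<in>\<U>. V \<subseteq> U) \<and> locally_finite_in X \<V>))"


section \<open>Banach modules and projectivity\<close>

text \<open>A module is a Banach space \<open>Y\<close> together with an action, which is passed separately.\<close>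

locale left_banach_module = banach_space Y
  for B :: "'b cnormed" and Y :: "'y cnormed" and act :: "'b \<Rightarrow> 'y \<Rightarrow> 'y" +
  assumes act_closed: "b \<in> carrier B \<Longrightarrow> y \<in> carrier Y \<Longrightarrow> act b y \<in> carrier Y"
    and act_add_left: "b \<in> carrier B \<Longrightarrow> c \<in> carrier B \<Longrightarrow> y \<in> carrier Y \<Longrightarrow>
      act (b \<oplus>\<^bsub>B\<^esub> c) y = act b y \<oplus>\<^bsub>Y\<^esub> act c y"
    and act_add_right: "b \<in> carrier B \<Longrightarrow> y \<in> carrier Y \<Longrightarrow> z \<in> carrier Y \<Longrightarrow>
      act b (y \<oplus>\<^bsub>Y\<^esub> z) = act b y \<oplus>\<^bsub>Y\<^esub> act b z"
    and act_smult_left: "b \<in> carrier B \<Longrightarrow> y \<in> carrier Y \<Longrightarrow>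
      act (k \<odot>\<^bsub>B\<^esub> b) y = k \<odot>\<^bsub>Y\<^esub> act b y"
    and act_smult_right: "b \<in> carrier B \<Longrightarrow> y \<in> carrier Y \<Longrightarrow>
      act b (k \<odot>\<^bsub>Y\<^esub> y) = k \<odot>\<^bsub>Y\<^esub> act b y"
    and act_mult: "b \<in> carrier B \<Longrightarrow> c \<in> carrier B \<Longrightarrow> y \<in> carrier Y \<Longrightarrow>
      act (b \<otimes>\<^bsub>B\<^esub> c) y = act b (act c y)"
    and act_bounded: "\<exists>K. \<forall>b\<in>carrier B. \<forall>y\<in>carrier Y. vnorm Y (act b y) \<le> K * vnorm B b * vnorm Y y"

locale right_banach_module = banach_space Y
  for B :: "'b cnormed" and Y :: "'y cnormed" and act :: "'y \<Rightarrow> 'b \<Rightarrow> 'y" +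
  assumes act_closed: "y \<in> carrier Y \<Longrightarrow> b \<in> carrier B \<Longrightarrow> act y b \<in> carrier Y"
    and act_add_left: "y \<in> carrier Y \<Longrightarrow> z \<in> carrier Y \<Longrightarrow> b \<in> carrier B \<Longrightarrow>
      act (y \<oplus>\<^bsub>Y\<^esub> z) b = act y b \<oplus>\<^bsub>Y\<^esub> act z b"
    and act_add_right: "y \<in> carrier Y \<Longrightarrow> b \<in> carrier B \<Longrightarrow> c \<in> carrier B \<Longrightarrow>
      act y (b \<oplus>\<^bsub>B\<^esub> c) = act y b \<oplus>\<^bsub>Y\<^esub> act y c"
    and act_smult_left: "y \<in> carrier Y \<Longrightarrow> b \<in> carrier B \<Longrightarrow>
      act (k \<odot>\<^bsub>Y\<^esub> y) b = k \<odot>\<^bsub>Y\<^esub> act y b"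
    and act_smult_right: "y \<in> carrier Y \<Longrightarrow> b \<in> carrier B \<Longrightarrow>
      act y (k \<odot>\<^bsub>B\<^esub> b) = k \<odot>\<^bsub>Y\<^esub> act y b"
    and act_mult: "y \<in> carrier Y \<Longrightarrow> b \<in> carrier B \<Longrightarrow> c \<in> carrier B \<Longrightarrow>
      act y (b \<otimes>\<^bsub>B\<^esub> c) = act (act y b) c"
    and act_bounded: "\<exists>K. \<forall>y\<in>carrier Y. \<forall>b\<in>carrier B. vnorm Y (act y b) \<le> K * vnorm Y y * vnorm B b"

locale banach_bimodule =
  left: left_banach_module B X lact + right: right_banach_module B X ract
  for B :: "'b cnormed" and X :: "'x cnormed"
    and lact :: "'b \<Rightarrow> 'x \<Rightarrow> 'x" and ract :: "'x \<Rightarrow> 'b \<Rightarrow> 'x" +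
  assumes act_commute: "b \<in> carrier B \<Longrightarrow> x \<in> carrier X \<Longrightarrow> c \<in> carrier B \<Longrightarrow>
    ract (lact b x) c = lact b (ract x c)"

definition right_annihilator :: "'b cnormed \<Rightarrow> 'x cnormed \<Rightarrow> ('x \<Rightarrow> 'b \<Rightarrow> 'x) \<Rightarrow> bool" where
  "right_annihilator B X ract \<longleftrightarrow> (\<forall>x\<in>carrier X. \<forall>b\<in>carrier B. ract x b = \<zero>\<^bsub>X\<^esub>)"

definition module_morphism ::
    "'b cnormed \<Rightarrow> 'y cnormed \<Rightarrow> ('b \<Rightarrow> 'y \<Rightarrow> 'y) \<Rightarrow> 'z cnormed \<Rightarrow> ('b \<Rightarrow> 'z \<Rightarrow> 'z) \<Rightarrow>
     ('y \<Rightarrow> 'z) \<Rightarrow> bool" where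
  "module_morphism B Y actY Z actZ f \<longleftrightarrow>
     bounded_linear_map Y Z f \<and>
     (\<forall>b\<in>carrier B. \<forall>y\<in>carrier Y. f (actY b y) = actZ b (f y))"

text \<open>
  The lifting property quantifies over modules \<open>Y\<close>, so it needs a type in which their
  carriers live; this is the \<open>TYPE\<close> argument.
\<close>

definition projective_module ::
    "'y itself \<Rightarrow> 'b cnormed \<Rightarrow> 'p cnormed \<Rightarrow> ('b \<Rightarrow> 'p \<Rightarrow> 'p) \<Rightarrow> bool" where
  "projective_module _ B P actP \<longleftrightarrow>
     (\<forall>(Y :: 'y cnormed) actY \<phi>.
        left_banach_module B Y actY \<and> module_morphism B Y actY P actP \<phi> \<and>
        \<phi> ` carrier Y = carrier P \<and>
        (\<exists>\<sigma>. bounded_linear_map P Y \<sigma> \<and> (\<forall>p\<in>carrier P. \<phi> (\<sigma> p) = p)) \<longrightarrow>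
        (\<exists>\<rho>. module_morphism B P actP Y actY \<rho> \<and> (\<forall>p\<in>carrier P. \<phi> (\<rho> p) = p)))"

definition left_projective :: "'y itself \<Rightarrow> 'b cnormed \<Rightarrow> bool" where
  "left_projective T B \<longleftrightarrow> projective_module T B B (monoid.mult B)"

text \<open>
  The type used for the carriers of modules over an algebra \<open>\<A>\<close> of sections. Up to
  isomorphism it contains the scalars and the elements of \<open>\<A>\<close>, and it is closed under
  countable sequences, hence large enough for direct sums with \<open>\<A>\<close> and for
  projective tensor products such as that of the unitization of \<open>\<A>\<close> with \<open>\<A>\<close>: their
  elements are represented by countable series of elementary tensors. So projectivity tested
  on modules in this type is projectivity. Moreover the type variable \<open>'x\<close> is free, so
  a theorem about this universe covers modules over any type.
\<close>

type_synonym ('t, 'a, 'x) module_universe = "nat \<Rightarrow> complex + ('t \<Rightarrow> 'a) + 'x"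


section \<open>Continuous Hochschild cohomology\<close>

text \<open>
  Arguments \<open>(a\<^sub>1, \<dots>, a\<^sub>n)\<close> of an \<open>n\<close>-cochain are lists of length \<open>n\<close>; cochains are
  \<open>undefined\<close> elsewhere.
\<close>

definition tuples :: "'b cnormed \<Rightarrow> nat \<Rightarrow> 'b list set" where
  "tuples A n = {as. length as = n \<and> set as \<subseteq> carrier A}"

definition cochains :: "'b cnormed \<Rightarrow> 'x cnormed \<Rightarrow> nat \<Rightarrow> ('b list \<Rightarrow> 'x) set" where
  "cochains A X n =
     {f \<in> tuples A n \<rightarrow>\<^sub>E carrier X.
        (\<forall>as\<in>tuples A n. \<forall>i<n. \<forall>a\<in>carrier A. \<forall>b\<in>carrier A.
           f (as[i := a \<oplus>\<^bsub>A\<^esub> b]) = f (as[i := a]) \<oplus>\<^bsub>X\<^esub> f (as[i := b])) \<and>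
        (\<forall>as\<in>tuples A n. \<forall>i<n. \<forall>k. \<forall>a\<in>carrier A.
           f (as[i := k \<odot>\<^bsub>A\<^esub> a]) = k \<odot>\<^bsub>X\<^esub> f (as[i := a])) \<and>
        (\<exists>K. \<forall>as\<in>tuples A n. vnorm X (f as) \<le> K * (\<Prod>a\<leftarrow>as. vnorm A a))}"

text \<open>\<open>merge A k as\<close> replaces the entries number \<open>k\<close> and \<open>k + 1\<close> (counting from 0) by their product.\<close>

definition merge :: "'b cnormed \<Rightarrow> nat \<Rightarrow> 'b list \<Rightarrow> 'b list" where
  "merge A k as = take k as @ [(as ! k) \<otimes>\<^bsub>A\<^esub> (as ! Suc k)] @ drop (Suc (Suc k)) as"

definition coboundary ::
    "'b cnormed \<Rightarrow> 'x cnormed \<Rightarrow> ('b \<Rightarrow> 'x \<Rightarrow> 'x) \<Rightarrow> ('x \<Rightarrow> 'b \<Rightarrow> 'x) \<Rightarrow> nat \<Rightarrow>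
     ('b list \<Rightarrow> 'x) \<Rightarrow> 'b list \<Rightarrow> 'x" where
  "coboundary A X lact ract n f =
     (\<lambda>as\<in>tuples A (Suc n).
        lact (hd as) (f (tl as)) \<oplus>\<^bsub>X\<^esub>
        (\<Oplus>\<^bsub>X\<^esub>k\<in>{..<n}. (- 1) ^ Suc k \<odot>\<^bsub>X\<^esub> f (merge A k as)) \<oplus>\<^bsub>X\<^esub>
        (- 1) ^ Suc n \<odot>\<^bsub>X\<^esub> ract (f (butlast as)) (last as))"

definition zero_cochain :: "'b cnormed \<Rightarrow> 'x cnormed \<Rightarrow> nat \<Rightarrow> 'b list \<Rightarrow> 'x" where
  "zero_cochain A X n = (\<lambda>as\<in>tuples A n. \<zero>\<^bsub>X\<^esub>)"

text \<open>The additive group of cocycles, written as a \<open>monoid\<close> record so that \<open>Mod\<close> applies.\<close>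

definition cocycle_group ::
    "'b cnormed \<Rightarrow> 'x cnormed \<Rightarrow> ('b \<Rightarrow> 'x \<Rightarrow> 'x) \<Rightarrow> ('x \<Rightarrow> 'b \<Rightarrow> 'x) \<Rightarrow> nat \<Rightarrow>
     ('b list \<Rightarrow> 'x) monoid" where
  "cocycle_group A X lact ract n =
     \<lparr>carrier = {f \<in> cochains A X n. coboundary A X lact ract n f = zero_cochain A X (Suc n)},
      monoid.mult = (\<lambda>f g. \<lambda>as\<in>tuples A n. f as \<oplus>\<^bsub>X\<^esub> g as),
      one = zero_cochain A X n\<rparr>"

definition coboundaries ::
    "'b cnormed \<Rightarrow> 'x cnormed \<Rightarrow> ('b \<Rightarrow> 'x \<Rightarrow> 'x) \<Rightarrow> ('x \<Rightarrow> 'b \<Rightarrow> 'x) \<Rightarrow> nat \<Rightarrow>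
     ('b list \<Rightarrow> 'x) set" where
  "coboundaries A X lact ract n =
     (case n of 0 \<Rightarrow> {zero_cochain A X 0}
      | Suc m \<Rightarrow> coboundary A X lact ract m ` cochains A X m)"

definition hochschild_cohomology ::
    "'b cnormed \<Rightarrow> 'x cnormed \<Rightarrow> ('b \<Rightarrow> 'x \<Rightarrow> 'x) \<Rightarrow> ('x \<Rightarrow> 'b \<Rightarrow> 'x) \<Rightarrow> nat \<Rightarrow>
     ('b list \<Rightarrow> 'x) set monoid" where
  "hochschild_cohomology A X lact ract n =
     cocycle_group A X lact ract n Mod coboundaries A X lact ract n"

end

theory Submission
  imports Defs
begin

text \<open>
  For an extension of left modules \<open>\<phi> : Y \<rightarrow> B\<close> with a bounded linear splitting \<open>\<sigma>\<close>, the map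
  \<open>(a, b) \<mapsto> a \<sigma>(b) - \<sigma>(a b)\<close> is a 2-cocycle with values in the right annihilator bimodule
  \<open>ker \<phi>\<close>, and it is a coboundary iff a module morphism splits \<open>\<phi>\<close>; conversely a 2-cocycle \<open>f\<close> defines the
  module \<open>X \<oplus> B\<close> with \<open>a (x, b) = (a x + f(a, b), a b)\<close>. So (iv) is left projectivity.

  On the topological side, a locally compact Hausdorff space is paracompact iff it carries a
  symmetric reflexive relation with open sections for which the image of every compact set is
  relatively compact. The classes of the equivalence relation that it generates are open and
  \<open>\<sigma>\<close>-compact, which gives the disjoint union of \<open>\<sigma>\<close>-locally trivial fields.
  It also gives functions \<open>g\<^sub>i\<close> of compact support, locally finite, with \<open>\<Sum> g\<^sub>i\<^sup>2 = 1\<close> and \<open>\<Sum> g\<^sub>i \<le> 2\<close>, and the splitting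
  \<open>\<rho>(a) = \<Sum> g\<^sub>i a \<cdot> \<sigma>(g\<^sub>i e)\<close>; the sums are bounded by averaging over signs.

  Conversely, a splitting \<open>\<rho>\<close> of the multiplication of a tensor product yields such a relation:
  \<open>s\<close> and \<open>t\<close> are related if \<open>\<rho>(f e)(s, t)\<close> is not small for cutoff functions \<open>f\<close> with \<open>f s = 1\<close>. As \<open>\<rho>\<close>
  is a module morphism this does not depend on \<open>f\<close>.
\<close>

section \<open>Banach spaces and Banach modules on a carrier\<close>

text \<open>There may be uncountably many \<open>g\<^sub>i\<close>, and the norms of the terms
  \<open>g\<^sub>i a \<cdot> \<sigma>(g\<^sub>i e)\<close> need not be summable, so the triangle
  inequality is useless. Averaging over signs bounds a partial sum by a product of two norms, of a
  signed sum of the \<open>g\<^sub>i a\<close> and of one of the \<open>g\<^sub>i e\<close>. Both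
  are suprema over points, and at a point the bound on \<open>\<Sum> g\<^sub>i\<close> suffices.
  Hence the squares: one factor stays with \<open>a\<close>, the other goes through
  \<open>\<sigma>\<close>.

  For the converse it is enough to have some module with a linearly split product map in which the
  diagonal and the decay in \<open>t\<close> can be read off. Since the fibres vary, a product of a
  value at \<open>s\<close> and a value at \<open>t\<close> makes sense only in a common chart, and
  only such pairs are tested. An identity has norm at least 1, so 1/2 can serve as the threshold for
  "not small".

  Projectivity is tested on modules in one fixed type. The modules that occur, namely functions of
  three points and direct sums with the algebra, therefore have to be injected into that
  type.\<close>

lemma complex_ring_simps [simp]:
  "carrier complex_ring = UNIV" "\<one>\<^bsub>complex_ring\<^esub> = 1" "\<zero>\<^bsub>complex_ring\<^esub> = 0"
  "a \<oplus>\<^bsub>complex_ring\<^esub> b = a + b" "a \<otimes>\<^bsub>complex_ring\<^esub> b = a * b"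
  by (simp_all add: complex_ring_def)

lemma cring_complex_ring: "cring complex_ring"
proof (intro cringI abelian_groupI comm_monoidI)
  fix x :: complex
  show "\<exists>y\<in>carrier complex_ring. y \<oplus>\<^bsub>complex_ring\<^esub> x = \<zero>\<^bsub>complex_ring\<^esub>"
    by (rule bexI[of _ "- x"]) auto
qed (auto simp: algebra_simps)

lemma a_inv_complex_ring [simp]: "\<ominus>\<^bsub>complex_ring\<^esub> c = - c"
proof -
  interpret cring complex_ring by (rule cring_complex_ring)
  have "- c \<oplus>\<^bsub>complex_ring\<^esub> c = \<zero>\<^bsub>complex_ring\<^esub>" by simp
  then show ?thesis
    using sum_zero_eq_neg[of "- c" c] by auto
qed

text \<open>Completeness is assumed for \<open>x \<oplus> (-1) \<odot> y\<close> instead of \<open>x \<ominus> y\<close>,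
  because the latter involves the carrier through the choice of the inverse.\<close>

lemma banach_spaceI:
  assumes add: "\<And>x y. x \<in> carrier V \<Longrightarrow> y \<in> carrier V \<Longrightarrow> x \<oplus>\<^bsub>V\<^esub> y \<in> carrier V"
    and zero: "\<zero>\<^bsub>V\<^esub> \<in> carrier V"
    and smult: "\<And>c x. x \<in> carrier V \<Longrightarrow> c \<odot>\<^bsub>V\<^esub> x \<in> carrier V"
    and assoc: "\<And>x y z. x \<in> carrier V \<Longrightarrow> y \<in> carrier V \<Longrightarrow> z \<in> carrier V \<Longrightarrow>
      (x \<oplus>\<^bsub>V\<^esub> y) \<oplus>\<^bsub>V\<^esub> z = x \<oplus>\<^bsub>V\<^esub> (y \<oplus>\<^bsub>V\<^esub> z)"
    and comm: "\<And>x y. x \<in> carrier V \<Longrightarrow> y \<in> carrier V \<Longrightarrow> x \<oplus>\<^bsub>V\<^esub> y = y \<oplus>\<^bsub>V\<^esub> x"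
    and l_zero: "\<And>x. x \<in> carrier V \<Longrightarrow> \<zero>\<^bsub>V\<^esub> \<oplus>\<^bsub>V\<^esub> x = x"
    and smult_0: "\<And>x. x \<in> carrier V \<Longrightarrow> 0 \<odot>\<^bsub>V\<^esub> x = \<zero>\<^bsub>V\<^esub>"
    and smult_1: "\<And>x. x \<in> carrier V \<Longrightarrow> 1 \<odot>\<^bsub>V\<^esub> x = x"
    and smult_l: "\<And>c d x. x \<in> carrier V \<Longrightarrow> (c + d) \<odot>\<^bsub>V\<^esub> x = c \<odot>\<^bsub>V\<^esub> x \<oplus>\<^bsub>V\<^esub> d \<odot>\<^bsub>V\<^esub> x"
    and smult_r: "\<And>c x y. x \<in> carrier V \<Longrightarrow> y \<in> carrier V \<Longrightarrow>
      c \<odot>\<^bsub>V\<^esub> (x \<oplus>\<^bsub>V\<^esub> y) = c \<odot>\<^bsub>V\<^esub> x \<oplus>\<^bsub>V\<^esub> c \<odot>\<^bsub>V\<^esub> y"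
    and smult_assoc: "\<And>c d x. x \<in> carrier V \<Longrightarrow> (c * d) \<odot>\<^bsub>V\<^esub> x = c \<odot>\<^bsub>V\<^esub> (d \<odot>\<^bsub>V\<^esub> x)"
    and nonneg: "\<And>x. x \<in> carrier V \<Longrightarrow> 0 \<le> vnorm V x"
    and definite: "\<And>x. x \<in> carrier V \<Longrightarrow> vnorm V x = 0 \<Longrightarrow> x = \<zero>\<^bsub>V\<^esub>"
    and triangle: "\<And>x y. x \<in> carrier V \<Longrightarrow> y \<in> carrier V \<Longrightarrow> vnorm V (x \<oplus>\<^bsub>V\<^esub> y) \<le> vnorm V x + vnorm V y"
    and homog: "\<And>c x. x \<in> carrier V \<Longrightarrow> vnorm V (c \<odot>\<^bsub>V\<^esub> x) = cmod c * vnorm V x"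
    and compl: "\<And>\<sigma> :: nat \<Rightarrow> _. (\<And>n. \<sigma> n \<in> carrier V) \<Longrightarrow>
      (\<And>\<epsilon>. \<epsilon> > 0 \<Longrightarrow> \<exists>N. \<forall>m\<ge>N. \<forall>n\<ge>N. vnorm V (\<sigma> m \<oplus>\<^bsub>V\<^esub> (-1) \<odot>\<^bsub>V\<^esub> \<sigma> n) < \<epsilon>) \<Longrightarrow>
      \<exists>l\<in>carrier V. \<forall>\<epsilon>>0. \<exists>N. \<forall>n\<ge>N. vnorm V (\<sigma> n \<oplus>\<^bsub>V\<^esub> (-1) \<odot>\<^bsub>V\<^esub> l) < \<epsilon>"
  shows "banach_space V"
proof -
  have ag: "abelian_group V"
  proof (rule abelian_groupI)
    fix x assume x: "x \<in> carrier V"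
    have "(-1) \<odot>\<^bsub>V\<^esub> x \<oplus>\<^bsub>V\<^esub> x = \<zero>\<^bsub>V\<^esub>"
      using smult_l[OF x, of "-1" 1] smult_0[OF x] smult_1[OF x] by simp
    then show "\<exists>y\<in>carrier V. y \<oplus>\<^bsub>V\<^esub> x = \<zero>\<^bsub>V\<^esub>" using smult[OF x] by blast
  qed (use assms in auto)
  interpret module complex_ring V
    by (rule moduleI[OF cring_complex_ring ag]) (use assms in auto)
  have minus: "x \<ominus>\<^bsub>V\<^esub> y = x \<oplus>\<^bsub>V\<^esub> (-1) \<odot>\<^bsub>V\<^esub> y" if "x \<in> carrier V" "y \<in> carrier V" for x y
    using smult_l_minus[of 1 y] that smult_1 by (simp add: a_minus_def)
  have minus_0: "x \<ominus>\<^bsub>V\<^esub> y = \<zero>\<^bsub>V\<^esub> \<longleftrightarrow> x = y" if "x \<in> carrier V" "y \<in> carrier V" for x y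
    using that by (metis M.add.inv_closed M.minus_eq M.minus_minus M.minus_unique M.r_neg M.a_comm)
  have n0: "vnorm V \<zero>\<^bsub>V\<^esub> = 0"
    using homog[OF zero, of 0] smult_0[OF zero] by simp
  have nd: "ndist V x y = vnorm V (x \<oplus>\<^bsub>V\<^esub> (-1) \<odot>\<^bsub>V\<^esub> y)" if "x \<in> carrier V" "y \<in> carrier V" for x y
    using that minus by (simp add: ndist_def)
  have sym: "ndist V x y = ndist V y x" if "x \<in> carrier V" "y \<in> carrier V" for x y
  proof -
    have "y \<oplus>\<^bsub>V\<^esub> (-1) \<odot>\<^bsub>V\<^esub> x = (-1) \<odot>\<^bsub>V\<^esub> (x \<oplus>\<^bsub>V\<^esub> (-1) \<odot>\<^bsub>V\<^esub> y)"
      using that by (simp add: smult_r smult smult_assoc[symmetric] smult_1 comm)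
    then show ?thesis using that by (simp add: nd homog add smult)
  qed
  interpret Metric_space "carrier V" "ndist V"
  proof
    show "0 \<le> ndist V x y" for x y using nonneg by (simp add: ndist_def minus add smult)
    show "ndist V x y = ndist V y x" for x y
      using sym[of x y] by (cases "x \<in> carrier V \<and> y \<in> carrier V") (auto simp: ndist_def)
    show "ndist V x y = 0 \<longleftrightarrow> x = y" if "x \<in> carrier V" "y \<in> carrier V" for x y
    proof
      assume "ndist V x y = 0"
      then have "x \<ominus>\<^bsub>V\<^esub> y = \<zero>\<^bsub>V\<^esub>" using that definite by (simp add: ndist_def minus add smult)
      then show "x = y" using that by (simp add: minus_0)
    next
      assume "x = y"
      then show "ndist V x y = 0" using that n0 minus_0[of y y] by (simp add: ndist_def)
    qed
    show "ndist V x z \<le> ndist V x y + ndist V y z" if "x \<in> carrier V" "y \<in> carrier V" "z \<in> carrier V" for x y z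
    proof -
      have "(x \<oplus>\<^bsub>V\<^esub> (\<ominus>\<^bsub>V\<^esub> y)) \<oplus>\<^bsub>V\<^esub> (y \<oplus>\<^bsub>V\<^esub> (\<ominus>\<^bsub>V\<^esub> z)) = x \<oplus>\<^bsub>V\<^esub> (\<ominus>\<^bsub>V\<^esub> z)"
        using that M.r_neg1 M.r_neg2 by (simp add: M.a_assoc)
      then have "x \<ominus>\<^bsub>V\<^esub> z = (x \<ominus>\<^bsub>V\<^esub> y) \<oplus>\<^bsub>V\<^esub> (y \<ominus>\<^bsub>V\<^esub> z)"
        by (simp add: a_minus_def)
      then show ?thesis using that triangle[of "x \<ominus>\<^bsub>V\<^esub> y" "y \<ominus>\<^bsub>V\<^esub> z"]
        by (simp add: ndist_def)
    qed
  qed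
  have "mcomplete"
    unfolding mcomplete_def
  proof (intro allI impI)
    fix \<sigma> assume C: "MCauchy \<sigma>"
    then have in_c: "\<And>n. \<sigma> n \<in> carrier V" by (auto simp: MCauchy_def)
    have "\<exists>l\<in>carrier V. \<forall>\<epsilon>>0. \<exists>N. \<forall>n\<ge>N. vnorm V (\<sigma> n \<oplus>\<^bsub>V\<^esub> (-1) \<odot>\<^bsub>V\<^esub> l) < \<epsilon>"
    proof (rule compl[OF in_c])
      fix \<epsilon> :: real assume "\<epsilon> > 0"
      then show "\<exists>N. \<forall>m\<ge>N. \<forall>n\<ge>N. vnorm V (\<sigma> m \<oplus>\<^bsub>V\<^esub> (-1) \<odot>\<^bsub>V\<^esub> \<sigma> n) < \<epsilon>"
        using C in_c unfolding MCauchy_def by (metis nd)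
    qed
    then show "\<exists>x. limitin mtopology \<sigma> x sequentially"
      using in_c by (auto simp: limit_metric_sequentially nd)
  qed
  then show ?thesis
    by unfold_locales (use assms n0 in auto)
qed

context banach_space begin

lemma add_in [simp, intro]: "x \<in> carrier V \<Longrightarrow> y \<in> carrier V \<Longrightarrow> x \<oplus>\<^bsub>V\<^esub> y \<in> carrier V"
  and zero_in [simp, intro]: "\<zero>\<^bsub>V\<^esub> \<in> carrier V"
  and smult_in [simp, intro]: "x \<in> carrier V \<Longrightarrow> c \<odot>\<^bsub>V\<^esub> x \<in> carrier V"
  and smult_zero [simp]: "c \<odot>\<^bsub>V\<^esub> \<zero>\<^bsub>V\<^esub> = \<zero>\<^bsub>V\<^esub>"
  and zero_smult [simp]: "x \<in> carrier V \<Longrightarrow> 0 \<odot>\<^bsub>V\<^esub> x = \<zero>\<^bsub>V\<^esub>"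
  and smult_plus_left: "x \<in> carrier V \<Longrightarrow> (c + d) \<odot>\<^bsub>V\<^esub> x = c \<odot>\<^bsub>V\<^esub> x \<oplus>\<^bsub>V\<^esub> d \<odot>\<^bsub>V\<^esub> x"
  and smult_plus_right: "x \<in> carrier V \<Longrightarrow> y \<in> carrier V \<Longrightarrow>
      c \<odot>\<^bsub>V\<^esub> (x \<oplus>\<^bsub>V\<^esub> y) = c \<odot>\<^bsub>V\<^esub> x \<oplus>\<^bsub>V\<^esub> c \<odot>\<^bsub>V\<^esub> y"
  and smult_smult: "x \<in> carrier V \<Longrightarrow> c \<odot>\<^bsub>V\<^esub> (d \<odot>\<^bsub>V\<^esub> x) = (c * d) \<odot>\<^bsub>V\<^esub> x"
  and one_smult [simp]: "x \<in> carrier V \<Longrightarrow> 1 \<odot>\<^bsub>V\<^esub> x = x"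
  using smult_closed smult_l_distr smult_r_distr smult_assoc1 smult_one smult_l_null smult_r_null
  by auto

lemma minus_eq_smult: "x \<in> carrier V \<Longrightarrow> y \<in> carrier V \<Longrightarrow> x \<ominus>\<^bsub>V\<^esub> y = x \<oplus>\<^bsub>V\<^esub> (-1) \<odot>\<^bsub>V\<^esub> y"
  using smult_l_minus[of 1 y] by (simp add: a_minus_def)

lemma minus_eq_zero_iff [simp]:
  "x \<in> carrier V \<Longrightarrow> y \<in> carrier V \<Longrightarrow> x \<ominus>\<^bsub>V\<^esub> y = \<zero>\<^bsub>V\<^esub> \<longleftrightarrow> x = y"
  by (metis M.add.inv_closed M.minus_eq M.minus_minus M.minus_unique M.r_neg M.a_comm)

lemma minus_self: "x \<in> carrier V \<Longrightarrow> x \<ominus>\<^bsub>V\<^esub> x = \<zero>\<^bsub>V\<^esub>"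
  by simp

lemma minus_zero [simp]: "x \<in> carrier V \<Longrightarrow> x \<ominus>\<^bsub>V\<^esub> \<zero>\<^bsub>V\<^esub> = x"
  by (simp add: minus_eq_smult)

lemma vnorm_zero [simp]: "vnorm V \<zero>\<^bsub>V\<^esub> = 0"
  using vnorm_eq_0_iff by auto

lemma ndist_eq: "x \<in> carrier V \<Longrightarrow> y \<in> carrier V \<Longrightarrow> ndist V x y = vnorm V (x \<ominus>\<^bsub>V\<^esub> y)"
  by (simp add: ndist_def)

lemma vnorm_eq_ndist: "x \<in> carrier V \<Longrightarrow> vnorm V x = ndist V x \<zero>\<^bsub>V\<^esub>"
  by (simp add: ndist_eq)

lemma minus_swap: "x \<in> carrier V \<Longrightarrow> y \<in> carrier V \<Longrightarrow> y \<ominus>\<^bsub>V\<^esub> x = (-1) \<odot>\<^bsub>V\<^esub> (x \<ominus>\<^bsub>V\<^esub> y)"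
  by (simp add: minus_eq_smult smult_plus_right smult_smult M.a_comm)

lemma Metric_space_ndist: "Metric_space (carrier V) (ndist V)"
proof
  show "0 \<le> ndist V x y" for x y by (simp add: ndist_def vnorm_nonneg)
  show "ndist V x y = ndist V y x" for x y
    using minus_swap[of y x] by (auto simp: ndist_def vnorm_smult)
  show "ndist V x y = 0 \<longleftrightarrow> x = y" if "x \<in> carrier V" "y \<in> carrier V" for x y
    using that by (simp add: ndist_eq vnorm_eq_0_iff)
  show "ndist V x z \<le> ndist V x y + ndist V y z" if "x \<in> carrier V" "y \<in> carrier V" "z \<in> carrier V" for x y z
  proof -
    have "(x \<oplus>\<^bsub>V\<^esub> (\<ominus>\<^bsub>V\<^esub> y)) \<oplus>\<^bsub>V\<^esub> (y \<oplus>\<^bsub>V\<^esub> (\<ominus>\<^bsub>V\<^esub> z)) = x \<oplus>\<^bsub>V\<^esub> (\<ominus>\<^bsub>V\<^esub> z)"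
      using that M.r_neg1 M.r_neg2 by (simp add: M.a_assoc)
    then have "x \<ominus>\<^bsub>V\<^esub> z = (x \<ominus>\<^bsub>V\<^esub> y) \<oplus>\<^bsub>V\<^esub> (y \<ominus>\<^bsub>V\<^esub> z)"
      by (simp add: a_minus_def)
    then show ?thesis using that vnorm_triangle[of "x \<ominus>\<^bsub>V\<^esub> y" "y \<ominus>\<^bsub>V\<^esub> z"]
      by (simp add: ndist_def)
  qed
qed

sublocale metric: Metric_space "carrier V" "ndist V"
  by (rule Metric_space_ndist)

lemma ntopology_eq: "ntopology V = metric.mtopology"
  by (simp add: ntopology_def)

lemma minus_add_swap:
  assumes "x \<in> carrier V" "y \<in> carrier V" "x' \<in> carrier V" "y' \<in> carrier V"
  shows "(x \<oplus>\<^bsub>V\<^esub> y) \<ominus>\<^bsub>V\<^esub> (x' \<oplus>\<^bsub>V\<^esub> y') = (x \<ominus>\<^bsub>V\<^esub> x') \<oplus>\<^bsub>V\<^esub> (y \<ominus>\<^bsub>V\<^esub> y')"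
  using assms by (simp add: minus_eq_smult smult_plus_right M.a_ac)

lemma smult_minus:
  assumes "x \<in> carrier V" "y \<in> carrier V"
  shows "c \<odot>\<^bsub>V\<^esub> (x \<ominus>\<^bsub>V\<^esub> y) = c \<odot>\<^bsub>V\<^esub> x \<ominus>\<^bsub>V\<^esub> c \<odot>\<^bsub>V\<^esub> y"
  using assms by (simp add: minus_eq_smult smult_plus_right smult_smult)

lemma ndist_add:
  assumes "x \<in> carrier V" "y \<in> carrier V" "x' \<in> carrier V" "y' \<in> carrier V"
  shows "ndist V (x \<oplus>\<^bsub>V\<^esub> y) (x' \<oplus>\<^bsub>V\<^esub> y') \<le> ndist V x x' + ndist V y y'"
  using assms by (simp add: ndist_eq minus_add_swap vnorm_triangle)

lemma ndist_smult:
  assumes "x \<in> carrier V" "y \<in> carrier V"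
  shows "ndist V (c \<odot>\<^bsub>V\<^esub> x) (c \<odot>\<^bsub>V\<^esub> y) = cmod c * ndist V x y"
  using assms by (simp add: ndist_eq smult_minus[symmetric] vnorm_smult)

lemma abs_vnorm_diff_le:
  assumes "x \<in> carrier V" "y \<in> carrier V"
  shows "\<bar>vnorm V x - vnorm V y\<bar> \<le> ndist V x y"
  using assms metric.triangle[of x y "\<zero>\<^bsub>V\<^esub>"] metric.triangle[of y x "\<zero>\<^bsub>V\<^esub>"] metric.commute[of x y]
  by (auto simp: vnorm_eq_ndist)

lemma add_minus_cancel: "x \<in> carrier V \<Longrightarrow> y \<in> carrier V \<Longrightarrow> y \<oplus>\<^bsub>V\<^esub> (x \<ominus>\<^bsub>V\<^esub> y) = x"
  using minus_eq_zero_iff[of y y] by (simp add: minus_eq_smult M.a_lcomm[of y x])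

lemma complete_Cauchy:
  assumes "\<And>n. \<sigma> n \<in> carrier V"
    and "\<And>\<epsilon>. \<epsilon> > 0 \<Longrightarrow> \<exists>N::nat. \<forall>m\<ge>N. \<forall>n\<ge>N. ndist V (\<sigma> m) (\<sigma> n) < \<epsilon>"
  shows "\<exists>l\<in>carrier V. \<forall>\<epsilon>>0. \<exists>N. \<forall>n\<ge>N. ndist V (\<sigma> n) l < \<epsilon>"
proof -
  have "metric.MCauchy \<sigma>" using assms unfolding metric.MCauchy_def by (meson image_subsetI)
  then obtain x where "limitin metric.mtopology \<sigma> x sequentially"
    using complete unfolding metric.mcomplete_def by blast
  then show ?thesis
    unfolding metric.limit_metric_sequentially by meson
qed

end

text \<open>Every algebraic law and the norm are pulled back along the injection \<open>j\<close>;
  only completeness needs a hypothesis of its own, that the image is sequentially closed.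
  Transported copies of a module and kernels of morphisms both arise in this way.\<close>

lemma banach_space_embed:
  assumes "banach_space V"
    and j: "inj_on j (carrier W)" "\<And>x. x \<in> carrier W \<Longrightarrow> j x \<in> carrier V"
    and add: "\<And>x y. x \<in> carrier W \<Longrightarrow> y \<in> carrier W \<Longrightarrow>
      x \<oplus>\<^bsub>W\<^esub> y \<in> carrier W \<and> j (x \<oplus>\<^bsub>W\<^esub> y) = j x \<oplus>\<^bsub>V\<^esub> j y"
    and zero: "\<zero>\<^bsub>W\<^esub> \<in> carrier W \<and> j \<zero>\<^bsub>W\<^esub> = \<zero>\<^bsub>V\<^esub>"
    and smult: "\<And>c x. x \<in> carrier W \<Longrightarrow> c \<odot>\<^bsub>W\<^esub> x \<in> carrier W \<and> j (c \<odot>\<^bsub>W\<^esub> x) = c \<odot>\<^bsub>V\<^esub> j x"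
    and vnorm: "\<And>x. x \<in> carrier W \<Longrightarrow> vnorm W x = vnorm V (j x)"
    and closed: "\<And>(\<sigma> :: nat \<Rightarrow> _) l. (\<And>n. \<sigma> n \<in> carrier W) \<Longrightarrow> l \<in> carrier V \<Longrightarrow>
      (\<And>\<epsilon>. \<epsilon> > 0 \<Longrightarrow> \<exists>N. \<forall>n\<ge>N. ndist V (j (\<sigma> n)) l < \<epsilon>) \<Longrightarrow> l \<in> j ` carrier W"
  shows "banach_space W"
proof -
  interpret V: banach_space V by fact
  have eqI: "x = y" if "j x = j y" "x \<in> carrier W" "y \<in> carrier W" for x y
    using j that by (auto dest: inj_onD)
  have nd: "vnorm W (x \<oplus>\<^bsub>W\<^esub> (-1) \<odot>\<^bsub>W\<^esub> y) = ndist V (j x) (j y)" if "x \<in> carrier W" "y \<in> carrier W" for x y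
    using that j add smult by (simp add: vnorm V.ndist_eq V.minus_eq_smult)
  show ?thesis
  proof (rule banach_spaceI)
    fix \<sigma> :: "nat \<Rightarrow> _"
    assume \<sigma>: "\<And>n. \<sigma> n \<in> carrier W"
      and C: "\<And>\<epsilon>. \<epsilon> > 0 \<Longrightarrow> \<exists>N. \<forall>m\<ge>N. \<forall>n\<ge>N. vnorm W (\<sigma> m \<oplus>\<^bsub>W\<^esub> (-1) \<odot>\<^bsub>W\<^esub> \<sigma> n) < \<epsilon>"
    have "\<exists>N. \<forall>m\<ge>N. \<forall>n\<ge>N. ndist V (j (\<sigma> m)) (j (\<sigma> n)) < \<epsilon>" if "\<epsilon> > 0" for \<epsilon>
      using C[OF that] by (simp add: nd \<sigma>)
    from V.complete_Cauchy[of "\<lambda>n. j (\<sigma> n)", OF j(2)[OF \<sigma>] this]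
    obtain l where l: "l \<in> carrier V" "\<forall>\<epsilon>>0. \<exists>N. \<forall>n\<ge>N. ndist V (j (\<sigma> n)) l < \<epsilon>" by auto
    have "l \<in> j ` carrier W" using \<sigma> l closed by (smt (verit, best))
    then obtain w where "w \<in> carrier W" "l = j w" by auto
    then show "\<exists>l\<in>carrier W. \<forall>\<epsilon>>0. \<exists>N. \<forall>n\<ge>N. vnorm W (\<sigma> n \<oplus>\<^bsub>W\<^esub> (-1) \<odot>\<^bsub>W\<^esub> l) < \<epsilon>"
      using l(2) \<sigma> by (auto simp: nd)
  next
    show "0 \<odot>\<^bsub>W\<^esub> x = \<zero>\<^bsub>W\<^esub>" if "x \<in> carrier W" for x
      by (rule eqI) (use that j smult zero in auto)
    show "1 \<odot>\<^bsub>W\<^esub> x = x" if "x \<in> carrier W" for x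
      by (rule eqI) (use that j smult zero in auto)
    show "\<zero>\<^bsub>W\<^esub> \<oplus>\<^bsub>W\<^esub> x = x" if "x \<in> carrier W" for x
      by (rule eqI) (use that j add zero in auto)
    show "x = \<zero>\<^bsub>W\<^esub>" if "x \<in> carrier W" "vnorm W x = 0" for x
      by (rule eqI) (use that V.vnorm_eq_0_iff vnorm zero j in auto)
    show "x \<oplus>\<^bsub>W\<^esub> y = y \<oplus>\<^bsub>W\<^esub> x" if "x \<in> carrier W" "y \<in> carrier W" for x y
      by (rule eqI) (use that j add V.M.a_comm in auto)
    show "(x \<oplus>\<^bsub>W\<^esub> y) \<oplus>\<^bsub>W\<^esub> z = x \<oplus>\<^bsub>W\<^esub> (y \<oplus>\<^bsub>W\<^esub> z)" if "x \<in> carrier W" "y \<in> carrier W" "z \<in> carrier W" for x y z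
      by (rule eqI) (use that j add V.M.a_assoc in auto)
    show "(c + d) \<odot>\<^bsub>W\<^esub> x = c \<odot>\<^bsub>W\<^esub> x \<oplus>\<^bsub>W\<^esub> d \<odot>\<^bsub>W\<^esub> x" if "x \<in> carrier W" for c d x
      by (rule eqI) (use that j add smult V.smult_plus_left in auto)
    show "c \<odot>\<^bsub>W\<^esub> (x \<oplus>\<^bsub>W\<^esub> y) = c \<odot>\<^bsub>W\<^esub> x \<oplus>\<^bsub>W\<^esub> c \<odot>\<^bsub>W\<^esub> y" if "x \<in> carrier W" "y \<in> carrier W" for c x y
      by (rule eqI) (use that j add smult V.smult_plus_right in auto)
    show "(c * d) \<odot>\<^bsub>W\<^esub> x = c \<odot>\<^bsub>W\<^esub> (d \<odot>\<^bsub>W\<^esub> x)" if "x \<in> carrier W" for c d x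
      by (rule eqI) (use that j smult V.smult_smult in auto)
  qed (use j add zero smult vnorm V.vnorm_nonneg V.vnorm_triangle V.vnorm_smult in auto)
qed

section \<open>Paracompact locally compact spaces\<close>

definition proper_relation :: "'t topology \<Rightarrow> ('t \<times> 't) set \<Rightarrow> bool" where
  "proper_relation X E \<longleftrightarrow>
     sym E \<and> (\<forall>x\<in>topspace X. (x, x) \<in> E \<and> openin X (E `` {x})) \<and>
     (\<forall>K. compactin X K \<longrightarrow> (\<exists>L. compactin X L \<and> E `` K \<subseteq> L))"

text \<open>A disjoint sum of \<sigma>-compact pieces, which is the form that paracompactness takes
  for locally compact Hausdorff spaces. The pieces are open as unions of the sets
  \<open>G W n\<close>, and closed because they partition the space.\<close>

definition clopen_exhaustion :: "'t topology \<Rightarrow> 't set set \<Rightarrow> ('t set \<Rightarrow> nat \<Rightarrow> 't set) \<Rightarrow> bool" where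
  "clopen_exhaustion X \<W> G \<longleftrightarrow>
     disjoint \<W> \<and> \<Union>\<W> = topspace X \<and>
     (\<forall>W\<in>\<W>. (\<forall>n. openin X (G W n) \<and> compactin X (X closure_of G W n) \<and>
                X closure_of G W n \<subseteq> G W (Suc n)) \<and> (\<Union>n. G W n) = W)"

text \<open>Local compactness supplies a neighbourhood \<open>A\<close> of \<open>K\<close> inside a
  compact set, regularity a neighbourhood \<open>B\<close> whose closure stays in \<open>U\<close>;
  their intersection has both properties.\<close>

lemma regular_compact_interpolation:
  assumes "locally_compact_space X" "Hausdorff_space X" "compactin X K" "openin X U" "K \<subseteq> U"
  obtains V where "openin X V" "K \<subseteq> V" "compactin X (X closure_of V)" "X closure_of V \<subseteq> U"
proof -
  obtain A L where A: "openin X A" "compactin X L" "closedin X L" "K \<subseteq> A" "A \<subseteq> L"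
    using assms locally_compact_space_compact_closed_compact[of X] by blast
  have "regular_space X"
    using assms locally_compact_Hausdorff_imp_regular_space by blast
  moreover have "closedin X (topspace X - U)" "disjnt K (topspace X - U)"
    using assms by (auto simp: disjnt_def)
  ultimately obtain B B' where B: "openin X B" "openin X B'" "K \<subseteq> B" "topspace X - U \<subseteq> B'" "disjnt B B'"
    using regular_space_compact_closed_separation[of X K "topspace X - U"] assms(3) by blast
  let ?V = "A \<inter> B"
  have cl: "X closure_of ?V \<subseteq> L"
    using A by (meson closure_of_minimal inf.coboundedI1)
  have "X closure_of ?V \<subseteq> topspace X - B'"
    using B by (intro closure_of_minimal) (auto simp: disjnt_iff dest: openin_subset)
  then have "X closure_of ?V \<subseteq> U" using B(4) closure_of_subset_topspace[of X ?V] by blast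
  moreover have "compactin X (X closure_of ?V)"
    using cl A(2) closed_compactin closedin_closure_of by metis
  ultimately show thesis using that[of ?V] A B by auto
qed

lemma compact_cutoff:
  assumes "locally_compact_space X" "Hausdorff_space X" "compactin X K" "openin X U" "K \<subseteq> U"
  obtains f :: "'t \<Rightarrow> real" and L where "continuous_map X euclideanreal f" "\<And>x. 0 \<le> f x" "\<And>x. f x \<le> 1"
    "\<And>x. x \<in> K \<Longrightarrow> f x = 1" "compactin X L" "L \<subseteq> U" "\<And>x. x \<notin> L \<Longrightarrow> f x = 0"
proof -
  obtain V where V: "openin X V" "K \<subseteq> V" "compactin X (X closure_of V)" "X closure_of V \<subseteq> U"
    using regular_compact_interpolation[OF assms] by blast
  have "completely_regular_space X"
    using assms locally_compact_regular_imp_completely_regular_space by blast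
  moreover have "closedin X (topspace X - V)" "disjnt K (topspace X - V)"
    using V by (auto simp: disjnt_def)
  ultimately obtain h :: "'t \<Rightarrow> real" where h: "continuous_map X (top_of_set {0..1}) h"
      "h ` (topspace X - V) \<subseteq> {0}" "h ` K \<subseteq> {1}"
    using Urysohn_completely_regular_compact_closed[of 0 1 X K "topspace X - V"] assms(3)
    by auto
  \<comment> \<open>Urysohn's function is arbitrary off the space. Cutting it off outside
    \<open>V\<close> changes nothing on the space and gives the bounds and the vanishing for every
    element of the type.\<close>
  define f where "f x = (if x \<in> V then h x else 0)" for x
  have VX: "V \<subseteq> topspace X" using V openin_subset by blast
  have eq: "f x = h x" if "x \<in> topspace X" for x using h(2) that by (auto simp: f_def)
  have h01: "h x \<in> {0..1}" if "x \<in> topspace X" for x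
    using h(1) that by (auto simp: continuous_map_in_subtopology)
  show thesis
  proof (rule that)
    show "continuous_map X euclideanreal f"
      by (rule continuous_map_eq[of _ _ h]) (use h(1) in \<open>auto simp: continuous_map_in_subtopology eq\<close>)
    show "0 \<le> f x" "f x \<le> 1" for x using h01[of x] VX by (auto simp: f_def)
    show "f x = 1" if "x \<in> K" for x using that h(3) V(2) by (auto simp: f_def)
    show "f x = 0" if "x \<notin> X closure_of V" for x
      using that closure_of_subset[OF VX] by (auto simp: f_def)
  qed (use V in auto)
qed

text \<open>Two points are related if they lie in a common member of a locally finite cover by
  relatively compact open sets. A compact set meets finitely many members, so its image lies in a
  finite union of compact closures.\<close>

lemma paracompact_imp_proper_relation:
  assumes "locally_compact_space X" "paracompact_space X"
  obtains E where "proper_relation X E"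
proof -
  define \<U> where "\<U> = {U. openin X U \<and> compactin X (X closure_of U)}"
  have H: "Hausdorff_space X" using assms(2) by (simp add: paracompact_space_def)
  have "\<Union>\<U> = topspace X"
  proof
    show "topspace X \<subseteq> \<Union>\<U>"
    proof
      fix x assume "x \<in> topspace X"
      then obtain V where "openin X V" "{x} \<subseteq> V" "compactin X (X closure_of V)"
        using regular_compact_interpolation[OF assms(1) H, of "{x}" "topspace X"] by auto
      then show "x \<in> \<Union>\<U>" by (auto simp: \<U>_def)
    qed
  qed (auto simp: \<U>_def dest: openin_subset)
  moreover have "\<forall>U\<in>\<U>. openin X U" by (simp add: \<U>_def)
  ultimately have "\<exists>\<V>. (\<forall>V\<in>\<V>. openin X V) \<and> \<Union>\<V> = topspace X \<and>
      (\<forall>V\<in>\<V>. \<exists>U\<in>\<U>. V \<subseteq> U) \<and> locally_finite_in X \<V>"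
    by (intro mp[OF spec[OF conjunct2[OF assms(2)[unfolded paracompact_space_def]]]] conjI)
  then obtain \<V> where \<V>: "\<forall>V\<in>\<V>. openin X V" "\<Union>\<V> = topspace X"
      "\<forall>V\<in>\<V>. \<exists>U\<in>\<U>. V \<subseteq> U" "locally_finite_in X \<V>"
    by (elim exE conjE)
  have cpt: "compactin X (X closure_of V)" if V: "V \<in> \<V>" for V
  proof -
    obtain U where "compactin X (X closure_of U)" "V \<subseteq> U"
      using bspec[OF \<V>(3) V] by (auto simp: \<U>_def)
    then show ?thesis
      by (meson closed_compactin closedin_closure_of closure_of_mono)
  qed
  define E where "E = (\<Union>V\<in>\<V>. V \<times> V)"
  have "sym E" by (auto simp: E_def sym_def)
  moreover have "(x, x) \<in> E" if "x \<in> topspace X" for x using that \<V>(2) by (auto simp: E_def)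
  moreover have "openin X (E `` {x})" for x
  proof -
    have "E `` {x} = \<Union>{V\<in>\<V>. x \<in> V}" by (auto simp: E_def)
    then show ?thesis using \<V>(1) by (metis (no_types, lifting) mem_Collect_eq openin_Union)
  qed
  moreover have "\<exists>L. compactin X L \<and> E `` K \<subseteq> L" if K: "compactin X K" for K
  proof -
    have "\<forall>x\<in>K. \<exists>V. openin X V \<and> x \<in> V \<and> finite {U \<in> \<V>. U \<inter> V \<noteq> {}}"
      using \<V>(4) K compactin_subset_topspace unfolding locally_finite_in_def by blast
    then obtain N where N: "\<And>x. x \<in> K \<Longrightarrow> openin X (N x) \<and> x \<in> N x \<and> finite {U \<in> \<V>. U \<inter> N x \<noteq> {}}"
      by metis
    have "\<exists>\<F>. finite \<F> \<and> \<F> \<subseteq> N ` K \<and> K \<subseteq> \<Union>\<F>"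
      by (rule compactinD[OF K]) (use N in auto)
    then obtain F where F: "finite F" "F \<subseteq> K" "K \<subseteq> \<Union>(N ` F)"
      by (metis finite_subset_image)
    define \<V>' where "\<V>' = (\<Union>x\<in>F. {U \<in> \<V>. U \<inter> N x \<noteq> {}})"
    have "finite \<V>'" unfolding \<V>'_def using F N by blast
    then have "compactin X (\<Union>((closure_of) X ` \<V>'))"
      using cpt by (intro compactin_Union) (auto simp: \<V>'_def)
    moreover have "E `` K \<subseteq> \<Union>((closure_of) X ` \<V>')"
    proof
      fix y assume "y \<in> E `` K"
      then obtain x V where xV: "x \<in> K" "V \<in> \<V>" "x \<in> V" "y \<in> V" by (auto simp: E_def)
      then obtain z where "z \<in> F" "x \<in> N z" using F(3) by blast
      then have "V \<in> \<V>'" using xV by (auto simp: \<V>'_def)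
      moreover have "y \<in> X closure_of V"
        using xV \<V>(1) by (meson closure_of_subset openin_subset subsetD)
      ultimately show "y \<in> \<Union>((closure_of) X ` \<V>')" by blast
    qed
    ultimately show ?thesis by blast
  qed
  ultimately show thesis using that unfolding proper_relation_def by blast
qed

text \<open>The classes are the sets reached from a point by iterating \<open>E\<close>. An
  invariant set is a union of open sections, and by symmetry so is its complement; hence the classes
  are clopen.\<close>

lemma proper_relation_imp_clopen_exhaustion:
  assumes "Hausdorff_space X" "proper_relation X E"
  obtains \<W> G where "clopen_exhaustion X \<W> G"
proof -
  have symE: "(y, x) \<in> E" if "(x, y) \<in> E" for x y
    using assms(2) that by (auto simp: proper_relation_def dest: symD)
  have refl: "(x, x) \<in> E" and openE: "openin X (E `` {x})" if "x \<in> topspace X" for x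
    using assms(2) that by (auto simp: proper_relation_def)
  have bdd: "\<exists>L. compactin X L \<and> E `` K \<subseteq> L" if "compactin X K" for K
    using assms(2) that by (auto simp: proper_relation_def)
  have openE': "openin X (E `` S)" if "S \<subseteq> topspace X" for S
  proof -
    have "E `` S = (\<Union>x\<in>S. E `` {x})" by auto
    then show ?thesis using openE that by (metis (no_types, lifting) imageE openin_Union subsetD)
  qed
  have cptE: "compactin X (X closure_of (E `` K))" if K: "compactin X K" for K
  proof -
    obtain L where L: "compactin X L" "E `` K \<subseteq> L" using bdd[OF K] by blast
    then have "X closure_of (E `` K) \<subseteq> L"
      using compactin_imp_closedin[OF assms(1)] closure_of_minimal by metis
    then show ?thesis using L closed_compactin closedin_closure_of by metis
  qed
  \<comment> \<open>Passing to the closure before applying \<open>E\<close> keeps every stage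
    relatively compact, and by reflexivity puts the closure of a stage into the next one.\<close>
  define G where "G s = rec_nat (E `` {s}) (\<lambda>_ S. E `` (X closure_of S))" for s
  have G0: "G s 0 = E `` {s}" and GS: "G s (Suc n) = E `` (X closure_of G s n)" for s n
    by (auto simp: G_def)
  have Gopen: "openin X (G s n)" if "s \<in> topspace X" for s n
    using openE[OF that] openE'[OF closure_of_subset_topspace] by (cases n) (auto simp: G0 GS)
  have Gcpt: "compactin X (X closure_of G s n)" if "s \<in> topspace X" for s n
    by (induction n) (auto simp: G0 GS that intro!: cptE)
  have clG: "X closure_of G s n \<subseteq> G s (Suc n)" for s n
    using refl closure_of_subset_topspace[of X "G s n"] by (auto simp: GS)
  define W where "W s = (\<Union>n. G s n)" for s
  have sW: "s \<in> W s" if "s \<in> topspace X" for s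
    using refl[OF that] G0 by (force simp: W_def)
  have Wtop: "W s \<subseteq> topspace X" if "s \<in> topspace X" for s
    using Gopen[OF that] by (auto simp: W_def dest: openin_subset)
  have EW: "E `` W s \<subseteq> W s" if s: "s \<in> topspace X" for s
  proof
    fix y assume "y \<in> E `` W s"
    then obtain x n where x: "(x, y) \<in> E" "x \<in> G s n" by (auto simp: W_def)
    then have "x \<in> X closure_of G s n"
      using closure_of_subset[OF openin_subset[OF Gopen[OF s]]] by blast
    then have "y \<in> G s (Suc n)" using x by (auto simp: GS)
    then show "y \<in> W s" by (auto simp: W_def)
  qed
  have EX: "y \<in> topspace X" if "(x, y) \<in> E" "x \<in> topspace X" for x y
    using openE[OF that(2)] that(1) openin_subset by blast
  have EW': "E `` (topspace X - W s) \<subseteq> topspace X - W s" if s: "s \<in> topspace X" for s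
    using EW[OF s] EX symE by blast
  have Wopen: "openin X (W s)" if "s \<in> topspace X" for s
    using Gopen[OF that] by (auto simp: W_def)
  have Wclosed: "closedin X (W s)" if s: "s \<in> topspace X" for s
  proof -
    have "topspace X - W s = E `` (topspace X - W s)"
      using EW'[OF s] refl by auto
    then show ?thesis using openE'[of "topspace X - W s"] Wtop[OF s] by (simp add: closedin_def)
  qed
  \<comment> \<open>\<open>W s\<close> is the least closed \<open>E\<close>-invariant set that
    contains \<open>s\<close>; this replaces any handling of chains of related points.\<close>
  have min: "W s \<subseteq> S" if S: "s \<in> S" "closedin X S" "E `` S \<subseteq> S" for s S
  proof -
    have "G s n \<subseteq> S" for n
    proof (induction n)
      case 0 then show ?case using S by (auto simp: G0)
    next
      case (Suc n)
      then have "X closure_of G s n \<subseteq> S" using S(2) closure_of_minimal by blast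
      then show ?case using S(3) by (auto simp: GS)
    qed
    then show ?thesis by (auto simp: W_def)
  qed
  have eq: "W x = W s" if s: "s \<in> topspace X" and x: "x \<in> W s" for x s
  proof
    have xX: "x \<in> topspace X" using x Wtop[OF s] by auto
    show "W x \<subseteq> W s" by (rule min[OF x Wclosed[OF s] EW[OF s]])
    have "s \<in> W x"
    proof (rule ccontr)
      \<comment> \<open>The complement of \<open>W x\<close> is then a closed invariant set
        containing \<open>s\<close>, so it contains \<open>W s\<close> and thereby \<open>x\<close>
        itself.\<close>
      assume "s \<notin> W x"
      then have "W s \<subseteq> topspace X - W x"
        using s Wopen[OF xX] EW'[OF xX] by (intro min) auto
      then show False using x sW[OF xX] by blast
    qed
    then show "W s \<subseteq> W x" by (rule min[OF _ Wclosed[OF xX] EW[OF xX]])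
  qed
  \<comment> \<open>The exhaustion has to be indexed by the pieces, so a generating point is chosen
    for each of them.\<close>
  define r where "r V = (SOME s. s \<in> topspace X \<and> W s = V)" for V
  have r: "r V \<in> topspace X \<and> W (r V) = V" if "V \<in> W ` topspace X" for V
    unfolding r_def by (rule someI_ex) (use that in blast)
  have "disjoint (W ` topspace X)"
    unfolding disjoint_def using eq Wtop by (metis disjoint_iff imageE)
  moreover have "\<Union>(W ` topspace X) = topspace X" using sW Wtop by blast
  moreover have "(\<Union>n. G (r V) n) = V" if "V \<in> W ` topspace X" for V
    using r[OF that] by (simp add: W_def)
  ultimately have "clopen_exhaustion X (W ` topspace X) (\<lambda>V. G (r V))"
    unfolding clopen_exhaustion_def using r Gopen Gcpt clG by simp
  then show thesis by (rule that)
qed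

locale exhausted_space =
  fixes X :: "'t topology" and \<W> :: "'t set set" and G :: "'t set \<Rightarrow> nat \<Rightarrow> 't set"
  assumes lc: "locally_compact_space X" and Hausdorff: "Hausdorff_space X"
    and exhaustion: "clopen_exhaustion X \<W> G"
begin

lemma disjoint_pieces: "V \<in> \<W> \<Longrightarrow> W \<in> \<W> \<Longrightarrow> x \<in> V \<Longrightarrow> x \<in> W \<Longrightarrow> V = W"
  using exhaustion unfolding clopen_exhaustion_def disjoint_def by blast

lemma Union_pieces: "\<Union>\<W> = topspace X"
  and open_G: "W \<in> \<W> \<Longrightarrow> openin X (G W n)"
  and compact_G: "W \<in> \<W> \<Longrightarrow> compactin X (X closure_of G W n)"
  and closure_G: "W \<in> \<W> \<Longrightarrow> X closure_of G W n \<subseteq> G W (Suc n)"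
  and Union_G: "W \<in> \<W> \<Longrightarrow> (\<Union>n. G W n) = W"
  using exhaustion unfolding clopen_exhaustion_def by blast+

lemma open_piece: "W \<in> \<W> \<Longrightarrow> openin X W"
  using open_G Union_G by (metis (no_types, lifting) imageE openin_Union)

lemma G_subset: "W \<in> \<W> \<Longrightarrow> G W n \<subseteq> W"
  using Union_G by blast

lemma G_closure: "W \<in> \<W> \<Longrightarrow> G W n \<subseteq> X closure_of G W n"
  by (meson closure_of_subset open_G openin_subset)

lemma G_mono: "W \<in> \<W> \<Longrightarrow> m \<le> n \<Longrightarrow> G W m \<subseteq> G W n"
  by (rule lift_Suc_mono_le[of "G W"]) (use G_closure[of W] closure_G[of W] in blast)+

lemma first_index:
  assumes "x \<in> topspace X"
  obtains W m where "W \<in> \<W>" "x \<in> G W m" "\<forall>n<m. x \<notin> G W n"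
proof -
  obtain W n where "W \<in> \<W>" "x \<in> G W n" using assms Union_pieces Union_G by blast
  then show thesis
    using that[of W "LEAST n. x \<in> G W n"] by (metis LeastI not_less_Least)
qed

text \<open>Each piece is cut into compact shells, every shell is covered by finitely many members
  of the given cover, and these are intersected with a thin open neighbourhood of the shell.\<close>

lemma exhausted_imp_paracompact: "paracompact_space X"
  unfolding paracompact_space_def
proof (intro conjI allI impI Hausdorff)
  fix \<U> assume \<U>: "(\<forall>U\<in>\<U>. openin X U) \<and> \<Union>\<U> = topspace X"
  define C where "C W n = X closure_of G W n - (if n = 0 then {} else G W (n - 1))" for W n
  \<comment> \<open>The closure of \<open>G W (n - 2)\<close> lies in \<open>G W (n - 1)\<close>,
    which the shell \<open>C W n\<close> omits, so removing it keeps \<open>C W n\<close> inside the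
    open set \<open>D W n\<close>. For \<open>n < 2\<close> there is no such stage to
    remove.\<close>
  define D where "D W n = G W (Suc n) - (if n < 2 then {} else X closure_of G W (n - 2))" for W n
  have C: "compactin X (C W n)" if "W \<in> \<W>" for W n
  proof -
    have "closedin X (C W n)" using open_G[OF that] by (auto simp: C_def intro: closedin_diff)
    then show ?thesis using compact_G[OF that, of n] closed_compactin by (metis C_def Diff_subset)
  qed
  have D: "openin X (D W n)" if "W \<in> \<W>" for W n
    using open_G[OF that] by (auto simp: D_def intro: openin_diff)
  have CD: "C W n \<subseteq> D W n" if "W \<in> \<W>" for W n
    using closure_G[OF that] closure_G[OF that, of "n - 2"]
    by (cases n rule: nat.exhaust; cases "n - 1"; auto simp: C_def D_def)
  have "\<exists>\<S>. finite \<S> \<and> \<S> \<subseteq> \<U> \<and> C W n \<subseteq> \<Union>\<S>" if "W \<in> \<W>" for W n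
    by (rule compactinD[OF C[OF that]]) (use \<U> C[OF that] compactin_subset_topspace in auto)
  then obtain \<S> where \<S>: "\<And>W n. W \<in> \<W> \<Longrightarrow> finite (\<S> W n) \<and> \<S> W n \<subseteq> \<U> \<and> C W n \<subseteq> \<Union>(\<S> W n)"
    by metis
  define \<V> where "\<V> = (\<Union>W\<in>\<W>. \<Union>n. (\<inter>) (D W n) ` \<S> W n)"
  have "openin X (D W n \<inter> U)" if "W \<in> \<W>" "U \<in> \<S> W n" for W n U
  proof -
    have "U \<in> \<U>" using \<S>[OF that(1), of n] that(2) by blast
    then show ?thesis using D[OF that(1)] \<U> by (intro openin_Int) auto
  qed
  then have 1: "\<forall>V\<in>\<V>. openin X V" by (auto simp: \<V>_def)
  have 2: "\<forall>V\<in>\<V>. \<exists>U\<in>\<U>. V \<subseteq> U" using \<S> by (force simp: \<V>_def)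
  have 3: "\<Union>\<V> = topspace X"
  proof
    show "\<Union>\<V> \<subseteq> topspace X" using 1 openin_subset by blast
    show "topspace X \<subseteq> \<Union>\<V>"
    proof
      fix x assume "x \<in> topspace X"
      then obtain W m where W: "W \<in> \<W>" "x \<in> G W m" "\<forall>n<m. x \<notin> G W n"
        by (rule first_index)
      then have x: "x \<in> C W m" using G_closure[OF W(1)] by (auto simp: C_def)
      then obtain U where "U \<in> \<S> W m" "x \<in> U" using \<S>[OF W(1)] by blast
      then show "x \<in> \<Union>\<V>" using CD[OF W(1)] x W(1) by (auto simp: \<V>_def)
    qed
  qed
  have 4: "locally_finite_in X \<V>"
    unfolding locally_finite_in_def
  proof (intro conjI ballI)
    fix x assume "x \<in> topspace X"
    then obtain W m where W: "W \<in> \<W>" "x \<in> G W m" using first_index by blast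
    \<comment> \<open>From \<open>n = m + 2\<close> on, \<open>D W n\<close> omits the closure of
      \<open>G W (n - 2)\<close> and with it \<open>G W m\<close>; the other pieces are disjoint
      from \<open>W\<close>. So \<open>G W m\<close> is a neighbourhood that witnesses local
      finiteness.\<close>
    have "{V \<in> \<V>. V \<inter> G W m \<noteq> {}} \<subseteq> (\<Union>n<m+2. (\<inter>) (D W n) ` \<S> W n)"
    proof
      fix V assume "V \<in> {V \<in> \<V>. V \<inter> G W m \<noteq> {}}"
      then obtain W' n U y where V: "W' \<in> \<W>" "U \<in> \<S> W' n" "V = D W' n \<inter> U" "y \<in> V" "y \<in> G W m"
        by (auto simp: \<V>_def)
      have "y \<in> D W' n" using V by auto
      then have "y \<in> W'" using G_subset[OF V(1)] by (auto simp: D_def)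
      then have W': "W' = W" using disjoint_pieces[OF V(1) W(1)] G_subset[OF W(1)] V by auto
      have "n < m + 2"
      proof (rule ccontr)
        assume "\<not> n < m + 2"
        then have "G W m \<subseteq> X closure_of G W (n - 2)"
          by (intro order_trans[OF G_mono[OF W(1)] G_closure[OF W(1)]]) linarith
        then show False using \<open>y \<in> D W' n\<close> V(5) \<open>\<not> n < m + 2\<close> W' by (auto simp: D_def)
      qed
      then show "V \<in> (\<Union>n<m+2. (\<inter>) (D W n) ` \<S> W n)" using V W' by auto
    qed
    moreover have "finite (\<Union>n<m+2. (\<inter>) (D W n) ` \<S> W n)" using \<S>[OF W(1)] by auto
    ultimately have "finite {V \<in> \<V>. V \<inter> G W m \<noteq> {}}" by (rule finite_subset)
    then show "\<exists>V. openin X V \<and> x \<in> V \<and> finite {U \<in> \<V>. U \<inter> V \<noteq> {}}"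
      using open_G[OF W(1)] W(2) by blast
  qed (use 3 in simp)
  show "\<exists>\<V>. (\<forall>V\<in>\<V>. openin X V) \<and> \<Union>\<V> = topspace X \<and> (\<forall>V\<in>\<V>. \<exists>U\<in>\<U>. V \<subseteq> U) \<and> locally_finite_in X \<V>"
    using 1 2 3 4 by blast
qed

text \<open>Successive differences of cutoffs telescope to 1, and at any point at most two of them
  are nonzero. The squares of their roots sum to 1, and as each root is at most 1, the sum of the
  roots is at most 2.\<close>

lemma square_partition_of_unity:
  obtains g :: "'t set \<times> nat \<Rightarrow> 't \<Rightarrow> real" and I where
    "\<forall>i\<in>I. continuous_map X euclideanreal (g i)"
    "\<forall>i\<in>I. \<forall>x\<in>topspace X. 0 \<le> g i x"
    "\<forall>i\<in>I. \<exists>K. compactin X K \<and> (\<forall>x\<in>topspace X - K. g i x = 0)"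
    "\<forall>K. compactin X K \<longrightarrow> finite {i \<in> I. \<exists>x\<in>K. g i x \<noteq> 0}"
    "\<forall>x\<in>topspace X. \<exists>J\<subseteq>I. finite J \<and> (\<forall>i\<in>I - J. g i x = 0) \<and>
       (\<Sum>i\<in>J. (g i x)\<^sup>2) = 1 \<and> (\<Sum>i\<in>J. g i x) \<le> 2"
proof -
  have "\<exists>f L. W \<in> \<W> \<longrightarrow> continuous_map X euclideanreal f \<and> (\<forall>x. 0 \<le> f x \<and> f x \<le> 1) \<and>
     (\<forall>x\<in>X closure_of G W n. f x = 1) \<and> compactin X L \<and> L \<subseteq> G W (Suc n) \<and> (\<forall>x. x \<notin> L \<longrightarrow> f x = 0)" for W n
  proof (cases "W \<in> \<W>")
    case True
    show ?thesis
      by (rule compact_cutoff[OF lc Hausdorff compact_G[OF True] open_G[OF True] closure_G[OF True], of n]) blast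
  qed auto
  then obtain f :: "'t set \<Rightarrow> nat \<Rightarrow> 't \<Rightarrow> real" and L where
    fL: "\<And>W n. W \<in> \<W> \<Longrightarrow> continuous_map X euclideanreal (f W n) \<and> (\<forall>x. 0 \<le> f W n x \<and> f W n x \<le> 1) \<and>
     (\<forall>x\<in>X closure_of G W n. f W n x = 1) \<and> compactin X (L W n) \<and> L W n \<subseteq> G W (Suc n) \<and>
     (\<forall>x. x \<notin> L W n \<longrightarrow> f W n x = 0)"
    by metis
  define p where "p W n x = (if n = 0 then f W 0 x else f W n x - f W (n - 1) x)" for W n x
  define g where "g = (\<lambda>(W, n) x. sqrt (p W n x))"
  have f1: "f W n x = 1" if "W \<in> \<W>" "x \<in> G W n" for W n x
    using fL[OF that(1), of n] that G_closure by blast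
  have f0: "f W n x = 0" if "W \<in> \<W>" "x \<notin> G W (Suc n)" for W n x
    using fL[OF that(1), of n] that by blast
  have p_outside: "p W n x = 0" if "W \<in> \<W>" "x \<notin> W" for W n x
  proof -
    have "f W k x = 0" for k using f0[OF that(1)] G_subset[OF that(1), of "Suc k"] that(2) by auto
    then show ?thesis by (simp add: p_def)
  qed
  \<comment> \<open>Where \<open>f W (n - 1)\<close> is nonzero, the point lies in
    \<open>G W n\<close>, on which \<open>f W n\<close> already has the value 1.\<close>
  have p_nonneg: "0 \<le> p W n x" if W: "W \<in> \<W>" for W n x
  proof (cases "n = 0 \<or> f W (n - 1) x = 0")
    case True then show ?thesis using fL[OF W] by (auto simp: p_def)
  next
    case False
    then have "x \<in> G W n" using f0[OF W, of x "n - 1"] by auto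
    then show ?thesis using f1[OF W, of x n] fL[OF W, of "n - 1"] by (auto simp: p_def)
  qed
  have p_later: "p W n x = 0" if "W \<in> \<W>" "x \<in> G W m" "m < n" for W n m x
  proof -
    have "x \<in> G W n" "x \<in> G W (n - 1)"
      using subsetD[OF G_mono[OF that(1)] that(2)] that(3) by simp_all
    then have "f W n x = 1" "f W (n - 1) x = 1" by (simp_all only: f1[OF that(1)])
    then show ?thesis using that(3) by (simp add: p_def)
  qed
  have p_early: "p W n x = 0" if "W \<in> \<W>" "x \<notin> G W (Suc n)" for W n x
  proof -
    have "x \<notin> G W (Suc (n - 1))"
      using subsetD[OF G_mono[OF that(1), of "Suc (n - 1)" "Suc n"], of x] that(2) by auto
    then have "f W n x = 0" "f W (n - 1) x = 0" using f0[OF that(1)] that(2) by auto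
    then show ?thesis by (cases "n = 0") (simp_all add: p_def)
  qed
  show thesis
  proof (rule that[of "\<W> \<times> UNIV" g]; (intro ballI allI impI)?)
    fix i assume "i \<in> \<W> \<times> (UNIV :: nat set)"
    then obtain W n where i: "i = (W, n)" "W \<in> \<W>" by auto
    have cf: "continuous_map X euclideanreal (f W n)" for n using fL[OF i(2)] by blast
    have "continuous_map X euclideanreal (p W n)"
      using continuous_map_diff[OF cf[of n] cf[of "n - 1"]] cf[of 0] unfolding p_def by (cases "n = 0") simp_all
    from continuous_map_compose[OF this, of euclideanreal sqrt]
    show "continuous_map X euclideanreal (g i)"
      by (simp add: g_def i o_def continuous_on_real_sqrt)
    show "0 \<le> g i x" for x using p_nonneg i by (simp add: g_def)
    have "\<forall>x\<in>topspace X - X closure_of G W (Suc n). g i x = 0"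
      using p_early[OF i(2)] G_closure[OF i(2)] by (auto simp: g_def i)
    then show "\<exists>K. compactin X K \<and> (\<forall>x\<in>topspace X - K. g i x = 0)"
      by (intro exI[of _ "X closure_of G W (Suc n)"] conjI compact_G[OF i(2)])
  next
    fix K assume K: "compactin X K"
    have "topspace X \<subseteq> \<Union>((\<lambda>(W, n). G W n) ` (\<W> \<times> UNIV))"
    proof
      fix x assume "x \<in> topspace X"
      then obtain W m where "W \<in> \<W>" "x \<in> G W m" using first_index by blast
      then show "x \<in> \<Union>((\<lambda>(W, n). G W n) ` (\<W> \<times> UNIV))" by force
    qed
    then have "\<exists>\<F>. finite \<F> \<and> \<F> \<subseteq> (\<lambda>(W, n). G W n) ` (\<W> \<times> UNIV) \<and> K \<subseteq> \<Union>\<F>"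
      using open_G compactin_subset_topspace[OF K] by (intro compactinD[OF K]) auto
    then obtain F where F: "finite F" "F \<subseteq> \<W> \<times> UNIV" "K \<subseteq> \<Union>((\<lambda>(W, n). G W n) ` F)"
      by (metis finite_subset_image)
    have "{i \<in> \<W> \<times> UNIV. \<exists>x\<in>K. g i x \<noteq> 0} \<subseteq> (\<Union>(W, m)\<in>F. {W} \<times> {..m})"
    proof
      fix i assume "i \<in> {i \<in> \<W> \<times> UNIV. \<exists>x\<in>K. g i x \<noteq> 0}"
      then obtain W n x where i: "i = (W, n)" "W \<in> \<W>" "x \<in> K" "p W n x \<noteq> 0"
        by (auto simp: g_def)
      obtain W' m where W': "(W', m) \<in> F" "W' \<in> \<W>" "x \<in> G W' m" using F i(3) by blast
      have "x \<in> W" using p_outside i by blast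
      then have [simp]: "W' = W" using disjoint_pieces i W' G_subset by blast
      have "n \<le> m" using p_later[of W x m n] i W' by (auto simp: not_less[symmetric])
      then show "i \<in> (\<Union>(W, m)\<in>F. {W} \<times> {..m})" using W' i by auto
    qed
    moreover have "finite (\<Union>(W, m)\<in>F. {W} \<times> {..m})" using F(1) by auto
    ultimately show "finite {i \<in> \<W> \<times> UNIV. \<exists>x\<in>K. g i x \<noteq> 0}" by (rule finite_subset)
  next
    fix x assume "x \<in> topspace X"
    then obtain W m where W: "W \<in> \<W>" "x \<in> G W m" "\<forall>n<m. x \<notin> G W n"
      by (rule first_index)
    \<comment> \<open>\<open>m\<close> is the first stage that contains \<open>x\<close>.
      Differences of index above \<open>m\<close> vanish because both cutoffs are 1, those of index
      below \<open>m - 1\<close> because the cutoffs involved are 0. For \<open>m = 0\<close> the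
      two indices in \<open>J\<close> coincide.\<close>
    define J where "J = {(W, m - 1), (W, m)}"
    have out: "g i x = 0" if "i \<in> \<W> \<times> UNIV - J" for i
    proof -
      obtain W' n where eq: "i = (W', n)" by (cases i)
      then have i: "i = (W', n)" "W' \<in> \<W>" "(W', n) \<notin> J" using that by auto
      show ?thesis
      proof (cases "W' = W")
        case False
        then have "x \<notin> W'" using disjoint_pieces W(1,2) i(2) G_subset by blast
        then show ?thesis using p_outside i by (simp add: g_def)
      next
        case True
        then have "m < n \<or> Suc n < m" using i(3) by (auto simp: J_def)
        then show ?thesis using p_later[OF W(1,2)] p_early[OF W(1)] W(3) True i by (auto simp: g_def)
      qed
    qed
    have fm: "f W m x = 1" using f1 W by blast
    \<comment> \<open>The point is outside \<open>G W (m - 1)\<close>, in which the cutoff of index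
      \<open>m - 2\<close> is supported.\<close>
    have fm2: "f W (m - 1 - 1) x = 0" if "m \<ge> 2"
      by (rule f0[OF W(1)]) (use W(3) that in \<open>simp add: Suc_diff_Suc numeral_2_eq_2\<close>)
    have bnd: "0 \<le> f W (m - 1) x" "f W (m - 1) x \<le> 1" using fL[OF W(1)] by blast+
    have "(\<Sum>i\<in>J. (g i x)\<^sup>2) = 1 \<and> (\<Sum>i\<in>J. g i x) \<le> 2"
    proof (cases "m = 0")
      case True then show ?thesis using fm by (simp add: J_def g_def p_def)
    next
      case False
      have "p W (m - 1) x = f W (m - 1) x"
        using fm2 False by (cases "m = 1") (simp_all add: p_def)
      moreover have "p W m x = 1 - f W (m - 1) x" using False fm by (simp add: p_def)
      moreover have "sqrt (f W (m - 1) x) + sqrt (1 - f W (m - 1) x) \<le> 1 + 1"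
        using bnd by (intro add_mono) simp_all
      ultimately show ?thesis using False bnd by (simp add: J_def g_def)
    qed
    note sums = this
    show "\<exists>J\<subseteq>\<W> \<times> UNIV. finite J \<and> (\<forall>i\<in>\<W> \<times> UNIV - J. g i x = 0) \<and>
       (\<Sum>i\<in>J. (g i x)\<^sup>2) = 1 \<and> (\<Sum>i\<in>J. g i x) \<le> 2"
    proof (intro exI[of _ J] conjI)
      show "J \<subseteq> \<W> \<times> UNIV" "finite J" using W(1) by (simp_all add: J_def)
      show "\<forall>i\<in>\<W> \<times> UNIV - J. g i x = 0" by (rule ballI) (rule out)
    qed (simp_all only: sums)
  qed
qed

end

section \<open>Bounded linear maps and module actions: elementary properties\<close>

lemma linear_map_closed: "linear_map V W f \<Longrightarrow> x \<in> carrier V \<Longrightarrow> f x \<in> carrier W"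
  and linear_map_add: "linear_map V W f \<Longrightarrow> x \<in> carrier V \<Longrightarrow> y \<in> carrier V \<Longrightarrow>
    f (x \<oplus>\<^bsub>V\<^esub> y) = f x \<oplus>\<^bsub>W\<^esub> f y"
  and linear_map_smult: "linear_map V W f \<Longrightarrow> x \<in> carrier V \<Longrightarrow> f (c \<odot>\<^bsub>V\<^esub> x) = c \<odot>\<^bsub>W\<^esub> f x"
  unfolding linear_map_def by blast+

lemma linear_mapI:
  assumes "\<And>x. x \<in> carrier V \<Longrightarrow> f x \<in> carrier W"
    "\<And>x y. x \<in> carrier V \<Longrightarrow> y \<in> carrier V \<Longrightarrow> f (x \<oplus>\<^bsub>V\<^esub> y) = f x \<oplus>\<^bsub>W\<^esub> f y"
    "\<And>c x. x \<in> carrier V \<Longrightarrow> f (c \<odot>\<^bsub>V\<^esub> x) = c \<odot>\<^bsub>W\<^esub> f x"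
  shows "linear_map V W f"
  using assms by (auto simp: linear_map_def)

lemma bounded_linear_map_linear: "bounded_linear_map V W f \<Longrightarrow> linear_map V W f"
  by (simp add: bounded_linear_map_def)

lemma bounded_linear_map_bound:
  assumes "bounded_linear_map V W f" "banach_space V"
  obtains K where "K \<ge> 0" "\<And>x. x \<in> carrier V \<Longrightarrow> vnorm W (f x) \<le> K * vnorm V x"
proof -
  obtain K where K: "\<forall>x\<in>carrier V. vnorm W (f x) \<le> K * vnorm V x"
    using assms(1) by (auto simp: bounded_linear_map_def)
  \<comment> \<open>A bound on a space consisting of zero alone may be negative, but later estimates
    multiply by the constant and need it nonnegative.\<close>
  have "K * vnorm V x \<le> max K 0 * vnorm V x" if "x \<in> carrier V" for x
    using banach_space.vnorm_nonneg[OF assms(2) that] by (intro mult_right_mono) auto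
  then show thesis using K by (intro that[of "max K 0"]) force+
qed

lemma linear_map_zero:
  assumes "linear_map V W f" "banach_space V" "banach_space W"
  shows "f \<zero>\<^bsub>V\<^esub> = \<zero>\<^bsub>W\<^esub>"
proof -
  interpret V: banach_space V by fact
  interpret W: banach_space W by fact
  show ?thesis
    using linear_map_smult[OF assms(1), of "\<zero>\<^bsub>V\<^esub>" 0] linear_map_closed[OF assms(1)] by simp
qed

lemma linear_map_minus:
  assumes "linear_map V W f" "banach_space V" "banach_space W" "x \<in> carrier V" "y \<in> carrier V"
  shows "f (x \<ominus>\<^bsub>V\<^esub> y) = f x \<ominus>\<^bsub>W\<^esub> f y"
proof -
  interpret V: banach_space V by fact
  interpret W: banach_space W by fact
  show ?thesis
    using assms by (simp add: V.minus_eq_smult W.minus_eq_smult linear_map_add[of V W]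
        linear_map_smult[of V W] linear_map_closed[of V W])
qed

lemma ndist_bounded_linear_map:
  assumes "linear_map V W f" "banach_space V" "banach_space W" "x \<in> carrier V" "y \<in> carrier V"
    and "\<And>x. x \<in> carrier V \<Longrightarrow> vnorm W (f x) \<le> K * vnorm V x"
  shows "ndist W (f x) (f y) \<le> K * ndist V x y"
proof -
  interpret V: banach_space V by fact
  interpret W: banach_space W by fact
  show ?thesis
    using assms(4,5) assms(6)[of "x \<ominus>\<^bsub>V\<^esub> y"] linear_map_minus[OF assms(1-5)] linear_map_closed[OF assms(1)]
    by (simp add: V.ndist_eq W.ndist_eq)
qed

context left_banach_module begin

lemma act_nonneg_bound:
  assumes "banach_space B"
  obtains K where "K \<ge> 0" "\<And>b y. b \<in> carrier B \<Longrightarrow> y \<in> carrier Y \<Longrightarrow>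
    vnorm Y (act b y) \<le> K * vnorm B b * vnorm Y y"
proof -
  obtain K where K: "\<forall>b\<in>carrier B. \<forall>y\<in>carrier Y. vnorm Y (act b y) \<le> K * vnorm B b * vnorm Y y"
    using act_bounded by blast
  have "K * vnorm B b * vnorm Y y \<le> max K 0 * vnorm B b * vnorm Y y"
    if "b \<in> carrier B" "y \<in> carrier Y" for b y
    using banach_space.vnorm_nonneg[OF assms that(1)] vnorm_nonneg[OF that(2)]
    by (intro mult_right_mono) auto
  then show thesis using K by (intro that[of "max K 0"]) force+
qed

end

section \<open>Transport of structure\<close>

definition transport :: "('y \<Rightarrow> 'u) \<Rightarrow> 'y cnormed \<Rightarrow> 'u cnormed" where
  "transport j Y = (let r = inv_into (carrier Y) j in
     \<lparr>carrier = j ` carrier Y,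
      monoid.mult = (\<lambda>x y. undefined),
      one = undefined,
      zero = j \<zero>\<^bsub>Y\<^esub>,
      add = (\<lambda>x y. j (r x \<oplus>\<^bsub>Y\<^esub> r y)),
      smult = (\<lambda>c x. j (c \<odot>\<^bsub>Y\<^esub> r x)),
      vnorm = (\<lambda>x. vnorm Y (r x))\<rparr>)"

text \<open>Projectivity is tested on modules in one type \<open>'u\<close>. A module in any type
  that can be injected into \<open>'u\<close> is copied there, the lifting is done on the copy, and
  the result is carried back.\<close>

lemma projective_module_transport:
  fixes Y :: "'y cnormed" and j :: "'y \<Rightarrow> 'u"
  assumes proj: "projective_module TYPE('u) B P actP"
    and Y: "left_banach_module B Y act" and j: "inj_on j (carrier Y)"
    and \<phi>: "module_morphism B Y act P actP \<phi>" "\<phi> ` carrier Y = carrier P"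
    and \<sigma>: "bounded_linear_map P Y \<sigma>" "\<And>p. p \<in> carrier P \<Longrightarrow> \<phi> (\<sigma> p) = p"
  shows "\<exists>\<rho>. module_morphism B P actP Y act \<rho> \<and> (\<forall>p\<in>carrier P. \<phi> (\<rho> p) = p)"
proof -
  interpret Y: left_banach_module B Y act by fact
  define r where "r = inv_into (carrier Y) j"
  define Y' where "Y' = transport j Y"
  define act' where "act' b x = j (act b (r x))" for b x
  have rj [simp]: "r (j y) = y" if "y \<in> carrier Y" for y
    unfolding r_def by (rule inv_into_f_f[OF j that])
  have Y'_simps [simp]: "carrier Y' = j ` carrier Y" "\<zero>\<^bsub>Y'\<^esub> = j \<zero>\<^bsub>Y\<^esub>"
     "\<And>x y. x \<oplus>\<^bsub>Y'\<^esub> y = j (r x \<oplus>\<^bsub>Y\<^esub> r y)" "\<And>c x. c \<odot>\<^bsub>Y'\<^esub> x = j (c \<odot>\<^bsub>Y\<^esub> r x)"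
     "\<And>x. vnorm Y' x = vnorm Y (r x)"
    by (simp_all add: Y'_def transport_def r_def Let_def)
  have Y': "banach_space Y'"
  proof (rule banach_space_embed[OF Y.banach_space_axioms, where j = r])
    show "inj_on r (carrier Y')" by (rule inj_on_inverseI[where g = j]) auto
    show "l \<in> r ` carrier Y'" if "l \<in> carrier Y" for l
      using that by (force simp: image_image)
  qed auto
  have "left_banach_module B Y' act'"
  proof (rule left_banach_module.intro[OF Y'], unfold_locales)
    show "\<exists>K. \<forall>b\<in>carrier B. \<forall>y\<in>carrier Y'. vnorm Y' (act' b y) \<le> K * vnorm B b * vnorm Y' y"
      using Y.act_bounded by (auto simp: act'_def Y.act_closed)
  qed (auto simp: act'_def Y.act_closed Y.act_add_left Y.act_add_right Y.act_smult_left
      Y.act_smult_right Y.act_mult)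
  moreover have "module_morphism B Y' act' P actP (\<phi> \<circ> r)"
    using \<phi>(1) by (auto simp: module_morphism_def bounded_linear_map_def linear_map_def act'_def
        Y.act_closed Pi_iff)
  moreover have "(\<phi> \<circ> r) ` carrier Y' = carrier P"
    using \<phi>(2) by (auto simp: image_image cong: image_cong)
  moreover have "bounded_linear_map P Y' (j \<circ> \<sigma>)"
    using \<sigma>(1) by (auto simp: bounded_linear_map_def linear_map_def Pi_iff)
  moreover have "\<forall>p\<in>carrier P. (\<phi> \<circ> r) ((j \<circ> \<sigma>) p) = p"
    using \<sigma> linear_map_closed[OF bounded_linear_map_linear[OF \<sigma>(1)]] by auto
  ultimately have "\<exists>\<rho>. module_morphism B P actP Y' act' \<rho> \<and> (\<forall>p\<in>carrier P. (\<phi> \<circ> r) (\<rho> p) = p)"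
    by (intro proj[unfolded projective_module_def, THEN spec, THEN spec, THEN spec, THEN mp]
        conjI exI[of _ "j \<circ> \<sigma>"])
  then obtain \<rho> where \<rho>: "module_morphism B P actP Y' act' \<rho>"
      "\<forall>p\<in>carrier P. (\<phi> \<circ> r) (\<rho> p) = p"
    by (elim exE conjE)
  have "r (\<rho> p) \<in> carrier Y" if "p \<in> carrier P" for p
  proof -
    have "linear_map P Y' \<rho>" using \<rho>(1) by (simp add: module_morphism_def bounded_linear_map_def)
    then have "\<rho> p \<in> j ` carrier Y" using linear_map_closed that by fastforce
    then show ?thesis by auto
  qed
  then have "module_morphism B P actP Y act (r \<circ> \<rho>)"
    using \<rho>(1) by (auto simp: module_morphism_def bounded_linear_map_def linear_map_def act'_def
        Y.act_closed)
  then show ?thesis using \<rho>(2) by (intro exI[of _ "r \<circ> \<rho>"]) auto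
qed

section \<open>Direct sums\<close>

definition direct_sum :: "'x cnormed \<Rightarrow> 'y cnormed \<Rightarrow> ('x \<times> 'y) cnormed" where
  "direct_sum X Y =
     \<lparr>carrier = carrier X \<times> carrier Y,
      monoid.mult = (\<lambda>x y. undefined),
      one = undefined,
      zero = (\<zero>\<^bsub>X\<^esub>, \<zero>\<^bsub>Y\<^esub>),
      add = (\<lambda>p q. (fst p \<oplus>\<^bsub>X\<^esub> fst q, snd p \<oplus>\<^bsub>Y\<^esub> snd q)),
      smult = (\<lambda>c p. (c \<odot>\<^bsub>X\<^esub> fst p, c \<odot>\<^bsub>Y\<^esub> snd p)),
      vnorm = (\<lambda>p. vnorm X (fst p) + vnorm Y (snd p))\<rparr>"

lemma direct_sum_simps [simp]:
  "carrier (direct_sum X Y) = carrier X \<times> carrier Y"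
  "\<zero>\<^bsub>direct_sum X Y\<^esub> = (\<zero>\<^bsub>X\<^esub>, \<zero>\<^bsub>Y\<^esub>)"
  "p \<oplus>\<^bsub>direct_sum X Y\<^esub> q = (fst p \<oplus>\<^bsub>X\<^esub> fst q, snd p \<oplus>\<^bsub>Y\<^esub> snd q)"
  "c \<odot>\<^bsub>direct_sum X Y\<^esub> p = (c \<odot>\<^bsub>X\<^esub> fst p, c \<odot>\<^bsub>Y\<^esub> snd p)"
  "vnorm (direct_sum X Y) p = vnorm X (fst p) + vnorm Y (snd p)"
  by (simp_all add: direct_sum_def)

lemma banach_space_direct_sum:
  assumes "banach_space X" "banach_space Y"
  shows "banach_space (direct_sum X Y)"
proof -
  interpret X: banach_space X by fact
  interpret Y: banach_space Y by fact
  show ?thesis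
  proof (rule banach_spaceI)
    fix p assume "p \<in> carrier (direct_sum X Y)" "vnorm (direct_sum X Y) p = 0"
    then show "p = \<zero>\<^bsub>direct_sum X Y\<^esub>"
      using X.vnorm_nonneg[of "fst p"] Y.vnorm_nonneg[of "snd p"]
      by (auto simp: add_nonneg_eq_0_iff X.vnorm_eq_0_iff Y.vnorm_eq_0_iff)
  next
    fix p q assume "p \<in> carrier (direct_sum X Y)" "q \<in> carrier (direct_sum X Y)"
    then show "vnorm (direct_sum X Y) (p \<oplus>\<^bsub>direct_sum X Y\<^esub> q)
        \<le> vnorm (direct_sum X Y) p + vnorm (direct_sum X Y) q"
      using X.vnorm_triangle[of "fst p" "fst q"] Y.vnorm_triangle[of "snd p" "snd q"] by auto
  next
    fix \<sigma> :: "nat \<Rightarrow> _"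
    assume \<sigma>: "\<And>n. \<sigma> n \<in> carrier (direct_sum X Y)"
      and C: "\<And>\<epsilon>. \<epsilon> > 0 \<Longrightarrow> \<exists>N. \<forall>m\<ge>N. \<forall>n\<ge>N.
        vnorm (direct_sum X Y) (\<sigma> m \<oplus>\<^bsub>direct_sum X Y\<^esub> (-1) \<odot>\<^bsub>direct_sum X Y\<^esub> \<sigma> n) < \<epsilon>"
    have in1: "fst (\<sigma> n) \<in> carrier X" and in2: "snd (\<sigma> n) \<in> carrier Y" for n
      using \<sigma>[of n] by auto
    have nd: "vnorm (direct_sum X Y) (p \<oplus>\<^bsub>direct_sum X Y\<^esub> (-1) \<odot>\<^bsub>direct_sum X Y\<^esub> q) =
        ndist X (fst p) (fst q) + ndist Y (snd p) (snd q)"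
      if "p \<in> carrier (direct_sum X Y)" "q \<in> carrier (direct_sum X Y)" for p q
      using that by (auto simp: X.ndist_eq Y.ndist_eq X.minus_eq_smult Y.minus_eq_smult)
    have "\<exists>N. \<forall>m\<ge>N. \<forall>n\<ge>N. ndist X (fst (\<sigma> m)) (fst (\<sigma> n)) + ndist Y (snd (\<sigma> m)) (snd (\<sigma> n)) < \<epsilon>"
      if "\<epsilon> > 0" for \<epsilon>
      using C[OF that] nd[OF \<sigma> \<sigma>] by simp
    then have C1: "\<exists>N. \<forall>m\<ge>N. \<forall>n\<ge>N. ndist X (fst (\<sigma> m)) (fst (\<sigma> n)) < \<epsilon>"
      and C2: "\<exists>N. \<forall>m\<ge>N. \<forall>n\<ge>N. ndist Y (snd (\<sigma> m)) (snd (\<sigma> n)) < \<epsilon>" if "\<epsilon> > 0" for \<epsilon>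
      using that X.metric.nonneg Y.metric.nonneg by (smt (verit, best))+
    obtain l where l: "l \<in> carrier X" "\<forall>\<epsilon>>0. \<exists>N. \<forall>n\<ge>N. ndist X (fst (\<sigma> n)) l < \<epsilon>"
      using X.complete_Cauchy[of "\<lambda>n. fst (\<sigma> n)", OF in1 C1] by auto
    obtain k where k: "k \<in> carrier Y" "\<forall>\<epsilon>>0. \<exists>N. \<forall>n\<ge>N. ndist Y (snd (\<sigma> n)) k < \<epsilon>"
      using Y.complete_Cauchy[of "\<lambda>n. snd (\<sigma> n)", OF in2 C2] by auto
    have "\<exists>N. \<forall>n\<ge>N. vnorm (direct_sum X Y)
        (\<sigma> n \<oplus>\<^bsub>direct_sum X Y\<^esub> (-1) \<odot>\<^bsub>direct_sum X Y\<^esub> (l, k)) < \<epsilon>" if "\<epsilon> > 0" for \<epsilon>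
    proof -
      obtain N1 where N1: "\<And>n. n \<ge> N1 \<Longrightarrow> ndist X (fst (\<sigma> n)) l < \<epsilon>/2"
        using l(2) \<open>\<epsilon> > 0\<close> half_gt_zero by blast
      obtain N2 where N2: "\<And>n. n \<ge> N2 \<Longrightarrow> ndist Y (snd (\<sigma> n)) k < \<epsilon>/2"
        using k(2) \<open>\<epsilon> > 0\<close> half_gt_zero by blast
      have "vnorm (direct_sum X Y) (\<sigma> n \<oplus>\<^bsub>direct_sum X Y\<^esub> (-1) \<odot>\<^bsub>direct_sum X Y\<^esub> (l, k)) < \<epsilon>"
        if "n \<ge> max N1 N2" for n
        using N1[of n] N2[of n] that nd[OF \<sigma>, of "(l, k)"] l(1) k(1) by simp
      then show ?thesis by blast
    qed
    then show "\<exists>l\<in>carrier (direct_sum X Y). \<forall>\<epsilon>>0. \<exists>N. \<forall>n\<ge>N. vnorm (direct_sum X Y)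
        (\<sigma> n \<oplus>\<^bsub>direct_sum X Y\<^esub> (-1) \<odot>\<^bsub>direct_sum X Y\<^esub> l) < \<epsilon>"
      using l(1) k(1) by (intro bexI[of _ "(l, k)"]) auto
  qed (auto simp: X.M.a_assoc Y.M.a_assoc X.smult_plus_left Y.smult_plus_left X.smult_smult
      Y.smult_smult X.smult_plus_right Y.smult_plus_right X.vnorm_nonneg Y.vnorm_nonneg
      X.vnorm_smult Y.vnorm_smult distrib_left intro: X.M.a_comm Y.M.a_comm)
qed

section \<open>Second cohomology and projectivity\<close>

lemma tuples_1: "as \<in> tuples A (Suc 0) \<longleftrightarrow> (\<exists>a\<in>carrier A. as = [a])"
  by (auto simp: tuples_def length_Suc_conv)

lemma tuples_2: "as \<in> tuples A 2 \<longleftrightarrow> (\<exists>a\<in>carrier A. \<exists>b\<in>carrier A. as = [a, b])"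
  by (auto simp: tuples_def length_Suc_conv numeral_2_eq_2)

lemma tuples_3: "as \<in> tuples A 3 \<longleftrightarrow>
    (\<exists>a\<in>carrier A. \<exists>b\<in>carrier A. \<exists>c\<in>carrier A. as = [a, b, c])"
  by (auto simp: tuples_def length_Suc_conv numeral_3_eq_3)

text \<open>In degrees 1 and 2 cochains are traded for maps of one and two variables, which spares
  updates of lists in all that follows.\<close>

lemma cochains_1_iff:
  "g \<in> cochains A X (Suc 0) \<longleftrightarrow>
     g \<in> extensional (tuples A (Suc 0)) \<and> bounded_linear_map A X (\<lambda>a. g [a])"
proof
  assume g: "g \<in> cochains A X (Suc 0)"
  have "g [a \<oplus>\<^bsub>A\<^esub> b] = g [a] \<oplus>\<^bsub>X\<^esub> g [b]" "g [c \<odot>\<^bsub>A\<^esub> a] = c \<odot>\<^bsub>X\<^esub> g [a]"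
    if "a \<in> carrier A" "b \<in> carrier A" for a b c
    using g that unfolding cochains_def Ball_def tuples_1 by (force dest: spec[of _ "[a]"])+
  then have "linear_map A X (\<lambda>a. g [a])"
    using g by (auto simp: linear_map_def cochains_def PiE_iff tuples_1)
  moreover obtain K where "\<forall>as\<in>tuples A (Suc 0). vnorm X (g as) \<le> K * (\<Prod>a\<leftarrow>as. vnorm A a)"
    using g by (auto simp: cochains_def)
  then have "\<forall>a\<in>carrier A. vnorm X (g [a]) \<le> K * vnorm A a"
    unfolding Ball_def tuples_1 by auto
  ultimately show "g \<in> extensional (tuples A (Suc 0)) \<and> bounded_linear_map A X (\<lambda>a. g [a])"
    using g by (auto simp: bounded_linear_map_def cochains_def PiE_iff)
next
  assume g: "g \<in> extensional (tuples A (Suc 0)) \<and> bounded_linear_map A X (\<lambda>a. g [a])"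
  then obtain K where K: "\<forall>a\<in>carrier A. vnorm X (g [a]) \<le> K * vnorm A a"
    by (auto simp: bounded_linear_map_def)
  then have "\<forall>as\<in>tuples A (Suc 0). vnorm X (g as) \<le> K * (\<Prod>a\<leftarrow>as. vnorm A a)"
    unfolding Ball_def tuples_1 by auto
  then show "g \<in> cochains A X (Suc 0)"
    using g unfolding cochains_def bounded_linear_map_def linear_map_def
    by (auto simp: tuples_1 PiE_iff)
qed

definition bounded_bilinear_map where
  "bounded_bilinear_map A B X F \<longleftrightarrow>
     (\<forall>a\<in>carrier A. linear_map B X (F a)) \<and> (\<forall>b\<in>carrier B. linear_map A X (\<lambda>a. F a b)) \<and>
     (\<exists>K. \<forall>a\<in>carrier A. \<forall>b\<in>carrier B. vnorm X (F a b) \<le> K * (vnorm A a * vnorm B b))"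

lemma cochains_2_iff:
  "f \<in> cochains A X 2 \<longleftrightarrow>
     f \<in> extensional (tuples A 2) \<and> bounded_bilinear_map A A X (\<lambda>a b. f [a, b])"
proof
  assume f: "f \<in> cochains A X 2"
  have add: "f (as[i := a \<oplus>\<^bsub>A\<^esub> b]) = f (as[i := a]) \<oplus>\<^bsub>X\<^esub> f (as[i := b])"
    if "as \<in> tuples A 2" "i < 2" "a \<in> carrier A" "b \<in> carrier A" for as i a b
    using f that by (simp add: cochains_def)
  have smult: "f (as[i := k \<odot>\<^bsub>A\<^esub> a]) = k \<odot>\<^bsub>X\<^esub> f (as[i := a])"
    if "as \<in> tuples A 2" "i < 2" "a \<in> carrier A" for as i a k
    using f that by (simp add: cochains_def)
  have "f [a, b \<oplus>\<^bsub>A\<^esub> b'] = f [a, b] \<oplus>\<^bsub>X\<^esub> f [a, b']" "f [b \<oplus>\<^bsub>A\<^esub> b', a] = f [b, a] \<oplus>\<^bsub>X\<^esub> f [b', a]"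
    "f [a, k \<odot>\<^bsub>A\<^esub> b] = k \<odot>\<^bsub>X\<^esub> f [a, b]" "f [k \<odot>\<^bsub>A\<^esub> b, a] = k \<odot>\<^bsub>X\<^esub> f [b, a]"
    if "a \<in> carrier A" "b \<in> carrier A" "b' \<in> carrier A" for a b b' k
    using add[of "[a, b]" 1 b b'] add[of "[b, a]" 0 b b'] smult[of "[a, b]" 1 b k]
      smult[of "[b, a]" 0 b k] that by (auto simp: tuples_2)
  moreover have "f [a, b] \<in> carrier X" if "a \<in> carrier A" "b \<in> carrier A" for a b
    using f that by (auto simp: cochains_def PiE_iff tuples_2)
  ultimately have "\<forall>a\<in>carrier A. linear_map A X (\<lambda>b. f [a, b])"
      "\<forall>b\<in>carrier A. linear_map A X (\<lambda>a. f [a, b])"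
    by (auto intro!: linear_mapI)
  moreover obtain K where "\<forall>as\<in>tuples A 2. vnorm X (f as) \<le> K * (\<Prod>a\<leftarrow>as. vnorm A a)"
    using f by (auto simp: cochains_def)
  then have "\<forall>a\<in>carrier A. \<forall>b\<in>carrier A. vnorm X (f [a, b]) \<le> K * (\<Prod>a\<leftarrow>[a, b]. vnorm A a)"
    by (simp del: list.map prod_list.Cons add: tuples_2)
  then have "\<forall>a\<in>carrier A. \<forall>b\<in>carrier A. vnorm X (f [a, b]) \<le> K * (vnorm A a * vnorm A b)"
    by simp
  ultimately show "f \<in> extensional (tuples A 2) \<and> bounded_bilinear_map A A X (\<lambda>a b. f [a, b])"
    using f by (auto simp: bounded_bilinear_map_def cochains_def PiE_iff)
next
  assume f: "f \<in> extensional (tuples A 2) \<and> bounded_bilinear_map A A X (\<lambda>a b. f [a, b])"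
  then obtain K where K: "\<forall>a\<in>carrier A. \<forall>b\<in>carrier A. vnorm X (f [a, b]) \<le> K * (vnorm A a * vnorm A b)"
    by (auto simp: bounded_bilinear_map_def)
  then have "\<forall>as\<in>tuples A 2. vnorm X (f as) \<le> K * (\<Prod>a\<leftarrow>as. vnorm A a)"
    unfolding Ball_def tuples_2 by auto
  then show "f \<in> cochains A X 2"
    using f unfolding cochains_def bounded_bilinear_map_def linear_map_def
    by (auto simp: tuples_2 PiE_iff Pi_iff less_2_cases_iff)
qed

locale right_annihilator_bimodule = banach_algebra A + X: banach_bimodule A X lact ract
  for A :: "'b cnormed" and X :: "'x cnormed" and lact :: "'b \<Rightarrow> 'x \<Rightarrow> 'x" and ract :: "'x \<Rightarrow> 'b \<Rightarrow> 'x" +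
  assumes annihilator: "right_annihilator A X ract"
begin

lemma ract_zero [simp]: "x \<in> carrier X \<Longrightarrow> b \<in> carrier A \<Longrightarrow> ract x b = \<zero>\<^bsub>X\<^esub>"
  using annihilator by (simp add: right_annihilator_def)

text \<open>The third Hochschild term, \<open>ract (g [a]) b\<close>, is zero for a right
  annihilator bimodule. What remains measures how far \<open>g\<close> is from being a module
  morphism.\<close>

lemma coboundary_1:
  assumes "g \<in> cochains A X (Suc 0)" "a \<in> carrier A" "b \<in> carrier A"
  shows "coboundary A X lact ract (Suc 0) g [a, b] = lact a (g [b]) \<oplus>\<^bsub>X\<^esub> (-1) \<odot>\<^bsub>X\<^esub> g [a \<otimes>\<^bsub>A\<^esub> b]"
proof -
  have g: "g [c] \<in> carrier X" if "c \<in> carrier A" for c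
    using assms(1) that unfolding cochains_1_iff by (auto dest: bounded_linear_map_linear linear_map_closed)
  have "[a, b] \<in> tuples A (Suc (Suc 0))" using assms by (auto simp: tuples_def)
  then show ?thesis
    using assms g mult_closed X.left.act_closed by (simp add: coboundary_def merge_def lessThan_Suc)
qed

text \<open>The inner terms carry the signs \<open>(- 1) ^ Suc k\<close>: merging \<open>a\<close>
  with \<open>b\<close> (\<open>k = 0\<close>) counts negatively, merging \<open>b\<close> with
  \<open>c\<close> positively. The term with the right action is zero.\<close>

lemma coboundary_2:
  assumes "f \<in> cochains A X 2" "a \<in> carrier A" "b \<in> carrier A" "c \<in> carrier A"
  shows "coboundary A X lact ract 2 f [a, b, c] =
    lact a (f [b, c]) \<oplus>\<^bsub>X\<^esub> (f [a, b \<otimes>\<^bsub>A\<^esub> c] \<oplus>\<^bsub>X\<^esub> (-1) \<odot>\<^bsub>X\<^esub> f [a \<otimes>\<^bsub>A\<^esub> b, c])"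
proof -
  have f: "f [d, d'] \<in> carrier X" if "d \<in> carrier A" "d' \<in> carrier A" for d d'
    using assms(1) that unfolding cochains_2_iff bounded_bilinear_map_def
    by (auto dest: linear_map_closed)
  have t: "[a, b, c] \<in> tuples A (Suc 2)" using assms by (auto simp: tuples_def)
  have "(\<Oplus>\<^bsub>X\<^esub>k\<in>{..<2}. (- 1) ^ Suc k \<odot>\<^bsub>X\<^esub> f (merge A k [a, b, c])) =
      f [a, b \<otimes>\<^bsub>A\<^esub> c] \<oplus>\<^bsub>X\<^esub> (-1) \<odot>\<^bsub>X\<^esub> f [a \<otimes>\<^bsub>A\<^esub> b, c]"
    using assms f mult_closed by (simp add: numeral_2_eq_2 lessThan_Suc merge_def)
  then show ?thesis
    using assms f mult_closed X.left.act_closed t by (simp add: coboundary_def)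
qed

lemma coboundary_extensional: "coboundary A X lact ract n f \<in> extensional (tuples A (Suc n))"
  by (simp add: coboundary_def)

lemma cocycle_iff:
  "f \<in> carrier (cocycle_group A X lact ract 2) \<longleftrightarrow>
     f \<in> cochains A X 2 \<and> (\<forall>a\<in>carrier A. \<forall>b\<in>carrier A. \<forall>c\<in>carrier A.
       lact a (f [b, c]) \<oplus>\<^bsub>X\<^esub> f [a, b \<otimes>\<^bsub>A\<^esub> c] = f [a \<otimes>\<^bsub>A\<^esub> b, c])"
proof (cases "f \<in> cochains A X 2")
  case True
  have f: "f [d, d'] \<in> carrier X" if "d \<in> carrier A" "d' \<in> carrier A" for d d'
    using True that unfolding cochains_2_iff bounded_bilinear_map_def
    by (auto dest: linear_map_closed)
  have eq: "coboundary A X lact ract 2 f [a, b, c] = \<zero>\<^bsub>X\<^esub> \<longleftrightarrow>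
      lact a (f [b, c]) \<oplus>\<^bsub>X\<^esub> f [a, b \<otimes>\<^bsub>A\<^esub> c] = f [a \<otimes>\<^bsub>A\<^esub> b, c]"
    if "a \<in> carrier A" "b \<in> carrier A" "c \<in> carrier A" for a b c
  proof -
    have "coboundary A X lact ract 2 f [a, b, c] =
       (lact a (f [b, c]) \<oplus>\<^bsub>X\<^esub> f [a, b \<otimes>\<^bsub>A\<^esub> c]) \<ominus>\<^bsub>X\<^esub> f [a \<otimes>\<^bsub>A\<^esub> b, c]"
      using that f mult_closed X.left.act_closed
      by (simp add: coboundary_2[OF True that] X.left.minus_eq_smult X.left.M.a_assoc)
    then show ?thesis using that f mult_closed X.left.act_closed by simp
  qed
  have "coboundary A X lact ract 2 f = zero_cochain A X (Suc 2) \<longleftrightarrow>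
      (\<forall>as\<in>tuples A 3. coboundary A X lact ract 2 f as = \<zero>\<^bsub>X\<^esub>)" (is "?l \<longleftrightarrow> ?r")
  proof
    show ?r if ?l using that by (simp add: zero_cochain_def)
    show ?l if ?r
      by (rule extensionalityI[OF coboundary_extensional]) (use that in \<open>auto simp: zero_cochain_def\<close>)
  qed
  then show ?thesis using True eq unfolding cocycle_group_def tuples_3 Ball_def by auto
qed (simp add: cocycle_group_def)

lemma coboundaries_2: "coboundaries A X lact ract 2 = coboundary A X lact ract (Suc 0) ` cochains A X (Suc 0)"
  by (simp add: coboundaries_def numeral_2_eq_2)

text \<open>The quotient \<open>Mod\<close> is formed for arbitrary records; its cosets can be
  compared with the cocycles once these are known to form a group.\<close>

lemma comm_group_cocycle_group: "comm_group (cocycle_group A X lact ract 2)" (is "comm_group ?Z")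
proof -
  have val: "f [a, b] \<in> carrier X" if "f \<in> carrier ?Z" "a \<in> carrier A" "b \<in> carrier A" for f a b
    using that unfolding cocycle_iff cochains_2_iff bounded_bilinear_map_def
    by (auto dest: linear_map_closed)
  have ext: "f \<in> extensional (tuples A 2)" if "f \<in> carrier ?Z" for f
    using that unfolding cocycle_iff cochains_2_iff by auto
  have mult: "f \<otimes>\<^bsub>?Z\<^esub> g = (\<lambda>as\<in>tuples A 2. f as \<oplus>\<^bsub>X\<^esub> g as)" for f g
    by (simp add: cocycle_group_def)
  have one: "\<one>\<^bsub>?Z\<^esub> = (\<lambda>as\<in>tuples A 2. \<zero>\<^bsub>X\<^esub>)"
    by (simp add: cocycle_group_def zero_cochain_def)
  have t2 [simp]: "[a, b] \<in> tuples A 2 \<longleftrightarrow> a \<in> carrier A \<and> b \<in> carrier A" for a b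
    by (auto simp: tuples_2)
  have bil: "linear_map A X (\<lambda>b. f [a, b])" "linear_map A X (\<lambda>b. f [b, a])"
    if "f \<in> carrier ?Z" "a \<in> carrier A" for f a
    using that unfolding cocycle_iff cochains_2_iff bounded_bilinear_map_def by auto
  \<comment> \<open>One closure property serves twice: \<open>c = 1\<close> gives sums, and
    \<open>c = -1\<close> together with the zero cochain gives inverses.\<close>
  have lin: "f \<in> carrier ?Z \<Longrightarrow> g \<in> carrier ?Z \<Longrightarrow>
      (\<lambda>as\<in>tuples A 2. c \<odot>\<^bsub>X\<^esub> f as \<oplus>\<^bsub>X\<^esub> g as) \<in> carrier ?Z" for f g c
  proof -
    assume f: "f \<in> carrier ?Z" and g: "g \<in> carrier ?Z"
    let ?h = "\<lambda>as\<in>tuples A 2. c \<odot>\<^bsub>X\<^esub> f as \<oplus>\<^bsub>X\<^esub> g as"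
    obtain K K' where K: "\<forall>a\<in>carrier A. \<forall>b\<in>carrier A. vnorm X (f [a, b]) \<le> K * (vnorm A a * vnorm A b)"
        "\<forall>a\<in>carrier A. \<forall>b\<in>carrier A. vnorm X (g [a, b]) \<le> K' * (vnorm A a * vnorm A b)"
      using f g unfolding cocycle_iff cochains_2_iff bounded_bilinear_map_def by auto
    have "vnorm X (?h [a, b]) \<le> (cmod c * K + K') * (vnorm A a * vnorm A b)"
      if "a \<in> carrier A" "b \<in> carrier A" for a b
    proof -
      have "vnorm X (?h [a, b]) \<le> cmod c * vnorm X (f [a, b]) + vnorm X (g [a, b])"
        using that val[OF f] val[OF g] X.left.vnorm_triangle[of "c \<odot>\<^bsub>X\<^esub> f [a, b]" "g [a, b]"]
        by (simp add: X.left.vnorm_smult)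
      also have "\<dots> \<le> cmod c * (K * (vnorm A a * vnorm A b)) + K' * (vnorm A a * vnorm A b)"
        using that K by (intro add_mono mult_left_mono) auto
      finally show ?thesis by (simp add: algebra_simps)
    qed
    moreover have "linear_map A X (\<lambda>b. ?h [a, b])" "linear_map A X (\<lambda>b. ?h [b, a])" if a: "a \<in> carrier A" for a
      using that val[OF f] val[OF g]
      by (auto intro!: linear_mapI simp: linear_map_add[OF bil(1)[OF f a]] linear_map_add[OF bil(2)[OF f a]]
          linear_map_add[OF bil(1)[OF g a]] linear_map_add[OF bil(2)[OF g a]]
          linear_map_smult[OF bil(1)[OF f a]] linear_map_smult[OF bil(2)[OF f a]]
          linear_map_smult[OF bil(1)[OF g a]] linear_map_smult[OF bil(2)[OF g a]]
          X.left.smult_plus_right X.left.smult_smult X.left.M.a_ac mult.commute)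
    ultimately have 1: "?h \<in> cochains A X 2"
      unfolding cochains_2_iff bounded_bilinear_map_def by auto
    have "lact a (?h [b, d]) \<oplus>\<^bsub>X\<^esub> ?h [a, b \<otimes>\<^bsub>A\<^esub> d] = ?h [a \<otimes>\<^bsub>A\<^esub> b, d]"
      if abd: "a \<in> carrier A" "b \<in> carrier A" "d \<in> carrier A" for a b d
    proof -
      have *: "lact a (f [b, d]) \<oplus>\<^bsub>X\<^esub> f [a, b \<otimes>\<^bsub>A\<^esub> d] = f [a \<otimes>\<^bsub>A\<^esub> b, d]"
        "lact a (g [b, d]) \<oplus>\<^bsub>X\<^esub> g [a, b \<otimes>\<^bsub>A\<^esub> d] = g [a \<otimes>\<^bsub>A\<^esub> b, d]"
        using f g abd unfolding cocycle_iff by auto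
      have "lact a (?h [b, d]) \<oplus>\<^bsub>X\<^esub> ?h [a, b \<otimes>\<^bsub>A\<^esub> d] =
          (c \<odot>\<^bsub>X\<^esub> lact a (f [b, d]) \<oplus>\<^bsub>X\<^esub> c \<odot>\<^bsub>X\<^esub> f [a, b \<otimes>\<^bsub>A\<^esub> d]) \<oplus>\<^bsub>X\<^esub>
          (lact a (g [b, d]) \<oplus>\<^bsub>X\<^esub> g [a, b \<otimes>\<^bsub>A\<^esub> d])"
        using abd val[OF f] val[OF g] mult_closed X.left.act_closed
        by (simp add: X.left.act_add_right X.left.act_smult_right X.left.M.a_ac)
      also have "\<dots> = c \<odot>\<^bsub>X\<^esub> f [a \<otimes>\<^bsub>A\<^esub> b, d] \<oplus>\<^bsub>X\<^esub> g [a \<otimes>\<^bsub>A\<^esub> b, d]"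
        using abd val[OF f] val[OF g] mult_closed X.left.act_closed
        by (simp add: X.left.smult_plus_right[symmetric] *)
      finally show ?thesis using abd mult_closed by simp
    qed
    then show "?h \<in> carrier ?Z" using 1 unfolding cocycle_iff by blast
  qed
  have zero: "\<one>\<^bsub>?Z\<^esub> \<in> carrier ?Z"
    unfolding cocycle_iff cochains_2_iff bounded_bilinear_map_def one
    using mult_closed X.left.act_closed X.left.act_smult_right[of _ "\<zero>\<^bsub>X\<^esub>" 0]
    by (auto intro!: linear_mapI exI[of _ 0])
  have eqI: "f = g" if "f \<in> extensional (tuples A 2)" "g \<in> extensional (tuples A 2)"
     "\<And>a b. a \<in> carrier A \<Longrightarrow> b \<in> carrier A \<Longrightarrow> f [a, b] = g [a, b]" for f g :: "'b list \<Rightarrow> 'x"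
    by (rule extensionalityI[OF that(1,2)]) (use that(3) in \<open>auto simp: tuples_2\<close>)
  show ?thesis
  proof (rule comm_groupI)
    fix f g assume f: "f \<in> carrier ?Z" and g: "g \<in> carrier ?Z"
    have "f \<otimes>\<^bsub>?Z\<^esub> g = (\<lambda>as\<in>tuples A 2. 1 \<odot>\<^bsub>X\<^esub> f as \<oplus>\<^bsub>X\<^esub> g as)"
      by (rule eqI) (use f g val in \<open>auto simp: mult\<close>)
    then show "f \<otimes>\<^bsub>?Z\<^esub> g \<in> carrier ?Z" using lin[OF f g, of 1] by simp
    show "f \<otimes>\<^bsub>?Z\<^esub> g = g \<otimes>\<^bsub>?Z\<^esub> f"
      by (rule eqI) (use f g val in \<open>auto simp: mult X.left.M.a_comm\<close>)
  next
    fix f g h assume fgh: "f \<in> carrier ?Z" "g \<in> carrier ?Z" "h \<in> carrier ?Z"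
    show "f \<otimes>\<^bsub>?Z\<^esub> g \<otimes>\<^bsub>?Z\<^esub> h = f \<otimes>\<^bsub>?Z\<^esub> (g \<otimes>\<^bsub>?Z\<^esub> h)"
      by (rule eqI) (use fgh val in \<open>auto simp: mult X.left.M.a_assoc\<close>)
  next
    fix f assume f: "f \<in> carrier ?Z"
    show "\<one>\<^bsub>?Z\<^esub> \<otimes>\<^bsub>?Z\<^esub> f = f"
      by (rule eqI) (use f val ext in \<open>auto simp: mult one\<close>)
    let ?g = "\<lambda>as\<in>tuples A 2. (-1) \<odot>\<^bsub>X\<^esub> f as \<oplus>\<^bsub>X\<^esub> \<one>\<^bsub>?Z\<^esub> as"
    have "(-1) \<odot>\<^bsub>X\<^esub> x \<oplus>\<^bsub>X\<^esub> x = \<zero>\<^bsub>X\<^esub>" if "x \<in> carrier X" for x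
      using X.left.smult_plus_left[OF that, of "-1" 1] that by simp
    then have "?g \<otimes>\<^bsub>?Z\<^esub> f = \<one>\<^bsub>?Z\<^esub>"
      by (intro eqI) (use f val in \<open>auto simp: mult one\<close>)
    then show "\<exists>g\<in>carrier ?Z. g \<otimes>\<^bsub>?Z\<^esub> f = \<one>\<^bsub>?Z\<^esub>" using lin[OF f zero] by blast
  qed (rule zero)
qed

text \<open>This is the identity d d = 0 in degree 1. In the cocycle equation the term in which
  \<open>a\<close> acts on the value of \<open>g\<close> at the product of \<open>b\<close> and
  \<open>c\<close> occurs with both signs and cancels; the rest matches by associativity of the
  product and of the action.\<close>

lemma coboundaries_subset:
  "coboundaries A X lact ract 2 \<subseteq> carrier (cocycle_group A X lact ract 2)" (is "?B \<subseteq> carrier ?Z")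
proof
  fix f assume "f \<in> ?B"
  then obtain g where g: "g \<in> cochains A X (Suc 0)" "f = coboundary A X lact ract (Suc 0) g"
    by (auto simp: coboundaries_2)
  have lin: "linear_map A X (\<lambda>a. g [a])" and bdd: "bounded_linear_map A X (\<lambda>a. g [a])"
    using g(1) unfolding cochains_1_iff by (auto dest: bounded_linear_map_linear)
  have val: "g [a] \<in> carrier X" if "a \<in> carrier A" for a using linear_map_closed[OF lin that] .
  have f: "f [a, b] = lact a (g [b]) \<oplus>\<^bsub>X\<^esub> (-1) \<odot>\<^bsub>X\<^esub> g [a \<otimes>\<^bsub>A\<^esub> b]"
    if "a \<in> carrier A" "b \<in> carrier A" for a b
    unfolding g(2) using coboundary_1[OF g(1) that] .
  obtain K where K: "K \<ge> 0" "\<And>a. a \<in> carrier A \<Longrightarrow> vnorm X (g [a]) \<le> K * vnorm A a"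
    using bounded_linear_map_bound[OF bdd banach_space_axioms] by blast
  obtain L where L: "L \<ge> 0" "\<And>b y. b \<in> carrier A \<Longrightarrow> y \<in> carrier X \<Longrightarrow>
      vnorm X (lact b y) \<le> L * vnorm A b * vnorm X y"
    using X.left.act_nonneg_bound[OF banach_space_axioms] by blast
  have "vnorm X (f [a, b]) \<le> (L * K + K) * (vnorm A a * vnorm A b)"
    if ab: "a \<in> carrier A" "b \<in> carrier A" for a b
  proof -
    have "vnorm X (f [a, b]) \<le> vnorm X (lact a (g [b])) + vnorm X (g [a \<otimes>\<^bsub>A\<^esub> b])"
      using ab val mult_closed X.left.act_closed f
        X.left.vnorm_triangle[of "lact a (g [b])" "(-1) \<odot>\<^bsub>X\<^esub> g [a \<otimes>\<^bsub>A\<^esub> b]"] by (simp add: X.left.vnorm_smult)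
    also have "\<dots> \<le> L * vnorm A a * (K * vnorm A b) + K * (vnorm A a * vnorm A b)"
    proof (rule add_mono)
      show "vnorm X (lact a (g [b])) \<le> L * vnorm A a * (K * vnorm A b)"
        using L(2)[OF ab(1) val[OF ab(2)]] K(2)[OF ab(2)] L(1) vnorm_nonneg[OF ab(1)]
        by (meson mult_left_mono mult_nonneg_nonneg order_trans)
      show "vnorm X (g [a \<otimes>\<^bsub>A\<^esub> b]) \<le> K * (vnorm A a * vnorm A b)"
        using K(2)[of "a \<otimes>\<^bsub>A\<^esub> b"] vnorm_mult[OF ab] K(1) ab mult_closed
        by (meson mult_left_mono order_trans)
    qed
    finally show ?thesis by (simp add: algebra_simps)
  qed
  moreover have "linear_map A X (\<lambda>b. f [a, b])" "linear_map A X (\<lambda>b. f [b, a])"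
    if a: "a \<in> carrier A" for a
    using a val mult_closed X.left.act_closed
    by (auto intro!: linear_mapI simp: f linear_map_add[OF lin] linear_map_smult[OF lin]
        mult_distrib_left mult_distrib_right smult_mult_left smult_mult_right
        X.left.act_add_left X.left.act_add_right X.left.act_smult_left X.left.act_smult_right
        X.left.smult_plus_right X.left.smult_smult X.left.M.a_ac mult.commute)
  ultimately have "f \<in> cochains A X 2"
    unfolding cochains_2_iff bounded_bilinear_map_def
    using coboundary_extensional[of "Suc 0" g] by (auto simp: g(2) numeral_2_eq_2)
  moreover have "lact a (f [b, c]) \<oplus>\<^bsub>X\<^esub> f [a, b \<otimes>\<^bsub>A\<^esub> c] = f [a \<otimes>\<^bsub>A\<^esub> b, c]"
    if abc: "a \<in> carrier A" "b \<in> carrier A" "c \<in> carrier A" for a b c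
  proof -
    have *: "(-1) \<odot>\<^bsub>X\<^esub> x \<oplus>\<^bsub>X\<^esub> (x \<oplus>\<^bsub>X\<^esub> y) = y" if "x \<in> carrier X" "y \<in> carrier X" for x y
      using X.left.smult_plus_left[OF that(1), of "-1" 1] that by (simp add: X.left.M.a_assoc[symmetric])
    show ?thesis
      using abc val mult_closed X.left.act_closed
      by (simp add: f X.left.act_add_right X.left.act_smult_right X.left.act_mult X.left.M.a_assoc *
          mult_assoc)
  qed
  ultimately show "f \<in> carrier ?Z" unfolding cocycle_iff by blast
qed

lemma trivial_cohomology_iff:
  "trivial_group (hochschild_cohomology A X lact ract 2) \<longleftrightarrow>
     carrier (cocycle_group A X lact ract 2) = coboundaries A X lact ract 2"
proof
  let ?Z = "cocycle_group A X lact ract 2" and ?B = "coboundaries A X lact ract 2"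
  interpret Z: comm_group ?Z by (rule comm_group_cocycle_group)
  show "trivial_group (hochschild_cohomology A X lact ract 2)" if eq: "carrier ?Z = ?B"
  proof -
    have N: "carrier ?Z \<lhd> ?Z" using Z.normal_iff_subgroup Z.subgroup_self by blast
    have "rcosets\<^bsub>?Z\<^esub> (carrier ?Z) = {carrier ?Z}"
      using Z.coset_join2[OF _ Z.subgroup_self] Z.one_closed by (auto simp: RCOSETS_def)
    then show ?thesis
      using normal.factorgroup_is_group[OF N]
      by (simp add: trivial_group_def hochschild_cohomology_def eq[symmetric] FactGroup_def)
  qed
  show "carrier ?Z = ?B" if triv: "trivial_group (hochschild_cohomology A X lact ract 2)"
  proof
    show "carrier ?Z \<subseteq> ?B"
    proof
      fix f assume f: "f \<in> carrier ?Z"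
      have "(?B #>\<^bsub>?Z\<^esub> f) \<in> carrier (?Z Mod ?B)"
        using f by (auto simp: FactGroup_def RCOSETS_def)
      then have B: "?B #>\<^bsub>?Z\<^esub> f = ?B"
        using triv by (auto simp: trivial_group_def hochschild_cohomology_def FactGroup_def)
      \<comment> \<open>To conclude that \<open>f\<close> lies in its own coset, the coboundaries
        must be known to contain the neutral element. The coboundary of the zero cochain provides
        it.\<close>
      let ?z = "\<lambda>as\<in>tuples A (Suc 0). \<zero>\<^bsub>X\<^esub>"
      have z: "?z \<in> cochains A X (Suc 0)"
        unfolding cochains_1_iff bounded_linear_map_def
        by (auto intro!: linear_mapI exI[of _ 0] simp: tuples_1)
      have "coboundary A X lact ract (Suc 0) ?z = \<one>\<^bsub>?Z\<^esub>"
      proof (rule extensionalityI[of _ "tuples A 2"])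
        show "coboundary A X lact ract (Suc 0) ?z \<in> extensional (tuples A 2)"
          using coboundary_extensional[of "Suc 0" ?z] by (simp add: numeral_2_eq_2)
        show "coboundary A X lact ract (Suc 0) ?z as = \<one>\<^bsub>?Z\<^esub> as" if as: "as \<in> tuples A 2" for as
        proof -
          obtain a b where ab: "a \<in> carrier A" "b \<in> carrier A" "as = [a, b]" using as unfolding tuples_2 by blast
          then have "[b] \<in> tuples A (Suc 0)" "[a \<otimes>\<^bsub>A\<^esub> b] \<in> tuples A (Suc 0)"
            using mult_closed by (auto simp: tuples_1)
          then show ?thesis
            using coboundary_1[OF z ab(1,2)] ab as X.left.act_smult_right[of a "\<zero>\<^bsub>X\<^esub>" 0]
              X.left.act_closed[of a "\<zero>\<^bsub>X\<^esub>"]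
            by (simp add: cocycle_group_def zero_cochain_def)
        qed
      qed (simp add: cocycle_group_def zero_cochain_def)
      then have "\<one>\<^bsub>?Z\<^esub> \<in> ?B" using z unfolding coboundaries_2 by force
      then have "\<one>\<^bsub>?Z\<^esub> \<otimes>\<^bsub>?Z\<^esub> f \<in> ?B #>\<^bsub>?Z\<^esub> f" by (auto simp: r_coset_def)
      then show "f \<in> ?B" using B f by simp
    qed
  qed (rule coboundaries_subset)
qed

text \<open>A morphism that splits the extension of \<open>A\<close> by \<open>X\<close> has the
  form \<open>b \<mapsto> (h b, b)\<close>, and compatibility with the action says that
  \<open>h\<close> of a product \<open>a b\<close> is \<open>a\<close> acting on \<open>h b\<close>,
  plus \<open>f [a, b]\<close>. So \<open>f\<close> is the coboundary of \<open>- h\<close>.\<close>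

lemma projective_imp_trivial_cohomology:
  fixes j :: "'x \<times> 'b \<Rightarrow> 'u"
  assumes "left_projective TYPE('u) A" "inj j"
  shows "trivial_group (hochschild_cohomology A X lact ract 2)"
proof -
  have "f \<in> coboundaries A X lact ract 2" if fZ: "f \<in> carrier (cocycle_group A X lact ract 2)" for f
  proof -
    have f: "f [a, b] \<in> carrier X" if "a \<in> carrier A" "b \<in> carrier A" for a b
      using fZ that unfolding cocycle_iff cochains_2_iff bounded_bilinear_map_def
      by (auto dest: linear_map_closed)
    have bil: "linear_map A X (\<lambda>b. f [a, b])" "linear_map A X (\<lambda>b. f [b, a])"
      if "a \<in> carrier A" for a
      using fZ that unfolding cocycle_iff cochains_2_iff bounded_bilinear_map_def by auto
    obtain K where K: "\<forall>a\<in>carrier A. \<forall>b\<in>carrier A. vnorm X (f [a, b]) \<le> K * (vnorm A a * vnorm A b)"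
      using fZ unfolding cocycle_iff cochains_2_iff bounded_bilinear_map_def by auto
    obtain L where L: "L \<ge> 0" "\<And>b y. b \<in> carrier A \<Longrightarrow> y \<in> carrier X \<Longrightarrow>
        vnorm X (lact b y) \<le> L * vnorm A b * vnorm X y"
      using X.left.act_nonneg_bound[OF banach_space_axioms] by blast
    have cocycle: "lact a (f [b, c]) \<oplus>\<^bsub>X\<^esub> f [a, b \<otimes>\<^bsub>A\<^esub> c] = f [a \<otimes>\<^bsub>A\<^esub> b, c]"
      if "a \<in> carrier A" "b \<in> carrier A" "c \<in> carrier A" for a b c
      using fZ that unfolding cocycle_iff by auto
    define Y where "Y = direct_sum X A"
    \<comment> \<open>Associativity of this action amounts to the cocycle identity for
      \<open>f\<close>.\<close>
    define act where "act a p = (lact a (fst p) \<oplus>\<^bsub>X\<^esub> f [a, snd p], a \<otimes>\<^bsub>A\<^esub> snd p)" for a p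
    have "banach_space Y"
      unfolding Y_def by (rule banach_space_direct_sum[OF X.left.banach_space_axioms banach_space_axioms])
    then interpret Y: left_banach_module A Y act
    proof (rule left_banach_module.intro, unfold_locales)
      fix a p assume "a \<in> carrier A" "p \<in> carrier Y"
      then show "act a p \<in> carrier Y"
        using f mult_closed X.left.act_closed by (auto simp: Y_def act_def)
    next
      fix a b p assume "a \<in> carrier A" "b \<in> carrier A" "p \<in> carrier Y"
      then show "act (a \<oplus>\<^bsub>A\<^esub> b) p = act a p \<oplus>\<^bsub>Y\<^esub> act b p"
        using f mult_closed X.left.act_closed
        by (auto simp: Y_def act_def X.left.act_add_left linear_map_add[OF bil(2)] mult_distrib_right X.left.M.a_ac)
    next
      fix a p q assume "a \<in> carrier A" "p \<in> carrier Y" "q \<in> carrier Y"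
      then show "act a (p \<oplus>\<^bsub>Y\<^esub> q) = act a p \<oplus>\<^bsub>Y\<^esub> act a q"
        using f mult_closed X.left.act_closed
        by (auto simp: Y_def act_def X.left.act_add_right linear_map_add[OF bil(1)] mult_distrib_left X.left.M.a_ac)
    next
      fix a p k assume "a \<in> carrier A" "p \<in> carrier Y"
      then show "act (k \<odot>\<^bsub>A\<^esub> a) p = k \<odot>\<^bsub>Y\<^esub> act a p" "act a (k \<odot>\<^bsub>Y\<^esub> p) = k \<odot>\<^bsub>Y\<^esub> act a p"
        using f mult_closed X.left.act_closed
        by (auto simp: Y_def act_def X.left.act_smult_left X.left.act_smult_right X.left.smult_plus_right
            linear_map_smult[OF bil(1)] linear_map_smult[OF bil(2)] smult_mult_left smult_mult_right)
    next
      fix a b p assume "a \<in> carrier A" "b \<in> carrier A" "p \<in> carrier Y"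
      then show "act (a \<otimes>\<^bsub>A\<^esub> b) p = act a (act b p)"
        using f mult_closed X.left.act_closed
        by (auto simp: Y_def act_def X.left.act_mult X.left.act_add_right mult_assoc X.left.M.a_assoc
            cocycle[symmetric])
    next
      \<comment> \<open>\<open>L\<close> comes from the action on \<open>X\<close>, \<open>K\<close>
        from the cocycle, and 1 from the product of \<open>A\<close>; the absolute value is taken
        because the bound on \<open>f\<close> comes without a sign.\<close>
      have "vnorm Y (act a p) \<le> (L + \<bar>K\<bar> + 1) * vnorm A a * vnorm Y p"
        if a: "a \<in> carrier A" and pY: "p \<in> carrier Y" for a p
      proof -
        obtain x b where p: "p = (x, b)" "x \<in> carrier X" "b \<in> carrier A"
          using pY by (cases p) (auto simp: Y_def)
        have nn: "0 \<le> vnorm A a" "0 \<le> vnorm A b" "0 \<le> vnorm X x"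
          using vnorm_nonneg X.left.vnorm_nonneg p that by auto
        have "vnorm Y (act a p) = vnorm X (lact a x \<oplus>\<^bsub>X\<^esub> f [a, b]) + vnorm A (a \<otimes>\<^bsub>A\<^esub> b)"
          by (simp add: Y_def act_def p)
        also have "\<dots> \<le> (vnorm X (lact a x) + vnorm X (f [a, b])) + vnorm A (a \<otimes>\<^bsub>A\<^esub> b)"
          using X.left.vnorm_triangle[of "lact a x" "f [a, b]"] f p that X.left.act_closed by simp
        also have "\<dots> \<le> (L * vnorm A a * vnorm X x + K * (vnorm A a * vnorm A b)) + vnorm A a * vnorm A b"
          using L(2)[of a x] K vnorm_mult[of a b] p that by (intro add_mono) auto
        also have "\<dots> \<le> (L * vnorm A a * vnorm X x + \<bar>K\<bar> * (vnorm A a * vnorm A b)) + vnorm A a * vnorm A b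
            + ((\<bar>K\<bar> + 1) * (vnorm A a * vnorm X x) + L * (vnorm A a * vnorm A b))"
        proof -
          have "K * (vnorm A a * vnorm A b) \<le> \<bar>K\<bar> * (vnorm A a * vnorm A b)"
            using nn by (intro mult_right_mono) auto
          moreover have "0 \<le> (\<bar>K\<bar> + 1) * (vnorm A a * vnorm X x)" "0 \<le> L * (vnorm A a * vnorm A b)"
            using nn L(1) by auto
          ultimately show ?thesis by linarith
        qed
        also have "\<dots> = (L + \<bar>K\<bar> + 1) * vnorm A a * vnorm Y p"
          by (simp add: Y_def p algebra_simps)
        finally show ?thesis .
      qed
      then show "\<exists>K. \<forall>b\<in>carrier A. \<forall>y\<in>carrier Y. vnorm Y (act b y) \<le> K * vnorm A b * vnorm Y y" by blast
    qed
    have "\<exists>\<rho>. module_morphism A A (monoid.mult A) Y act \<rho> \<and> (\<forall>p\<in>carrier A. snd (\<rho> p) = p)"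
    proof (rule projective_module_transport[of A A "monoid.mult A" Y act j snd "\<lambda>b. (\<zero>\<^bsub>X\<^esub>, b)"])
      show "projective_module TYPE('u) A A (\<otimes>\<^bsub>A\<^esub>)"
        using assms(1) by (simp add: left_projective_def)
      show "left_banach_module A Y act" by (rule Y.left_banach_module_axioms)
      show "inj_on j (carrier Y)" using assms(2) by (rule inj_on_subset) auto
      show "module_morphism A Y act A (\<otimes>\<^bsub>A\<^esub>) snd"
        unfolding module_morphism_def bounded_linear_map_def
        by (auto intro!: linear_mapI exI[of _ 1] simp: Y_def act_def X.left.vnorm_nonneg)
      show "snd ` carrier Y = carrier A"
        using X.left.zero_in by (force simp: Y_def image_iff)
      show "bounded_linear_map A Y (\<lambda>b. (\<zero>\<^bsub>X\<^esub>, b))"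
        unfolding bounded_linear_map_def by (auto intro!: linear_mapI exI[of _ 1] simp: Y_def)
    qed simp
    then obtain \<rho> where \<rho>: "module_morphism A A (monoid.mult A) Y act \<rho>" "\<And>p. p \<in> carrier A \<Longrightarrow> snd (\<rho> p) = p"
      by blast
    define h where "h = (\<lambda>a. fst (\<rho> a))"
    have \<rho>lin: "linear_map A Y \<rho>" and \<rho>b: "bounded_linear_map A Y \<rho>"
      using \<rho>(1) by (auto simp: module_morphism_def bounded_linear_map_def)
    have h: "h a \<in> carrier X" if "a \<in> carrier A" for a
      using linear_map_closed[OF \<rho>lin that] by (auto simp: Y_def h_def)
    have h_add: "h (a \<oplus>\<^bsub>A\<^esub> b) = h a \<oplus>\<^bsub>X\<^esub> h b" if "a \<in> carrier A" "b \<in> carrier A" for a b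
      using linear_map_add[OF \<rho>lin that] by (simp add: h_def Y_def)
    have h_smult: "h (k \<odot>\<^bsub>A\<^esub> a) = k \<odot>\<^bsub>X\<^esub> h a" if "a \<in> carrier A" for a k
      using linear_map_smult[OF \<rho>lin that] by (simp add: h_def Y_def)
    have h_mult: "h (a \<otimes>\<^bsub>A\<^esub> b) = lact a (h b) \<oplus>\<^bsub>X\<^esub> f [a, b]" if "a \<in> carrier A" "b \<in> carrier A" for a b
    proof -
      have "\<rho> (a \<otimes>\<^bsub>A\<^esub> b) = act a (\<rho> b)" using \<rho>(1) that by (auto simp: module_morphism_def)
      then show ?thesis by (simp add: h_def act_def \<rho>(2)[OF that(2)])
    qed
    obtain M where M: "M \<ge> 0" "\<And>a. a \<in> carrier A \<Longrightarrow> vnorm Y (\<rho> a) \<le> M * vnorm A a"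
      using bounded_linear_map_bound[OF \<rho>b banach_space_axioms] by blast
    have hM: "vnorm X (h a) \<le> M * vnorm A a" if "a \<in> carrier A" for a
      using M(2)[OF that] vnorm_nonneg[of "snd (\<rho> a)"] that \<rho>(2)[OF that] by (simp add: h_def Y_def)
    define g where "g = (\<lambda>as\<in>tuples A (Suc 0). (-1) \<odot>\<^bsub>X\<^esub> h (hd as))"
    have g: "g [a] = (-1) \<odot>\<^bsub>X\<^esub> h a" if "a \<in> carrier A" for a
      using that by (auto simp: g_def tuples_1)
    have gc: "g \<in> cochains A X (Suc 0)"
      unfolding cochains_1_iff bounded_linear_map_def
      using h hM by (auto intro!: linear_mapI exI[of _ M] simp: g h_add h_smult X.left.smult_plus_right
          X.left.smult_smult X.left.vnorm_smult mult.commute) (simp add: g_def)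
    have "f = coboundary A X lact ract (Suc 0) g"
    proof (rule extensionalityI[of _ "tuples A 2"])
      show "f \<in> extensional (tuples A 2)" using fZ unfolding cocycle_iff cochains_2_iff by blast
      show "coboundary A X lact ract (Suc 0) g \<in> extensional (tuples A 2)"
        using coboundary_extensional[of "Suc 0" g] by (simp add: numeral_2_eq_2)
      fix as assume "as \<in> tuples A 2"
      then obtain a b where ab: "as = [a, b]" "a \<in> carrier A" "b \<in> carrier A" unfolding tuples_2 by blast
      have *: "(-1) \<odot>\<^bsub>X\<^esub> x \<oplus>\<^bsub>X\<^esub> (x \<oplus>\<^bsub>X\<^esub> y) = y" if "x \<in> carrier X" "y \<in> carrier X" for x y
        using X.left.smult_plus_left[OF that(1), of "-1" 1] that by (simp add: X.left.M.a_assoc[symmetric])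
      show "f as = coboundary A X lact ract (Suc 0) g as"
        using ab h mult_closed f X.left.act_closed
        by (simp add: coboundary_1[OF gc] g h_mult X.left.smult_smult X.left.act_smult_right *)
    qed
    then show ?thesis using gc unfolding coboundaries_2 by blast
  qed
  moreover have "coboundaries A X lact ract 2 \<subseteq> carrier (cocycle_group A X lact ract 2)"
    using coboundaries_subset .
  ultimately show ?thesis unfolding trivial_cohomology_iff by blast
qed

end

lemma (in banach_space) diff_eq_diff_swap:
  assumes "p \<in> carrier V" "q \<in> carrier V" "r \<in> carrier V" "t \<in> carrier V"
    and eq: "p \<ominus>\<^bsub>V\<^esub> q = r \<ominus>\<^bsub>V\<^esub> t"
  shows "q \<ominus>\<^bsub>V\<^esub> t = p \<ominus>\<^bsub>V\<^esub> r"
proof -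
  have "p \<ominus>\<^bsub>V\<^esub> r = (q \<oplus>\<^bsub>V\<^esub> (p \<ominus>\<^bsub>V\<^esub> q)) \<ominus>\<^bsub>V\<^esub> r"
    using add_minus_cancel[OF assms(1,2)] by simp
  also have "\<dots> = (r \<ominus>\<^bsub>V\<^esub> r) \<oplus>\<^bsub>V\<^esub> (q \<ominus>\<^bsub>V\<^esub> t)"
    unfolding eq using assms(1-4) by (simp add: minus_eq_smult M.a_ac del: minus_eq_zero_iff)
  finally show ?thesis using assms by simp
qed

text \<open>The failure of \<open>\<sigma>\<close> to be a morphism is a cocycle with values in the
  kernel of \<open>\<phi>\<close>. A cochain \<open>g\<close> of which it is the coboundary has its
  values in the kernel as well, so subtracting \<open>g\<close> from \<open>\<sigma>\<close> leaves
  a splitting and makes it a morphism. The kernel lives in the type of \<open>Y\<close>, so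
  hypothesis \<open>H\<close> and conclusion concern the same type.\<close>

lemma trivial_cohomology_imp_projective:
  fixes A :: "'b cnormed"
  assumes A: "banach_algebra A"
    and H: "\<And>(X :: 'u cnormed) lact ract. banach_bimodule A X lact ract \<Longrightarrow> right_annihilator A X ract \<Longrightarrow>
      trivial_group (hochschild_cohomology A X lact ract 2)"
  shows "left_projective TYPE('u) A"
  unfolding left_projective_def projective_module_def
proof (intro allI impI, elim conjE exE)
  interpret A: banach_algebra A by fact
  fix Y :: "'u cnormed" and act \<phi> \<sigma>
  assume Y: "left_banach_module A Y act" and \<phi>: "module_morphism A Y act A (\<otimes>\<^bsub>A\<^esub>) \<phi>"
    and \<sigma>: "bounded_linear_map A Y \<sigma>" and \<phi>\<sigma>: "\<forall>p\<in>carrier A. \<phi> (\<sigma> p) = p"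
  interpret Y: left_banach_module A Y act by fact
  have \<phi>act: "\<phi> (act b y) = b \<otimes>\<^bsub>A\<^esub> \<phi> y" if "b \<in> carrier A" "y \<in> carrier Y" for b y
    using \<phi> that by (simp add: module_morphism_def)
  have \<phi>lin: "linear_map Y A \<phi>" and \<phi>bdd: "bounded_linear_map Y A \<phi>"
    using \<phi> by (simp_all add: module_morphism_def bounded_linear_map_def)
  note \<phi>add = linear_map_add[OF \<phi>lin] and \<phi>smult = linear_map_smult[OF \<phi>lin]
    and \<phi>in = linear_map_closed[OF \<phi>lin]
    and \<phi>0 = linear_map_zero[OF \<phi>lin Y.banach_space_axioms A.banach_space_axioms]
  have \<sigma>lin: "linear_map A Y \<sigma>" by (rule bounded_linear_map_linear[OF \<sigma>])
  note \<sigma>add = linear_map_add[OF \<sigma>lin] and \<sigma>smult = linear_map_smult[OF \<sigma>lin]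
    and \<sigma>in = linear_map_closed[OF \<sigma>lin]
  define X where "X = Y\<lparr>carrier := {y \<in> carrier Y. \<phi> y = \<zero>\<^bsub>A\<^esub>}\<rparr>"
  define ract where "ract = (\<lambda>(x :: 'u) (b :: 'b). \<zero>\<^bsub>Y\<^esub>)"
  have X_simps [simp]: "carrier X = {y \<in> carrier Y. \<phi> y = \<zero>\<^bsub>A\<^esub>}" "\<zero>\<^bsub>X\<^esub> = \<zero>\<^bsub>Y\<^esub>"
    "x \<oplus>\<^bsub>X\<^esub> y = x \<oplus>\<^bsub>Y\<^esub> y" "c \<odot>\<^bsub>X\<^esub> x = c \<odot>\<^bsub>Y\<^esub> x" "vnorm X x = vnorm Y x" for x y c
    by (simp_all add: X_def)
  obtain K where K: "K \<ge> 0" "\<And>y. y \<in> carrier Y \<Longrightarrow> vnorm A (\<phi> y) \<le> K * vnorm Y y"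
    using bounded_linear_map_bound[OF \<phi>bdd Y.banach_space_axioms] by blast
  have X: "banach_space X"
  proof (rule banach_space_embed[OF Y.banach_space_axioms, where j = id])
    fix s :: "nat \<Rightarrow> _" and l
    assume s: "\<And>n. s n \<in> carrier X" and l: "l \<in> carrier Y"
      and lim: "\<And>\<epsilon>. \<epsilon> > 0 \<Longrightarrow> \<exists>N. \<forall>n\<ge>N. ndist Y (id (s n)) l < \<epsilon>"
    \<comment> \<open>The kernel is closed because \<open>\<phi>\<close> is continuous; dividing by
      \<open>K + 1\<close> avoids the case \<open>K = 0\<close>.\<close>
    have "vnorm A (\<phi> l) \<le> 0 + e" if e: "e > 0" for e
    proof -
      have "e / (K + 1) > 0" using K(1) e by simp
      then obtain N where "ndist Y (s N) l < e / (K + 1)" using lim by force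
      moreover have "ndist A (\<phi> (s N)) (\<phi> l) \<le> K * ndist Y (s N) l"
        using s[of N] l K(2)
        by (intro ndist_bounded_linear_map[OF \<phi>lin Y.banach_space_axioms A.banach_space_axioms]) auto
      moreover have "ndist A (\<phi> (s N)) (\<phi> l) = vnorm A (\<phi> l)"
        using s[of N] \<phi>in[OF l] A.metric.commute A.vnorm_eq_ndist by simp
      moreover have "K * ndist Y (s N) l \<le> (K + 1) * ndist Y (s N) l"
        using Y.metric.nonneg by (intro mult_right_mono) auto
      moreover have "(K + 1) * ndist Y (s N) l \<le> (K + 1) * (e / (K + 1))"
        using K(1) calculation(1) by (intro mult_left_mono) auto
      moreover have "(K + 1) * (e / (K + 1)) = e" using K(1) by simp
      ultimately show ?thesis by linarith
    qed
    then have "vnorm A (\<phi> l) = 0"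
      using field_le_epsilon[of "vnorm A (\<phi> l)" 0] A.vnorm_nonneg[OF \<phi>in[OF l]] by force
    then show "l \<in> id ` carrier X" using l \<phi>in[OF l] A.vnorm_eq_0_iff by simp
  qed (auto simp: \<phi>add \<phi>smult \<phi>0)
  have zero_right: "b \<otimes>\<^bsub>A\<^esub> \<zero>\<^bsub>A\<^esub> = \<zero>\<^bsub>A\<^esub>" if "b \<in> carrier A" for b
    using A.smult_mult_right[OF that A.zero_in, of 0] A.mult_closed[OF that A.zero_in] by simp
  have act_zero: "act b \<zero>\<^bsub>Y\<^esub> = \<zero>\<^bsub>Y\<^esub>" if "b \<in> carrier A" for b
    using Y.act_smult_right[OF that Y.zero_in, of 0] Y.act_closed[OF that Y.zero_in] by simp
  have left: "left_banach_module A X act"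
  proof (rule left_banach_module.intro[OF X], unfold_locales)
    show "\<exists>K. \<forall>b\<in>carrier A. \<forall>y\<in>carrier X. vnorm X (act b y) \<le> K * vnorm A b * vnorm X y"
      using Y.act_bounded by auto
  qed (auto simp: Y.act_closed Y.act_add_left Y.act_add_right Y.act_smult_left Y.act_smult_right
      Y.act_mult \<phi>act zero_right)
  have right: "right_banach_module A X ract"
    by (rule right_banach_module.intro[OF X], unfold_locales) (auto simp: ract_def \<phi>0 intro: exI[of _ 0])
  have bimod: "banach_bimodule A X act ract"
    by (rule banach_bimodule.intro[OF left right], unfold_locales) (simp add: ract_def act_zero)
  have annih: "right_annihilator A X ract" by (simp add: right_annihilator_def ract_def)
  interpret X: right_annihilator_bimodule A X act ract
    by (rule right_annihilator_bimodule.intro[OF A bimod], unfold_locales) (rule annih)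
  define F where "F a b = act a (\<sigma> b) \<oplus>\<^bsub>Y\<^esub> (-1) \<odot>\<^bsub>Y\<^esub> \<sigma> (a \<otimes>\<^bsub>A\<^esub> b)" for a b
  define f where "f = (\<lambda>as\<in>tuples A 2. F (as ! 0) (as ! 1))"
  have f: "f [a, b] = F a b" if "a \<in> carrier A" "b \<in> carrier A" for a b
    using that by (auto simp: f_def tuples_2)
  have Fin: "F a b \<in> carrier X" if "a \<in> carrier A" "b \<in> carrier A" for a b
    using that \<phi>\<sigma> A.mult_closed A.smult_plus_left[of "a \<otimes>\<^bsub>A\<^esub> b" 1 "-1"]
    by (auto simp: F_def Y.act_closed \<sigma>in \<phi>add \<phi>smult \<phi>act)
  obtain L where L: "L \<ge> 0" "\<And>b y. b \<in> carrier A \<Longrightarrow> y \<in> carrier Y \<Longrightarrow>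
      vnorm Y (act b y) \<le> L * vnorm A b * vnorm Y y"
    using Y.act_nonneg_bound[OF A.banach_space_axioms] by blast
  obtain M where M: "M \<ge> 0" "\<And>a. a \<in> carrier A \<Longrightarrow> vnorm Y (\<sigma> a) \<le> M * vnorm A a"
    using bounded_linear_map_bound[OF \<sigma> A.banach_space_axioms] by blast
  have bound: "vnorm X (f [a, b]) \<le> (L * M + M) * (vnorm A a * vnorm A b)"
    if ab: "a \<in> carrier A" "b \<in> carrier A" for a b
  proof -
    have "vnorm X (f [a, b]) \<le> vnorm Y (act a (\<sigma> b)) + vnorm Y (\<sigma> (a \<otimes>\<^bsub>A\<^esub> b))"
      using ab A.mult_closed Y.act_closed \<sigma>in
        Y.vnorm_triangle[of "act a (\<sigma> b)" "(-1) \<odot>\<^bsub>Y\<^esub> \<sigma> (a \<otimes>\<^bsub>A\<^esub> b)"]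
      by (simp add: f F_def Y.vnorm_smult)
    also have "\<dots> \<le> L * vnorm A a * (M * vnorm A b) + M * (vnorm A a * vnorm A b)"
    proof (rule add_mono)
      show "vnorm Y (act a (\<sigma> b)) \<le> L * vnorm A a * (M * vnorm A b)"
        using L(2)[OF ab(1) \<sigma>in[OF ab(2)]] M(2)[OF ab(2)] L(1) A.vnorm_nonneg[OF ab(1)]
        by (meson mult_left_mono mult_nonneg_nonneg order_trans)
      show "vnorm Y (\<sigma> (a \<otimes>\<^bsub>A\<^esub> b)) \<le> M * (vnorm A a * vnorm A b)"
        using M(2)[of "a \<otimes>\<^bsub>A\<^esub> b"] A.vnorm_mult[OF ab] M(1) ab A.mult_closed
        by (meson mult_left_mono order_trans)
    qed
    finally show ?thesis by (simp add: algebra_simps)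
  qed
  have "linear_map A X (\<lambda>b. f [a, b])" "linear_map A X (\<lambda>b. f [b, a])" if a: "a \<in> carrier A" for a
  proof -
    have in_Y: "\<sigma> x \<in> carrier Y" "act y (\<sigma> x) \<in> carrier Y" "x \<otimes>\<^bsub>A\<^esub> y \<in> carrier A"
      if "x \<in> carrier A" "y \<in> carrier A" for x y
      using that A.mult_closed Y.act_closed \<sigma>in by auto
    show "linear_map A X (\<lambda>b. f [a, b])" "linear_map A X (\<lambda>b. f [b, a])"
      using a Fin
      by (auto intro!: linear_mapI simp: f)
        (auto simp: F_def in_Y \<sigma>add \<sigma>smult A.mult_distrib_left A.mult_distrib_right A.smult_mult_left
          A.smult_mult_right Y.act_add_left Y.act_add_right Y.act_smult_left Y.act_smult_right
          Y.smult_plus_right Y.smult_smult Y.M.a_ac mult.commute)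
  qed
  moreover have "f \<in> extensional (tuples A 2)" by (simp add: f_def)
  ultimately have fc: "f \<in> cochains A X 2"
    unfolding cochains_2_iff bounded_bilinear_map_def using bound by blast
  have "act a (f [b, c]) \<oplus>\<^bsub>X\<^esub> f [a, b \<otimes>\<^bsub>A\<^esub> c] = f [a \<otimes>\<^bsub>A\<^esub> b, c]"
    if abc: "a \<in> carrier A" "b \<in> carrier A" "c \<in> carrier A" for a b c
  proof -
    have *: "(-1) \<odot>\<^bsub>Y\<^esub> x \<oplus>\<^bsub>Y\<^esub> (x \<oplus>\<^bsub>Y\<^esub> y) = y" if "x \<in> carrier Y" "y \<in> carrier Y" for x y
      using Y.smult_plus_left[OF that(1), of "-1" 1] that by (simp add: Y.M.a_assoc[symmetric])
    show ?thesis
      using abc A.mult_closed Y.act_closed \<sigma>in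
      by (simp add: f F_def Y.act_add_right Y.act_smult_right Y.act_mult Y.M.a_assoc * A.mult_assoc)
  qed
  then have "f \<in> carrier (cocycle_group A X act ract 2)"
    unfolding X.cocycle_iff using fc by blast
  moreover have "carrier (cocycle_group A X act ract 2) = coboundaries A X act ract 2"
    using H[OF bimod annih] X.trivial_cohomology_iff by blast
  ultimately obtain g where g: "g \<in> cochains A X (Suc 0)" "f = coboundary A X act ract (Suc 0) g"
    unfolding X.coboundaries_2 by blast
  have gbdd: "bounded_linear_map A X (\<lambda>a. g [a])" using g(1) unfolding cochains_1_iff by blast
  note glin = bounded_linear_map_linear[OF gbdd]
  have gX: "g [a] \<in> carrier X" if "a \<in> carrier A" for a by (rule linear_map_closed[OF glin that])
  then have gY: "g [a] \<in> carrier Y" "\<phi> (g [a]) = \<zero>\<^bsub>A\<^esub>" if "a \<in> carrier A" for a using that by auto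
  have g_add: "g [a \<oplus>\<^bsub>A\<^esub> b] = g [a] \<oplus>\<^bsub>Y\<^esub> g [b]" if "a \<in> carrier A" "b \<in> carrier A" for a b
    using linear_map_add[OF glin that] by simp
  have g_smult: "g [c \<odot>\<^bsub>A\<^esub> a] = c \<odot>\<^bsub>Y\<^esub> g [a]" if "a \<in> carrier A" for a c
    using linear_map_smult[OF glin that] by simp
  obtain N where N: "N \<ge> 0" "\<And>a. a \<in> carrier A \<Longrightarrow> vnorm Y (g [a]) \<le> N * vnorm A a"
    using bounded_linear_map_bound[OF gbdd A.banach_space_axioms] by auto
  define \<rho> where "\<rho> a = \<sigma> a \<oplus>\<^bsub>Y\<^esub> (-1) \<odot>\<^bsub>Y\<^esub> g [a]" for a
  have "linear_map A Y \<rho>"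
    by (rule linear_mapI)
      (auto simp: \<rho>_def gY \<sigma>in \<sigma>add \<sigma>smult g_add g_smult Y.smult_plus_right Y.smult_smult Y.M.a_ac mult.commute)
  moreover have "vnorm Y (\<rho> a) \<le> (M + N) * vnorm A a" if "a \<in> carrier A" for a
    using Y.vnorm_triangle[of "\<sigma> a" "(-1) \<odot>\<^bsub>Y\<^esub> g [a]"] M(2)[OF that] N(2)[OF that] that gY(1)[OF that] \<sigma>in[OF that]
    by (simp add: \<rho>_def Y.vnorm_smult algebra_simps)
  moreover have "\<rho> (a \<otimes>\<^bsub>A\<^esub> b) = act a (\<rho> b)" if ab: "a \<in> carrier A" "b \<in> carrier A" for a b
  proof -
    have in_Y: "\<sigma> b \<in> carrier Y" "act a (\<sigma> b) \<in> carrier Y" "\<sigma> (a \<otimes>\<^bsub>A\<^esub> b) \<in> carrier Y"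
      "g [b] \<in> carrier Y" "act a (g [b]) \<in> carrier Y" "g [a \<otimes>\<^bsub>A\<^esub> b] \<in> carrier Y"
      using ab A.mult_closed Y.act_closed \<sigma>in gY by auto
    have "act a (\<sigma> b) \<oplus>\<^bsub>Y\<^esub> (-1) \<odot>\<^bsub>Y\<^esub> \<sigma> (a \<otimes>\<^bsub>A\<^esub> b) = act a (g [b]) \<oplus>\<^bsub>Y\<^esub> (-1) \<odot>\<^bsub>Y\<^esub> g [a \<otimes>\<^bsub>A\<^esub> b]"
      using X.coboundary_1[OF g(1) ab] f[OF ab] unfolding g(2)[symmetric] by (simp add: F_def)
    then have "act a (\<sigma> b) \<ominus>\<^bsub>Y\<^esub> \<sigma> (a \<otimes>\<^bsub>A\<^esub> b) = act a (g [b]) \<ominus>\<^bsub>Y\<^esub> g [a \<otimes>\<^bsub>A\<^esub> b]"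
      using in_Y by (simp add: Y.minus_eq_smult)
    then have "\<sigma> (a \<otimes>\<^bsub>A\<^esub> b) \<ominus>\<^bsub>Y\<^esub> g [a \<otimes>\<^bsub>A\<^esub> b] = act a (\<sigma> b) \<ominus>\<^bsub>Y\<^esub> act a (g [b])"
      using in_Y Y.diff_eq_diff_swap by blast
    then show ?thesis
      using in_Y ab gY(1)[OF ab(2)] by (simp add: \<rho>_def Y.minus_eq_smult Y.act_add_right Y.act_smult_right)
  qed
  ultimately have "module_morphism A A (\<otimes>\<^bsub>A\<^esub>) Y act \<rho>"
    unfolding module_morphism_def bounded_linear_map_def by blast
  moreover have "\<phi> (\<rho> a) = a" if "a \<in> carrier A" for a
    using that gY \<phi>\<sigma> by (simp add: \<rho>_def \<phi>add \<phi>smult \<sigma>in)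
  ultimately show "\<exists>\<rho>. module_morphism A A (\<otimes>\<^bsub>A\<^esub>) Y act \<rho> \<and> (\<forall>p\<in>carrier A. \<phi> (\<rho> p) = p)" by blast
qed

section \<open>Sums over finite sets\<close>

lemma linear_map_finsum:
  assumes "linear_map V W f" "banach_space V" "banach_space W" "finite F" "\<And>i. i \<in> F \<Longrightarrow> x i \<in> carrier V"
  shows "f (\<Oplus>\<^bsub>V\<^esub>i\<in>F. x i) = (\<Oplus>\<^bsub>W\<^esub>i\<in>F. f (x i))"
proof -
  interpret V: banach_space V by fact
  interpret W: banach_space W by fact
  show ?thesis using assms(4,5)
  proof (induction F rule: finite_induct)
    case empty
    then show ?case using linear_map_zero[OF assms(1-3)] by simp
  next
    case (insert i F)
    have "x \<in> F \<rightarrow> carrier V" "(\<lambda>i. f (x i)) \<in> F \<rightarrow> carrier W"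
      using insert.prems linear_map_closed[OF assms(1)] by auto
    then show ?case
      using insert linear_map_closed[OF assms(1)] by (simp add: linear_map_add[OF assms(1)])
  qed
qed

text \<open>The average of \<open>B (\<Sum> \<epsilon>\<^sub>i x\<^sub>i) (\<Sum> \<epsilon>\<^sub>i z\<^sub>i)\<close> over all
  choices of signs is \<open>\<Sum> B x\<^sub>i z\<^sub>i\<close>, so some choice gives at least its norm.\<close>

lemma sign_averaging:
  fixes x :: "'i \<Rightarrow> 'b" and z :: "'i \<Rightarrow> 'c" and V :: "'v cnormed"
  assumes "banach_space A" "banach_space Z" "banach_space V"
    and l1: "\<And>a. a \<in> carrier A \<Longrightarrow> linear_map Z V (B a)"
    and l2: "\<And>b. b \<in> carrier Z \<Longrightarrow> linear_map A V (\<lambda>a. B a b)"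
    and "finite F" "\<And>i. i \<in> F \<Longrightarrow> x i \<in> carrier A" "\<And>i. i \<in> F \<Longrightarrow> z i \<in> carrier Z"
    and "x0 \<in> carrier A" "z0 \<in> carrier Z"
  shows "\<exists>s :: 'i \<Rightarrow> real. (\<forall>i. \<bar>s i\<bar> = 1) \<and>
     vnorm V (B x0 z0 \<oplus>\<^bsub>V\<^esub> (\<Oplus>\<^bsub>V\<^esub>i\<in>F. B (x i) (z i))) \<le>
     vnorm V (B (x0 \<oplus>\<^bsub>A\<^esub> (\<Oplus>\<^bsub>A\<^esub>i\<in>F. complex_of_real (s i) \<odot>\<^bsub>A\<^esub> x i))
       (z0 \<oplus>\<^bsub>Z\<^esub> (\<Oplus>\<^bsub>Z\<^esub>i\<in>F. complex_of_real (s i) \<odot>\<^bsub>Z\<^esub> z i)))"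
proof -
  interpret A: banach_space A by fact
  interpret Z: banach_space Z by fact
  interpret V: banach_space V by fact
  have B_in: "B a b \<in> carrier V" if "a \<in> carrier A" "b \<in> carrier Z" for a b
    using linear_map_closed[OF l1[OF that(1)] that(2)] .
  show ?thesis using assms(6-)
  proof (induction F arbitrary: x0 z0 rule: finite_induct)
    case empty
    then show ?case using B_in by (intro exI[of _ "\<lambda>_. 1"]) simp
  next
    case (insert j F)
    have xj: "x j \<in> carrier A" and zj: "z j \<in> carrier Z"
      and xF: "\<And>i. i \<in> F \<Longrightarrow> x i \<in> carrier A" and zF: "\<And>i. i \<in> F \<Longrightarrow> z i \<in> carrier Z"
      using insert.prems by auto
    note x0 = insert.prems(3) and z0 = insert.prems(4)
    define T where "T = (\<Oplus>\<^bsub>V\<^esub>i\<in>F. B (x i) (z i))"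
    have T: "T \<in> carrier V" unfolding T_def by (rule V.M.finsum_closed) (auto simp: B_in xF zF)
    \<comment> \<open>For \<open>s = 1\<close> and \<open>s = -1\<close> the cross terms
      \<open>m\<close> enter \<open>Q s\<close> with opposite signs, so twice \<open>P\<close> is
      \<open>Q 1\<close> plus \<open>Q (-1)\<close>, and one of these has norm at least that of
      \<open>P\<close>. The induction then absorbs the chosen terms into \<open>x0\<close> and
      \<open>z0\<close>, which is why these are arbitrary.\<close>
    define P where "P = B x0 z0 \<oplus>\<^bsub>V\<^esub> (B (x j) (z j) \<oplus>\<^bsub>V\<^esub> T)"
    define m where "m = B x0 (z j) \<oplus>\<^bsub>V\<^esub> B (x j) z0"
    define Q where "Q s = B (x0 \<oplus>\<^bsub>A\<^esub> complex_of_real s \<odot>\<^bsub>A\<^esub> x j) (z0 \<oplus>\<^bsub>Z\<^esub> complex_of_real s \<odot>\<^bsub>Z\<^esub> z j) \<oplus>\<^bsub>V\<^esub> T" for s :: real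
    have Pm: "P \<in> carrier V" "m \<in> carrier V"
      using B_in T xj zj x0 z0 by (auto simp: P_def m_def)
    have Q: "Q s = P \<oplus>\<^bsub>V\<^esub> complex_of_real s \<odot>\<^bsub>V\<^esub> m" if s: "s * s = 1" for s
    proof -
      have ss: "complex_of_real s * complex_of_real s = 1"
        using s by (metis of_real_1 of_real_mult)
      have "Q s = ((B x0 z0 \<oplus>\<^bsub>V\<^esub> complex_of_real s \<odot>\<^bsub>V\<^esub> B x0 (z j)) \<oplus>\<^bsub>V\<^esub>
          (complex_of_real s \<odot>\<^bsub>V\<^esub> B (x j) z0 \<oplus>\<^bsub>V\<^esub> B (x j) (z j))) \<oplus>\<^bsub>V\<^esub> T"
        using B_in T xj zj x0 z0
        by (simp add: Q_def linear_map_add[OF l1] linear_map_add[OF l2] linear_map_smult[OF l1]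
            linear_map_smult[OF l2] V.smult_plus_right V.smult_smult ss V.M.a_ac)
      also have "\<dots> = P \<oplus>\<^bsub>V\<^esub> complex_of_real s \<odot>\<^bsub>V\<^esub> m"
        using B_in T xj zj x0 z0 by (simp add: P_def m_def V.smult_plus_right V.M.a_ac)
      finally show ?thesis .
    qed
    have "2 * vnorm V P = vnorm V (2 \<odot>\<^bsub>V\<^esub> P)" using Pm by (simp add: V.vnorm_smult)
    also have "2 \<odot>\<^bsub>V\<^esub> P = P \<oplus>\<^bsub>V\<^esub> P"
      using V.smult_plus_left[OF Pm(1), of 1 1] Pm by simp
    also have "P \<oplus>\<^bsub>V\<^esub> P = Q 1 \<oplus>\<^bsub>V\<^esub> Q (-1)"
    proof -
      have "m \<oplus>\<^bsub>V\<^esub> (-1) \<odot>\<^bsub>V\<^esub> m = \<zero>\<^bsub>V\<^esub>" using V.smult_plus_left[OF Pm(2), of 1 "-1"] Pm by simp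
      moreover have "Q 1 \<oplus>\<^bsub>V\<^esub> Q (-1) = (P \<oplus>\<^bsub>V\<^esub> P) \<oplus>\<^bsub>V\<^esub> (m \<oplus>\<^bsub>V\<^esub> (-1) \<odot>\<^bsub>V\<^esub> m)"
        using Pm by (simp add: Q V.M.a_ac)
      ultimately show ?thesis using Pm by simp
    qed
    also have "vnorm V (Q 1 \<oplus>\<^bsub>V\<^esub> Q (-1)) \<le> vnorm V (Q 1) + vnorm V (Q (-1))"
      using Pm by (intro V.vnorm_triangle) (simp_all add: Q)
    finally have "vnorm V P \<le> vnorm V (Q 1) \<or> vnorm V P \<le> vnorm V (Q (-1))" by linarith
    then obtain t :: real where t: "\<bar>t\<bar> = 1" "vnorm V P \<le> vnorm V (Q t)"
      by (metis abs_1 abs_minus_cancel)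
    let ?x = "x0 \<oplus>\<^bsub>A\<^esub> complex_of_real t \<odot>\<^bsub>A\<^esub> x j" and ?z = "z0 \<oplus>\<^bsub>Z\<^esub> complex_of_real t \<odot>\<^bsub>Z\<^esub> z j"
    have "?x \<in> carrier A" "?z \<in> carrier Z" using xj zj x0 z0 by auto
    from insert.IH[OF xF zF this]
    obtain s :: "'i \<Rightarrow> real" where s: "\<forall>i. \<bar>s i\<bar> = 1" "vnorm V (B ?x ?z \<oplus>\<^bsub>V\<^esub> (\<Oplus>\<^bsub>V\<^esub>i\<in>F. B (x i) (z i))) \<le>
       vnorm V (B (?x \<oplus>\<^bsub>A\<^esub> (\<Oplus>\<^bsub>A\<^esub>i\<in>F. complex_of_real (s i) \<odot>\<^bsub>A\<^esub> x i))
         (?z \<oplus>\<^bsub>Z\<^esub> (\<Oplus>\<^bsub>Z\<^esub>i\<in>F. complex_of_real (s i) \<odot>\<^bsub>Z\<^esub> z i)))" by auto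
    let ?s = "s(j := t)"
    have sumA: "(\<Oplus>\<^bsub>A\<^esub>i\<in>insert j F. complex_of_real (?s i) \<odot>\<^bsub>A\<^esub> x i) =
        complex_of_real t \<odot>\<^bsub>A\<^esub> x j \<oplus>\<^bsub>A\<^esub> (\<Oplus>\<^bsub>A\<^esub>i\<in>F. complex_of_real (s i) \<odot>\<^bsub>A\<^esub> x i)"
    proof -
      have "(\<Oplus>\<^bsub>A\<^esub>i\<in>F. complex_of_real (?s i) \<odot>\<^bsub>A\<^esub> x i) = (\<Oplus>\<^bsub>A\<^esub>i\<in>F. complex_of_real (s i) \<odot>\<^bsub>A\<^esub> x i)"
        by (rule A.M.finsum_cong') (use xF insert.hyps(2) in auto)
      moreover have "(\<Oplus>\<^bsub>A\<^esub>i\<in>insert j F. complex_of_real (?s i) \<odot>\<^bsub>A\<^esub> x i) =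
        complex_of_real (?s j) \<odot>\<^bsub>A\<^esub> x j \<oplus>\<^bsub>A\<^esub> (\<Oplus>\<^bsub>A\<^esub>i\<in>F. complex_of_real (?s i) \<odot>\<^bsub>A\<^esub> x i)"
        by (rule A.M.finsum_insert) (use xF xj insert.hyps in auto)
      ultimately show ?thesis by simp
    qed
    have sumZ: "(\<Oplus>\<^bsub>Z\<^esub>i\<in>insert j F. complex_of_real (?s i) \<odot>\<^bsub>Z\<^esub> z i) =
        complex_of_real t \<odot>\<^bsub>Z\<^esub> z j \<oplus>\<^bsub>Z\<^esub> (\<Oplus>\<^bsub>Z\<^esub>i\<in>F. complex_of_real (s i) \<odot>\<^bsub>Z\<^esub> z i)"
    proof -
      have "(\<Oplus>\<^bsub>Z\<^esub>i\<in>F. complex_of_real (?s i) \<odot>\<^bsub>Z\<^esub> z i) = (\<Oplus>\<^bsub>Z\<^esub>i\<in>F. complex_of_real (s i) \<odot>\<^bsub>Z\<^esub> z i)"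
        by (rule Z.M.finsum_cong') (use zF insert.hyps(2) in auto)
      moreover have "(\<Oplus>\<^bsub>Z\<^esub>i\<in>insert j F. complex_of_real (?s i) \<odot>\<^bsub>Z\<^esub> z i) =
        complex_of_real (?s j) \<odot>\<^bsub>Z\<^esub> z j \<oplus>\<^bsub>Z\<^esub> (\<Oplus>\<^bsub>Z\<^esub>i\<in>F. complex_of_real (?s i) \<odot>\<^bsub>Z\<^esub> z i)"
        by (rule Z.M.finsum_insert) (use zF zj insert.hyps in auto)
      ultimately show ?thesis by simp
    qed
    have SA: "(\<Oplus>\<^bsub>A\<^esub>i\<in>F. complex_of_real (s i) \<odot>\<^bsub>A\<^esub> x i) \<in> carrier A"
      by (rule A.M.finsum_closed) (auto simp: xF)
    have SZ: "(\<Oplus>\<^bsub>Z\<^esub>i\<in>F. complex_of_real (s i) \<odot>\<^bsub>Z\<^esub> z i) \<in> carrier Z"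
      by (rule Z.M.finsum_closed) (auto simp: zF)
    have "(\<Oplus>\<^bsub>V\<^esub>i\<in>insert j F. B (x i) (z i)) = B (x j) (z j) \<oplus>\<^bsub>V\<^esub> T"
      unfolding T_def by (rule V.M.finsum_insert) (use xF zF xj zj insert.hyps B_in in auto)
    then have "vnorm V (B x0 z0 \<oplus>\<^bsub>V\<^esub> (\<Oplus>\<^bsub>V\<^esub>i\<in>insert j F. B (x i) (z i))) \<le> vnorm V (Q t)"
      using t(2) by (simp add: P_def)
    also have "\<dots> \<le> vnorm V (B (x0 \<oplus>\<^bsub>A\<^esub> (\<Oplus>\<^bsub>A\<^esub>i\<in>insert j F. complex_of_real (?s i) \<odot>\<^bsub>A\<^esub> x i))
       (z0 \<oplus>\<^bsub>Z\<^esub> (\<Oplus>\<^bsub>Z\<^esub>i\<in>insert j F. complex_of_real (?s i) \<odot>\<^bsub>Z\<^esub> z i)))"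
      using s(2) SA SZ xj zj x0 z0 unfolding sumA sumZ by (simp add: Q_def T_def A.M.a_assoc Z.M.a_assoc)
    finally show ?case using s(1) t(1) by (intro exI[of _ ?s]) auto
  qed
qed

section \<open>Unconditional sums and a criterion for projectivity\<close>

text \<open>Convergence along the net of finite subsets of \<open>I\<close>. A paracompact space may
  have uncountably many pieces, and then no enumeration of the index set is available.\<close>

definition finite_limit :: "'v cnormed \<Rightarrow> 'i set \<Rightarrow> ('i set \<Rightarrow> 'v) \<Rightarrow> 'v \<Rightarrow> bool" where
  "finite_limit V I s l \<longleftrightarrow> l \<in> carrier V \<and>
     (\<forall>\<epsilon>>0. \<exists>F\<^sub>0. finite F\<^sub>0 \<and> F\<^sub>0 \<subseteq> I \<and> (\<forall>F. finite F \<longrightarrow> F\<^sub>0 \<subseteq> F \<longrightarrow> F \<subseteq> I \<longrightarrow> ndist V (s F) l \<le> \<epsilon>))"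

lemma finite_limitD:
  assumes "finite_limit V I s l" "\<epsilon> > 0"
  obtains F\<^sub>0 where "finite F\<^sub>0" "F\<^sub>0 \<subseteq> I" "\<And>F. finite F \<Longrightarrow> F\<^sub>0 \<subseteq> F \<Longrightarrow> F \<subseteq> I \<Longrightarrow> ndist V (s F) l \<le> \<epsilon>"
  using assms unfolding finite_limit_def by meson

context banach_space begin

lemma finite_limit_vnorm_le:
  assumes lim: "finite_limit V I s l"
    and s: "\<And>F. finite F \<Longrightarrow> F \<subseteq> I \<Longrightarrow> s F \<in> carrier V"
    and B: "\<And>F. finite F \<Longrightarrow> F \<subseteq> I \<Longrightarrow> vnorm V (s F) \<le> B"
  shows "vnorm V l \<le> B"
proof (rule field_le_epsilon)
  fix \<epsilon> :: real assume "\<epsilon> > 0"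
  from finite_limitD[OF lim this] obtain F where F: "finite F" "F \<subseteq> I" "ndist V (s F) l \<le> \<epsilon>"
    by (metis order_refl)
  have "l \<in> carrier V" using lim by (simp add: finite_limit_def)
  then show "vnorm V l \<le> B + \<epsilon>" using abs_vnorm_diff_le[OF s[OF F(1,2)], of l] B[OF F(1,2)] F(3) by linarith
qed

lemma finite_limit_unique:
  assumes lim: "finite_limit V I s l" "finite_limit V I s k"
    and s: "\<And>F. finite F \<Longrightarrow> F \<subseteq> I \<Longrightarrow> s F \<in> carrier V"
  shows "l = k"
proof -
  have in_V: "l \<in> carrier V" "k \<in> carrier V" using lim by (simp_all add: finite_limit_def)
  have "ndist V l k \<le> 0"
  proof (rule field_le_epsilon)
    fix \<epsilon> :: real assume "\<epsilon> > 0"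
    then have e: "\<epsilon>/2 > 0" by simp
    obtain F\<^sub>0 where F0: "finite F\<^sub>0" "F\<^sub>0 \<subseteq> I" "\<And>F. finite F \<Longrightarrow> F\<^sub>0 \<subseteq> F \<Longrightarrow> F \<subseteq> I \<Longrightarrow> ndist V (s F) l \<le> \<epsilon>/2"
      using finite_limitD[OF lim(1) e] by metis
    obtain F\<^sub>1 where F1: "finite F\<^sub>1" "F\<^sub>1 \<subseteq> I" "\<And>F. finite F \<Longrightarrow> F\<^sub>1 \<subseteq> F \<Longrightarrow> F \<subseteq> I \<Longrightarrow> ndist V (s F) k \<le> \<epsilon>/2"
      using finite_limitD[OF lim(2) e] by metis
    have "ndist V l k \<le> ndist V (s (F\<^sub>0 \<union> F\<^sub>1)) l + ndist V (s (F\<^sub>0 \<union> F\<^sub>1)) k"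
      using metric.triangle[of l "s (F\<^sub>0 \<union> F\<^sub>1)" k] metric.commute in_V s F0 F1 by simp
    moreover have "ndist V (s (F\<^sub>0 \<union> F\<^sub>1)) l \<le> \<epsilon>/2" by (rule F0(3)) (use F0 F1 in auto)
    moreover have "ndist V (s (F\<^sub>0 \<union> F\<^sub>1)) k \<le> \<epsilon>/2" by (rule F1(3)) (use F0 F1 in auto)
    ultimately show "ndist V l k \<le> 0 + \<epsilon>" by simp
  qed
  then show ?thesis using metric.zero[OF in_V] metric.nonneg[of l k] by simp
qed

lemma finite_limit_add:
  assumes lim: "finite_limit V I s l" "finite_limit V I t k"
    and s: "\<And>F. finite F \<Longrightarrow> F \<subseteq> I \<Longrightarrow> s F \<in> carrier V" "\<And>F. finite F \<Longrightarrow> F \<subseteq> I \<Longrightarrow> t F \<in> carrier V"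
  shows "finite_limit V I (\<lambda>F. s F \<oplus>\<^bsub>V\<^esub> t F) (l \<oplus>\<^bsub>V\<^esub> k)"
  unfolding finite_limit_def
proof (intro conjI allI impI)
  have in_V: "l \<in> carrier V" "k \<in> carrier V" using lim by (simp_all add: finite_limit_def)
  then show "l \<oplus>\<^bsub>V\<^esub> k \<in> carrier V" by simp
  fix \<epsilon> :: real assume "\<epsilon> > 0"
  then have e: "\<epsilon>/2 > 0" by simp
  obtain F\<^sub>0 where F0: "finite F\<^sub>0" "F\<^sub>0 \<subseteq> I" "\<And>F. finite F \<Longrightarrow> F\<^sub>0 \<subseteq> F \<Longrightarrow> F \<subseteq> I \<Longrightarrow> ndist V (s F) l \<le> \<epsilon>/2"
    using finite_limitD[OF lim(1) e] by metis
  obtain F\<^sub>1 where F1: "finite F\<^sub>1" "F\<^sub>1 \<subseteq> I" "\<And>F. finite F \<Longrightarrow> F\<^sub>1 \<subseteq> F \<Longrightarrow> F \<subseteq> I \<Longrightarrow> ndist V (t F) k \<le> \<epsilon>/2"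
    using finite_limitD[OF lim(2) e] by metis
  have "ndist V (s F \<oplus>\<^bsub>V\<^esub> t F) (l \<oplus>\<^bsub>V\<^esub> k) \<le> \<epsilon>" if F: "finite F" "F\<^sub>0 \<union> F\<^sub>1 \<subseteq> F" "F \<subseteq> I" for F
    using ndist_add[of "s F" "t F" l k] s[OF F(1,3)] in_V F0(3)[of F] F1(3)[of F] F by simp
  then show "\<exists>F\<^sub>0. finite F\<^sub>0 \<and> F\<^sub>0 \<subseteq> I \<and> (\<forall>F. finite F \<longrightarrow> F\<^sub>0 \<subseteq> F \<longrightarrow> F \<subseteq> I \<longrightarrow>
      ndist V (s F \<oplus>\<^bsub>V\<^esub> t F) (l \<oplus>\<^bsub>V\<^esub> k) \<le> \<epsilon>)"
    using F0 F1 by (intro exI[of _ "F\<^sub>0 \<union> F\<^sub>1"]) auto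
qed

lemma finite_limit_exists:
  assumes s: "\<And>F. finite F \<Longrightarrow> F \<subseteq> I \<Longrightarrow> s F \<in> carrier V"
    and Cauchy: "\<And>\<epsilon>. \<epsilon> > 0 \<Longrightarrow> \<exists>F\<^sub>0. finite F\<^sub>0 \<and> F\<^sub>0 \<subseteq> I \<and>
      (\<forall>F. finite F \<longrightarrow> F\<^sub>0 \<subseteq> F \<longrightarrow> F \<subseteq> I \<longrightarrow> ndist V (s F) (s F\<^sub>0) \<le> \<epsilon>)"
  obtains l where "finite_limit V I s l"
proof -
  define e :: "nat \<Rightarrow> real" where "e n = inverse (real (Suc n))" for n
  have "\<exists>F\<^sub>0. finite F\<^sub>0 \<and> F\<^sub>0 \<subseteq> I \<and>
      (\<forall>F. finite F \<longrightarrow> F\<^sub>0 \<subseteq> F \<longrightarrow> F \<subseteq> I \<longrightarrow> ndist V (s F) (s F\<^sub>0) \<le> e n)" for n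
    by (rule Cauchy) (simp add: e_def)
  from choice[OF allI[OF this]] obtain F where F': "\<forall>n. finite (F n) \<and> F n \<subseteq> I \<and>
      (\<forall>E. finite E \<longrightarrow> F n \<subseteq> E \<longrightarrow> E \<subseteq> I \<longrightarrow> ndist V (s E) (s (F n)) \<le> e n)" ..
  then have F: "finite (F n)" "F n \<subseteq> I"
      "finite E \<Longrightarrow> F n \<subseteq> E \<Longrightarrow> E \<subseteq> I \<Longrightarrow> ndist V (s E) (s (F n)) \<le> e n" for n E
    by simp_all
  \<comment> \<open>Unions make the test sets increase, while \<open>E n\<close> still contains
    \<open>F n\<close>, so that \<open>s (E n)\<close> is within \<open>e n\<close> of
    \<open>s (F n)\<close>. The values \<open>s (E n)\<close> form a Cauchy sequence, and its limit
    is the limit of the net.\<close>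
  define E where "E n = (\<Union>k\<le>n. F k)" for n
  have E: "finite (E n)" "E n \<subseteq> I" "k \<le> n \<Longrightarrow> F k \<subseteq> E n" for k n
    using F by (auto simp: E_def)
  have sE: "s (E n) \<in> carrier V" "s (F n) \<in> carrier V" for n
    using s[OF E(1,2)] s[OF F(1,2)] by simp_all
  have close: "ndist V (s A) (s B) \<le> 2 * e n" if "finite A" "finite B" "F n \<subseteq> A" "F n \<subseteq> B" "A \<subseteq> I" "B \<subseteq> I" for A B n
  proof -
    have "ndist V (s A) (s B) \<le> ndist V (s A) (s (F n)) + ndist V (s B) (s (F n))"
      using metric.triangle[of "s A" "s (F n)" "s B"] metric.commute[of "s B"] that s sE by simp
    then show ?thesis using F(3)[of A n] F(3)[of B n] that by simp
  qed
  have e: "\<exists>N. \<forall>n\<ge>N. 2 * e n < \<epsilon>" if pos: "\<epsilon> > 0" for \<epsilon>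
  proof -
    obtain N where N: "inverse (real (Suc N)) < \<epsilon>/2" using reals_Archimedean[of "\<epsilon>/2"] pos by auto
    have "2 * e n < \<epsilon>" if "n \<ge> N" for n
    proof -
      have "e n \<le> inverse (real (Suc N))" using that by (simp add: e_def le_imp_inverse_le)
      then show ?thesis using N by simp
    qed
    then show ?thesis by blast
  qed
  have "\<exists>N. \<forall>m\<ge>N. \<forall>n\<ge>N. ndist V (s (E m)) (s (E n)) < \<epsilon>" if pos: "\<epsilon> > 0" for \<epsilon>
  proof -
    obtain N where N: "2 * e N < \<epsilon>" using e[OF pos] by blast
    have "ndist V (s (E m)) (s (E n)) < \<epsilon>" if "m \<ge> N" "n \<ge> N" for m n
      using close[of "E m" "E n" N] E that N by force
    then show ?thesis by blast
  qed
  from complete_Cauchy[of "\<lambda>n. s (E n)", OF sE(1) this]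
  obtain l where l: "l \<in> carrier V" "\<forall>\<epsilon>>0. \<exists>N. \<forall>n\<ge>N. ndist V (s (E n)) l < \<epsilon>" by auto
  have "finite_limit V I s l"
    unfolding finite_limit_def
  proof (intro conjI allI impI l(1))
    fix \<epsilon> :: real assume "\<epsilon> > 0"
    then have h: "\<epsilon>/2 > 0" by simp
    obtain N1 where N1: "\<forall>n\<ge>N1. ndist V (s (E n)) l < \<epsilon>/2" using l(2) h by blast
    obtain N2 where N2: "\<forall>n\<ge>N2. 2 * e n < \<epsilon>/2" using e[OF h] by blast
    define N where "N = max N1 N2"
    have "ndist V (s A) l \<le> \<epsilon>" if "finite A" "F N \<subseteq> A" "A \<subseteq> I" for A
    proof -
      have "ndist V (s A) l \<le> ndist V (s A) (s (E N)) + ndist V (s (E N)) l"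
        using metric.triangle[of "s A" "s (E N)" l] that s sE l(1) by simp
      moreover have "ndist V (s A) (s (E N)) \<le> 2 * e N" using close[of A "E N" N] that E by simp
      moreover have "2 * e N < \<epsilon>/2" "ndist V (s (E N)) l < \<epsilon>/2" using N1 N2 by (auto simp: N_def)
      ultimately show ?thesis by linarith
    qed
    then show "\<exists>F\<^sub>0. finite F\<^sub>0 \<and> F\<^sub>0 \<subseteq> I \<and> (\<forall>F. finite F \<longrightarrow> F\<^sub>0 \<subseteq> F \<longrightarrow> F \<subseteq> I \<longrightarrow> ndist V (s F) l \<le> \<epsilon>)"
      using F(1,2) by (intro exI[of _ "F N"]) auto
  qed
  then show thesis by (rule that)
qed

end

lemma finite_limit_image:
  assumes lim: "finite_limit V I s l" and f: "bounded_linear_map V W f"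
    and "banach_space V" "banach_space W"
    and s: "\<And>F. finite F \<Longrightarrow> F \<subseteq> I \<Longrightarrow> s F \<in> carrier V"
  shows "finite_limit W I (\<lambda>F. f (s F)) (f l)"
  unfolding finite_limit_def
proof (intro conjI allI impI)
  interpret V: banach_space V by fact
  interpret W: banach_space W by fact
  note flin = bounded_linear_map_linear[OF f]
  have l: "l \<in> carrier V" using lim by (simp add: finite_limit_def)
  then show "f l \<in> carrier W" by (rule linear_map_closed[OF flin])
  obtain K where K: "K \<ge> 0" "\<And>x. x \<in> carrier V \<Longrightarrow> vnorm W (f x) \<le> K * vnorm V x"
    using bounded_linear_map_bound[OF f assms(3)] by blast
  fix \<epsilon> :: real assume e: "\<epsilon> > 0"
  then have "\<epsilon> / (K + 1) > 0" using K(1) by simp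
  from finite_limitD[OF lim this] obtain F\<^sub>0 where F0: "finite F\<^sub>0" "F\<^sub>0 \<subseteq> I"
    "\<And>F. finite F \<Longrightarrow> F\<^sub>0 \<subseteq> F \<Longrightarrow> F \<subseteq> I \<Longrightarrow> ndist V (s F) l \<le> \<epsilon> / (K + 1)" by metis
  have "ndist W (f (s F)) (f l) \<le> \<epsilon>" if F: "finite F" "F\<^sub>0 \<subseteq> F" "F \<subseteq> I" for F
  proof -
    have "ndist W (f (s F)) (f l) \<le> K * ndist V (s F) l"
      by (rule ndist_bounded_linear_map[OF flin assms(3,4) s[OF F(1,3)] l K(2)])
    also have "\<dots> \<le> (K + 1) * (\<epsilon> / (K + 1))"
      using K(1) F0(3)[OF F] V.metric.nonneg e by (intro mult_mono) auto
    also have "\<dots> = \<epsilon>" using K(1) by simp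
    finally show ?thesis .
  qed
  then show "\<exists>F\<^sub>0. finite F\<^sub>0 \<and> F\<^sub>0 \<subseteq> I \<and> (\<forall>F. finite F \<longrightarrow> F\<^sub>0 \<subseteq> F \<longrightarrow> F \<subseteq> I \<longrightarrow> ndist W (f (s F)) (f l) \<le> \<epsilon>)"
    using F0 by blast
qed

text \<open>Here \<open>\<gamma> i\<close> stands for multiplication by a function of the partition
  and \<open>u i\<close> for that function times the identity. The splitting is the limit of the
  sums of the terms \<open>act (\<gamma> i a) (\<sigma> (u i))\<close>: \<open>tail\<close> makes
  the net converge, \<open>mod\<close> makes the limit a morphism in \<open>a\<close>, and
  \<open>unit\<close> makes it a right inverse.\<close>

lemma left_projective_if_square_partition:
  fixes A :: "'b cnormed" and \<gamma> :: "'i \<Rightarrow> 'b \<Rightarrow> 'b"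
  assumes A: "banach_algebra A"
    and u: "\<And>i. i \<in> I \<Longrightarrow> u i \<in> carrier A"
    and lin: "\<And>i. i \<in> I \<Longrightarrow> linear_map A A (\<gamma> i)"
    and mod: "\<And>i a b. i \<in> I \<Longrightarrow> a \<in> carrier A \<Longrightarrow> b \<in> carrier A \<Longrightarrow> \<gamma> i (b \<otimes>\<^bsub>A\<^esub> a) = b \<otimes>\<^bsub>A\<^esub> \<gamma> i a"
    and M: "M \<ge> 0"
    and bound1: "\<And>F (s :: 'i \<Rightarrow> real) a. finite F \<Longrightarrow> F \<subseteq> I \<Longrightarrow> \<forall>i. \<bar>s i\<bar> = 1 \<Longrightarrow> a \<in> carrier A \<Longrightarrow>
      vnorm A (\<Oplus>\<^bsub>A\<^esub>i\<in>F. complex_of_real (s i) \<odot>\<^bsub>A\<^esub> \<gamma> i a) \<le> M * vnorm A a"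
    and bound2: "\<And>F (s :: 'i \<Rightarrow> real). finite F \<Longrightarrow> F \<subseteq> I \<Longrightarrow> \<forall>i. \<bar>s i\<bar> = 1 \<Longrightarrow>
      vnorm A (\<Oplus>\<^bsub>A\<^esub>i\<in>F. complex_of_real (s i) \<odot>\<^bsub>A\<^esub> u i) \<le> M"
    and tail: "\<And>a \<epsilon>. a \<in> carrier A \<Longrightarrow> \<epsilon> > 0 \<Longrightarrow> \<exists>F\<^sub>0. finite F\<^sub>0 \<and> F\<^sub>0 \<subseteq> I \<and>
      (\<forall>F (s :: 'i \<Rightarrow> real). finite F \<longrightarrow> F \<subseteq> I - F\<^sub>0 \<longrightarrow> (\<forall>i. \<bar>s i\<bar> = 1) \<longrightarrow>
         vnorm A (\<Oplus>\<^bsub>A\<^esub>i\<in>F. complex_of_real (s i) \<odot>\<^bsub>A\<^esub> \<gamma> i a) \<le> \<epsilon>)"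
    and unit: "\<And>a. a \<in> carrier A \<Longrightarrow> finite_limit A I (\<lambda>F. \<Oplus>\<^bsub>A\<^esub>i\<in>F. \<gamma> i a \<otimes>\<^bsub>A\<^esub> u i) a"
  shows "left_projective TYPE('u) A"
  unfolding left_projective_def projective_module_def
proof (intro allI impI, elim conjE exE)
  interpret A: banach_algebra A by fact
  fix Y :: "'u cnormed" and act \<phi> \<sigma>
  assume Y: "left_banach_module A Y act" and \<phi>: "module_morphism A Y act A (\<otimes>\<^bsub>A\<^esub>) \<phi>"
    and \<sigma>: "bounded_linear_map A Y \<sigma>" and \<phi>\<sigma>: "\<forall>p\<in>carrier A. \<phi> (\<sigma> p) = p"
  interpret Y: left_banach_module A Y act by fact
  have \<phi>lin: "linear_map Y A \<phi>" and \<phi>bdd: "bounded_linear_map Y A \<phi>"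
    using \<phi> by (auto simp: module_morphism_def bounded_linear_map_def)
  have \<phi>act: "\<phi> (act b y) = b \<otimes>\<^bsub>A\<^esub> \<phi> y" if "b \<in> carrier A" "y \<in> carrier Y" for b y
    using \<phi> that by (auto simp: module_morphism_def)
  have \<sigma>lin: "linear_map A Y \<sigma>" by (rule bounded_linear_map_linear[OF \<sigma>])
  note \<sigma>in = linear_map_closed[OF \<sigma>lin]
  obtain L where L: "L \<ge> 0" "\<And>b y. b \<in> carrier A \<Longrightarrow> y \<in> carrier Y \<Longrightarrow>
      vnorm Y (act b y) \<le> L * vnorm A b * vnorm Y y"
    using Y.act_nonneg_bound[OF A.banach_space_axioms] by blast
  obtain N where N: "N \<ge> 0" "\<And>a. a \<in> carrier A \<Longrightarrow> vnorm Y (\<sigma> a) \<le> N * vnorm A a"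
    using bounded_linear_map_bound[OF \<sigma> A.banach_space_axioms] by blast
  have actlin: "linear_map Y Y (act b)" and actbdd: "bounded_linear_map Y Y (act b)" if "b \<in> carrier A" for b
  proof -
    show "linear_map Y Y (act b)"
      using that by (auto intro!: linear_mapI simp: Y.act_closed Y.act_add_right Y.act_smult_right)
    then show "bounded_linear_map Y Y (act b)"
      using L(2)[OF that] unfolding bounded_linear_map_def by blast
  qed
  have B1: "linear_map A Y (\<lambda>b. act a (\<sigma> b))" if "a \<in> carrier A" for a
    using that by (auto intro!: linear_mapI simp: Y.act_closed \<sigma>in linear_map_add[OF \<sigma>lin]
        linear_map_smult[OF \<sigma>lin] Y.act_add_right Y.act_smult_right)
  have B2: "linear_map A Y (\<lambda>a. act a (\<sigma> b))" if "b \<in> carrier A" for b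
    using that by (auto intro!: linear_mapI simp: Y.act_closed \<sigma>in Y.act_add_left Y.act_smult_left)
  have \<gamma>in: "\<gamma> i a \<in> carrier A" if "i \<in> I" "a \<in> carrier A" for i a
    using linear_map_closed[OF lin] that by blast
  define T where "T a i = act (\<gamma> i a) (\<sigma> (u i))" for a i
  have T_in: "T a i \<in> carrier Y" if "i \<in> I" "a \<in> carrier A" for i a
    using that by (simp add: T_def Y.act_closed \<gamma>in \<sigma>in u)
  define S where "S a F = (\<Oplus>\<^bsub>Y\<^esub>i\<in>F. T a i)" for a F
  have S_in: "S a F \<in> carrier Y" if "finite F" "F \<subseteq> I" "a \<in> carrier A" for a F
    unfolding S_def by (rule Y.M.finsum_closed) (use that T_in in auto)
  \<comment> \<open>Signs are averaged for the bilinear map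
    \<open>(b, c) \<mapsto> act b (\<sigma> c)\<close> with zero as initial vectors. The estimate
    depends only on the two signed sums and not on the number of terms.\<close>
  have S_bound: "vnorm Y (S a F) \<le> L * N * M * B"
    if F: "finite F" "F \<subseteq> I" and a: "a \<in> carrier A"
      and B: "\<And>s :: 'i \<Rightarrow> real. \<forall>i. \<bar>s i\<bar> = 1 \<Longrightarrow> vnorm A (\<Oplus>\<^bsub>A\<^esub>i\<in>F. complex_of_real (s i) \<odot>\<^bsub>A\<^esub> \<gamma> i a) \<le> B"
    for a F B
  proof -
    have "\<exists>s :: 'i \<Rightarrow> real. (\<forall>i. \<bar>s i\<bar> = 1) \<and>
       vnorm Y (act \<zero>\<^bsub>A\<^esub> (\<sigma> \<zero>\<^bsub>A\<^esub>) \<oplus>\<^bsub>Y\<^esub> (\<Oplus>\<^bsub>Y\<^esub>i\<in>F. act (\<gamma> i a) (\<sigma> (u i)))) \<le>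
       vnorm Y (act (\<zero>\<^bsub>A\<^esub> \<oplus>\<^bsub>A\<^esub> (\<Oplus>\<^bsub>A\<^esub>i\<in>F. complex_of_real (s i) \<odot>\<^bsub>A\<^esub> \<gamma> i a))
         (\<sigma> (\<zero>\<^bsub>A\<^esub> \<oplus>\<^bsub>A\<^esub> (\<Oplus>\<^bsub>A\<^esub>i\<in>F. complex_of_real (s i) \<odot>\<^bsub>A\<^esub> u i))))"
      by (rule sign_averaging[OF A.banach_space_axioms A.banach_space_axioms Y.banach_space_axioms B1 B2 F(1)])
        (use F a u \<gamma>in in auto)
    then obtain s :: "'i \<Rightarrow> real" where s: "\<forall>i. \<bar>s i\<bar> = 1"
       "vnorm Y (act \<zero>\<^bsub>A\<^esub> (\<sigma> \<zero>\<^bsub>A\<^esub>) \<oplus>\<^bsub>Y\<^esub> S a F) \<le>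
       vnorm Y (act (\<zero>\<^bsub>A\<^esub> \<oplus>\<^bsub>A\<^esub> (\<Oplus>\<^bsub>A\<^esub>i\<in>F. complex_of_real (s i) \<odot>\<^bsub>A\<^esub> \<gamma> i a))
         (\<sigma> (\<zero>\<^bsub>A\<^esub> \<oplus>\<^bsub>A\<^esub> (\<Oplus>\<^bsub>A\<^esub>i\<in>F. complex_of_real (s i) \<odot>\<^bsub>A\<^esub> u i))))"
      unfolding S_def T_def by blast
    let ?p = "\<Oplus>\<^bsub>A\<^esub>i\<in>F. complex_of_real (s i) \<odot>\<^bsub>A\<^esub> \<gamma> i a" and ?q = "\<Oplus>\<^bsub>A\<^esub>i\<in>F. complex_of_real (s i) \<odot>\<^bsub>A\<^esub> u i"
    have pq: "?p \<in> carrier A" "?q \<in> carrier A"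
      using F a u \<gamma>in by (auto intro!: A.M.finsum_closed)
    have "act \<zero>\<^bsub>A\<^esub> (\<sigma> \<zero>\<^bsub>A\<^esub>) = \<zero>\<^bsub>Y\<^esub>"
      by (rule linear_map_zero[OF B1 A.banach_space_axioms Y.banach_space_axioms]) simp
    then have "vnorm Y (S a F) \<le> vnorm Y (act ?p (\<sigma> ?q))"
      using s(2) pq S_in[OF F a] by simp
    also have "\<dots> \<le> L * vnorm A ?p * vnorm Y (\<sigma> ?q)" using L(2)[OF pq(1) \<sigma>in[OF pq(2)]] .
    also have "\<dots> \<le> L * B * (N * M)"
    proof (rule mult_mono)
      show "L * vnorm A ?p \<le> L * B" using B[OF s(1)] L(1) by (rule mult_left_mono)
      show "vnorm Y (\<sigma> ?q) \<le> N * M"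
        using N(2)[OF pq(2)] bound2[OF F s(1)] N(1) by (meson mult_left_mono order_trans)
      show "0 \<le> L * B" using L(1) B[OF s(1)] A.vnorm_nonneg[OF pq(1)] by simp
      show "0 \<le> vnorm Y (\<sigma> ?q)" using Y.vnorm_nonneg[OF \<sigma>in[OF pq(2)]] .
    qed
    finally show ?thesis by (simp add: mult_ac)
  qed
  have S_diff: "ndist Y (S a F) (S a E) = vnorm Y (S a (F - E))"
    if "finite F" "E \<subseteq> F" "F \<subseteq> I" "a \<in> carrier A" for a F E
  proof -
    have fin: "finite E" "E \<subseteq> I" using that finite_subset by auto
    have "S a F = S a (E \<union> (F - E))" using that by (simp add: Un_absorb1)
    also have "\<dots> = S a E \<oplus>\<^bsub>Y\<^esub> S a (F - E)"
      unfolding S_def by (rule Y.M.finsum_Un_disjoint) (use that fin T_in in auto)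
    finally have eq: "S a F = S a E \<oplus>\<^bsub>Y\<^esub> S a (F - E)" .
    have "F - E \<subseteq> I" using that(3) by auto
    then have in_Y: "S a E \<in> carrier Y" "S a (F - E) \<in> carrier Y" using S_in that fin by simp_all
    have "S a F \<ominus>\<^bsub>Y\<^esub> S a E = S a (F - E) \<oplus>\<^bsub>Y\<^esub> (S a E \<ominus>\<^bsub>Y\<^esub> S a E)"
      unfolding eq using in_Y by (simp add: Y.minus_eq_smult Y.M.a_ac del: Y.minus_eq_zero_iff)
    then have "S a F \<ominus>\<^bsub>Y\<^esub> S a E = S a (F - E)" using in_Y by simp
    then show ?thesis using S_in[OF fin that(4)] S_in[OF that(1,3,4)] by (simp add: Y.ndist_eq)
  qed
  have "\<exists>l. finite_limit Y I (S a) l" if a: "a \<in> carrier A" for a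
  proof (rule Y.finite_limit_exists[of I "S a"])
    show "S a F \<in> carrier Y" if "finite F" "F \<subseteq> I" for F using S_in that a by blast
    fix \<epsilon> :: real assume e: "\<epsilon> > 0"
    \<comment> \<open>The difference of two nested partial sums is again such a sum, over indices
      outside \<open>F\<^sub>0\<close>, hence at most \<open>L * N * M * \<delta>\<close>. The added
      1 avoids a division by zero.\<close>
    define \<delta> where "\<delta> = \<epsilon> / (L * N * M + 1)"
    have LNM: "L * N * M \<ge> 0" using L N M by simp
    then have \<delta>: "\<delta> > 0" using e by (simp add: \<delta>_def add_nonneg_pos)
    obtain F\<^sub>0 where F0: "finite F\<^sub>0" "F\<^sub>0 \<subseteq> I" "\<And>F (s :: 'i \<Rightarrow> real). finite F \<Longrightarrow> F \<subseteq> I - F\<^sub>0 \<Longrightarrow> \<forall>i. \<bar>s i\<bar> = 1 \<Longrightarrow>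
         vnorm A (\<Oplus>\<^bsub>A\<^esub>i\<in>F. complex_of_real (s i) \<odot>\<^bsub>A\<^esub> \<gamma> i a) \<le> \<delta>"
      using tail[OF a \<delta>] by metis
    have "ndist Y (S a F) (S a F\<^sub>0) \<le> \<epsilon>" if "finite F" "F\<^sub>0 \<subseteq> F" "F \<subseteq> I" for F
    proof -
      have "ndist Y (S a F) (S a F\<^sub>0) \<le> L * N * M * \<delta>"
        unfolding S_diff[OF that a]
      proof (rule S_bound)
        have "F - F\<^sub>0 \<subseteq> I - F\<^sub>0" using that(3) by auto
        then show "vnorm A (\<Oplus>\<^bsub>A\<^esub>i\<in>F - F\<^sub>0. complex_of_real (s i) \<odot>\<^bsub>A\<^esub> \<gamma> i a) \<le> \<delta>"
          if "\<forall>i. \<bar>s i\<bar> = 1" for s :: "'i \<Rightarrow> real"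
          using F0(3)[of "F - F\<^sub>0" s] \<open>finite F\<close> that by simp
      qed (use that a in auto)
      also have "\<dots> \<le> (L * N * M + 1) * \<delta>" using \<delta> by (intro mult_right_mono) auto
      also have "\<dots> = \<epsilon>" using LNM by (simp add: \<delta>_def)
      finally show ?thesis .
    qed
    then show "\<exists>F\<^sub>0. finite F\<^sub>0 \<and> F\<^sub>0 \<subseteq> I \<and>
      (\<forall>F. finite F \<longrightarrow> F\<^sub>0 \<subseteq> F \<longrightarrow> F \<subseteq> I \<longrightarrow> ndist Y (S a F) (S a F\<^sub>0) \<le> \<epsilon>)"
      using F0(1,2) by blast
  qed blast
  then obtain \<rho> where \<rho>: "\<And>a. a \<in> carrier A \<Longrightarrow> finite_limit Y I (S a) (\<rho> a)" by metis
  have \<rho>in: "\<rho> a \<in> carrier Y" if "a \<in> carrier A" for a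
    using \<rho>[OF that] by (simp add: finite_limit_def)
  have S_image: "S b F = g (S a F)"
    if "finite F" "F \<subseteq> I" "a \<in> carrier A" "linear_map Y Y g" "\<And>i. i \<in> I \<Longrightarrow> T b i = g (T a i)" for a b F g
  proof -
    have "g (S a F) = (\<Oplus>\<^bsub>Y\<^esub>i\<in>F. g (T a i))"
      unfolding S_def using that T_in
      by (intro linear_map_finsum[OF _ Y.banach_space_axioms Y.banach_space_axioms]) auto
    also have "\<dots> = S b F"
      unfolding S_def using that T_in linear_map_closed[OF that(4)]
      by (intro Y.M.finsum_cong') auto
    finally show ?thesis by simp
  qed
  have cong: "finite_limit Y I s l" 
    if "finite_limit Y I t l" "\<And>F. finite F \<Longrightarrow> F \<subseteq> I \<Longrightarrow> s F = t F" for s t l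
    using that unfolding finite_limit_def by simp
  \<comment> \<open>A continuous linear map that takes the terms for \<open>a\<close> to those for
    \<open>b\<close> does the same with the sums and their limits. Scalar multiplication yields
    homogeneity of \<open>\<rho>\<close>, the action of an element yields the module
    property.\<close>
  have lim_image: "\<rho> b = g (\<rho> a)"
    if "a \<in> carrier A" "b \<in> carrier A" "bounded_linear_map Y Y g" "\<And>i. i \<in> I \<Longrightarrow> T b i = g (T a i)" for a b g
  proof (rule Y.finite_limit_unique[OF \<rho>[OF that(2)]])
    show "finite_limit Y I (S b) (g (\<rho> a))"
      by (rule cong[OF finite_limit_image[OF \<rho>[OF that(1)] that(3) Y.banach_space_axioms Y.banach_space_axioms]])
        (use S_in that(1) S_image[OF _ _ that(1) bounded_linear_map_linear[OF that(3)] that(4)] in auto)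
    show "S b F \<in> carrier Y" if "finite F" "F \<subseteq> I" for F using S_in that \<open>b \<in> carrier A\<close> by blast
  qed
  have \<rho>add: "\<rho> (a \<oplus>\<^bsub>A\<^esub> b) = \<rho> a \<oplus>\<^bsub>Y\<^esub> \<rho> b" if ab: "a \<in> carrier A" "b \<in> carrier A" for a b
  proof (rule Y.finite_limit_unique[OF \<rho>])
    have "S (a \<oplus>\<^bsub>A\<^esub> b) F = S a F \<oplus>\<^bsub>Y\<^esub> S b F" if F: "finite F" "F \<subseteq> I" for F
    proof -
      have "S (a \<oplus>\<^bsub>A\<^esub> b) F = (\<Oplus>\<^bsub>Y\<^esub>i\<in>F. T a i \<oplus>\<^bsub>Y\<^esub> T b i)"
        unfolding S_def
      proof (rule Y.M.finsum_cong')
        show "T (a \<oplus>\<^bsub>A\<^esub> b) i = T a i \<oplus>\<^bsub>Y\<^esub> T b i" if "i \<in> F" for i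
          using that F ab by (auto simp: T_def linear_map_add[OF lin] Y.act_add_left \<gamma>in \<sigma>in u subset_iff)
      qed (use T_in F ab in auto)
      also have "\<dots> = S a F \<oplus>\<^bsub>Y\<^esub> S b F"
        unfolding S_def by (rule Y.M.finsum_addf) (use T_in F ab in auto)
      finally show ?thesis .
    qed
    then show "finite_limit Y I (S (a \<oplus>\<^bsub>A\<^esub> b)) (\<rho> a \<oplus>\<^bsub>Y\<^esub> \<rho> b)"
      by (intro cong[OF Y.finite_limit_add[OF \<rho>[OF ab(1)] \<rho>[OF ab(2)]]]) (use S_in ab in auto)
  qed (use ab S_in in auto)
  have smult_bdd: "bounded_linear_map Y Y (\<lambda>y. c \<odot>\<^bsub>Y\<^esub> y)" for c
    unfolding bounded_linear_map_def
    by (auto intro!: linear_mapI exI[of _ "cmod c"] simp: Y.smult_plus_right Y.smult_smult Y.vnorm_smult mult.commute)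
  have \<rho>smult: "\<rho> (c \<odot>\<^bsub>A\<^esub> a) = c \<odot>\<^bsub>Y\<^esub> \<rho> a" if "a \<in> carrier A" for a c
    by (rule lim_image[OF that _ smult_bdd])
      (use that in \<open>auto simp: T_def linear_map_smult[OF lin] Y.act_smult_left \<gamma>in \<sigma>in u\<close>)
  have \<rho>act: "\<rho> (b \<otimes>\<^bsub>A\<^esub> a) = act b (\<rho> a)" if "a \<in> carrier A" "b \<in> carrier A" for a b
    by (rule lim_image[OF that(1) _ actbdd[OF that(2)]])
      (use that in \<open>auto simp: T_def mod Y.act_mult \<gamma>in \<sigma>in u A.mult_closed\<close>)
  have "vnorm Y (\<rho> a) \<le> (L * N * M * M) * vnorm A a" if a: "a \<in> carrier A" for a
  proof (rule Y.finite_limit_vnorm_le[OF \<rho>[OF a]])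
    show "vnorm Y (S a F) \<le> L * N * M * M * vnorm A a" if "finite F" "F \<subseteq> I" for F
      using S_bound[OF that a, of "M * vnorm A a"] bound1[OF that _ a] by (simp add: mult_ac)
  qed (use S_in a in blast)
  then have "module_morphism A A (\<otimes>\<^bsub>A\<^esub>) Y act \<rho>"
    unfolding module_morphism_def bounded_linear_map_def
    using \<rho>act by (auto intro!: linear_mapI simp: \<rho>add \<rho>smult \<rho>in)
  moreover have "\<phi> (\<rho> a) = a" if a: "a \<in> carrier A" for a
  proof (rule A.finite_limit_unique[OF _ unit[OF a]])
    have "\<phi> (S a F) = (\<Oplus>\<^bsub>A\<^esub>i\<in>F. \<gamma> i a \<otimes>\<^bsub>A\<^esub> u i)" if F: "finite F" "F \<subseteq> I" for F
    proof -
      have "\<phi> (S a F) = (\<Oplus>\<^bsub>A\<^esub>i\<in>F. \<phi> (T a i))"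
        unfolding S_def using F a T_in
        by (intro linear_map_finsum[OF \<phi>lin Y.banach_space_axioms A.banach_space_axioms]) auto
      also have "\<dots> = (\<Oplus>\<^bsub>A\<^esub>i\<in>F. \<gamma> i a \<otimes>\<^bsub>A\<^esub> u i)"
        by (rule A.M.finsum_cong')
          (use F a u \<gamma>in \<phi>\<sigma> in \<open>auto simp: T_def \<phi>act \<sigma>in A.mult_closed subset_iff\<close>)
      finally show ?thesis .
    qed
    moreover have "finite_limit A I (\<lambda>F. \<phi> (S a F)) (\<phi> (\<rho> a))"
      by (rule finite_limit_image[OF \<rho>[OF a] \<phi>bdd Y.banach_space_axioms A.banach_space_axioms]) (use S_in a in blast)
    ultimately show "finite_limit A I (\<lambda>F. \<Oplus>\<^bsub>A\<^esub>i\<in>F. \<gamma> i a \<otimes>\<^bsub>A\<^esub> u i) (\<phi> (\<rho> a))"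
      unfolding finite_limit_def by simp
    show "(\<Oplus>\<^bsub>A\<^esub>i\<in>F. \<gamma> i a \<otimes>\<^bsub>A\<^esub> u i) \<in> carrier A" if "finite F" "F \<subseteq> I" for F
      by (rule A.M.finsum_closed) (use that a u \<gamma>in A.mult_closed in auto)
  qed
  ultimately show "\<exists>\<rho>. module_morphism A A (\<otimes>\<^bsub>A\<^esub>) Y act \<rho> \<and> (\<forall>p\<in>carrier A. \<phi> (\<rho> p) = p)" by blast
qed

section \<open>Spaces of bounded functions\<close>

lemma le_Sup_insert_0:
  fixes h :: "'j \<Rightarrow> real"
  assumes "\<And>j. j \<in> J \<Longrightarrow> h j \<le> B" "j \<in> J"
  shows "h j \<le> Sup (insert 0 (h ` J))"
proof (rule cSup_upper)
  show "bdd_above (insert 0 (h ` J))" using assms(1) by (auto intro!: bdd_aboveI2)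
qed (use assms(2) in auto)

lemma Sup_insert_0_le:
  fixes h :: "'j \<Rightarrow> real"
  assumes "\<And>j. j \<in> J \<Longrightarrow> h j \<le> B" "0 \<le> B"
  shows "Sup (insert 0 (h ` J)) \<le> B"
  by (rule cSup_least) (use assms in auto)

text \<open>The common source of completeness for the algebra of the field and for the tensor
  functions: bounded selections from a family of Banach spaces under the supremum norm, taken from a
  set that is closed under uniform limits.\<close>

lemma banach_space_bounded_functions:
  fixes W :: "('j \<Rightarrow> 'a) cnormed" and M :: "'j \<Rightarrow> 'a cnormed"
  assumes M: "\<And>j. j \<in> J \<Longrightarrow> banach_space (M j)"
    and sub: "carrier W \<subseteq> (\<Pi>\<^sub>E j\<in>J. carrier (M j))"
    and bounded: "\<And>y. y \<in> carrier W \<Longrightarrow> \<exists>B. \<forall>j\<in>J. vnorm (M j) (y j) \<le> B"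
    and zero: "\<zero>\<^bsub>W\<^esub> = (\<lambda>j\<in>J. \<zero>\<^bsub>M j\<^esub>)" "\<zero>\<^bsub>W\<^esub> \<in> carrier W"
    and add: "\<And>x y. x \<oplus>\<^bsub>W\<^esub> y = (\<lambda>j\<in>J. x j \<oplus>\<^bsub>M j\<^esub> y j)"
      "\<And>x y. x \<in> carrier W \<Longrightarrow> y \<in> carrier W \<Longrightarrow> x \<oplus>\<^bsub>W\<^esub> y \<in> carrier W"
    and smult: "\<And>c x. c \<odot>\<^bsub>W\<^esub> x = (\<lambda>j\<in>J. c \<odot>\<^bsub>M j\<^esub> x j)"
      "\<And>c x. x \<in> carrier W \<Longrightarrow> c \<odot>\<^bsub>W\<^esub> x \<in> carrier W"
    and vnorm: "\<And>x. vnorm W x = Sup (insert 0 ((\<lambda>j. vnorm (M j) (x j)) ` J))"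
    and closed: "\<And>y. y \<in> (\<Pi>\<^sub>E j\<in>J. carrier (M j)) \<Longrightarrow>
      (\<And>\<epsilon>. \<epsilon> > 0 \<Longrightarrow> \<exists>x\<in>carrier W. \<forall>j\<in>J. ndist (M j) (y j) (x j) \<le> \<epsilon>) \<Longrightarrow> y \<in> carrier W"
  shows "banach_space W"
proof -
  have in_M: "x j \<in> carrier (M j)" if "x \<in> carrier W" "j \<in> J" for x j
    using sub that by auto
  have ext: "x \<in> extensional J" if "x \<in> carrier W" for x
    using subsetD[OF sub that] by (simp add: PiE_def)
  have eqI: "x = y" if "x \<in> carrier W" "y \<in> carrier W" "\<And>j. j \<in> J \<Longrightarrow> x j = y j" for x y
    by (rule extensionalityI[OF ext[OF that(1)] ext[OF that(2)] that(3)])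
  have le: "vnorm (M j) (x j) \<le> vnorm W x" if xW: "x \<in> carrier W" and j: "j \<in> J" for x j
  proof -
    obtain B where B: "\<forall>j\<in>J. vnorm (M j) (x j) \<le> B" using bounded[OF xW] by blast
    show ?thesis unfolding vnorm
      by (rule le_Sup_insert_0[of J "\<lambda>j. vnorm (M j) (x j)" B]) (use B j in auto)
  qed
  have ge: "vnorm W x \<le> B" if "\<And>j. j \<in> J \<Longrightarrow> vnorm (M j) (x j) \<le> B" "0 \<le> B" for x B
    unfolding vnorm by (rule Sup_insert_0_le) (use that in auto)
  have nonneg: "0 \<le> vnorm W x" if xW: "x \<in> carrier W" for x
  proof -
    obtain B where B: "\<forall>j\<in>J. vnorm (M j) (x j) \<le> B" using bounded[OF xW] by blast
    show ?thesis unfolding vnorm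
      by (rule cSup_upper) (use B in \<open>auto intro!: bdd_aboveI[where M = "max 0 B"] simp: max.coboundedI2\<close>)
  qed
  have nd: "ndist (M j) (x j) (y j) = vnorm (M j) ((x \<oplus>\<^bsub>W\<^esub> (-1) \<odot>\<^bsub>W\<^esub> y) j)"
    if "x \<in> (\<Pi>\<^sub>E j\<in>J. carrier (M j))" "y \<in> (\<Pi>\<^sub>E j\<in>J. carrier (M j))" "j \<in> J" for x y j
  proof -
    interpret banach_space "M j" using M that by blast
    have "x j \<in> carrier (M j)" "y j \<in> carrier (M j)" using that by auto
    then show ?thesis using that(3) by (simp add: ndist_eq minus_eq_smult add smult)
  qed
  show ?thesis
  proof (rule banach_spaceI)
    fix x y z and c d :: complex
    assume xyz: "x \<in> carrier W" "y \<in> carrier W" "z \<in> carrier W"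
    have fib: "banach_space (M j)" "x j \<in> carrier (M j)" "y j \<in> carrier (M j)" "z j \<in> carrier (M j)"
      if "j \<in> J" for j using M in_M xyz that by auto
    have pt: "((x \<oplus>\<^bsub>W\<^esub> y) \<oplus>\<^bsub>W\<^esub> z) j = (x \<oplus>\<^bsub>W\<^esub> (y \<oplus>\<^bsub>W\<^esub> z)) j"
      "(x \<oplus>\<^bsub>W\<^esub> y) j = (y \<oplus>\<^bsub>W\<^esub> x) j" "(\<zero>\<^bsub>W\<^esub> \<oplus>\<^bsub>W\<^esub> x) j = x j" "(0 \<odot>\<^bsub>W\<^esub> x) j = \<zero>\<^bsub>W\<^esub> j"
      "(1 \<odot>\<^bsub>W\<^esub> x) j = x j" "((c + d) \<odot>\<^bsub>W\<^esub> x) j = (c \<odot>\<^bsub>W\<^esub> x \<oplus>\<^bsub>W\<^esub> d \<odot>\<^bsub>W\<^esub> x) j"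
      "(c \<odot>\<^bsub>W\<^esub> (x \<oplus>\<^bsub>W\<^esub> y)) j = (c \<odot>\<^bsub>W\<^esub> x \<oplus>\<^bsub>W\<^esub> c \<odot>\<^bsub>W\<^esub> y) j"
      "((c * d) \<odot>\<^bsub>W\<^esub> x) j = (c \<odot>\<^bsub>W\<^esub> (d \<odot>\<^bsub>W\<^esub> x)) j"
      "vnorm (M j) ((x \<oplus>\<^bsub>W\<^esub> y) j) \<le> vnorm (M j) (x j) + vnorm (M j) (y j)"
      "vnorm (M j) ((c \<odot>\<^bsub>W\<^esub> x) j) = cmod c * vnorm (M j) (x j)"
      if j: "j \<in> J" for j
    proof -
      interpret banach_space "M j" using fib(1)[OF j] .
      note f = fib(2-4)[OF j]
      show "(x \<oplus>\<^bsub>W\<^esub> y) j = (y \<oplus>\<^bsub>W\<^esub> x) j" using j f by (simp add: add(1) M.a_comm)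
      show "((x \<oplus>\<^bsub>W\<^esub> y) \<oplus>\<^bsub>W\<^esub> z) j = (x \<oplus>\<^bsub>W\<^esub> (y \<oplus>\<^bsub>W\<^esub> z)) j"
      "(\<zero>\<^bsub>W\<^esub> \<oplus>\<^bsub>W\<^esub> x) j = x j" "(0 \<odot>\<^bsub>W\<^esub> x) j = \<zero>\<^bsub>W\<^esub> j"
      "(1 \<odot>\<^bsub>W\<^esub> x) j = x j" "((c + d) \<odot>\<^bsub>W\<^esub> x) j = (c \<odot>\<^bsub>W\<^esub> x \<oplus>\<^bsub>W\<^esub> d \<odot>\<^bsub>W\<^esub> x) j"
      "(c \<odot>\<^bsub>W\<^esub> (x \<oplus>\<^bsub>W\<^esub> y)) j = (c \<odot>\<^bsub>W\<^esub> x \<oplus>\<^bsub>W\<^esub> c \<odot>\<^bsub>W\<^esub> y) j"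
      "((c * d) \<odot>\<^bsub>W\<^esub> x) j = (c \<odot>\<^bsub>W\<^esub> (d \<odot>\<^bsub>W\<^esub> x)) j"
      "vnorm (M j) ((x \<oplus>\<^bsub>W\<^esub> y) j) \<le> vnorm (M j) (x j) + vnorm (M j) (y j)"
      "vnorm (M j) ((c \<odot>\<^bsub>W\<^esub> x) j) = cmod c * vnorm (M j) (x j)"
        using j f by (simp_all add: zero(1) add(1) smult(1) M.a_assoc smult_plus_left
            smult_plus_right smult_smult vnorm_triangle vnorm_smult)
    qed
    note clos = xyz add(2) smult(2) zero(2)
    show "(x \<oplus>\<^bsub>W\<^esub> y) \<oplus>\<^bsub>W\<^esub> z = x \<oplus>\<^bsub>W\<^esub> (y \<oplus>\<^bsub>W\<^esub> z)" by (rule eqI) (simp_all add: clos pt)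
    show "x \<oplus>\<^bsub>W\<^esub> y = y \<oplus>\<^bsub>W\<^esub> x" by (rule eqI) (simp_all only: clos pt)
    show "\<zero>\<^bsub>W\<^esub> \<oplus>\<^bsub>W\<^esub> x = x" by (rule eqI) (simp_all only: clos pt)
    show "0 \<odot>\<^bsub>W\<^esub> x = \<zero>\<^bsub>W\<^esub>" by (rule eqI) (simp_all only: clos pt)
    show "1 \<odot>\<^bsub>W\<^esub> x = x" by (rule eqI) (simp_all only: clos pt)
    show "(c + d) \<odot>\<^bsub>W\<^esub> x = c \<odot>\<^bsub>W\<^esub> x \<oplus>\<^bsub>W\<^esub> d \<odot>\<^bsub>W\<^esub> x" by (rule eqI) (simp_all only: clos pt)
    show "c \<odot>\<^bsub>W\<^esub> (x \<oplus>\<^bsub>W\<^esub> y) = c \<odot>\<^bsub>W\<^esub> x \<oplus>\<^bsub>W\<^esub> c \<odot>\<^bsub>W\<^esub> y" by (rule eqI) (simp_all only: clos pt)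
    show "(c * d) \<odot>\<^bsub>W\<^esub> x = c \<odot>\<^bsub>W\<^esub> (d \<odot>\<^bsub>W\<^esub> x)" by (rule eqI) (simp_all only: clos pt)
    show "vnorm W (x \<oplus>\<^bsub>W\<^esub> y) \<le> vnorm W x + vnorm W y"
    proof (rule ge)
      show "vnorm (M j) ((x \<oplus>\<^bsub>W\<^esub> y) j) \<le> vnorm W x + vnorm W y" if "j \<in> J" for j
        using pt(9)[OF that] le[OF xyz(1) that] le[OF xyz(2) that] by linarith
    qed (use nonneg xyz in auto)
    show "vnorm W (c \<odot>\<^bsub>W\<^esub> x) = cmod c * vnorm W x"
    proof (rule antisym)
      show "vnorm W (c \<odot>\<^bsub>W\<^esub> x) \<le> cmod c * vnorm W x"
        using pt(10) le[OF xyz(1)] nonneg[OF xyz(1)] by (intro ge) (simp_all add: mult_left_mono)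
      show "cmod c * vnorm W x \<le> vnorm W (c \<odot>\<^bsub>W\<^esub> x)"
      proof (cases "c = 0")
        case False
        have "vnorm W x \<le> vnorm W (c \<odot>\<^bsub>W\<^esub> x) / cmod c"
        proof (rule ge)
          show "vnorm (M j) (x j) \<le> vnorm W (c \<odot>\<^bsub>W\<^esub> x) / cmod c" if "j \<in> J" for j
            using le[OF smult(2)[OF xyz(1)] that, of c] pt(10)[OF that] False by (simp add: field_simps)
        qed (use nonneg[OF smult(2)[OF xyz(1), of c]] in simp)
        then show ?thesis using False by (simp add: field_simps)
      qed (use nonneg[OF smult(2)[OF xyz(1), of c]] in simp)
    qed
  next
    fix x assume x: "x \<in> carrier W" "vnorm W x = 0"
    show "x = \<zero>\<^bsub>W\<^esub>"
    proof (rule eqI[OF x(1) zero(2)])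
      fix j assume j: "j \<in> J"
      interpret banach_space "M j" using M[OF j] .
      have "vnorm (M j) (x j) = 0" using le[OF x(1) j] x(2) vnorm_nonneg[OF in_M[OF x(1) j]] by simp
      then show "x j = \<zero>\<^bsub>W\<^esub> j" using in_M[OF x(1) j] j vnorm_eq_0_iff zero(1) by simp
    qed
  next
    fix \<sigma> :: "nat \<Rightarrow> _"
    assume \<sigma>: "\<And>n. \<sigma> n \<in> carrier W"
      and C: "\<And>\<epsilon>. \<epsilon> > 0 \<Longrightarrow> \<exists>N. \<forall>m\<ge>N. \<forall>n\<ge>N. vnorm W (\<sigma> m \<oplus>\<^bsub>W\<^esub> (-1) \<odot>\<^bsub>W\<^esub> \<sigma> n) < \<epsilon>"
    have \<sigma>': "\<sigma> n \<in> (\<Pi>\<^sub>E j\<in>J. carrier (M j))" for n using \<sigma> sub by blast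
    have ptC: "ndist (M j) (\<sigma> m j) (\<sigma> n j) \<le> vnorm W (\<sigma> m \<oplus>\<^bsub>W\<^esub> (-1) \<odot>\<^bsub>W\<^esub> \<sigma> n)" if "j \<in> J" for j m n
      unfolding nd[OF \<sigma>' \<sigma>' that] by (rule le[OF add(2)[OF \<sigma> smult(2)[OF \<sigma>]] that])
    have "\<exists>l\<in>carrier (M j). \<forall>\<epsilon>>0. \<exists>N. \<forall>n\<ge>N. ndist (M j) (\<sigma> n j) l < \<epsilon>" if j: "j \<in> J" for j
    proof -
      interpret banach_space "M j" using M[OF j] .
      show ?thesis
      proof (rule complete_Cauchy)
        show "\<sigma> n j \<in> carrier (M j)" for n using in_M[OF \<sigma> j] .
        fix \<epsilon> :: real assume "\<epsilon> > 0"
        then obtain N where "\<forall>m\<ge>N. \<forall>n\<ge>N. vnorm W (\<sigma> m \<oplus>\<^bsub>W\<^esub> (-1) \<odot>\<^bsub>W\<^esub> \<sigma> n) < \<epsilon>" using C by blast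
        then show "\<exists>N. \<forall>m\<ge>N. \<forall>n\<ge>N. ndist (M j) (\<sigma> m j) (\<sigma> n j) < \<epsilon>"
          using ptC[OF j] by (intro exI[of _ N]) (meson le_less_trans)
      qed
    qed
    then have "\<forall>j\<in>J. \<exists>l. l \<in> carrier (M j) \<and> (\<forall>\<epsilon>>0. \<exists>N. \<forall>n\<ge>N. ndist (M j) (\<sigma> n j) l < \<epsilon>)" by blast
    from bchoice[OF this] obtain l0 where
      l0: "\<forall>j\<in>J. l0 j \<in> carrier (M j) \<and> (\<forall>\<epsilon>>0. \<exists>N. \<forall>n\<ge>N. ndist (M j) (\<sigma> n j) (l0 j) < \<epsilon>)" ..
    define l where "l = restrict l0 J"
    have l: "l \<in> (\<Pi>\<^sub>E j\<in>J. carrier (M j))" using l0 by (auto simp: l_def)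
    \<comment> \<open>The Cauchy estimate is uniform in \<open>j\<close>. For each \<open>j\<close>
      the second index is chosen far out, depending on \<open>j\<close>, and then drops out of the
      bound.\<close>
    have unif: "\<exists>N. \<forall>n\<ge>N. \<forall>j\<in>J. ndist (M j) (\<sigma> n j) (l j) \<le> \<epsilon>" if e: "\<epsilon> > 0" for \<epsilon>
    proof -
      have "\<epsilon>/2 > 0" using e by simp
      then obtain N where N: "\<forall>m\<ge>N. \<forall>n\<ge>N. vnorm W (\<sigma> m \<oplus>\<^bsub>W\<^esub> (-1) \<odot>\<^bsub>W\<^esub> \<sigma> n) < \<epsilon>/2" using C by blast
      have "ndist (M j) (\<sigma> n j) (l j) \<le> \<epsilon>" if n: "n \<ge> N" and j: "j \<in> J" for n j
      proof -
        interpret banach_space "M j" using M[OF j] .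
        obtain N' where N': "\<forall>m\<ge>N'. ndist (M j) (\<sigma> m j) (l0 j) < \<epsilon>/2" using l0 j \<open>\<epsilon>/2 > 0\<close> by blast
        let ?m = "max N N'"
        have "ndist (M j) (\<sigma> n j) (l j) \<le> ndist (M j) (\<sigma> n j) (\<sigma> ?m j) + ndist (M j) (\<sigma> ?m j) (l j)"
          by (rule metric.triangle) (use in_M[OF \<sigma> j] l j in auto)
        moreover have "ndist (M j) (\<sigma> n j) (\<sigma> ?m j) < \<epsilon>/2"
          using ptC[OF j, of n ?m] N n by (meson le_less_trans max.cobounded1)
        moreover have "ndist (M j) (\<sigma> ?m j) (l j) < \<epsilon>/2" using N' j by (simp add: l_def)
        ultimately show ?thesis by linarith
      qed
      then show ?thesis by blast
    qed
    have lW: "l \<in> carrier W"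
    proof (rule closed[OF l])
      fix \<epsilon> :: real assume "\<epsilon> > 0"
      then obtain N where "\<forall>n\<ge>N. \<forall>j\<in>J. ndist (M j) (\<sigma> n j) (l j) \<le> \<epsilon>" using unif by blast
      moreover have "ndist (M j) (\<sigma> N j) (l j) = ndist (M j) (l j) (\<sigma> N j)" if "j \<in> J" for j
        using Metric_space.commute[OF banach_space.Metric_space_ndist[OF M[OF that]]] .
      ultimately show "\<exists>x\<in>carrier W. \<forall>j\<in>J. ndist (M j) (l j) (x j) \<le> \<epsilon>"
        using \<sigma>[of N] by (intro bexI[of _ "\<sigma> N"]) auto
    qed
    have "\<exists>N. \<forall>n\<ge>N. vnorm W (\<sigma> n \<oplus>\<^bsub>W\<^esub> (-1) \<odot>\<^bsub>W\<^esub> l) < \<epsilon>" if e: "\<epsilon> > 0" for \<epsilon>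
    proof -
      have h: "\<epsilon>/2 > 0" using e by simp
      obtain N where N: "\<forall>n\<ge>N. \<forall>j\<in>J. ndist (M j) (\<sigma> n j) (l j) \<le> \<epsilon>/2" using unif[OF h] by blast
      have "vnorm W (\<sigma> n \<oplus>\<^bsub>W\<^esub> (-1) \<odot>\<^bsub>W\<^esub> l) \<le> \<epsilon>/2" if "n \<ge> N" for n
        by (rule ge) (use N that nd[OF \<sigma>' l, symmetric] h in auto)
      then show ?thesis using h by (intro exI[of _ N]) fastforce
    qed
    then show "\<exists>l\<in>carrier W. \<forall>\<epsilon>>0. \<exists>N. \<forall>n\<ge>N. vnorm W (\<sigma> n \<oplus>\<^bsub>W\<^esub> (-1) \<odot>\<^bsub>W\<^esub> l) < \<epsilon>"
      using lW by blast
  qed (use zero add smult nonneg in auto)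
qed

section \<open>Isometric isomorphisms\<close>

lemma
  assumes "isometric_algebra_iso A B f"
  shows iso_linear: "linear_map A B f"
    and iso_closed: "x \<in> carrier A \<Longrightarrow> f x \<in> carrier B"
    and iso_mult: "x \<in> carrier A \<Longrightarrow> y \<in> carrier A \<Longrightarrow> f (x \<otimes>\<^bsub>A\<^esub> y) = f x \<otimes>\<^bsub>B\<^esub> f y"
    and iso_vnorm: "x \<in> carrier A \<Longrightarrow> vnorm B (f x) = vnorm A x"
    and iso_bij: "bij_betw f (carrier A) (carrier B)"
  using assms by (auto simp: isometric_algebra_iso_def linear_map_def)

lemma iso_ndist:
  assumes "isometric_algebra_iso A B f" "banach_space A" "banach_space B" "x \<in> carrier A" "y \<in> carrier A"
  shows "ndist B (f x) (f y) = ndist A x y"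
proof -
  interpret A: banach_space A by fact
  interpret B: banach_space B by fact
  show ?thesis
    using linear_map_minus[OF iso_linear[OF assms(1)] assms(2-5)] iso_vnorm[OF assms(1), of "x \<ominus>\<^bsub>A\<^esub> y"]
      iso_closed[OF assms(1)] assms(4,5) by (simp add: A.ndist_eq B.ndist_eq)
qed

lemma iso_inv_into:
  assumes iso: "isometric_algebra_iso A B f" and A: "banach_algebra A"
  shows "isometric_algebra_iso B A (inv_into (carrier A) f)"
proof -
  interpret A: banach_algebra A by fact
  let ?g = "inv_into (carrier A) f"
  have bij: "bij_betw f (carrier A) (carrier B)" by (rule iso_bij[OF iso])
  have g: "?g y \<in> carrier A" "f (?g y) = y" if "y \<in> carrier B" for y
    using that bij by (auto simp: bij_betw_def inv_into_into f_inv_into_f)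
  have gI: "?g y = x" if "x \<in> carrier A" "f x = y" for x y
    using that bij by (auto simp: bij_betw_def inv_into_f_f)
  have "linear_map B A ?g"
    by (rule linear_mapI)
      (auto simp: g A.mult_closed linear_map_add[OF iso_linear[OF iso]] linear_map_smult[OF iso_linear[OF iso]]
        intro!: gI)
  then show ?thesis
    unfolding isometric_algebra_iso_def
    using bij_betw_inv_into[OF bij] g iso_mult[OF iso] iso_vnorm[OF iso] A.mult_closed
    by (auto intro!: gI) (metis g iso_vnorm[OF iso])
qed

lemma iso_compose:
  assumes "isometric_algebra_iso A B f" "isometric_algebra_iso B C g"
  shows "isometric_algebra_iso A C (g \<circ> f)"
  using assms bij_betw_trans[of f "carrier A" "carrier B" g "carrier C"]
  by (auto simp: isometric_algebra_iso_def linear_map_def Pi_iff)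

lemma is_identity_unique:
  assumes "is_identity A e" "is_identity A e'"
  shows "e = e'"
  using assms unfolding is_identity_def by metis

lemma iso_identity:
  assumes iso: "isometric_algebra_iso A B f" and e: "is_identity A e"
  shows "is_identity B (f e)"
  unfolding is_identity_def
proof (intro conjI ballI)
  show "f e \<in> carrier B" using e iso_closed[OF iso] by (simp add: is_identity_def)
  fix b assume "b \<in> carrier B"
  then obtain a where "a \<in> carrier A" "b = f a"
    using iso_bij[OF iso] by (auto simp: bij_betw_def)
  then show "f e \<otimes>\<^bsub>B\<^esub> b = b" "b \<otimes>\<^bsub>B\<^esub> f e = b"
    using e iso_mult[OF iso] by (auto simp: is_identity_def) (metis iso_mult[OF iso])+
qed

section \<open>Sections of a continuous field\<close>

lemma continuous_map_real_nbhd: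
  assumes "continuous_map X euclideanreal f" "t \<in> topspace X" "\<epsilon> > 0"
  obtains N where "openin X N" "t \<in> N" "\<And>s. s \<in> N \<Longrightarrow> \<bar>f s - f t\<bar> < \<epsilon>"
proof (rule that)
  show "openin X {s \<in> topspace X. f s \<in> ball (f t) \<epsilon>}"
    by (rule openin_continuous_map_preimage[OF assms(1)]) simp
qed (use assms in \<open>auto simp: dist_real_def abs_minus_commute\<close>)

lemma vanishes_at_infinityD:
  assumes "vanishes_at_infinity X f" "\<epsilon> > 0"
  obtains K where "compactin X K" "\<And>t. t \<in> topspace X \<Longrightarrow> t \<notin> K \<Longrightarrow> \<bar>f t\<bar> < \<epsilon>"
  using assms unfolding vanishes_at_infinity_def by (metis DiffI)

lemma vanishes_at_infinity_dominated:
  assumes "vanishes_at_infinity X f" "\<And>t. t \<in> topspace X \<Longrightarrow> \<bar>h t\<bar> \<le> B * \<bar>f t\<bar>"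
  shows "vanishes_at_infinity X h"
  unfolding vanishes_at_infinity_def
proof (intro allI impI)
  fix \<epsilon> :: real assume "\<epsilon> > 0"
  then have "\<epsilon> / (\<bar>B\<bar> + 1) > 0" by simp
  from vanishes_at_infinityD[OF assms(1) this]
  obtain K where K: "compactin X K" "\<And>t. t \<in> topspace X \<Longrightarrow> t \<notin> K \<Longrightarrow> \<bar>f t\<bar> < \<epsilon> / (\<bar>B\<bar> + 1)"
    by metis
  have "\<bar>h t\<bar> < \<epsilon>" if t: "t \<in> topspace X - K" for t
  proof -
    have "\<bar>h t\<bar> \<le> (\<bar>B\<bar> + 1) * \<bar>f t\<bar>"
      using assms(2)[OF DiffD1[OF t]] mult_right_mono[of B "\<bar>B\<bar> + 1" "\<bar>f t\<bar>"] by linarith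
    also have "\<dots> < (\<bar>B\<bar> + 1) * (\<epsilon> / (\<bar>B\<bar> + 1))"
      using K(2)[of t] t by (intro mult_strict_left_mono) auto
    finally show ?thesis by simp
  qed
  then show "\<exists>K. compactin X K \<and> (\<forall>t\<in>topspace X - K. \<bar>h t\<bar> < \<epsilon>)" using K(1) by blast
qed

lemma vanishes_at_infinity_add:
  assumes "vanishes_at_infinity X f" "vanishes_at_infinity X g" "\<And>t. t \<in> topspace X \<Longrightarrow> \<bar>h t\<bar> \<le> \<bar>f t\<bar> + \<bar>g t\<bar>"
  shows "vanishes_at_infinity X h"
  unfolding vanishes_at_infinity_def
proof (intro allI impI)
  fix \<epsilon> :: real assume "\<epsilon> > 0"
  then have e: "\<epsilon>/2 > 0" by simp
  obtain K where K: "compactin X K" "\<And>t. t \<in> topspace X \<Longrightarrow> t \<notin> K \<Longrightarrow> \<bar>f t\<bar> < \<epsilon>/2"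
    using vanishes_at_infinityD[OF assms(1) e] by metis
  obtain L where L: "compactin X L" "\<And>t. t \<in> topspace X \<Longrightarrow> t \<notin> L \<Longrightarrow> \<bar>g t\<bar> < \<epsilon>/2"
    using vanishes_at_infinityD[OF assms(2) e] by metis
  have "\<bar>h t\<bar> < \<epsilon>" if "t \<in> topspace X - (K \<union> L)" for t
    using assms(3)[of t] K(2)[of t] L(2)[of t] that by auto
  then show "\<exists>K. compactin X K \<and> (\<forall>t\<in>topspace X - K. \<bar>h t\<bar> < \<epsilon>)"
    using compactin_Un[OF K(1) L(1)] by blast
qed

lemma field_algebra_simps:
  "carrier (field_algebra U) = {x \<in> sections U. vanishes_at_infinity (base U) (\<lambda>t. vnorm (fibre U t) (x t))}"
  "x \<otimes>\<^bsub>field_algebra U\<^esub> y = (\<lambda>t\<in>topspace (base U). x t \<otimes>\<^bsub>fibre U t\<^esub> y t)"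
  "\<zero>\<^bsub>field_algebra U\<^esub> = (\<lambda>t\<in>topspace (base U). \<zero>\<^bsub>fibre U t\<^esub>)"
  "x \<oplus>\<^bsub>field_algebra U\<^esub> y = (\<lambda>t\<in>topspace (base U). x t \<oplus>\<^bsub>fibre U t\<^esub> y t)"
  "c \<odot>\<^bsub>field_algebra U\<^esub> x = (\<lambda>t\<in>topspace (base U). c \<odot>\<^bsub>fibre U t\<^esub> x t)"
  "vnorm (field_algebra U) x = Sup (insert 0 ((\<lambda>t. vnorm (fibre U t) (x t)) ` topspace (base U)))"
  by (simp_all add: field_algebra_def)

text \<open>A local trivialisation with values in the fibre at \<open>p\<close> itself and equal to
  the identity there. In it sections become continuous functions into one Banach space; the last
  clause is this continuity on \<open>N\<close>, written out with open sets of the base.\<close>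

definition chart :: "('t, 'a) alg_field \<Rightarrow> 't \<Rightarrow> 't set \<Rightarrow> ('t \<Rightarrow> 'a \<Rightarrow> 'a) \<Rightarrow> bool" where
  "chart U p N \<psi> \<longleftrightarrow>
     openin (base U) N \<and> p \<in> N \<and>
     (\<forall>t\<in>N. isometric_algebra_iso (fibre U t) (fibre U p) (\<psi> t)) \<and>
     (\<forall>a\<in>carrier (fibre U p). \<psi> p a = a) \<and>
     (\<forall>x\<in>sections U. \<forall>t\<in>N. \<forall>\<epsilon>>0. \<exists>G. openin (base U) G \<and> t \<in> G \<and> G \<subseteq> N \<and>
        (\<forall>s\<in>G. ndist (fibre U p) (\<psi> s (x s)) (\<psi> t (x t)) < \<epsilon>))"

context continuous_field begin

abbreviation "\<A> \<equiv> field_algebra U"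
abbreviation "T \<equiv> topspace (base U)"

lemma banach_space_fibre: "t \<in> T \<Longrightarrow> banach_space (fibre U t)"
  using banach_fibre by (simp add: banach_algebra_def)

lemma Metric_space_fibre: "t \<in> T \<Longrightarrow> Metric_space (carrier (fibre U t)) (ndist (fibre U t))"
  by (rule banach_space.Metric_space_ndist[OF banach_space_fibre])

lemma section_in: "x \<in> sections U \<Longrightarrow> t \<in> T \<Longrightarrow> x t \<in> carrier (fibre U t)"
  using sections_subset by auto

lemma section_extensional: "x \<in> sections U \<Longrightarrow> x \<in> extensional T"
  using sections_subset by (auto simp: PiE_def)

lemma sectionI:
  assumes x: "x \<in> section_space (fibre U) T"
    and approx: "\<And>t \<epsilon>. t \<in> T \<Longrightarrow> \<epsilon> > 0 \<Longrightarrow> \<exists>x'\<in>sections U. \<exists>N. openin (base U) N \<and> t \<in> N \<and>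
      (\<forall>s\<in>N. ndist (fibre U s) (x s) (x' s) \<le> \<epsilon>)"
  shows "x \<in> sections U"
proof (rule subsetD[OF approximated_section])
  have "\<exists>x'\<in>sections U. \<exists>N. openin (subtopology (base U) T) N \<and> t \<in> N \<and>
          (\<forall>s\<in>N. vnorm (fibre U s) (x s \<ominus>\<^bsub>fibre U s\<^esub> x' s) \<le> \<epsilon>)" if "t \<in> T" "\<epsilon> > 0" for t \<epsilon>
  proof -
    from approx[OF that] obtain x' N where N: "x' \<in> sections U" "openin (base U) N" "t \<in> N"
        "\<forall>s\<in>N. ndist (fibre U s) (x s) (x' s) \<le> \<epsilon>"
      by (elim bexE exE conjE)
    have "vnorm (fibre U s) (x s \<ominus>\<^bsub>fibre U s\<^esub> x' s) \<le> \<epsilon>" if "s \<in> N" for s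
    proof -
      have "s \<in> T" using that openin_subset[OF N(2)] by auto
      then have "x s \<in> carrier (fibre U s)" "x' s \<in> carrier (fibre U s)"
        using x section_in[OF N(1)] by auto
      then show ?thesis using N(4) that by (auto simp: ndist_def)
    qed
    then show ?thesis using N by (auto simp: subtopology_topspace)
  qed
  then show "x \<in> locally_approximated (base U) (fibre U) (sections U) T"
    using x unfolding locally_approximated_def by blast
qed

lemma section_uniform_limit:
  assumes "x \<in> section_space (fibre U) T"
    and "\<And>\<epsilon>. \<epsilon> > 0 \<Longrightarrow> \<exists>x'\<in>sections U. \<forall>s\<in>T. ndist (fibre U s) (x s) (x' s) \<le> \<epsilon>"
  shows "x \<in> sections U"
proof (rule sectionI[OF assms(1)])
  fix t and \<epsilon> :: real assume t: "t \<in> T" and "\<epsilon> > 0"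
  from assms(2)[OF this(2)] obtain x' where "x' \<in> sections U" "\<forall>s\<in>T. ndist (fibre U s) (x s) (x' s) \<le> \<epsilon>" ..
  then show "\<exists>x'\<in>sections U. \<exists>N. openin (base U) N \<and> t \<in> N \<and> (\<forall>s\<in>N. ndist (fibre U s) (x s) (x' s) \<le> \<epsilon>)"
    using t by (intro bexI[of _ x'] exI[of _ T]) auto
qed

text \<open>Near \<open>t\<close> the product is close to the multiple of \<open>x\<close> by the
  constant \<open>f t\<close>, which is a section by linearity. The error is small because
  \<open>x\<close> is locally bounded, its norm being continuous.\<close>

lemma scaled_section:
  assumes f: "continuous_map (base U) euclideanreal f" and x: "x \<in> sections U"
  shows "(\<lambda>t\<in>T. complex_of_real (f t) \<odot>\<^bsub>fibre U t\<^esub> x t) \<in> sections U"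
proof (rule sectionI)
  show "(\<lambda>t\<in>T. complex_of_real (f t) \<odot>\<^bsub>fibre U t\<^esub> x t) \<in> section_space (fibre U) T"
    using section_in[OF x] banach_space.smult_in[OF banach_space_fibre] by auto
next
  fix t and \<epsilon> :: real assume t: "t \<in> T" and e: "\<epsilon> > 0"
  \<comment> \<open>Near \<open>t\<close> the norm of \<open>x\<close> is at most its value at
    \<open>t\<close> plus 1, which explains the denominator.\<close>
  define c where "c = \<epsilon> / (vnorm (fibre U t) (x t) + 1)"
  have nn: "0 \<le> vnorm (fibre U t) (x t)"
    by (rule banach_space.vnorm_nonneg[OF banach_space_fibre[OF t] section_in[OF x t]])
  then have c: "c > 0" using e by (simp add: c_def add_nonneg_pos)
  obtain N1 where N1: "openin (base U) N1" "t \<in> N1" "\<And>s. s \<in> N1 \<Longrightarrow> \<bar>f s - f t\<bar> < c"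
    using continuous_map_real_nbhd[OF f t c] by metis
  obtain N2 where N2: "openin (base U) N2" "t \<in> N2"
      "\<And>s. s \<in> N2 \<Longrightarrow> \<bar>vnorm (fibre U s) (x s) - vnorm (fibre U t) (x t)\<bar> < 1"
    using continuous_map_real_nbhd[OF continuous_vnorm[OF x] t zero_less_one] by metis
  let ?y = "\<lambda>s\<in>T. complex_of_real (f t) \<odot>\<^bsub>fibre U s\<^esub> x s"
  have "ndist (fibre U s) ((\<lambda>t\<in>T. complex_of_real (f t) \<odot>\<^bsub>fibre U t\<^esub> x t) s) (?y s) \<le> \<epsilon>"
    if s: "s \<in> N1 \<inter> N2" for s
  proof -
    have sT: "s \<in> T" using s openin_subset[OF N1(1)] by auto
    interpret banach_space "fibre U s" using banach_space_fibre[OF sT] .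
    have xs: "x s \<in> carrier (fibre U s)" by (rule section_in[OF x sT])
    have "complex_of_real (f s) \<odot>\<^bsub>fibre U s\<^esub> x s \<ominus>\<^bsub>fibre U s\<^esub> complex_of_real (f t) \<odot>\<^bsub>fibre U s\<^esub> x s =
        complex_of_real (f s - f t) \<odot>\<^bsub>fibre U s\<^esub> x s"
      using xs smult_plus_left[OF xs, of "complex_of_real (f s)" "- complex_of_real (f t)"]
      by (simp add: minus_eq_smult smult_smult)
    then have "ndist (fibre U s) (complex_of_real (f s) \<odot>\<^bsub>fibre U s\<^esub> x s) (complex_of_real (f t) \<odot>\<^bsub>fibre U s\<^esub> x s) =
        \<bar>f s - f t\<bar> * vnorm (fibre U s) (x s)"
      using xs by (simp add: ndist_eq vnorm_smult del: of_real_diff)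
    also have "\<dots> \<le> c * (vnorm (fibre U t) (x t) + 1)"
      using N1(3)[of s] N2(3)[of s] s c vnorm_nonneg[OF xs] by (intro mult_mono) auto
    also have "\<dots> = \<epsilon>" using nn by (simp add: c_def)
    finally show ?thesis using sT by simp
  qed
  moreover have "?y \<in> sections U" by (rule smult_section[OF x])
  ultimately show "\<exists>x'\<in>sections U. \<exists>N. openin (base U) N \<and> t \<in> N \<and>
      (\<forall>s\<in>N. ndist (fibre U s) ((\<lambda>t\<in>T. complex_of_real (f t) \<odot>\<^bsub>fibre U t\<^esub> x t) s) (x' s) \<le> \<epsilon>)"
    using N1(1,2) N2(1,2) by (intro bexI[of _ ?y] exI[of _ "N1 \<inter> N2"] conjI) auto
qed

lemma algebra_in: "x \<in> carrier \<A> \<Longrightarrow> t \<in> T \<Longrightarrow> x t \<in> carrier (fibre U t)"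
  using section_in by (simp add: field_algebra_simps)

lemma algebra_extensional: "x \<in> carrier \<A> \<Longrightarrow> x \<in> extensional T"
  using section_extensional by (simp add: field_algebra_simps)

lemma algebra_eqI:
  "x \<in> carrier \<A> \<Longrightarrow> y \<in> carrier \<A> \<Longrightarrow> (\<And>t. t \<in> T \<Longrightarrow> x t = y t) \<Longrightarrow> x = y"
  by (rule extensionalityI[OF algebra_extensional algebra_extensional])

lemma fibre_vnorm_nonneg: "x \<in> sections U \<Longrightarrow> t \<in> T \<Longrightarrow> 0 \<le> vnorm (fibre U t) (x t)"
  by (rule banach_space.vnorm_nonneg[OF banach_space_fibre section_in])

lemma algebra_apply:
  assumes "t \<in> T"
  shows "(x \<otimes>\<^bsub>\<A>\<^esub> y) t = x t \<otimes>\<^bsub>fibre U t\<^esub> y t" "\<zero>\<^bsub>\<A>\<^esub> t = \<zero>\<^bsub>fibre U t\<^esub>"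
    "(x \<oplus>\<^bsub>\<A>\<^esub> y) t = x t \<oplus>\<^bsub>fibre U t\<^esub> y t" "(c \<odot>\<^bsub>\<A>\<^esub> x) t = c \<odot>\<^bsub>fibre U t\<^esub> x t"
  using assms by (simp_all add: field_algebra_simps)

lemma algebra_small:
  assumes "x \<in> carrier \<A>" "\<epsilon> > 0"
  obtains K where "compactin (base U) K" "\<And>t. t \<in> T \<Longrightarrow> t \<notin> K \<Longrightarrow> vnorm (fibre U t) (x t) < \<epsilon>"
proof -
  have "vanishes_at_infinity (base U) (\<lambda>t. vnorm (fibre U t) (x t))"
    using assms(1) by (simp add: field_algebra_simps)
  from vanishes_at_infinityD[OF this assms(2)] show thesis using that by (metis abs_less_iff)
qed

text \<open>Off some compact set the norm is below 1, and on the compact set it is bounded by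
  continuity.\<close>

lemma algebra_bounded:
  assumes x: "x \<in> carrier \<A>"
  shows "\<exists>B. \<forall>t\<in>T. vnorm (fibre U t) (x t) \<le> B"
proof -
  obtain K where K: "compactin (base U) K" "\<And>t. t \<in> T \<Longrightarrow> t \<notin> K \<Longrightarrow> vnorm (fibre U t) (x t) < 1"
    using algebra_small[OF x zero_less_one] by metis
  have "continuous_map (base U) euclideanreal (\<lambda>t. vnorm (fibre U t) (x t))"
    using continuous_vnorm x by (simp add: field_algebra_simps)
  then have "compact ((\<lambda>t. vnorm (fibre U t) (x t)) ` K)"
    using image_compactin[OF K(1)] compactin_euclidean_iff by blast
  then obtain B where "\<And>t. t \<in> K \<Longrightarrow> vnorm (fibre U t) (x t) \<le> B"
    by (meson bdd_above_def bounded_imp_bdd_above compact_imp_bounded imageI)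
  then have "\<forall>t\<in>T. vnorm (fibre U t) (x t) \<le> max B 1"
    using K(2) by (meson le_max_iff_disj less_imp_le)
  then show ?thesis by blast
qed

lemma algebra_vnorm_ge: "x \<in> carrier \<A> \<Longrightarrow> t \<in> T \<Longrightarrow> vnorm (fibre U t) (x t) \<le> vnorm \<A> x"
  using algebra_bounded[of x] le_Sup_insert_0[of T "\<lambda>t. vnorm (fibre U t) (x t)"]
  by (auto simp: field_algebra_simps)

lemma algebra_vnorm_le: "(\<And>t. t \<in> T \<Longrightarrow> vnorm (fibre U t) (x t) \<le> B) \<Longrightarrow> 0 \<le> B \<Longrightarrow> vnorm \<A> x \<le> B"
  unfolding field_algebra_simps by (rule Sup_insert_0_le)

lemma algebra_add: "x \<in> carrier \<A> \<Longrightarrow> y \<in> carrier \<A> \<Longrightarrow> x \<oplus>\<^bsub>\<A>\<^esub> y \<in> carrier \<A>"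
proof -
  assume x: "x \<in> carrier \<A>" and y: "y \<in> carrier \<A>"
  have "vanishes_at_infinity (base U) (\<lambda>t. vnorm (fibre U t) ((x \<oplus>\<^bsub>\<A>\<^esub> y) t))"
  proof (rule vanishes_at_infinity_add)
    show "vanishes_at_infinity (base U) (\<lambda>t. vnorm (fibre U t) (x t))"
      "vanishes_at_infinity (base U) (\<lambda>t. vnorm (fibre U t) (y t))"
      using x y by (simp_all add: field_algebra_simps)
    fix t assume t: "t \<in> T"
    interpret banach_space "fibre U t" using banach_space_fibre[OF t] .
    show "\<bar>vnorm (fibre U t) ((x \<oplus>\<^bsub>\<A>\<^esub> y) t)\<bar> \<le> \<bar>vnorm (fibre U t) (x t)\<bar> + \<bar>vnorm (fibre U t) (y t)\<bar>"
      using algebra_in[OF x t] algebra_in[OF y t] t vnorm_triangle[of "x t" "y t"]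
      by (simp add: field_algebra_simps vnorm_nonneg)
  qed
  then show ?thesis using add_section[of x y] x y by (simp add: field_algebra_simps)
qed

lemma algebra_smult: "x \<in> carrier \<A> \<Longrightarrow> c \<odot>\<^bsub>\<A>\<^esub> x \<in> carrier \<A>"
proof -
  assume x: "x \<in> carrier \<A>"
  have "vanishes_at_infinity (base U) (\<lambda>t. vnorm (fibre U t) ((c \<odot>\<^bsub>\<A>\<^esub> x) t))"
  proof (rule vanishes_at_infinity_dominated)
    show "vanishes_at_infinity (base U) (\<lambda>t. vnorm (fibre U t) (x t))"
      using x by (simp add: field_algebra_simps)
    fix t assume t: "t \<in> T"
    interpret banach_space "fibre U t" using banach_space_fibre[OF t] .
    show "\<bar>vnorm (fibre U t) ((c \<odot>\<^bsub>\<A>\<^esub> x) t)\<bar> \<le> cmod c * \<bar>vnorm (fibre U t) (x t)\<bar>"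
      using algebra_in[OF x t] t by (simp add: field_algebra_simps vnorm_smult abs_mult)
  qed
  then show ?thesis using smult_section[of x c] x by (simp add: field_algebra_simps)
qed

text \<open>One factor is bounded, and the other vanishes at infinity.\<close>

lemma algebra_mult: "x \<in> carrier \<A> \<Longrightarrow> y \<in> carrier \<A> \<Longrightarrow> x \<otimes>\<^bsub>\<A>\<^esub> y \<in> carrier \<A>"
proof -
  assume x: "x \<in> carrier \<A>" and y: "y \<in> carrier \<A>"
  have "vanishes_at_infinity (base U) (\<lambda>t. vnorm (fibre U t) ((x \<otimes>\<^bsub>\<A>\<^esub> y) t))"
  proof (rule vanishes_at_infinity_dominated)
    show "vanishes_at_infinity (base U) (\<lambda>t. vnorm (fibre U t) (y t))"
      using y by (simp add: field_algebra_simps)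
    fix t assume t: "t \<in> T"
    interpret banach_algebra "fibre U t" using banach_fibre[OF t] .
    have "vnorm (fibre U t) (x t \<otimes>\<^bsub>fibre U t\<^esub> y t) \<le> vnorm (fibre U t) (x t) * vnorm (fibre U t) (y t)"
      using algebra_in[OF x t] algebra_in[OF y t] by (rule vnorm_mult)
    also have "\<dots> \<le> vnorm \<A> x * vnorm (fibre U t) (y t)"
      using algebra_vnorm_ge[OF x t] vnorm_nonneg[OF algebra_in[OF y t]] by (rule mult_right_mono)
    finally show "\<bar>vnorm (fibre U t) ((x \<otimes>\<^bsub>\<A>\<^esub> y) t)\<bar> \<le> vnorm \<A> x * \<bar>vnorm (fibre U t) (y t)\<bar>"
      using algebra_in[OF x t] algebra_in[OF y t] t
      by (simp add: field_algebra_simps(2) vnorm_nonneg mult_closed)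
  qed
  then show ?thesis using mult_section[of x y] x y by (simp add: field_algebra_simps)
qed

lemma banach_space_algebra: "banach_space \<A>"
proof (rule banach_space_bounded_functions[where J = T and M = "fibre U"])
  show "carrier \<A> \<subseteq> section_space (fibre U) T"
    using sections_subset by (auto simp: field_algebra_simps)
  have "vanishes_at_infinity (base U) (\<lambda>t. vnorm (fibre U t) (\<zero>\<^bsub>\<A>\<^esub> t))"
    unfolding vanishes_at_infinity_def
    using banach_space.vnorm_zero[OF banach_space_fibre]
    by (auto simp: field_algebra_simps intro!: exI[of _ "{}"])
  then show "\<zero>\<^bsub>\<A>\<^esub> \<in> carrier \<A>" using zero_section by (simp add: field_algebra_simps)
  fix y assume y: "y \<in> section_space (fibre U) T"
    and lim: "\<And>\<epsilon>. \<epsilon> > 0 \<Longrightarrow> \<exists>x\<in>carrier \<A>. \<forall>t\<in>T. ndist (fibre U t) (y t) (x t) \<le> \<epsilon>"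
  have "y \<in> sections U"
    by (rule section_uniform_limit[OF y]) (use lim in \<open>auto simp: field_algebra_simps\<close>)
  moreover have "vanishes_at_infinity (base U) (\<lambda>t. vnorm (fibre U t) (y t))"
    unfolding vanishes_at_infinity_def
  proof (intro allI impI)
    fix \<epsilon> :: real assume "\<epsilon> > 0"
    then have e: "\<epsilon>/2 > 0" by simp
    obtain x where x: "x \<in> carrier \<A>" "\<And>t. t \<in> T \<Longrightarrow> ndist (fibre U t) (y t) (x t) \<le> \<epsilon>/2"
      using lim[OF e] by blast
    obtain K where K: "compactin (base U) K" "\<And>t. t \<in> T \<Longrightarrow> t \<notin> K \<Longrightarrow> vnorm (fibre U t) (x t) < \<epsilon>/2"
      using algebra_small[OF x(1) e] by metis
    have "\<bar>vnorm (fibre U t) (y t)\<bar> < \<epsilon>" if t: "t \<in> T - K" for t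
    proof -
      have tT: "t \<in> T" using t by auto
      interpret banach_space "fibre U t" using banach_space_fibre[OF tT] .
      have yt: "y t \<in> carrier (fibre U t)" using y tT by auto
      show ?thesis
        using abs_vnorm_diff_le[OF yt algebra_in[OF x(1) tT]] x(2)[OF tT] K(2)[OF tT] t vnorm_nonneg[OF yt]
        by auto
    qed
    then show "\<exists>K. compactin (base U) K \<and> (\<forall>t\<in>T - K. \<bar>vnorm (fibre U t) (y t)\<bar> < \<epsilon>)"
      using K(1) by blast
  qed
  ultimately show "y \<in> carrier \<A>" by (simp add: field_algebra_simps)
qed (use banach_space_fibre algebra_bounded algebra_add algebra_smult in \<open>auto simp: field_algebra_simps(3-6)\<close>)

lemma banach_algebra_algebra: "banach_algebra \<A>"
proof -
  interpret A: banach_space \<A> by (rule banach_space_algebra)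
  have fib: "banach_algebra (fibre U t)" "x t \<in> carrier (fibre U t)" if "x \<in> carrier \<A>" "t \<in> T" for x t
    using banach_fibre algebra_in that by auto
  show ?thesis
  proof (rule banach_algebra.intro[OF banach_space_algebra], unfold_locales)
    show "a \<otimes>\<^bsub>\<A>\<^esub> b \<in> carrier \<A>" if "a \<in> carrier \<A>" "b \<in> carrier \<A>" for a b
      using that by (rule algebra_mult)
    fix a b c :: "'t \<Rightarrow> 'a" assume abc: "a \<in> carrier \<A>" "b \<in> carrier \<A>" "c \<in> carrier \<A>"
    have pt: "(a \<otimes>\<^bsub>\<A>\<^esub> b \<otimes>\<^bsub>\<A>\<^esub> c) t = (a \<otimes>\<^bsub>\<A>\<^esub> (b \<otimes>\<^bsub>\<A>\<^esub> c)) t"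
      "(a \<otimes>\<^bsub>\<A>\<^esub> (b \<oplus>\<^bsub>\<A>\<^esub> c)) t = (a \<otimes>\<^bsub>\<A>\<^esub> b \<oplus>\<^bsub>\<A>\<^esub> a \<otimes>\<^bsub>\<A>\<^esub> c) t"
      "((a \<oplus>\<^bsub>\<A>\<^esub> b) \<otimes>\<^bsub>\<A>\<^esub> c) t = (a \<otimes>\<^bsub>\<A>\<^esub> c \<oplus>\<^bsub>\<A>\<^esub> b \<otimes>\<^bsub>\<A>\<^esub> c) t" if t: "t \<in> T" for t
    proof -
      interpret F: banach_algebra "fibre U t" using banach_fibre[OF t] .
      note v = algebra_in[OF abc(1) t] algebra_in[OF abc(2) t] algebra_in[OF abc(3) t]
      show "(a \<otimes>\<^bsub>\<A>\<^esub> b \<otimes>\<^bsub>\<A>\<^esub> c) t = (a \<otimes>\<^bsub>\<A>\<^esub> (b \<otimes>\<^bsub>\<A>\<^esub> c)) t"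
        "(a \<otimes>\<^bsub>\<A>\<^esub> (b \<oplus>\<^bsub>\<A>\<^esub> c)) t = (a \<otimes>\<^bsub>\<A>\<^esub> b \<oplus>\<^bsub>\<A>\<^esub> a \<otimes>\<^bsub>\<A>\<^esub> c) t"
        "((a \<oplus>\<^bsub>\<A>\<^esub> b) \<otimes>\<^bsub>\<A>\<^esub> c) t = (a \<otimes>\<^bsub>\<A>\<^esub> c \<oplus>\<^bsub>\<A>\<^esub> b \<otimes>\<^bsub>\<A>\<^esub> c) t"
        using t v by (simp_all add: algebra_apply F.mult_assoc F.mult_distrib_left F.mult_distrib_right)
    qed
    note clos = abc algebra_mult algebra_add
    show "a \<otimes>\<^bsub>\<A>\<^esub> b \<otimes>\<^bsub>\<A>\<^esub> c = a \<otimes>\<^bsub>\<A>\<^esub> (b \<otimes>\<^bsub>\<A>\<^esub> c)" by (rule algebra_eqI) (simp_all only: clos pt)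
    show "a \<otimes>\<^bsub>\<A>\<^esub> (b \<oplus>\<^bsub>\<A>\<^esub> c) = a \<otimes>\<^bsub>\<A>\<^esub> b \<oplus>\<^bsub>\<A>\<^esub> a \<otimes>\<^bsub>\<A>\<^esub> c" by (rule algebra_eqI) (simp_all only: clos pt)
    show "(a \<oplus>\<^bsub>\<A>\<^esub> b) \<otimes>\<^bsub>\<A>\<^esub> c = a \<otimes>\<^bsub>\<A>\<^esub> c \<oplus>\<^bsub>\<A>\<^esub> b \<otimes>\<^bsub>\<A>\<^esub> c" by (rule algebra_eqI) (simp_all only: clos pt)
  next
    fix a b :: "'t \<Rightarrow> 'a" and z assume ab: "a \<in> carrier \<A>" "b \<in> carrier \<A>"
    have pt: "((z \<odot>\<^bsub>\<A>\<^esub> a) \<otimes>\<^bsub>\<A>\<^esub> b) t = (z \<odot>\<^bsub>\<A>\<^esub> (a \<otimes>\<^bsub>\<A>\<^esub> b)) t"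
      "(a \<otimes>\<^bsub>\<A>\<^esub> (z \<odot>\<^bsub>\<A>\<^esub> b)) t = (z \<odot>\<^bsub>\<A>\<^esub> (a \<otimes>\<^bsub>\<A>\<^esub> b)) t" if t: "t \<in> T" for t
    proof -
      interpret F: banach_algebra "fibre U t" using banach_fibre[OF t] .
      show "((z \<odot>\<^bsub>\<A>\<^esub> a) \<otimes>\<^bsub>\<A>\<^esub> b) t = (z \<odot>\<^bsub>\<A>\<^esub> (a \<otimes>\<^bsub>\<A>\<^esub> b)) t"
        "(a \<otimes>\<^bsub>\<A>\<^esub> (z \<odot>\<^bsub>\<A>\<^esub> b)) t = (z \<odot>\<^bsub>\<A>\<^esub> (a \<otimes>\<^bsub>\<A>\<^esub> b)) t"
        using t algebra_in[OF ab(1) t] algebra_in[OF ab(2) t]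
        by (simp_all add: algebra_apply F.smult_mult_left F.smult_mult_right)
    qed
    note clos = ab algebra_mult algebra_smult
    show "(z \<odot>\<^bsub>\<A>\<^esub> a) \<otimes>\<^bsub>\<A>\<^esub> b = z \<odot>\<^bsub>\<A>\<^esub> (a \<otimes>\<^bsub>\<A>\<^esub> b)" by (rule algebra_eqI) (simp_all only: clos pt)
    show "a \<otimes>\<^bsub>\<A>\<^esub> (z \<odot>\<^bsub>\<A>\<^esub> b) = z \<odot>\<^bsub>\<A>\<^esub> (a \<otimes>\<^bsub>\<A>\<^esub> b)" by (rule algebra_eqI) (simp_all only: clos pt)
  next
    show "vnorm \<A> (a \<otimes>\<^bsub>\<A>\<^esub> b) \<le> vnorm \<A> a * vnorm \<A> b" if ab: "a \<in> carrier \<A>" "b \<in> carrier \<A>" for a b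
    proof (rule algebra_vnorm_le)
      fix t assume t: "t \<in> T"
      interpret F: banach_algebra "fibre U t" using banach_fibre[OF t] .
      have "vnorm (fibre U t) (a t \<otimes>\<^bsub>fibre U t\<^esub> b t) \<le> vnorm (fibre U t) (a t) * vnorm (fibre U t) (b t)"
        by (rule F.vnorm_mult[OF algebra_in[OF ab(1) t] algebra_in[OF ab(2) t]])
      also have "\<dots> \<le> vnorm \<A> a * vnorm \<A> b"
        using algebra_vnorm_ge[OF ab(1) t] algebra_vnorm_ge[OF ab(2) t] A.vnorm_nonneg[OF ab(1)]
          F.vnorm_nonneg[OF algebra_in[OF ab(2) t]] by (intro mult_mono)
      finally show "vnorm (fibre U t) ((a \<otimes>\<^bsub>\<A>\<^esub> b) t) \<le> vnorm \<A> a * vnorm \<A> b"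
        using t by (simp add: field_algebra_simps(2))
    qed (use A.vnorm_nonneg ab in simp)
  qed
qed

lemma scaled_algebra:
  assumes f: "continuous_map (base U) euclideanreal f" and x: "x \<in> carrier \<A>"
    and B: "\<And>t. t \<in> T \<Longrightarrow> \<bar>f t\<bar> \<le> B"
  shows "(\<lambda>t\<in>T. complex_of_real (f t) \<odot>\<^bsub>fibre U t\<^esub> x t) \<in> carrier \<A>" (is "?y \<in> _")
proof -
  have "vanishes_at_infinity (base U) (\<lambda>t. vnorm (fibre U t) (?y t))"
  proof (rule vanishes_at_infinity_dominated)
    show "vanishes_at_infinity (base U) (\<lambda>t. vnorm (fibre U t) (x t))"
      using x by (simp add: field_algebra_simps)
    show "\<bar>vnorm (fibre U t) (?y t)\<bar> \<le> B * \<bar>vnorm (fibre U t) (x t)\<bar>" if "t \<in> T" for t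
      using that algebra_in[OF x that] B[OF that]
      by (simp add: banach_space.vnorm_smult[OF banach_space_fibre] abs_mult mult_right_mono)
  qed
  then show ?thesis using scaled_section[OF f, of x] x by (simp add: field_algebra_simps)
qed

text \<open>Here \<open>x\<close> is any section. The case in view is the section of identities,
  which need not vanish at infinity and thus need not belong to the algebra.\<close>

lemma compactly_supported_algebra:
  assumes f: "continuous_map (base U) euclideanreal f" and x: "x \<in> sections U"
    and K: "compactin (base U) K" "\<And>t. t \<in> T \<Longrightarrow> t \<notin> K \<Longrightarrow> f t = 0"
  shows "(\<lambda>t\<in>T. complex_of_real (f t) \<odot>\<^bsub>fibre U t\<^esub> x t) \<in> carrier \<A>" (is "?y \<in> _")
proof -
  have "vnorm (fibre U t) (?y t) = 0" if "t \<in> T" "t \<notin> K" for t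
    using that K(2) section_in[OF x] by (simp add: banach_space.vnorm_smult[OF banach_space_fibre])
  then have "vanishes_at_infinity (base U) (\<lambda>t. vnorm (fibre U t) (?y t))"
    unfolding vanishes_at_infinity_def using K(1) by (auto intro!: exI[of _ K])
  then show ?thesis using scaled_section[OF f x] by (simp add: field_algebra_simps)
qed

text \<open>A trivialisation over \<open>V\<close> identifies its fibres with a model algebra;
  following it by the inverse of the identification at \<open>p\<close> replaces the model by the
  fibre at \<open>p\<close>.\<close>

lemma chart_exists:
  assumes lt: "locally_trivial_field U" and p: "p \<in> T"
  obtains N \<psi> where "chart U p N \<psi>"
proof -
  from bspec[OF lt[unfolded locally_trivial_field_def] p]
  obtain N V where N: "openin (base U) N" "p \<in> N" "N \<subseteq> V" "V \<subseteq> T" "trivial_field (induced_field U V)"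
    by (elim exE conjE)
  let ?U = "induced_field U V"
  from N(5) obtain A :: "'a cnormed" where A: "banach_algebra A"
    and iso: "isomorphic_fields ?U (constant_field (base ?U) A)"
    unfolding trivial_field_def by (elim exE conjE)
  from iso obtain \<phi> where \<phi>': "\<forall>t\<in>topspace (base ?U). isometric_algebra_iso (fibre ?U t)
       (fibre (constant_field (base ?U) A) t) (\<phi> t)"
    and \<phi>sec': "\<forall>x\<in>sections ?U. (\<lambda>t\<in>topspace (base ?U). \<phi> t (x t)) \<in> sections (constant_field (base ?U) A)"
    unfolding isomorphic_fields_def by (elim exE conjE)
  have topV: "topspace (base ?U) = V" using N(4) by (simp add: induced_field_def Int_absorb1)
  have \<phi>: "isometric_algebra_iso (fibre U t) A (\<phi> t)" if "t \<in> V" for t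
    using \<phi>' that unfolding topV by (simp add: induced_field_def constant_field_def)
  have \<phi>sec: "continuous_map (subtopology (base U) V) (ntopology A) (\<lambda>t\<in>V. \<phi> t (x t))"
    if "x \<in> locally_approximated (base U) (fibre U) (sections U) V" for x
    using \<phi>sec' that unfolding topV by (simp add: induced_field_def constant_field_def)
  have A': "banach_space A" using A by (simp add: banach_algebra_def)
  have pV: "p \<in> V" using N by auto
  have "isometric_algebra_iso A (fibre U p) (inv_into (carrier (fibre U p)) (\<phi> p))" (is "isometric_algebra_iso A _ ?g")
    by (rule iso_inv_into[OF \<phi>[OF pV] banach_fibre[OF p]])
  note g = this
  define \<psi> where "\<psi> t = ?g \<circ> \<phi> t" for t
  have "isometric_algebra_iso (fibre U t) (fibre U p) (\<psi> t)" if "t \<in> N" for t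
    unfolding \<psi>_def by (rule iso_compose[OF \<phi> g]) (use that N(3) in auto)
  moreover have "\<psi> p a = a" if "a \<in> carrier (fibre U p)" for a
    using iso_bij[OF \<phi>[OF pV]] that by (simp add: \<psi>_def bij_betw_def inv_into_f_f)
  moreover have "\<exists>G. openin (base U) G \<and> t \<in> G \<and> G \<subseteq> N \<and>
        (\<forall>s\<in>G. ndist (fibre U p) (\<psi> s (x s)) (\<psi> t (x t)) < \<epsilon>)"
    if x: "x \<in> sections U" and t: "t \<in> N" and e: "\<epsilon> > 0" for x t \<epsilon>
  proof -
    \<comment> \<open>Triviality over \<open>V\<close> concerns sections of the induced field. The
      restriction of a global section is one of them, approximated by the global section
      itself.\<close>
    have xV: "restrict x V \<in> locally_approximated (base U) (fibre U) (sections U) V"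
      unfolding locally_approximated_def
    proof (intro CollectI conjI ballI allI impI)
      show "restrict x V \<in> section_space (fibre U) V" using section_in[OF x] N(4) by auto
      fix t and \<epsilon> :: real assume t: "t \<in> V" and e: "0 < \<epsilon>"
      have "vnorm (fibre U s) (restrict x V s \<ominus>\<^bsub>fibre U s\<^esub> x s) \<le> \<epsilon>" if s: "s \<in> V" for s
      proof -
        have "s \<in> T" using s N(4) by auto
        then interpret banach_space "fibre U s" by (rule banach_space_fibre)
        show ?thesis
          using s section_in[OF x \<open>s \<in> T\<close>] e by (simp add: minus_self)
      qed
      moreover have "openin (subtopology (base U) V) V" using N(4) openin_topspace[of "subtopology (base U) V"] by (simp add: Int_absorb1)
      ultimately show "\<exists>x'\<in>sections U. \<exists>N. openin (subtopology (base U) V) N \<and> t \<in> N \<and>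
          (\<forall>s\<in>N. vnorm (fibre U s) (restrict x V s \<ominus>\<^bsub>fibre U s\<^esub> x' s) \<le> \<epsilon>)"
        using x t by (intro bexI[of _ x] exI[of _ V]) auto
    qed
    have "continuous_map (subtopology (base U) V) (Metric_space.mtopology (carrier A) (ndist A)) (\<lambda>t\<in>V. \<phi> t (restrict x V t))"
      using \<phi>sec[OF xV] by (simp add: ntopology_def)
    moreover have "t \<in> topspace (subtopology (base U) V)" using t N by auto
    ultimately obtain G where G: "openin (subtopology (base U) V) G" "t \<in> G"
       "\<forall>s\<in>G. (\<lambda>t\<in>V. \<phi> t (restrict x V t)) s \<in> Metric_space.mball (carrier A) (ndist A) ((\<lambda>t\<in>V. \<phi> t (restrict x V t)) t) \<epsilon>"
      using e unfolding Metric_space.continuous_map_to_metric[OF banach_space.Metric_space_ndist[OF A']]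
      by blast
    \<comment> \<open>\<open>V\<close> need not be open, so \<open>G\<close> is open only relative
      to \<open>V\<close>; intersecting with the open set \<open>N\<close> gives a neighbourhood in
      the base.\<close>
    obtain G' where G': "openin (base U) G'" "G = G' \<inter> V" using G(1) by (auto simp: openin_subtopology)
    have "ndist (fibre U p) (\<psi> s (x s)) (\<psi> t (x t)) < \<epsilon>" if s: "s \<in> G' \<inter> N" for s
    proof -
      have sV: "s \<in> V" "s \<in> T" "t \<in> V" "t \<in> T" using s t N by auto
      have in_A: "\<phi> s (x s) \<in> carrier A" "\<phi> t (x t) \<in> carrier A"
        using iso_closed[OF \<phi>] section_in[OF x] sV by auto
      have "ndist A (\<phi> t (x t)) (\<phi> s (x s)) < \<epsilon>"
        using G(3) s G'(2) sV by (auto simp: Metric_space.in_mball[OF banach_space.Metric_space_ndist[OF A']])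
      then show ?thesis
        using iso_ndist[OF g A' banach_space_fibre[OF p] in_A]
          Metric_space.commute[OF banach_space.Metric_space_ndist[OF A']] by (simp add: \<psi>_def)
    qed
    then show ?thesis
      using G G' t N openin_Int[OF G'(1) N(1)] by (intro exI[of _ "G' \<inter> N"]) auto
  qed
  ultimately have "chart U p N \<psi>" using N(1,2) unfolding chart_def by blast
  then show thesis by (rule that)
qed

end

lemma (in banach_space) finsum_smult_const:
  assumes "finite F" "x \<in> carrier V"
  shows "(\<Oplus>\<^bsub>V\<^esub>i\<in>F. c i \<odot>\<^bsub>V\<^esub> x) = (\<Sum>i\<in>F. c i) \<odot>\<^bsub>V\<^esub> x"
  using assms
proof (induction F rule: finite_induct)
  case (insert j F)
  then have "(\<Oplus>\<^bsub>V\<^esub>i\<in>insert j F. c i \<odot>\<^bsub>V\<^esub> x) = c j \<odot>\<^bsub>V\<^esub> x \<oplus>\<^bsub>V\<^esub> (\<Oplus>\<^bsub>V\<^esub>i\<in>F. c i \<odot>\<^bsub>V\<^esub> x)"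
    by (intro M.finsum_insert) auto
  then show ?case using insert by (simp add: smult_plus_left)
qed simp

lemma chart_continuous:
  assumes "chart U p N \<psi>" "x \<in> sections U" "t \<in> N" "\<epsilon> > 0"
  shows "\<exists>G. openin (base U) G \<and> t \<in> G \<and> G \<subseteq> N \<and> (\<forall>s\<in>G. ndist (fibre U p) (\<psi> s (x s)) (\<psi> t (x t)) < \<epsilon>)"
  using assms by (simp add: chart_def)

context continuous_field begin

definition scale :: "('t \<Rightarrow> real) \<Rightarrow> ('t \<Rightarrow> 'a) \<Rightarrow> 't \<Rightarrow> 'a" where
  "scale f x = (\<lambda>t\<in>T. complex_of_real (f t) \<odot>\<^bsub>fibre U t\<^esub> x t)"

lemma scale_apply: "t \<in> T \<Longrightarrow> scale f x t = complex_of_real (f t) \<odot>\<^bsub>fibre U t\<^esub> x t"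
  by (simp add: scale_def)

lemma evaluation_linear: "t \<in> T \<Longrightarrow> linear_map \<A> (fibre U t) (\<lambda>x. x t)"
  by (rule linear_mapI) (simp_all add: algebra_in algebra_apply)

lemma algebra_finsum_apply:
  assumes "finite F" "\<And>i. i \<in> F \<Longrightarrow> x i \<in> carrier \<A>" "t \<in> T"
  shows "(\<Oplus>\<^bsub>\<A>\<^esub>i\<in>F. x i) t = (\<Oplus>\<^bsub>fibre U t\<^esub>i\<in>F. x i t)"
  by (rule linear_map_finsum[OF evaluation_linear[OF assms(3)] banach_space_algebra
        banach_space_fibre[OF assms(3)] assms(1,2)])

text \<open>The field is induced twice, first on a piece \<open>W\<close>, then on a part of a chart
  domain in it. A section is therefore compared first with a section over \<open>W\<close> and then
  with a global one, to which the continuity of the chart applies.\<close>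

lemma trivial_induced_field:
  assumes chart: "chart U p N \<psi>" and W: "W' \<subseteq> N" "W' \<subseteq> W" "W \<subseteq> T"
  shows "trivial_field (induced_field (induced_field U W) W')"
proof -
  let ?U = "induced_field (induced_field U W) W'"
  have N: "openin (base U) N" "p \<in> N" using chart by (simp_all add: chart_def)
  have p: "p \<in> T" using N openin_subset by blast
  have iso: "isometric_algebra_iso (fibre U t) (fibre U p) (\<psi> t)" if "t \<in> W'" for t
    using chart W(1) that unfolding chart_def by blast
  interpret P: banach_space "fibre U p" by (rule banach_space_fibre[OF p])
  have base: "base ?U = subtopology (base U) W'"
    using W(2) by (simp add: induced_field_def subtopology_subtopology Int_absorb1)
  have top: "topspace (base ?U) = W'" using W by (auto simp: base)
  have "(\<lambda>t\<in>W'. \<psi> t (x t)) \<in> sections (constant_field (base ?U) (fibre U p))"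
    if "x \<in> sections ?U" for x
  proof -
    have x: "x \<in> locally_approximated (subtopology (base U) W) (fibre U)
        (locally_approximated (base U) (fibre U) (sections U) W) W'"
      using that by (simp add: induced_field_def)
    have x_in: "x s \<in> carrier (fibre U s)" if "s \<in> W'" for s
      using x that by (auto simp: locally_approximated_def)
    have "continuous_map (subtopology (base U) W') P.metric.mtopology (\<lambda>t\<in>W'. \<psi> t (x t))"
      unfolding P.metric.continuous_map_to_metric
    proof (intro ballI allI impI)
      fix t and \<epsilon> :: real assume "t \<in> topspace (subtopology (base U) W')" and \<epsilon>: "\<epsilon> > 0"
      then have t: "t \<in> W'" by auto
      then have tW: "t \<in> W" "t \<in> N" using W by auto
      \<comment> \<open>The two approximations cost \<open>2 * d\<close> at \<open>s\<close> and
        again at \<open>t\<close>, and the chart costs \<open>d\<close>: five times \<open>d\<close>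
        in all, which is less than \<open>\<epsilon>\<close>.\<close>
      define d where "d = \<epsilon> / 8"
      have d: "d > 0" using \<epsilon> by (simp add: d_def)
      have "\<forall>t\<in>W'. \<forall>\<epsilon>>0. \<exists>x'\<in>locally_approximated (base U) (fibre U) (sections U) W.
          \<exists>N. openin (subtopology (subtopology (base U) W) W') N \<and> t \<in> N \<and>
          (\<forall>s\<in>N. vnorm (fibre U s) (x s \<ominus>\<^bsub>fibre U s\<^esub> x' s) \<le> \<epsilon>)"
        using x unfolding locally_approximated_def[of "subtopology (base U) W"] by simp
      from this[rule_format, OF t d] obtain x1 N1
        where x1: "x1 \<in> locally_approximated (base U) (fibre U) (sections U) W"
          and N1: "openin (subtopology (subtopology (base U) W) W') N1" "t \<in> N1"
          "\<forall>s\<in>N1. vnorm (fibre U s) (x s \<ominus>\<^bsub>fibre U s\<^esub> x1 s) \<le> d"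
        by (elim bexE exE conjE)
      have "\<forall>t\<in>W. \<forall>\<epsilon>>0. \<exists>x'\<in>sections U. \<exists>N. openin (subtopology (base U) W) N \<and> t \<in> N \<and>
          (\<forall>s\<in>N. vnorm (fibre U s) (x1 s \<ominus>\<^bsub>fibre U s\<^esub> x' s) \<le> \<epsilon>)"
        using x1 unfolding locally_approximated_def by simp
      from this[rule_format, OF tW(1) d] obtain x2 N2
        where x2: "x2 \<in> sections U"
          and N2: "openin (subtopology (base U) W) N2" "t \<in> N2"
          "\<forall>s\<in>N2. vnorm (fibre U s) (x1 s \<ominus>\<^bsub>fibre U s\<^esub> x2 s) \<le> d"
        by (elim bexE exE conjE)
      from chart_continuous[OF chart x2 tW(2) d] obtain G where G: "openin (base U) G" "t \<in> G"
          "\<forall>s\<in>G. ndist (fibre U p) (\<psi> s (x2 s)) (\<psi> t (x2 t)) < d"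
        by (elim exE conjE)
      obtain G1 where G1: "openin (base U) G1" "N1 = G1 \<inter> W'"
        using N1(1) W(2) by (auto simp: subtopology_subtopology Int_absorb1 openin_subtopology)
      obtain G2 where G2: "openin (base U) G2" "N2 = G2 \<inter> W" using N2(1) by (auto simp: openin_subtopology)
      have x1_in: "x1 s \<in> carrier (fibre U s)" if "s \<in> W'" for s
        using x1 that W by (auto simp: locally_approximated_def)
      have close: "ndist (fibre U p) (\<psi> s (x s)) (\<psi> s (x2 s)) \<le> 2 * d" if s: "s \<in> G1 \<inter> G2 \<inter> W'" for s
      proof -
        have sT: "s \<in> T" "s \<in> W'" using s W by auto
        interpret S: banach_space "fibre U s" by (rule banach_space_fibre[OF sT(1)])
        note v = x_in[OF sT(2)] x1_in[OF sT(2)] section_in[OF x2 sT(1)]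
        have "ndist (fibre U p) (\<psi> s (x s)) (\<psi> s (x2 s)) = ndist (fibre U s) (x s) (x2 s)"
          by (rule iso_ndist[OF iso[OF sT(2)] S.banach_space_axioms P.banach_space_axioms v(1,3)])
        also have "\<dots> \<le> ndist (fibre U s) (x s) (x1 s) + ndist (fibre U s) (x1 s) (x2 s)"
          using v by (rule S.metric.triangle)
        also have "\<dots> \<le> d + d"
          using N1(3) N2(3) G1(2) G2(2) s W v by (intro add_mono) (auto simp: S.ndist_eq)
        finally show ?thesis by simp
      qed
      have \<psi>_in: "\<psi> s (x s) \<in> carrier (fibre U p)" "\<psi> s (x2 s) \<in> carrier (fibre U p)" if "s \<in> W'" for s
        using iso_closed[OF iso[OF that]] x_in[OF that] section_in[OF x2, of s] that W by auto
      have tG: "t \<in> G1 \<inter> G2 \<inter> W'" using N1(2) N2(2) G1 G2 by auto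
      have "(\<lambda>t\<in>W'. \<psi> t (x t)) s \<in> P.metric.mball ((\<lambda>t\<in>W'. \<psi> t (x t)) t) \<epsilon>"
        if s: "s \<in> G1 \<inter> G2 \<inter> G \<inter> W'" for s
      proof -
        have sW: "s \<in> W'" "s \<in> G1 \<inter> G2 \<inter> W'" "s \<in> G" using s by auto
        note i = \<psi>_in[OF t] \<psi>_in[OF sW(1)]
        have "ndist (fibre U p) (\<psi> t (x t)) (\<psi> s (x s)) \<le>
            ndist (fibre U p) (\<psi> t (x t)) (\<psi> t (x2 t)) + ndist (fibre U p) (\<psi> t (x2 t)) (\<psi> s (x s))"
          using i by (intro P.metric.triangle)
        also have "ndist (fibre U p) (\<psi> t (x2 t)) (\<psi> s (x s)) \<le>
            ndist (fibre U p) (\<psi> t (x2 t)) (\<psi> s (x2 s)) + ndist (fibre U p) (\<psi> s (x2 s)) (\<psi> s (x s))"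
          using i by (intro P.metric.triangle)
        also have "ndist (fibre U p) (\<psi> t (x t)) (\<psi> t (x2 t)) +
            (ndist (fibre U p) (\<psi> t (x2 t)) (\<psi> s (x2 s)) + ndist (fibre U p) (\<psi> s (x2 s)) (\<psi> s (x s))) \<le>
            2 * d + (d + 2 * d)"
          using close[OF tG] close[OF sW(2)] bspec[OF G(3) sW(3)]
            P.metric.commute[of "\<psi> s (x2 s)" "\<psi> s (x s)"] P.metric.commute[of "\<psi> t (x2 t)" "\<psi> s (x2 s)"]
          by linarith
        also have "\<dots> < \<epsilon>" using \<epsilon> by (simp add: d_def)
        finally show ?thesis using i t sW(1) by simp
      qed
      moreover have "openin (subtopology (base U) W') (G1 \<inter> G2 \<inter> G \<inter> W')"
        using G1(1) G2(1) G(1) unfolding openin_subtopology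
        by (intro exI[of _ "G1 \<inter> G2 \<inter> G"]) auto
      ultimately show "\<exists>V. openin (subtopology (base U) W') V \<and> t \<in> V \<and>
         (\<forall>s\<in>V. (\<lambda>t\<in>W'. \<psi> t (x t)) s \<in> P.metric.mball ((\<lambda>t\<in>W'. \<psi> t (x t)) t) \<epsilon>)"
        using tG G(2) by (intro exI[of _ "G1 \<inter> G2 \<inter> G \<inter> W'"]) auto
    qed
    then show ?thesis
      using top unfolding base by (simp add: constant_field_def P.ntopology_eq)
  qed
  then have "isomorphic_fields ?U (constant_field (base ?U) (fibre U p))"
    unfolding isomorphic_fields_def top
    using iso by (auto simp: constant_field_def induced_field_def intro!: exI[of _ \<psi>])
  then show ?thesis unfolding trivial_field_def using banach_fibre[OF p] by blast
qed

text \<open>On a piece the trivialising cover consists of chart domains. Every point has a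
  neighbourhood with closure inside its chart domain, and since the piece is a countable union of
  relatively compact sets, countably many of these neighbourhoods cover it.\<close>

lemma exhausted_imp_disjoint_union:
  assumes lt: "locally_trivial_field U" and "exhausted_space (base U) \<W> G"
  shows "disjoint_union_of_fields sigma_locally_trivial_field U"
proof -
  interpret E: exhausted_space "base U" \<W> G by fact
  have "\<exists>N \<psi>. p \<in> T \<longrightarrow> chart U p N \<psi>" for p
    using chart_exists[OF lt, of p] by metis
  then obtain N \<psi> where chart: "\<And>p. p \<in> T \<Longrightarrow> chart U p (N p) (\<psi> p)" by metis
  have N: "openin (base U) (N p)" "p \<in> N p" if "p \<in> T" for p
    using chart[OF that] by (simp_all add: chart_def)
  have "sigma_locally_trivial_field (induced_field U W)" if W: "W \<in> \<W>" for W
  proof -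
    have WT: "W \<subseteq> T" and Wo: "openin (base U) W"
      using E.open_piece[OF W] openin_subset by auto
    have base: "base (induced_field U W) = subtopology (base U) W" by (simp add: induced_field_def)
    have "\<exists>V. p \<in> W \<longrightarrow> openin (base U) V \<and> p \<in> V \<and> base U closure_of V \<subseteq> N p \<inter> W" for p
    proof (cases "p \<in> W")
      case True
      then have "p \<in> T" using WT by auto
      then have 1: "compactin (base U) {p}" "openin (base U) (N p \<inter> W)" "{p} \<subseteq> N p \<inter> W"
        using N Wo True by auto
      show ?thesis
        using regular_compact_interpolation[OF locally_compact Hausdorff 1] by (metis insert_subset)
    qed simp
    then obtain V where V: "\<And>p. p \<in> W \<Longrightarrow> openin (base U) (V p) \<and> p \<in> V p \<and> base U closure_of V p \<subseteq> N p \<inter> W"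
      by metis
    have VW: "V p \<subseteq> W" if "p \<in> W" for p
      using V[OF that] closure_of_subset[OF openin_subset] by blast
    have "\<exists>F. finite F \<and> F \<subseteq> W \<and> G W n \<subseteq> \<Union>(V ` F)" for n
    proof -
      have "base U closure_of G W n \<subseteq> W" using E.closure_G[OF W] E.G_subset[OF W] by blast
      then have "base U closure_of G W n \<subseteq> \<Union>(V ` W)" using V by blast
      then have "\<exists>\<F>. finite \<F> \<and> \<F> \<subseteq> V ` W \<and> base U closure_of G W n \<subseteq> \<Union>\<F>"
        using V by (intro compactinD[OF E.compact_G[OF W]]) auto
      then obtain F where "finite F" "F \<subseteq> W" "base U closure_of G W n \<subseteq> \<Union>(V ` F)"
        by (metis finite_subset_image)
      then show ?thesis using E.G_closure[OF W, of n] by blast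
    qed
    then obtain F where F: "\<And>n. finite (F n) \<and> F n \<subseteq> W \<and> G W n \<subseteq> \<Union>(V ` F n)" by metis
    define \<V> where "\<V> = (\<Union>n. V ` F n)"
    define \<U> where "\<U> = (\<lambda>p. N p \<inter> W) ` W"
    have top: "topspace (subtopology (base U) W) = W" using WT by auto
    have "countable (V ` F n)" for n using F[of n] by (intro countable_finite) simp
    then have "countable \<V>" unfolding \<V>_def by (intro countable_UN) auto
    moreover have "openin (subtopology (base U) W) A" if A: "A \<in> \<V>" for A
    proof -
      obtain n p where "p \<in> F n" "A = V p" using A unfolding \<V>_def by auto
      then have "p \<in> W" "A = V p" using F[of n] by auto
      then show ?thesis using V[of p] VW[of p] by (auto simp: openin_subtopology intro!: exI[of _ "V p"])
    qed
    moreover have "\<Union>\<V> = W"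
    proof
      have "V p \<subseteq> W" if "p \<in> F n" for p n using VW F[of n] that by auto
      then show "\<Union>\<V> \<subseteq> W" unfolding \<V>_def by auto
      have "G W n \<subseteq> \<Union>\<V>" for n
      proof -
        have "\<Union>(V ` F n) \<subseteq> \<Union>\<V>" unfolding \<V>_def by auto
        then show ?thesis using F[of n] by auto
      qed
      then have "(\<Union>n. G W n) \<subseteq> \<Union>\<V>" by (rule UN_least)
      then show "W \<subseteq> \<Union>\<V>" unfolding E.Union_G[OF W] .
    qed
    moreover have "\<exists>B\<in>\<U>. subtopology (base U) W closure_of A \<subseteq> B" if A: "A \<in> \<V>" for A
    proof -
      obtain n p where "p \<in> F n" "A = V p" using A unfolding \<V>_def by auto
      then have p: "p \<in> W" "A = V p" using F[of n] by auto
      have "subtopology (base U) W closure_of A \<subseteq> base U closure_of A"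
        by (rule closure_of_subtopology_subset)
      then have "subtopology (base U) W closure_of A \<subseteq> N p \<inter> W" using V[OF p(1)] p(2) by auto
      then show ?thesis using p by (auto simp: \<U>_def)
    qed
    moreover have "openin (subtopology (base U) W) B \<and> trivial_field (induced_field (induced_field U W) B)"
      if B: "B \<in> \<U>" for B
    proof -
      obtain p where p: "p \<in> W" "B = N p \<inter> W" using B by (auto simp: \<U>_def)
      have pT: "p \<in> T" using p WT by auto
      have "openin (subtopology (base U) W) B" using N[OF pT] p by (auto simp: openin_subtopology)
      moreover have "trivial_field (induced_field (induced_field U W) B)"
        by (rule trivial_induced_field[OF chart[OF pT]]) (use p WT in auto)
      ultimately show ?thesis ..
    qed
    moreover have "\<Union>\<U> = W" using N WT by (auto simp: \<U>_def)
    ultimately show ?thesis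
      unfolding sigma_locally_trivial_field_def base top
      by (intro exI[of _ \<U>] exI[of _ \<V>] conjI ballI) simp_all
  qed
  then show ?thesis
    unfolding disjoint_union_of_fields_def
    using E.open_piece E.Union_pieces E.exhaustion
    by (intro exI[of _ \<W>] conjI ballI) (simp_all add: clopen_exhaustion_def)
qed

end

section \<open>Locally trivial fields of unital algebras\<close>

locale unital_field = continuous_field U for U :: "('t, 'a) alg_field" +
  fixes e :: "'t \<Rightarrow> 'a" and C :: real
  assumes locally_trivial: "locally_trivial_field U"
    and identity: "t \<in> topspace (base U) \<Longrightarrow> is_identity (fibre U t) (e t)"
    and nonzero: "t \<in> topspace (base U) \<Longrightarrow> e t \<noteq> \<zero>\<^bsub>fibre U t\<^esub>"
    and bound: "t \<in> topspace (base U) \<Longrightarrow> vnorm (fibre U t) (e t) \<le> C"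
begin

lemma e_in: "t \<in> T \<Longrightarrow> e t \<in> carrier (fibre U t)"
  and e_left: "t \<in> T \<Longrightarrow> a \<in> carrier (fibre U t) \<Longrightarrow> e t \<otimes>\<^bsub>fibre U t\<^esub> a = a"
  and e_right: "t \<in> T \<Longrightarrow> a \<in> carrier (fibre U t) \<Longrightarrow> a \<otimes>\<^bsub>fibre U t\<^esub> e t = a"
  using identity by (auto simp: is_identity_def)

text \<open>As the identity is its own square, its norm \<open>r\<close> satisfies
  \<open>r \<le> r * r\<close>, and \<open>r\<close> is not 0. This lower bound is what later
  separates the diagonal from infinity.\<close>

lemma e_vnorm_ge_1:
  assumes t: "t \<in> T"
  shows "1 \<le> vnorm (fibre U t) (e t)"
proof -
  interpret F: banach_algebra "fibre U t" using banach_fibre[OF t] .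
  have "vnorm (fibre U t) (e t) > 0"
    using nonzero[OF t] F.vnorm_eq_0_iff[OF e_in[OF t]] F.vnorm_nonneg[OF e_in[OF t]] by auto
  moreover have "vnorm (fibre U t) (e t) \<le> vnorm (fibre U t) (e t) * vnorm (fibre U t) (e t)"
    using F.vnorm_mult[OF e_in[OF t] e_in[OF t]] e_left[OF t e_in[OF t]] by simp
  ultimately show ?thesis by simp
qed

definition unit_section :: "'t \<Rightarrow> 'a" where
  "unit_section = restrict e T"

lemma unit_section_apply: "t \<in> T \<Longrightarrow> unit_section t = e t"
  by (simp add: unit_section_def)

text \<open>In a chart the identities form a constant function, since isomorphisms preserve the
  identity and it is unique.\<close>

lemma chart_identity:
  assumes "chart U p N \<psi>" "t \<in> N"
  shows "\<psi> t (e t) = e p"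
proof -
  have N: "openin (base U) N" "p \<in> N" "isometric_algebra_iso (fibre U t) (fibre U p) (\<psi> t)"
    using assms by (simp_all add: chart_def)
  then have T: "t \<in> T" "p \<in> T" using openin_subset assms(2) by auto
  show ?thesis
    by (rule is_identity_unique[OF iso_identity[OF N(3) identity[OF T(1)]] identity[OF T(2)]])
qed

text \<open>Some section is close to the identity at \<open>p\<close>, by density of values. It
  stays close to the identity nearby, because in a chart the identity is constant and the section
  continuous. So the identities are locally approximated by sections.\<close>

lemma unit_section: "unit_section \<in> sections U"
proof (rule sectionI)
  show "unit_section \<in> section_space (fibre U) T" using e_in by (auto simp: unit_section_def)
  fix p and \<epsilon> :: real assume p: "p \<in> T" and \<epsilon>: "\<epsilon> > 0"
  interpret P: banach_space "fibre U p" by (rule banach_space_fibre[OF p])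
  have e2: "\<epsilon>/2 > 0" using \<epsilon> by simp
  have "e p \<in> P.metric.mtopology closure_of ((\<lambda>x. x p) ` sections U)"
    using dense_values[OF p] e_in[OF p] by (simp add: P.ntopology_eq)
  then have "\<forall>r>0. \<exists>y\<in>(\<lambda>x. x p) ` sections U. y \<in> P.metric.mball (e p) r"
    unfolding P.metric.metric_closure_of by auto
  then obtain x where x: "x \<in> sections U" "x p \<in> P.metric.mball (e p) (\<epsilon>/2)" using e2 by blast
  obtain N \<psi> where ch: "chart U p N \<psi>" using chart_exists[OF locally_trivial p] .
  have pN: "p \<in> N" using ch by (simp add: chart_def)
  from chart_continuous[OF ch x(1) pN e2] obtain G where G: "openin (base U) G" "p \<in> G" "G \<subseteq> N"
     "\<forall>s\<in>G. ndist (fibre U p) (\<psi> s (x s)) (\<psi> p (x p)) < \<epsilon>/2" by (elim exE conjE)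
  have \<psi>p: "\<psi> p (x p) = x p" using ch section_in[OF x(1) p] by (simp add: chart_def)
  have "ndist (fibre U s) (unit_section s) (x s) \<le> \<epsilon>" if s: "s \<in> G" for s
  proof -
    have sN: "s \<in> N" "s \<in> T" using s G openin_subset by blast+
    have iso: "isometric_algebra_iso (fibre U s) (fibre U p) (\<psi> s)" using ch sN by (simp add: chart_def)
    note v = e_in[OF sN(2)] section_in[OF x(1) sN(2)]
    have "ndist (fibre U s) (e s) (x s) = ndist (fibre U p) (e p) (\<psi> s (x s))"
      using iso_ndist[OF iso banach_space_fibre[OF sN(2)] P.banach_space_axioms v] chart_identity[OF ch sN(1)]
      by simp
    also have "\<dots> \<le> ndist (fibre U p) (e p) (x p) + ndist (fibre U p) (x p) (\<psi> s (x s))"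
      using e_in[OF p] section_in[OF x(1) p] iso_closed[OF iso v(2)] by (rule P.metric.triangle)
    also have "\<dots> \<le> \<epsilon>/2 + \<epsilon>/2"
      using x(2) bspec[OF G(4) s] P.metric.commute[of "x p"] by (intro add_mono) (auto simp: \<psi>p)
    finally show ?thesis using sN(2) by (simp add: unit_section_apply)
  qed
  then show "\<exists>x'\<in>sections U. \<exists>N. openin (base U) N \<and> p \<in> N \<and>
      (\<forall>s\<in>N. ndist (fibre U s) (unit_section s) (x' s) \<le> \<epsilon>)"
    using x(1) G(1,2) by (intro bexI[of _ x] exI[of _ G]) auto
qed

lemma exhausted_imp_left_projective:
  assumes "exhausted_space (base U) \<W> G"
  shows "left_projective TYPE('u) \<A>"
proof -
  interpret E: exhausted_space "base U" \<W> G by fact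
  interpret A: banach_algebra \<A> by (rule banach_algebra_algebra)
  obtain g :: "'t set \<times> nat \<Rightarrow> 't \<Rightarrow> real" and I where
    g_cont': "\<forall>i\<in>I. continuous_map (base U) euclideanreal (g i)" and
    g_nonneg': "\<forall>i\<in>I. \<forall>x\<in>T. 0 \<le> g i x" and
    g_supp': "\<forall>i\<in>I. \<exists>K. compactin (base U) K \<and> (\<forall>x\<in>T - K. g i x = 0)" and
    g_fin': "\<forall>K. compactin (base U) K \<longrightarrow> finite {i \<in> I. \<exists>x\<in>K. g i x \<noteq> 0}" and
    g_sum': "\<forall>x\<in>T. \<exists>J\<subseteq>I. finite J \<and> (\<forall>i\<in>I - J. g i x = 0) \<and>
       (\<Sum>i\<in>J. (g i x)\<^sup>2) = 1 \<and> (\<Sum>i\<in>J. g i x) \<le> 2"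
    by (rule E.square_partition_of_unity)
  note g_cont = bspec[OF g_cont'] and g_nonneg = bspec[OF bspec[OF g_nonneg']] and g_supp = bspec[OF g_supp']
    and g_fin = mp[OF spec[OF g_fin']] and g_sum = bspec[OF g_sum']
  have sums: "(\<Sum>i\<in>F. g i t) \<le> 2" "(\<Sum>i\<in>F. (g i t)\<^sup>2) \<le> 1" if F: "finite F" "F \<subseteq> I" and t: "t \<in> T" for F t
  proof -
    obtain J where J: "J \<subseteq> I" "finite J" "\<forall>i\<in>I - J. g i t = 0" "(\<Sum>i\<in>J. (g i t)\<^sup>2) = 1" "(\<Sum>i\<in>J. g i t) \<le> 2"
      using g_sum[OF t] by (elim exE conjE)
    have "(\<Sum>i\<in>F. g i t) = (\<Sum>i\<in>F \<inter> J. g i t)" "(\<Sum>i\<in>F. (g i t)\<^sup>2) = (\<Sum>i\<in>F \<inter> J. (g i t)\<^sup>2)"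
      using J F by (auto intro!: sum.mono_neutral_right)
    moreover have "(\<Sum>i\<in>F \<inter> J. g i t) \<le> (\<Sum>i\<in>J. g i t)"
      by (rule sum_mono2) (use J(1,2) g_nonneg[OF _ t] in auto)
    moreover have "(\<Sum>i\<in>F \<inter> J. (g i t)\<^sup>2) \<le> (\<Sum>i\<in>J. (g i t)\<^sup>2)"
      by (rule sum_mono2) (use J(2) in auto)
    ultimately show "(\<Sum>i\<in>F. g i t) \<le> 2" "(\<Sum>i\<in>F. (g i t)\<^sup>2) \<le> 1" using J by linarith+
  qed
  have g_le: "\<bar>g i t\<bar> \<le> 2" if "i \<in> I" "t \<in> T" for i t
    using sums(1)[of "{i}" t] g_nonneg that by simp
  have signed: "\<bar>\<Sum>i\<in>F. s i * g i t\<bar> \<le> 2"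
    if F: "finite F" "F \<subseteq> I" and t: "t \<in> T" and s: "\<forall>i. \<bar>s i\<bar> = 1" for F t and s :: "'t set \<times> nat \<Rightarrow> real"
  proof -
    have "\<bar>\<Sum>i\<in>F. s i * g i t\<bar> \<le> (\<Sum>i\<in>F. \<bar>s i * g i t\<bar>)" by (rule sum_abs)
    also have "\<dots> = (\<Sum>i\<in>F. g i t)" using s g_nonneg t F by (intro sum.cong) (auto simp: abs_mult)
    finally show ?thesis using sums(1)[OF F t] by linarith
  qed
  have scale_in: "scale (g i) a \<in> carrier \<A>" if "i \<in> I" "a \<in> carrier \<A>" for i a
    unfolding scale_def by (rule scaled_algebra[OF g_cont[OF that(1)] that(2), of 2]) (use g_le that in auto)
  have u_in: "scale (g i) unit_section \<in> carrier \<A>" if i: "i \<in> I" for i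
  proof -
    obtain K where "compactin (base U) K" "\<forall>x\<in>T - K. g i x = 0" using g_supp[OF i] by (elim exE conjE)
    then show ?thesis
      unfolding scale_def by (intro compactly_supported_algebra[OF g_cont[OF i] unit_section]) auto
  qed
  have scale_in': "\<forall>i\<in>I. scale (g i) a \<in> carrier \<A>" if "a \<in> carrier \<A>" for a
    using scale_in that by simp
  have u_in': "\<forall>i\<in>I. scale (g i) unit_section \<in> carrier \<A>" using u_in by simp
  \<comment> \<open>At a point all terms are multiples of the one vector \<open>a t\<close>, so a
    signed sum is a scalar multiple of it, and \<open>signed\<close> bounds the scalar by 2. The
    norm of the algebra is a supremum over points, which is why the number of terms does not
    matter.\<close>
  have combination: "vnorm (fibre U t) ((\<Oplus>\<^bsub>\<A>\<^esub>i\<in>F. complex_of_real (s i) \<odot>\<^bsub>\<A>\<^esub> scale (g i) a) t) =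
      \<bar>\<Sum>i\<in>F. s i * g i t\<bar> * vnorm (fibre U t) (a t)"
    if F: "finite F" "F \<subseteq> I" and a: "\<forall>i\<in>I. scale (g i) a \<in> carrier \<A>" "a t \<in> carrier (fibre U t)"
      and t: "t \<in> T" for F a t and s :: "'t set \<times> nat \<Rightarrow> real"
  proof -
    interpret F: banach_space "fibre U t" by (rule banach_space_fibre[OF t])
    have "(\<Oplus>\<^bsub>\<A>\<^esub>i\<in>F. complex_of_real (s i) \<odot>\<^bsub>\<A>\<^esub> scale (g i) a) t =
        (\<Oplus>\<^bsub>fibre U t\<^esub>i\<in>F. (complex_of_real (s i) \<odot>\<^bsub>\<A>\<^esub> scale (g i) a) t)"
      using F a t by (intro algebra_finsum_apply) (auto intro!: algebra_smult)
    also have "\<dots> = (\<Oplus>\<^bsub>fibre U t\<^esub>i\<in>F. complex_of_real (s i * g i t) \<odot>\<^bsub>fibre U t\<^esub> a t)"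
      using t a(2) by (simp add: algebra_apply scale_apply F.smult_smult)
    also have "\<dots> = (\<Sum>i\<in>F. complex_of_real (s i * g i t)) \<odot>\<^bsub>fibre U t\<^esub> a t"
      by (rule F.finsum_smult_const[OF F(1) a(2)])
    also have "(\<Sum>i\<in>F. complex_of_real (s i * g i t)) = complex_of_real (\<Sum>i\<in>F. s i * g i t)" by simp
    finally have eq: "(\<Oplus>\<^bsub>\<A>\<^esub>i\<in>F. complex_of_real (s i) \<odot>\<^bsub>\<A>\<^esub> scale (g i) a) t =
        complex_of_real (\<Sum>i\<in>F. s i * g i t) \<odot>\<^bsub>fibre U t\<^esub> a t" .
    show ?thesis unfolding eq F.vnorm_smult[OF a(2)] norm_of_real ..
  qed
  show ?thesis
  \<comment> \<open>The signed sums are bounded by \<open>2 * vnorm \<A> a\<close> and by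
    \<open>2 * \<bar>C\<bar>\<close>; a single constant has to serve for both.\<close>
  proof (rule left_projective_if_square_partition[where I = I and u = "\<lambda>i. scale (g i) unit_section"
        and \<gamma> = "\<lambda>i. scale (g i)" and M = "2 + 2 * \<bar>C\<bar>"])
    show "banach_algebra \<A>" by (rule banach_algebra_algebra)
    show "scale (g i) unit_section \<in> carrier \<A>" if "i \<in> I" for i by (rule u_in[OF that])
    show "linear_map \<A> \<A> (scale (g i))" if i: "i \<in> I" for i
    proof (rule linear_mapI)
      fix x y c assume x: "x \<in> carrier \<A>" and y: "y \<in> carrier \<A>"
      show "scale (g i) (x \<oplus>\<^bsub>\<A>\<^esub> y) = scale (g i) x \<oplus>\<^bsub>\<A>\<^esub> scale (g i) y"
        by (rule algebra_eqI)
          (use i x y in \<open>simp_all add: scale_in algebra_add algebra_apply scale_apply algebra_in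
            banach_space.smult_plus_right[OF banach_space_fibre]\<close>)
    next
      fix x c assume x: "x \<in> carrier \<A>"
      show "scale (g i) (c \<odot>\<^bsub>\<A>\<^esub> x) = c \<odot>\<^bsub>\<A>\<^esub> scale (g i) x"
        by (rule algebra_eqI)
          (use i x in \<open>simp_all add: scale_in algebra_smult algebra_apply scale_apply algebra_in
            banach_space.smult_smult[OF banach_space_fibre] mult.commute\<close>)
    qed (rule scale_in[OF i])
    show "scale (g i) (b \<otimes>\<^bsub>\<A>\<^esub> a) = b \<otimes>\<^bsub>\<A>\<^esub> scale (g i) a"
      if i: "i \<in> I" and a: "a \<in> carrier \<A>" and b: "b \<in> carrier \<A>" for i a b
      by (rule algebra_eqI)
        (use i a b in \<open>simp_all add: scale_in algebra_mult algebra_apply scale_apply algebra_in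
          banach_algebra.smult_mult_right[OF banach_fibre]\<close>)
    show "vnorm \<A> (\<Oplus>\<^bsub>\<A>\<^esub>i\<in>F. complex_of_real (s i) \<odot>\<^bsub>\<A>\<^esub> scale (g i) a) \<le> (2 + 2 * \<bar>C\<bar>) * vnorm \<A> a"
      if F: "finite F" "F \<subseteq> I" and s: "\<forall>i. \<bar>s i\<bar> = 1" and a: "a \<in> carrier \<A>"
      for F a and s :: "'t set \<times> nat \<Rightarrow> real"
    proof (rule algebra_vnorm_le)
      show "0 \<le> (2 + 2 * \<bar>C\<bar>) * vnorm \<A> a" using A.vnorm_nonneg[OF a] by simp
      fix t assume t: "t \<in> T"
      have "\<bar>\<Sum>i\<in>F. s i * g i t\<bar> * vnorm (fibre U t) (a t) \<le> (2 + 2 * \<bar>C\<bar>) * vnorm \<A> a"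
        using signed[OF F t s] algebra_vnorm_ge[OF a t] fibre_vnorm_nonneg[OF _ t, of a] a
        by (intro mult_mono) (auto simp: field_algebra_simps(1))
      then show "vnorm (fibre U t) ((\<Oplus>\<^bsub>\<A>\<^esub>i\<in>F. complex_of_real (s i) \<odot>\<^bsub>\<A>\<^esub> scale (g i) a) t) \<le>
          (2 + 2 * \<bar>C\<bar>) * vnorm \<A> a"
        unfolding combination[OF F scale_in'[OF a] algebra_in[OF a t] t] .
    qed
    show "vnorm \<A> (\<Oplus>\<^bsub>\<A>\<^esub>i\<in>F. complex_of_real (s i) \<odot>\<^bsub>\<A>\<^esub> scale (g i) unit_section) \<le> 2 + 2 * \<bar>C\<bar>"
      if F: "finite F" "F \<subseteq> I" and s: "\<forall>i. \<bar>s i\<bar> = 1" for F and s :: "'t set \<times> nat \<Rightarrow> real"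
    proof (rule algebra_vnorm_le)
      fix t assume t: "t \<in> T"
      have "vnorm (fibre U t) (unit_section t) \<le> \<bar>C\<bar>"
        using bound[OF t] by (simp add: unit_section_apply t)
      then have "\<bar>\<Sum>i\<in>F. s i * g i t\<bar> * vnorm (fibre U t) (unit_section t) \<le> 2 * \<bar>C\<bar>"
        using signed[OF F t s] fibre_vnorm_nonneg[OF unit_section t] by (intro mult_mono) auto
      then show "vnorm (fibre U t) ((\<Oplus>\<^bsub>\<A>\<^esub>i\<in>F. complex_of_real (s i) \<odot>\<^bsub>\<A>\<^esub> scale (g i) unit_section) t) \<le>
          2 + 2 * \<bar>C\<bar>"
        unfolding combination[OF F u_in' section_in[OF unit_section t] t] by linarith
    qed simp
    show "\<exists>F\<^sub>0. finite F\<^sub>0 \<and> F\<^sub>0 \<subseteq> I \<and> (\<forall>F (s :: 't set \<times> nat \<Rightarrow> real). finite F \<longrightarrow> F \<subseteq> I - F\<^sub>0 \<longrightarrow>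
        (\<forall>i. \<bar>s i\<bar> = 1) \<longrightarrow> vnorm \<A> (\<Oplus>\<^bsub>\<A>\<^esub>i\<in>F. complex_of_real (s i) \<odot>\<^bsub>\<A>\<^esub> scale (g i) a) \<le> \<epsilon>)"
      if a: "a \<in> carrier \<A>" and \<epsilon>: "\<epsilon> > 0" for a \<epsilon>
    proof -
      have e2: "\<epsilon>/2 > 0" using \<epsilon> by simp
      \<comment> \<open>The functions outside \<open>F\<^sub>0\<close> vanish on \<open>K\<close>;
        off \<open>K\<close> the norm of \<open>a\<close> is below \<open>\<epsilon>/2\<close>, and
        the signed scalar is at most 2.\<close>
      obtain K where K: "compactin (base U) K" "\<And>t. t \<in> T \<Longrightarrow> t \<notin> K \<Longrightarrow> vnorm (fibre U t) (a t) < \<epsilon>/2"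
        using algebra_small[OF a e2] by metis
      define F\<^sub>0 where "F\<^sub>0 = {i \<in> I. \<exists>x\<in>K. g i x \<noteq> 0}"
      have "vnorm \<A> (\<Oplus>\<^bsub>\<A>\<^esub>i\<in>F. complex_of_real (s i) \<odot>\<^bsub>\<A>\<^esub> scale (g i) a) \<le> \<epsilon>"
        if F: "finite F" "F \<subseteq> I - F\<^sub>0" and s: "\<forall>i. \<bar>s i\<bar> = 1" for F and s :: "'t set \<times> nat \<Rightarrow> real"
      proof (rule algebra_vnorm_le)
        fix t assume t: "t \<in> T"
        have FI: "F \<subseteq> I" using F(2) by auto
        have nn: "0 \<le> vnorm (fibre U t) (a t)" using fibre_vnorm_nonneg[OF _ t, of a] a by (simp add: field_algebra_simps(1))
        have "\<bar>\<Sum>i\<in>F. s i * g i t\<bar> * vnorm (fibre U t) (a t) \<le> \<epsilon>"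
        proof (cases "t \<in> K")
          case True
          then have "(\<Sum>i\<in>F. s i * g i t) = 0" using F(2) by (intro sum.neutral) (auto simp: F\<^sub>0_def)
          then show ?thesis using \<epsilon> by simp
        next
          case False
          have "\<bar>\<Sum>i\<in>F. s i * g i t\<bar> * vnorm (fibre U t) (a t) \<le> 2 * (\<epsilon>/2)"
            using signed[OF F(1) FI t s] less_imp_le[OF K(2)[OF t False]] nn by (intro mult_mono) auto
          then show ?thesis by simp
        qed
        then show "vnorm (fibre U t) ((\<Oplus>\<^bsub>\<A>\<^esub>i\<in>F. complex_of_real (s i) \<odot>\<^bsub>\<A>\<^esub> scale (g i) a) t) \<le> \<epsilon>"
          unfolding combination[OF F(1) FI scale_in'[OF a] algebra_in[OF a t] t] .
      qed (use \<epsilon> in simp)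
      then show ?thesis using g_fin[OF K(1)] unfolding F\<^sub>0_def[symmetric]
        by (intro exI[of _ F\<^sub>0] conjI allI impI) (auto simp: F\<^sub>0_def)
    qed
    show "finite_limit \<A> I (\<lambda>F. \<Oplus>\<^bsub>\<A>\<^esub>i\<in>F. scale (g i) a \<otimes>\<^bsub>\<A>\<^esub> scale (g i) unit_section) a"
      if a: "a \<in> carrier \<A>" for a
      unfolding finite_limit_def
    proof (intro conjI allI impI a)
      fix \<epsilon> :: real assume \<epsilon>: "\<epsilon> > 0"
      \<comment> \<open>On \<open>K\<close> a finite set that contains \<open>F\<^sub>0\<close>
        includes all indices of nonzero functions, so the squares sum to exactly 1. Off
        \<open>K\<close> their sum lies between 0 and 1, so the error is at most the norm of
        \<open>a\<close>, which is below \<open>\<epsilon>\<close> there.\<close>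
      obtain K where K: "compactin (base U) K" "\<And>t. t \<in> T \<Longrightarrow> t \<notin> K \<Longrightarrow> vnorm (fibre U t) (a t) < \<epsilon>"
        using algebra_small[OF a \<epsilon>] by metis
      define F\<^sub>0 where "F\<^sub>0 = {i \<in> I. \<exists>x\<in>K. g i x \<noteq> 0}"
      have "ndist \<A> (\<Oplus>\<^bsub>\<A>\<^esub>i\<in>F. scale (g i) a \<otimes>\<^bsub>\<A>\<^esub> scale (g i) unit_section) a \<le> \<epsilon>"
        if F: "finite F" "F\<^sub>0 \<subseteq> F" "F \<subseteq> I" for F
      proof -
        let ?S = "\<Oplus>\<^bsub>\<A>\<^esub>i\<in>F. scale (g i) a \<otimes>\<^bsub>\<A>\<^esub> scale (g i) unit_section"
        have terms: "scale (g i) a \<otimes>\<^bsub>\<A>\<^esub> scale (g i) unit_section \<in> carrier \<A>" if "i \<in> F" for i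
        proof (rule algebra_mult)
          have "i \<in> I" using that F(3) by auto
          then show "scale (g i) a \<in> carrier \<A>" "scale (g i) unit_section \<in> carrier \<A>"
            using scale_in a u_in by simp_all
        qed
        then have S: "?S \<in> carrier \<A>" by (intro A.M.finsum_closed) auto
        have "vnorm \<A> (?S \<ominus>\<^bsub>\<A>\<^esub> a) \<le> \<epsilon>"
        proof (rule algebra_vnorm_le)
          fix t assume t: "t \<in> T"
          interpret Ft: banach_algebra "fibre U t" using banach_fibre[OF t] .
          have at: "a t \<in> carrier (fibre U t)" by (rule algebra_in[OF a t])
          have "?S t = (\<Oplus>\<^bsub>fibre U t\<^esub>i\<in>F. (scale (g i) a \<otimes>\<^bsub>\<A>\<^esub> scale (g i) unit_section) t)"
            by (rule algebra_finsum_apply[OF F(1) terms t])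
          also have "\<dots> = (\<Oplus>\<^bsub>fibre U t\<^esub>i\<in>F. complex_of_real ((g i t)\<^sup>2) \<odot>\<^bsub>fibre U t\<^esub> a t)"
            using t at by (simp add: algebra_apply scale_apply unit_section_apply Ft.smult_mult_left
                Ft.smult_mult_right e_in e_right Ft.smult_smult power2_eq_square)
          also have "\<dots> = (\<Sum>i\<in>F. complex_of_real ((g i t)\<^sup>2)) \<odot>\<^bsub>fibre U t\<^esub> a t"
            by (rule Ft.finsum_smult_const[OF F(1) at])
          also have "(\<Sum>i\<in>F. complex_of_real ((g i t)\<^sup>2)) = complex_of_real (\<Sum>i\<in>F. (g i t)\<^sup>2)" by simp
          finally have St: "?S t = complex_of_real (\<Sum>i\<in>F. (g i t)\<^sup>2) \<odot>\<^bsub>fibre U t\<^esub> a t" .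
          have "(?S \<ominus>\<^bsub>\<A>\<^esub> a) t = complex_of_real ((\<Sum>i\<in>F. (g i t)\<^sup>2) - 1) \<odot>\<^bsub>fibre U t\<^esub> a t"
            using A.minus_eq_smult[OF S a] t St at
              Ft.smult_plus_left[OF at, of "complex_of_real (\<Sum>i\<in>F. (g i t)\<^sup>2)" "-1"]
            by (simp add: algebra_apply)
          then have eq: "vnorm (fibre U t) ((?S \<ominus>\<^bsub>\<A>\<^esub> a) t) = \<bar>(\<Sum>i\<in>F. (g i t)\<^sup>2) - 1\<bar> * vnorm (fibre U t) (a t)"
            using Ft.vnorm_smult[OF at] by (simp only: norm_of_real)
          show "vnorm (fibre U t) ((?S \<ominus>\<^bsub>\<A>\<^esub> a) t) \<le> \<epsilon>"
          proof (cases "t \<in> K")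
            case True
            obtain J where J: "J \<subseteq> I" "finite J" "\<forall>i\<in>I - J. g i t = 0" "(\<Sum>i\<in>J. (g i t)\<^sup>2) = 1"
              using g_sum[OF t] by (elim exE conjE)
            have "(\<Sum>i\<in>F. (g i t)\<^sup>2) = (\<Sum>i\<in>F \<inter> J. (g i t)\<^sup>2)"
              using J F by (intro sum.mono_neutral_right) auto
            also have "\<dots> = (\<Sum>i\<in>J. (g i t)\<^sup>2)"
              using J F True by (intro sum.mono_neutral_left) (auto simp: F\<^sub>0_def)
            finally show ?thesis using J(4) \<epsilon> unfolding eq by simp
          next
            case False
            have "\<bar>(\<Sum>i\<in>F. (g i t)\<^sup>2) - 1\<bar> \<le> 1"
              using sums(2)[OF F(1,3) t] sum_nonneg[of F "\<lambda>i. (g i t)\<^sup>2"] by auto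
            then have "\<bar>(\<Sum>i\<in>F. (g i t)\<^sup>2) - 1\<bar> * vnorm (fibre U t) (a t) \<le> 1 * \<epsilon>"
              using less_imp_le[OF K(2)[OF t False]] Ft.vnorm_nonneg[OF at] by (intro mult_mono) auto
            then show ?thesis unfolding eq by simp
          qed
        qed (use \<epsilon> in simp)
        then show ?thesis using S a by (simp add: A.ndist_eq)
      qed
      then show "\<exists>F\<^sub>0. finite F\<^sub>0 \<and> F\<^sub>0 \<subseteq> I \<and> (\<forall>F. finite F \<longrightarrow> F\<^sub>0 \<subseteq> F \<longrightarrow> F \<subseteq> I \<longrightarrow>
          ndist \<A> (\<Oplus>\<^bsub>\<A>\<^esub>i\<in>F. scale (g i) a \<otimes>\<^bsub>\<A>\<^esub> scale (g i) unit_section) a \<le> \<epsilon>)"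
        using g_fin[OF K(1)] unfolding F\<^sub>0_def[symmetric]
        by (intro exI[of _ F\<^sub>0] conjI allI impI) (auto simp: F\<^sub>0_def)
    qed
  qed simp
qed

end

section \<open>Continuity at the points of an open set\<close>

text \<open>Continuity at every point of \<open>N\<close>, for functions whose values matter only
  there. The condition \<open>G \<subseteq> N\<close> forces \<open>N\<close> to be open and keeps
  the points of comparison inside it.\<close>

definition continuous_into :: "'t topology \<Rightarrow> 'v cnormed \<Rightarrow> 't set \<Rightarrow> ('t \<Rightarrow> 'v) \<Rightarrow> bool" where
  "continuous_into X V N z \<longleftrightarrow>
     (\<forall>t\<in>N. \<forall>\<epsilon>>0. \<exists>G. openin X G \<and> t \<in> G \<and> G \<subseteq> N \<and> (\<forall>s\<in>G. ndist V (z s) (z t) \<le> \<epsilon>))"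

lemma continuous_intoD:
  assumes "continuous_into X V N z" "t \<in> N" "\<epsilon> > 0"
  obtains G where "openin X G" "t \<in> G" "G \<subseteq> N" "\<forall>s\<in>G. ndist V (z s) (z t) \<le> \<epsilon>"
proof -
  have "\<exists>G. openin X G \<and> t \<in> G \<and> G \<subseteq> N \<and> (\<forall>s\<in>G. ndist V (z s) (z t) \<le> \<epsilon>)"
    using assms by (simp add: continuous_into_def)
  then show thesis using that by (elim exE conjE)
qed

lemma continuous_intoI:
  assumes "\<And>t \<epsilon>. t \<in> N \<Longrightarrow> \<epsilon> > 0 \<Longrightarrow> \<exists>G. openin X G \<and> t \<in> G \<and> G \<subseteq> N \<and> (\<forall>s\<in>G. ndist V (z s) (z t) \<le> \<epsilon>)"
  shows "continuous_into X V N z"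
  using assms by (simp add: continuous_into_def)

lemma chart_continuous_into:
  assumes "chart U p N \<psi>" "x \<in> sections U"
  shows "continuous_into (base U) (fibre U p) N (\<lambda>s. \<psi> s (x s))"
proof (rule continuous_intoI)
  fix t and \<epsilon> :: real assume "t \<in> N" "\<epsilon> > 0"
  from chart_continuous[OF assms this] obtain G where "openin (base U) G" "t \<in> G" "G \<subseteq> N"
    "\<forall>s\<in>G. ndist (fibre U p) (\<psi> s (x s)) (\<psi> t (x t)) < \<epsilon>" by (elim exE conjE)
  then show "\<exists>G. openin (base U) G \<and> t \<in> G \<and> G \<subseteq> N \<and>
      (\<forall>s\<in>G. ndist (fibre U p) (\<psi> s (x s)) (\<psi> t (x t)) \<le> \<epsilon>)"
    by (intro exI[of _ G]) (simp add: less_imp_le)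
qed

lemma continuous_into_cong:
  assumes "continuous_into X V N w" "\<And>t. t \<in> N \<Longrightarrow> z t = w t"
  shows "continuous_into X V N z"
proof (rule continuous_intoI)
  fix t and \<epsilon> :: real assume t: "t \<in> N" and e: "\<epsilon> > 0"
  obtain G where G: "openin X G" "t \<in> G" "G \<subseteq> N" "\<forall>s\<in>G. ndist V (w s) (w t) \<le> \<epsilon>"
    using continuous_intoD[OF assms(1) t e] .
  then show "\<exists>G. openin X G \<and> t \<in> G \<and> G \<subseteq> N \<and> (\<forall>s\<in>G. ndist V (z s) (z t) \<le> \<epsilon>)"
    using assms(2) t by (intro exI[of _ G]) (auto simp: subset_iff)
qed

context banach_space begin

lemma continuous_into_const:
  assumes "openin X N" "c \<in> carrier V"
  shows "continuous_into X V N (\<lambda>t. c)"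
  by (rule continuous_intoI) (use assms in \<open>auto intro!: exI[of _ N]\<close>)

lemma continuous_into_add:
  assumes "continuous_into X V N z" "continuous_into X V N w"
    and "\<And>t. t \<in> N \<Longrightarrow> z t \<in> carrier V" "\<And>t. t \<in> N \<Longrightarrow> w t \<in> carrier V"
  shows "continuous_into X V N (\<lambda>t. z t \<oplus>\<^bsub>V\<^esub> w t)"
proof (rule continuous_intoI)
  fix t and \<epsilon> :: real assume t: "t \<in> N" and "\<epsilon> > 0"
  then have e: "\<epsilon>/2 > 0" by simp
  obtain G where G: "openin X G" "t \<in> G" "G \<subseteq> N" "\<forall>s\<in>G. ndist V (z s) (z t) \<le> \<epsilon>/2"
    using continuous_intoD[OF assms(1) t e] .
  obtain H where H: "openin X H" "t \<in> H" "H \<subseteq> N" "\<forall>s\<in>H. ndist V (w s) (w t) \<le> \<epsilon>/2"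
    using continuous_intoD[OF assms(2) t e] .
  have "ndist V (z s \<oplus>\<^bsub>V\<^esub> w s) (z t \<oplus>\<^bsub>V\<^esub> w t) \<le> \<epsilon>" if "s \<in> G \<inter> H" for s
  proof -
    have "s \<in> N" using that G(3) by auto
    then have "ndist V (z s \<oplus>\<^bsub>V\<^esub> w s) (z t \<oplus>\<^bsub>V\<^esub> w t) \<le> ndist V (z s) (z t) + ndist V (w s) (w t)"
      using assms(3,4) t by (intro ndist_add) auto
    also have "\<dots> \<le> \<epsilon>/2 + \<epsilon>/2" using G(4) H(4) that by (intro add_mono) auto
    finally show ?thesis by simp
  qed
  then show "\<exists>G. openin X G \<and> t \<in> G \<and> G \<subseteq> N \<and> (\<forall>s\<in>G. ndist V (z s \<oplus>\<^bsub>V\<^esub> w s) (z t \<oplus>\<^bsub>V\<^esub> w t) \<le> \<epsilon>)"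
    using G H by (intro exI[of _ "G \<inter> H"]) auto
qed

lemma continuous_into_smult:
  assumes "continuous_into X V N z" "\<And>t. t \<in> N \<Longrightarrow> z t \<in> carrier V"
  shows "continuous_into X V N (\<lambda>t. c \<odot>\<^bsub>V\<^esub> z t)"
proof (rule continuous_intoI)
  fix t and \<epsilon> :: real assume t: "t \<in> N" and e: "\<epsilon> > 0"
  then have "\<epsilon> / (cmod c + 1) > 0" by (simp add: add_nonneg_pos)
  then obtain G where G: "openin X G" "t \<in> G" "G \<subseteq> N" "\<forall>s\<in>G. ndist V (z s) (z t) \<le> \<epsilon> / (cmod c + 1)"
    using continuous_intoD[OF assms(1) t] by metis
  have "ndist V (c \<odot>\<^bsub>V\<^esub> z s) (c \<odot>\<^bsub>V\<^esub> z t) \<le> \<epsilon>" if s: "s \<in> G" for s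
  proof -
    have "s \<in> N" using s G(3) by auto
    then have "ndist V (c \<odot>\<^bsub>V\<^esub> z s) (c \<odot>\<^bsub>V\<^esub> z t) = cmod c * ndist V (z s) (z t)"
      using assms(2) t by (intro ndist_smult)
    also have "\<dots> \<le> (cmod c + 1) * (\<epsilon> / (cmod c + 1))"
      using G(4) s by (intro mult_mono) auto
    also have "\<dots> = \<epsilon>" using norm_ge_zero[of c] by (simp add: add_nonneg_eq_0_iff)
    finally show ?thesis .
  qed
  then show "\<exists>G. openin X G \<and> t \<in> G \<and> G \<subseteq> N \<and> (\<forall>s\<in>G. ndist V (c \<odot>\<^bsub>V\<^esub> z s) (c \<odot>\<^bsub>V\<^esub> z t) \<le> \<epsilon>)"
    using G by (intro exI[of _ G]) auto
qed

lemma continuous_into_uniform_limit: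
  assumes z: "\<And>t. t \<in> N \<Longrightarrow> z t \<in> carrier V"
    and lim: "\<And>\<epsilon>. \<epsilon> > 0 \<Longrightarrow> \<exists>w. continuous_into X V N w \<and> (\<forall>t\<in>N. w t \<in> carrier V \<and> ndist V (z t) (w t) \<le> \<epsilon>)"
  shows "continuous_into X V N z"
proof (rule continuous_intoI)
  fix t and \<epsilon> :: real assume t: "t \<in> N" and "\<epsilon> > 0"
  then have e: "\<epsilon>/3 > 0" by simp
  obtain w where w: "continuous_into X V N w" "\<forall>t\<in>N. w t \<in> carrier V \<and> ndist V (z t) (w t) \<le> \<epsilon>/3"
    using lim[OF e] by (elim exE conjE)
  obtain G where G: "openin X G" "t \<in> G" "G \<subseteq> N" "\<forall>s\<in>G. ndist V (w s) (w t) \<le> \<epsilon>/3"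
    using continuous_intoD[OF w(1) t e] .
  have "ndist V (z s) (z t) \<le> \<epsilon>" if s: "s \<in> G" for s
  proof -
    have sN: "s \<in> N" using s G(3) by auto
    note v = z[OF sN] z[OF t] bspec[OF w(2) sN] bspec[OF w(2) t]
    have "ndist V (z s) (z t) \<le> ndist V (z s) (w s) + ndist V (w s) (z t)"
      using v by (intro metric.triangle) auto
    also have "ndist V (w s) (z t) \<le> ndist V (w s) (w t) + ndist V (w t) (z t)"
      using v by (intro metric.triangle) auto
    also have "ndist V (z s) (w s) + (ndist V (w s) (w t) + ndist V (w t) (z t)) \<le> \<epsilon>/3 + (\<epsilon>/3 + \<epsilon>/3)"
      using v G(4) s metric.commute[of "w t" "z t"] by (intro add_mono) auto
    finally show ?thesis by simp
  qed
  then show "\<exists>G. openin X G \<and> t \<in> G \<and> G \<subseteq> N \<and> (\<forall>s\<in>G. ndist V (z s) (z t) \<le> \<epsilon>)"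
    using G by (intro exI[of _ G]) auto
qed

end

lemma (in banach_algebra) ndist_mult:
  assumes "a \<in> carrier A" "b \<in> carrier A" "a' \<in> carrier A" "b' \<in> carrier A"
  shows "ndist A (a \<otimes>\<^bsub>A\<^esub> b) (a' \<otimes>\<^bsub>A\<^esub> b') \<le> ndist A a a' * vnorm A b + vnorm A a' * ndist A b b'"
proof -
  note in_A = mult_closed[OF assms(1,2)] mult_closed[OF assms(3,2)] mult_closed[OF assms(3,4)]
  have "a \<otimes>\<^bsub>A\<^esub> b \<ominus>\<^bsub>A\<^esub> a' \<otimes>\<^bsub>A\<^esub> b = (a \<ominus>\<^bsub>A\<^esub> a') \<otimes>\<^bsub>A\<^esub> b"
    using assms in_A by (simp add: minus_eq_smult mult_distrib_right smult_mult_left)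
  then have 1: "ndist A (a \<otimes>\<^bsub>A\<^esub> b) (a' \<otimes>\<^bsub>A\<^esub> b) \<le> ndist A a a' * vnorm A b"
    using assms in_A vnorm_mult[of "a \<ominus>\<^bsub>A\<^esub> a'" b] by (simp add: ndist_eq)
  have "a' \<otimes>\<^bsub>A\<^esub> b \<ominus>\<^bsub>A\<^esub> a' \<otimes>\<^bsub>A\<^esub> b' = a' \<otimes>\<^bsub>A\<^esub> (b \<ominus>\<^bsub>A\<^esub> b')"
    using assms in_A by (simp add: minus_eq_smult mult_distrib_left smult_mult_right)
  then have 2: "ndist A (a' \<otimes>\<^bsub>A\<^esub> b) (a' \<otimes>\<^bsub>A\<^esub> b') \<le> vnorm A a' * ndist A b b'"
    using assms in_A vnorm_mult[of a' "b \<ominus>\<^bsub>A\<^esub> b'"] by (simp add: ndist_eq)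
  show ?thesis using metric.triangle[OF in_A] 1 2 by linarith
qed

lemma (in banach_algebra) continuous_into_mult:
  assumes "continuous_into X A N z" "continuous_into X A N w"
    and "\<And>t. t \<in> N \<Longrightarrow> z t \<in> carrier A" "\<And>t. t \<in> N \<Longrightarrow> w t \<in> carrier A"
  shows "continuous_into X A N (\<lambda>t. z t \<otimes>\<^bsub>A\<^esub> w t)"
proof (rule continuous_intoI)
  fix t and \<epsilon> :: real assume t: "t \<in> N" and e: "\<epsilon> > 0"
  have nn: "0 \<le> vnorm A (z t)" "0 \<le> vnorm A (w t)" using assms(3,4)[OF t] vnorm_nonneg by auto
  \<comment> \<open>The bound \<open>d \<le> 1\<close> gives
    \<open>vnorm A (w s) \<le> vnorm A (w t) + 1\<close> nearby, and so the error is at most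
    \<open>d * (vnorm A (z t) + vnorm A (w t) + 1)\<close>.\<close>
  define d where "d = min 1 (\<epsilon> / (vnorm A (z t) + vnorm A (w t) + 1))"
  have d: "d > 0" "d \<le> 1" using e nn by (auto simp: d_def)
  have "d \<le> \<epsilon> / (vnorm A (z t) + vnorm A (w t) + 1)" by (simp add: d_def)
  then have d': "d * (vnorm A (z t) + vnorm A (w t) + 1) \<le> \<epsilon>" using nn by (simp add: pos_le_divide_eq)
  obtain G where G: "openin X G" "t \<in> G" "G \<subseteq> N" "\<forall>s\<in>G. ndist A (z s) (z t) \<le> d"
    using continuous_intoD[OF assms(1) t d(1)] .
  obtain H where H: "openin X H" "t \<in> H" "H \<subseteq> N" "\<forall>s\<in>H. ndist A (w s) (w t) \<le> d"
    using continuous_intoD[OF assms(2) t d(1)] .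
  have "ndist A (z s \<otimes>\<^bsub>A\<^esub> w s) (z t \<otimes>\<^bsub>A\<^esub> w t) \<le> \<epsilon>" if s: "s \<in> G \<inter> H" for s
  proof -
    have sN: "s \<in> N" using s G(3) by auto
    note v = assms(3)[OF sN] assms(4)[OF sN] assms(3)[OF t] assms(4)[OF t]
    have wd: "ndist A (w s) (w t) \<le> d" and zd: "ndist A (z s) (z t) \<le> d" using G(4) H(4) s by auto
    have "vnorm A (w s) \<le> vnorm A (w t) + 1"
      using abs_vnorm_diff_le[OF v(2,4)] wd d(2) by linarith
    then have "ndist A (z s) (z t) * vnorm A (w s) \<le> d * (vnorm A (w t) + 1)"
      using zd d(1) vnorm_nonneg[OF v(2)] by (intro mult_mono) auto
    moreover have "vnorm A (z t) * ndist A (w s) (w t) \<le> vnorm A (z t) * d"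
      using wd nn(1) by (rule mult_left_mono)
    ultimately have "ndist A (z s \<otimes>\<^bsub>A\<^esub> w s) (z t \<otimes>\<^bsub>A\<^esub> w t) \<le> d * (vnorm A (w t) + 1) + vnorm A (z t) * d"
      using ndist_mult[OF v] by linarith
    also have "\<dots> = d * (vnorm A (z t) + vnorm A (w t) + 1)" by (simp add: algebra_simps)
    finally show ?thesis using d' by linarith
  qed
  then show "\<exists>G. openin X G \<and> t \<in> G \<and> G \<subseteq> N \<and> (\<forall>s\<in>G. ndist A (z s \<otimes>\<^bsub>A\<^esub> w s) (z t \<otimes>\<^bsub>A\<^esub> w t) \<le> \<epsilon>)"
    using G H by (intro exI[of _ "G \<inter> H"]) auto
qed

text \<open>Used to turn the separate continuity of tensor functions into the openness of the
  sections of a relation.\<close>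

lemma (in banach_space) continuous_into_vnorm_greater:
  assumes "continuous_into X V N z" "t \<in> N" "\<And>t. t \<in> N \<Longrightarrow> z t \<in> carrier V" "r < vnorm V (z t)"
  obtains G where "openin X G" "t \<in> G" "G \<subseteq> N" "\<forall>s\<in>G. r < vnorm V (z s)"
proof -
  have "(vnorm V (z t) - r) / 2 > 0" using assms(4) by simp
  then obtain G where G: "openin X G" "t \<in> G" "G \<subseteq> N" "\<forall>s\<in>G. ndist V (z s) (z t) \<le> (vnorm V (z t) - r) / 2"
    using continuous_intoD[OF assms(1,2)] by metis
  have "r < vnorm V (z s)" if "s \<in> G" for s
  proof -
    have "ndist V (z s) (z t) \<le> (vnorm V (z t) - r) / 2" "s \<in> N" using G that by auto
    then show ?thesis using abs_vnorm_diff_le[OF assms(3)[of s] assms(3)[OF assms(2)]] assms(4) by auto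
  qed
  then show thesis using that G by simp
qed

section \<open>Injections into the module universe\<close>

text \<open>An infinite type absorbs its own powers, whereas the triples over a finite type can be
  numbered. The factor \<open>nat\<close> covers the finite case.\<close>

lemma ex_inj_triple: "\<exists>h :: 't \<times> 't \<times> 't \<Rightarrow> nat \<times> 't. inj h"
proof (cases "finite (UNIV :: 't set)")
  case True
  then have "finite (UNIV :: ('t \<times> 't \<times> 't) set)" by (simp add: finite_prod)
  then obtain f :: "'t \<times> 't \<times> 't \<Rightarrow> nat" where "inj f"
    using finite_imp_inj_to_nat_seg by blast
  then have "inj (\<lambda>x. (f x, undefined :: 't))" by (simp add: inj_def)
  then show ?thesis by blast
next
  case False
  have "\<exists>f. inj_on f ((UNIV :: 't set) \<times> (UNIV :: 't set)) \<and> f ` (UNIV \<times> UNIV) \<subseteq> (UNIV :: 't set)"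
    unfolding card_of_ordLeq using card_of_Times_same_infinite[OF False] ordIso_iff_ordLeq by blast
  then obtain f :: "'t \<times> 't \<Rightarrow> 't" where "inj_on f (UNIV \<times> UNIV)" by (elim exE conjE)
  then have f: "f p = f q \<longleftrightarrow> p = q" for p q by (simp add: inj_eq)
  have "inj (\<lambda>x. (0 :: nat, f (fst x, f (snd x))))" by (rule injI) (auto simp: f prod_eq_iff)
  then show ?thesis by blast
qed

text \<open>A function of a natural number and a point is a sequence of functions of a point, and
  such sequences sit in the summand \<open>'t \<Rightarrow> 'a\<close> of the universe.\<close>

lemma ex_inj_function_universe:
  "\<exists>j :: ('t \<times> 't \<times> 't \<Rightarrow> 'a) \<Rightarrow> ('t, 'a, 'x) module_universe. inj j"
proof -
  obtain h :: "'t \<times> 't \<times> 't \<Rightarrow> nat \<times> 't" where h: "inj h" using ex_inj_triple by blast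
  have "inj (\<lambda>(y :: 't \<times> 't \<times> 't \<Rightarrow> 'a) n. Inr (Inl (\<lambda>t. y (inv_into UNIV h (n, t)))) :: complex + ('t \<Rightarrow> 'a) + 'x)"
  proof (rule injI)
    fix y z :: "'t \<times> 't \<times> 't \<Rightarrow> 'a"
    assume "(\<lambda>n. Inr (Inl (\<lambda>t. y (inv_into UNIV h (n, t)))) :: complex + ('t \<Rightarrow> 'a) + 'x) =
      (\<lambda>n. Inr (Inl (\<lambda>t. z (inv_into UNIV h (n, t)))))"
    then have "y (inv_into UNIV h (n, t)) = z (inv_into UNIV h (n, t))" for n t by (simp add: fun_eq_iff)
    then have "y (inv_into UNIV h (h q)) = z (inv_into UNIV h (h q))" for q by (metis prod.collapse)
    then show "y = z" using h by (simp add: fun_eq_iff inv_into_f_f)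
  qed
  then show ?thesis by blast
qed

text \<open>Sequences leave room for one more entry: the section becomes entry 0 and the rest is
  shifted. Hence the direct sum of a module in the universe with the algebra can be placed in the
  universe again.\<close>

lemma inj_pair_universe:
  "inj (\<lambda>(w, b) n. case n of 0 \<Rightarrow> Inr (Inl b) | Suc m \<Rightarrow> (w :: ('t, 'a, 'x) module_universe) m)"
proof (rule injI)
  fix p q :: "('t, 'a, 'x) module_universe \<times> ('t \<Rightarrow> 'a)"
  assume "(\<lambda>(w, b) n. case n of 0 \<Rightarrow> Inr (Inl b) | Suc m \<Rightarrow> w m) p =
     (\<lambda>(w, b) n. case n of 0 \<Rightarrow> Inr (Inl b) | Suc m \<Rightarrow> w m) q"
  then have eq: "(case n of 0 \<Rightarrow> Inr (Inl (snd p)) | Suc m \<Rightarrow> fst p m) =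
      (case n of 0 \<Rightarrow> Inr (Inl (snd q)) | Suc m \<Rightarrow> fst q m)" for n
    by (simp add: case_prod_beta fun_eq_iff)
  have "fst p m = fst q m" for m using eq[of "Suc m"] by simp
  moreover have "snd p = snd q" using eq[of 0] by simp
  ultimately show "p = q" by (simp add: prod_eq_iff fun_eq_iff)
qed

section \<open>Left projectivity implies paracompactness\<close>

text \<open>One chart per point is fixed for good, because the tensor functions are indexed by the
  base points of the charts.\<close>

locale charted_field = unital_field U e C for U :: "('t, 'a) alg_field" and e C +
  fixes N :: "'t \<Rightarrow> 't set" and \<psi> :: "'t \<Rightarrow> 't \<Rightarrow> 'a \<Rightarrow> 'a"
  assumes charts: "p \<in> topspace (base U) \<Longrightarrow> chart U p (N p) (\<psi> p)"
begin

lemma N_open: "p \<in> T \<Longrightarrow> openin (base U) (N p)" and N_self: "p \<in> T \<Longrightarrow> p \<in> N p"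
  and \<psi>_iso: "p \<in> T \<Longrightarrow> t \<in> N p \<Longrightarrow> isometric_algebra_iso (fibre U t) (fibre U p) (\<psi> p t)"
  and \<psi>_self: "p \<in> T \<Longrightarrow> a \<in> carrier (fibre U p) \<Longrightarrow> \<psi> p p a = a"
  using charts by (simp_all add: chart_def)

lemma N_T: "p \<in> T \<Longrightarrow> t \<in> N p \<Longrightarrow> t \<in> T"
  using N_open openin_subset by blast

lemma \<psi>_in: "p \<in> T \<Longrightarrow> t \<in> N p \<Longrightarrow> a \<in> carrier (fibre U t) \<Longrightarrow> \<psi> p t a \<in> carrier (fibre U p)"
  and \<psi>_vnorm: "p \<in> T \<Longrightarrow> t \<in> N p \<Longrightarrow> a \<in> carrier (fibre U t) \<Longrightarrow> vnorm (fibre U p) (\<psi> p t a) = vnorm (fibre U t) a"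
  using iso_closed[OF \<psi>_iso] iso_vnorm[OF \<psi>_iso] by auto

lemma \<psi>_add: "p \<in> T \<Longrightarrow> t \<in> N p \<Longrightarrow> a \<in> carrier (fibre U t) \<Longrightarrow> b \<in> carrier (fibre U t) \<Longrightarrow>
    \<psi> p t (a \<oplus>\<^bsub>fibre U t\<^esub> b) = \<psi> p t a \<oplus>\<^bsub>fibre U p\<^esub> \<psi> p t b"
  and \<psi>_smult: "p \<in> T \<Longrightarrow> t \<in> N p \<Longrightarrow> a \<in> carrier (fibre U t) \<Longrightarrow>
    \<psi> p t (c \<odot>\<^bsub>fibre U t\<^esub> a) = c \<odot>\<^bsub>fibre U p\<^esub> \<psi> p t a"
  and \<psi>_mult: "p \<in> T \<Longrightarrow> t \<in> N p \<Longrightarrow> a \<in> carrier (fibre U t) \<Longrightarrow> b \<in> carrier (fibre U t) \<Longrightarrow>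
    \<psi> p t (a \<otimes>\<^bsub>fibre U t\<^esub> b) = \<psi> p t a \<otimes>\<^bsub>fibre U p\<^esub> \<psi> p t b"
  by (rule linear_map_add[OF iso_linear[OF \<psi>_iso]] linear_map_smult[OF iso_linear[OF \<psi>_iso]]
      iso_mult[OF \<psi>_iso]; assumption)+

text \<open>A substitute for the projective tensor product of the unitization of the algebra with the
  algebra itself: \<open>a \<otimes> b\<close> is represented by the function \<open>(p, s, t) \<mapsto> a s \<cdot> b t\<close>, for
  \<open>s\<close> and \<open>t\<close> in a common chart at \<open>p\<close>, where both factors are transported to the fibre at \<open>p\<close>.
  It remembers the product (for \<open>s = t\<close>) and the decay in \<open>t\<close>.\<close>

definition triples :: "('t \<times> 't \<times> 't) set" where
  "triples = {(p, s, t). p \<in> T \<and> s \<in> N p \<and> t \<in> N p}"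

text \<open>The clauses are stable under uniform limits and under the action, and they hold for all
  tensors \<open>1 \<otimes> b\<close>. The diagonal clause ties all charts to one element of the
  algebra, so that the product lands in the algebra; the decay in \<open>t\<close> is uniform in the
  chart and in \<open>s\<close>; separate continuity is what makes the sections of the relation
  open.\<close>

definition tensor_functions :: "('t \<times> 't \<times> 't \<Rightarrow> 'a) set" where
  "tensor_functions =
     {y \<in> (\<Pi>\<^sub>E j\<in>triples. carrier (fibre U (fst j))).
        (\<exists>B. \<forall>j\<in>triples. vnorm (fibre U (fst j)) (y j) \<le> B) \<and>
        (\<exists>b\<in>carrier \<A>. \<forall>p\<in>T. \<forall>s\<in>N p. y (p, s, s) = \<psi> p s (b s)) \<and>
        (\<forall>\<epsilon>>0. \<exists>K. compactin (base U) K \<and> (\<forall>p\<in>T. \<forall>s\<in>N p. \<forall>t\<in>N p - K. vnorm (fibre U p) (y (p, s, t)) \<le> \<epsilon>)) \<and>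
        (\<forall>p\<in>T. \<forall>s\<in>N p. continuous_into (base U) (fibre U p) (N p) (\<lambda>t. y (p, s, t))) \<and>
        (\<forall>p\<in>T. \<forall>t\<in>N p. continuous_into (base U) (fibre U p) (N p) (\<lambda>s. y (p, s, t)))}"

definition tensor_space :: "('t \<times> 't \<times> 't \<Rightarrow> 'a) cnormed" where
  "tensor_space =
     \<lparr>carrier = tensor_functions,
      monoid.mult = (\<lambda>x y. undefined),
      one = undefined,
      zero = (\<lambda>j\<in>triples. \<zero>\<^bsub>fibre U (fst j)\<^esub>),
      add = (\<lambda>x y. \<lambda>j\<in>triples. x j \<oplus>\<^bsub>fibre U (fst j)\<^esub> y j),
      smult = (\<lambda>c x. \<lambda>j\<in>triples. c \<odot>\<^bsub>fibre U (fst j)\<^esub> x j),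
      vnorm = (\<lambda>x. Sup (insert 0 ((\<lambda>j. vnorm (fibre U (fst j)) (x j)) ` triples)))\<rparr>"

definition tensor_act :: "('t \<Rightarrow> 'a) \<Rightarrow> ('t \<times> 't \<times> 't \<Rightarrow> 'a) \<Rightarrow> 't \<times> 't \<times> 't \<Rightarrow> 'a" where
  "tensor_act a y = (\<lambda>j\<in>triples. \<psi> (fst j) (fst (snd j)) (a (fst (snd j))) \<otimes>\<^bsub>fibre U (fst j)\<^esub> y j)"

definition tensor_product :: "('t \<times> 't \<times> 't \<Rightarrow> 'a) \<Rightarrow> 't \<Rightarrow> 'a" where
  "tensor_product y = (\<lambda>p\<in>T. y (p, p, p))"

text \<open>The tensor \<open>1 \<otimes> b\<close>, where 1 is the identity of the unitization:
  constant in \<open>s\<close>, and a linear splitting of the product that in general does not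
  respect the action.\<close>

definition one_tensor :: "('t \<Rightarrow> 'a) \<Rightarrow> 't \<times> 't \<times> 't \<Rightarrow> 'a" where
  "one_tensor b = (\<lambda>j\<in>triples. \<psi> (fst j) (snd (snd j)) (b (snd (snd j))))"

lemma triples_iff [simp]: "(p, s, t) \<in> triples \<longleftrightarrow> p \<in> T \<and> s \<in> N p \<and> t \<in> N p"
  by (simp add: triples_def)

lemma triplesD: "\<forall>j\<in>triples. Q j \<Longrightarrow> p \<in> T \<Longrightarrow> s \<in> N p \<Longrightarrow> t \<in> N p \<Longrightarrow> Q (p, s, t)"
  by simp

lemma tensor_space_simps:
  "carrier tensor_space = tensor_functions"
  "\<zero>\<^bsub>tensor_space\<^esub> = (\<lambda>j\<in>triples. \<zero>\<^bsub>fibre U (fst j)\<^esub>)"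
  "x \<oplus>\<^bsub>tensor_space\<^esub> y = (\<lambda>j\<in>triples. x j \<oplus>\<^bsub>fibre U (fst j)\<^esub> y j)"
  "c \<odot>\<^bsub>tensor_space\<^esub> x = (\<lambda>j\<in>triples. c \<odot>\<^bsub>fibre U (fst j)\<^esub> x j)"
  "vnorm tensor_space x = Sup (insert 0 ((\<lambda>j. vnorm (fibre U (fst j)) (x j)) ` triples))"
  by (simp_all add: tensor_space_def)

lemma tensor_functionsI:
  assumes ext: "y \<in> extensional triples"
    and "\<And>p s t. p \<in> T \<Longrightarrow> s \<in> N p \<Longrightarrow> t \<in> N p \<Longrightarrow> y (p, s, t) \<in> carrier (fibre U p)"
    and "\<And>p s t. p \<in> T \<Longrightarrow> s \<in> N p \<Longrightarrow> t \<in> N p \<Longrightarrow> vnorm (fibre U p) (y (p, s, t)) \<le> B"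
    and "b \<in> carrier \<A>" "\<And>p s. p \<in> T \<Longrightarrow> s \<in> N p \<Longrightarrow> y (p, s, s) = \<psi> p s (b s)"
    and "\<And>\<epsilon>. \<epsilon> > 0 \<Longrightarrow> \<exists>K. compactin (base U) K \<and>
      (\<forall>p\<in>T. \<forall>s\<in>N p. \<forall>t\<in>N p - K. vnorm (fibre U p) (y (p, s, t)) \<le> \<epsilon>)"
    and "\<And>p s. p \<in> T \<Longrightarrow> s \<in> N p \<Longrightarrow> continuous_into (base U) (fibre U p) (N p) (\<lambda>t. y (p, s, t))"
    and "\<And>p t. p \<in> T \<Longrightarrow> t \<in> N p \<Longrightarrow> continuous_into (base U) (fibre U p) (N p) (\<lambda>s. y (p, s, t))"
  shows "y \<in> tensor_functions"
proof -
  have "y \<in> (\<Pi>\<^sub>E j\<in>triples. carrier (fibre U (fst j)))"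
    using ext assms(2) by (auto simp: PiE_iff triples_def)
  moreover have "\<exists>B. \<forall>j\<in>triples. vnorm (fibre U (fst j)) (y j) \<le> B"
    using assms(3) by (auto simp: triples_def)
  moreover have "\<exists>b\<in>carrier \<A>. \<forall>p\<in>T. \<forall>s\<in>N p. y (p, s, s) = \<psi> p s (b s)"
    using assms(4,5) by (intro bexI[of _ b]) auto
  ultimately show ?thesis using assms(6-8) by (simp add: tensor_functions_def)
qed

lemma
  assumes y: "y \<in> tensor_functions"
  shows tensor_extensional: "y \<in> extensional triples"
    and tensor_in: "p \<in> T \<Longrightarrow> s \<in> N p \<Longrightarrow> t \<in> N p \<Longrightarrow> y (p, s, t) \<in> carrier (fibre U p)"
    and tensor_bounded: "\<exists>B. \<forall>j\<in>triples. vnorm (fibre U (fst j)) (y j) \<le> B"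
    and tensor_diagonal: "\<exists>b\<in>carrier \<A>. \<forall>p\<in>T. \<forall>s\<in>N p. y (p, s, s) = \<psi> p s (b s)"
    and tensor_vanishes: "\<epsilon> > 0 \<Longrightarrow> \<exists>K. compactin (base U) K \<and>
      (\<forall>p\<in>T. \<forall>s\<in>N p. \<forall>t\<in>N p - K. vnorm (fibre U p) (y (p, s, t)) \<le> \<epsilon>)"
    and tensor_continuous_right: "p \<in> T \<Longrightarrow> s \<in> N p \<Longrightarrow> continuous_into (base U) (fibre U p) (N p) (\<lambda>t. y (p, s, t))"
    and tensor_continuous_left: "p \<in> T \<Longrightarrow> t \<in> N p \<Longrightarrow> continuous_into (base U) (fibre U p) (N p) (\<lambda>s. y (p, s, t))"
proof -
  show "y \<in> extensional triples" using y by (simp add: tensor_functions_def PiE_iff)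
  have "y \<in> (\<Pi>\<^sub>E j\<in>triples. carrier (fibre U (fst j)))" using y by (simp add: tensor_functions_def)
  from PiE_mem[OF this, of "(p, s, t)"]
  show "p \<in> T \<Longrightarrow> s \<in> N p \<Longrightarrow> t \<in> N p \<Longrightarrow> y (p, s, t) \<in> carrier (fibre U p)" by simp
qed (use y in \<open>simp_all add: tensor_functions_def\<close>)

lemma tensor_eqI:
  assumes "y \<in> tensor_functions" "z \<in> tensor_functions"
    and "\<And>p s t. p \<in> T \<Longrightarrow> s \<in> N p \<Longrightarrow> t \<in> N p \<Longrightarrow> y (p, s, t) = z (p, s, t)"
  shows "y = z"
  by (rule extensionalityI[OF tensor_extensional[OF assms(1)] tensor_extensional[OF assms(2)]])
    (use assms(3) in \<open>auto simp: triples_def\<close>)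

lemma tensor_bound:
  assumes "y \<in> tensor_functions"
  obtains B where "\<And>p s t. p \<in> T \<Longrightarrow> s \<in> N p \<Longrightarrow> t \<in> N p \<Longrightarrow> vnorm (fibre U p) (y (p, s, t)) \<le> B"
proof -
  obtain B where "\<forall>j\<in>triples. vnorm (fibre U (fst j)) (y j) \<le> B" using tensor_bounded[OF assms] ..
  from triplesD[OF this] show thesis by (intro that[of B]) simp
qed

lemma one_tensor_in:
  assumes b: "b \<in> carrier \<A>"
  shows "one_tensor b \<in> tensor_functions"
proof (rule tensor_functionsI)
  have bs: "b \<in> sections U" using b by (simp add: field_algebra_simps)
  show "one_tensor b \<in> extensional triples" by (simp add: one_tensor_def)
  show "one_tensor b (p, s, t) \<in> carrier (fibre U p)" if "p \<in> T" "s \<in> N p" "t \<in> N p" for p s t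
    using that \<psi>_in algebra_in[OF b] N_T by (simp add: one_tensor_def)
  have norm: "vnorm (fibre U p) (one_tensor b (p, s, t)) = vnorm (fibre U t) (b t)"
    if "p \<in> T" "s \<in> N p" "t \<in> N p" for p s t
    using that \<psi>_vnorm algebra_in[OF b] N_T by (simp add: one_tensor_def)
  show "vnorm (fibre U p) (one_tensor b (p, s, t)) \<le> vnorm \<A> b" if "p \<in> T" "s \<in> N p" "t \<in> N p" for p s t
    unfolding norm[OF that] by (rule algebra_vnorm_ge[OF b N_T[OF that(1,3)]])
  show "b \<in> carrier \<A>" by fact
  show "one_tensor b (p, s, s) = \<psi> p s (b s)" if "p \<in> T" "s \<in> N p" for p s
    using that by (simp add: one_tensor_def)
  show "\<exists>K. compactin (base U) K \<and>
      (\<forall>p\<in>T. \<forall>s\<in>N p. \<forall>t\<in>N p - K. vnorm (fibre U p) (one_tensor b (p, s, t)) \<le> \<epsilon>)" if "\<epsilon> > 0" for \<epsilon>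
  proof -
    obtain K where K: "compactin (base U) K" "\<And>t. t \<in> T \<Longrightarrow> t \<notin> K \<Longrightarrow> vnorm (fibre U t) (b t) < \<epsilon>"
      using algebra_small[OF b \<open>\<epsilon> > 0\<close>] by metis
    show ?thesis
    proof (intro exI[of _ K] conjI ballI K(1))
      fix p s t assume "p \<in> T" "s \<in> N p" "t \<in> N p - K"
      then show "vnorm (fibre U p) (one_tensor b (p, s, t)) \<le> \<epsilon>"
        using norm[of p s t] K(2)[of t] N_T[of p t] by auto
    qed
  qed
  show "continuous_into (base U) (fibre U p) (N p) (\<lambda>t. one_tensor b (p, s, t))" if "p \<in> T" "s \<in> N p" for p s
    by (rule continuous_into_cong[OF chart_continuous_into[OF charts[OF that(1)] bs]])
      (use that in \<open>simp add: one_tensor_def\<close>)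
  show "continuous_into (base U) (fibre U p) (N p) (\<lambda>s. one_tensor b (p, s, t))" if pt: "p \<in> T" "t \<in> N p" for p t
  proof -
    interpret P: banach_space "fibre U p" by (rule banach_space_fibre[OF pt(1)])
    show ?thesis
      by (rule continuous_into_cong[OF P.continuous_into_const[OF N_open[OF pt(1)], of "\<psi> p t (b t)"]])
        (use pt \<psi>_in algebra_in[OF b] N_T in \<open>simp_all add: one_tensor_def\<close>)
  qed
qed

text \<open>The action multiplies in the variable \<open>s\<close> only, so the decay in
  \<open>t\<close> survives with the factor \<open>vnorm \<A> a\<close>. On the diagonal the charts
  are multiplicative, and the element \<open>b\<close> is replaced by the product of
  \<open>a\<close> and \<open>b\<close>.\<close>

lemma tensor_act_in:
  assumes a: "a \<in> carrier \<A>" and y: "y \<in> tensor_functions"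
  shows "tensor_act a y \<in> tensor_functions"
proof -
  have as: "a \<in> sections U" using a by (simp add: field_algebra_simps)
  interpret A: banach_space \<A> by (rule banach_space_algebra)
  have ev: "tensor_act a y (p, s, t) = \<psi> p s (a s) \<otimes>\<^bsub>fibre U p\<^esub> y (p, s, t)"
    if "p \<in> T" "s \<in> N p" "t \<in> N p" for p s t using that by (simp add: tensor_act_def)
  have \<psi>a: "\<psi> p s (a s) \<in> carrier (fibre U p)" if "p \<in> T" "s \<in> N p" for p s
    using that \<psi>_in algebra_in[OF a] N_T by simp
  have norm: "vnorm (fibre U p) (tensor_act a y (p, s, t)) \<le> vnorm \<A> a * vnorm (fibre U p) (y (p, s, t))"
    if pst: "p \<in> T" "s \<in> N p" "t \<in> N p" for p s t
  proof -
    interpret P: banach_algebra "fibre U p" using banach_fibre[OF pst(1)] .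
    have "vnorm (fibre U p) (tensor_act a y (p, s, t)) \<le>
        vnorm (fibre U p) (\<psi> p s (a s)) * vnorm (fibre U p) (y (p, s, t))"
      unfolding ev[OF pst] using \<psi>a[OF pst(1,2)] tensor_in[OF y pst] by (rule P.vnorm_mult)
    also have "\<dots> \<le> vnorm \<A> a * vnorm (fibre U p) (y (p, s, t))"
      using algebra_vnorm_ge[OF a N_T[OF pst(1,2)]] \<psi>_vnorm[OF pst(1,2) algebra_in[OF a N_T[OF pst(1,2)]]]
        P.vnorm_nonneg[OF tensor_in[OF y pst]] by (intro mult_right_mono) auto
    finally show ?thesis .
  qed
  obtain B where B: "\<And>p s t. p \<in> T \<Longrightarrow> s \<in> N p \<Longrightarrow> t \<in> N p \<Longrightarrow> vnorm (fibre U p) (y (p, s, t)) \<le> B"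
    using tensor_bound[OF y] by blast
  obtain b where b: "b \<in> carrier \<A>" "\<forall>p\<in>T. \<forall>s\<in>N p. y (p, s, s) = \<psi> p s (b s)"
    using tensor_diagonal[OF y] ..
  show ?thesis
  proof (rule tensor_functionsI)
    show "tensor_act a y \<in> extensional triples" by (simp add: tensor_act_def)
    show "tensor_act a y (p, s, t) \<in> carrier (fibre U p)" if pst: "p \<in> T" "s \<in> N p" "t \<in> N p" for p s t
    proof -
      interpret P: banach_algebra "fibre U p" using banach_fibre[OF pst(1)] .
      show ?thesis unfolding ev[OF pst] using \<psi>a[OF pst(1,2)] tensor_in[OF y pst] by (rule P.mult_closed)
    qed
    show "vnorm (fibre U p) (tensor_act a y (p, s, t)) \<le> vnorm \<A> a * B" if pst: "p \<in> T" "s \<in> N p" "t \<in> N p" for p s t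
      using norm[OF pst] mult_left_mono[OF B[OF pst] A.vnorm_nonneg[OF a]] by linarith
    show "a \<otimes>\<^bsub>\<A>\<^esub> b \<in> carrier \<A>" by (rule algebra_mult[OF a b(1)])
    show "tensor_act a y (p, s, s) = \<psi> p s ((a \<otimes>\<^bsub>\<A>\<^esub> b) s)" if "p \<in> T" "s \<in> N p" for p s
      using that b(2) N_T[OF that] algebra_in[OF a] algebra_in[OF b(1)] by (simp add: ev algebra_apply \<psi>_mult)
    show "\<exists>K. compactin (base U) K \<and>
      (\<forall>p\<in>T. \<forall>s\<in>N p. \<forall>t\<in>N p - K. vnorm (fibre U p) (tensor_act a y (p, s, t)) \<le> \<epsilon>)" if \<epsilon>: "\<epsilon> > 0" for \<epsilon>
    proof -
      have "\<epsilon> / (vnorm \<A> a + 1) > 0" using \<epsilon> A.vnorm_nonneg[OF a] by simp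
      from tensor_vanishes[OF y this] obtain K where K: "compactin (base U) K"
        "\<forall>p\<in>T. \<forall>s\<in>N p. \<forall>t\<in>N p - K. vnorm (fibre U p) (y (p, s, t)) \<le> \<epsilon> / (vnorm \<A> a + 1)"
        by (elim exE conjE)
      show ?thesis
      proof (intro exI[of _ K] conjI ballI K(1))
        fix p s t assume pst: "p \<in> T" "s \<in> N p" "t \<in> N p - K"
        then have t: "t \<in> N p" by auto
        interpret P: banach_algebra "fibre U p" using banach_fibre[OF pst(1)] .
        have "vnorm \<A> a * vnorm (fibre U p) (y (p, s, t)) \<le> (vnorm \<A> a + 1) * (\<epsilon> / (vnorm \<A> a + 1))"
          using K(2) pst A.vnorm_nonneg[OF a] P.vnorm_nonneg[OF tensor_in[OF y pst(1,2) t]] by (intro mult_mono) auto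
        also have "\<dots> = \<epsilon>" using A.vnorm_nonneg[OF a] by simp
        finally show "vnorm (fibre U p) (tensor_act a y (p, s, t)) \<le> \<epsilon>" using norm[OF pst(1,2) t] by linarith
      qed
    qed
    show "continuous_into (base U) (fibre U p) (N p) (\<lambda>t. tensor_act a y (p, s, t))" if ps: "p \<in> T" "s \<in> N p" for p s
    proof -
      interpret P: banach_algebra "fibre U p" using banach_fibre[OF ps(1)] .
      have "continuous_into (base U) (fibre U p) (N p) (\<lambda>t. \<psi> p s (a s) \<otimes>\<^bsub>fibre U p\<^esub> y (p, s, t))"
        by (rule P.continuous_into_mult[OF P.continuous_into_const[OF N_open[OF ps(1)] \<psi>a[OF ps]]
              tensor_continuous_right[OF y ps] \<psi>a[OF ps] tensor_in[OF y ps]])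
      then show ?thesis by (rule continuous_into_cong) (use ps ev in simp)
    qed
    show "continuous_into (base U) (fibre U p) (N p) (\<lambda>s. tensor_act a y (p, s, t))" if pt: "p \<in> T" "t \<in> N p" for p t
    proof -
      interpret P: banach_algebra "fibre U p" using banach_fibre[OF pt(1)] .
      have "continuous_into (base U) (fibre U p) (N p) (\<lambda>s. \<psi> p s (a s) \<otimes>\<^bsub>fibre U p\<^esub> y (p, s, t))"
        by (rule P.continuous_into_mult[OF chart_continuous_into[OF charts[OF pt(1)] as]
              tensor_continuous_left[OF y pt] \<psi>a[OF pt(1)] tensor_in[OF y pt(1) _ pt(2)]])
      then show ?thesis by (rule continuous_into_cong) (use pt ev in simp)
    qed
  qed
qed

text \<open>Sums and scalar multiples are treated at once; they are recovered with
  \<open>c = 1\<close> and with \<open>y\<close> zero.\<close>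

lemma tensor_add_smult_in:
  assumes x: "x \<in> tensor_functions" and y: "y \<in> tensor_functions"
  shows "(\<lambda>j\<in>triples. c \<odot>\<^bsub>fibre U (fst j)\<^esub> x j \<oplus>\<^bsub>fibre U (fst j)\<^esub> y j) \<in> tensor_functions" (is "?z \<in> _")
proof -
  interpret A: banach_space \<A> by (rule banach_space_algebra)
  have ev: "?z (p, s, t) = c \<odot>\<^bsub>fibre U p\<^esub> x (p, s, t) \<oplus>\<^bsub>fibre U p\<^esub> y (p, s, t)"
    if "p \<in> T" "s \<in> N p" "t \<in> N p" for p s t using that by simp
  have norm: "vnorm (fibre U p) (?z (p, s, t)) \<le> cmod c * vnorm (fibre U p) (x (p, s, t)) + vnorm (fibre U p) (y (p, s, t))"
    if pst: "p \<in> T" "s \<in> N p" "t \<in> N p" for p s t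
  proof -
    interpret P: banach_space "fibre U p" by (rule banach_space_fibre[OF pst(1)])
    show ?thesis unfolding ev[OF pst]
      using P.vnorm_triangle[of "c \<odot>\<^bsub>fibre U p\<^esub> x (p, s, t)" "y (p, s, t)"] tensor_in[OF x pst] tensor_in[OF y pst]
      by (simp add: P.vnorm_smult)
  qed
  obtain B where B: "\<And>p s t. p \<in> T \<Longrightarrow> s \<in> N p \<Longrightarrow> t \<in> N p \<Longrightarrow> vnorm (fibre U p) (x (p, s, t)) \<le> B"
    using tensor_bound[OF x] by blast
  obtain B' where B': "\<And>p s t. p \<in> T \<Longrightarrow> s \<in> N p \<Longrightarrow> t \<in> N p \<Longrightarrow> vnorm (fibre U p) (y (p, s, t)) \<le> B'"
    using tensor_bound[OF y] by blast
  obtain b where b: "b \<in> carrier \<A>" "\<forall>p\<in>T. \<forall>s\<in>N p. x (p, s, s) = \<psi> p s (b s)" using tensor_diagonal[OF x] ..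
  obtain b' where b': "b' \<in> carrier \<A>" "\<forall>p\<in>T. \<forall>s\<in>N p. y (p, s, s) = \<psi> p s (b' s)" using tensor_diagonal[OF y] ..
  show ?thesis
  proof (rule tensor_functionsI)
    show "?z \<in> extensional triples" by simp
    show "?z (p, s, t) \<in> carrier (fibre U p)" if pst: "p \<in> T" "s \<in> N p" "t \<in> N p" for p s t
    proof -
      interpret P: banach_space "fibre U p" by (rule banach_space_fibre[OF pst(1)])
      show ?thesis unfolding ev[OF pst] using tensor_in[OF x pst] tensor_in[OF y pst] by simp
    qed
    show "vnorm (fibre U p) (?z (p, s, t)) \<le> cmod c * B + B'" if pst: "p \<in> T" "s \<in> N p" "t \<in> N p" for p s t
      using norm[OF pst] mult_left_mono[OF B[OF pst] norm_ge_zero[of c]] B'[OF pst] by linarith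
    show "c \<odot>\<^bsub>\<A>\<^esub> b \<oplus>\<^bsub>\<A>\<^esub> b' \<in> carrier \<A>" using b(1) b'(1) by simp
    show "?z (p, s, s) = \<psi> p s ((c \<odot>\<^bsub>\<A>\<^esub> b \<oplus>\<^bsub>\<A>\<^esub> b') s)" if ps: "p \<in> T" "s \<in> N p" for p s
    proof -
      interpret S: banach_space "fibre U s" by (rule banach_space_fibre[OF N_T[OF ps]])
      show ?thesis
        unfolding ev[OF ps ps(2)]
        using ps b(2) b'(2) N_T[OF ps] algebra_in[OF b(1)] algebra_in[OF b'(1)]
        by (simp add: algebra_apply \<psi>_add \<psi>_smult)
    qed
    show "\<exists>K. compactin (base U) K \<and>
      (\<forall>p\<in>T. \<forall>s\<in>N p. \<forall>t\<in>N p - K. vnorm (fibre U p) (?z (p, s, t)) \<le> \<epsilon>)" if \<epsilon>: "\<epsilon> > 0" for \<epsilon>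
    proof -
      have e1: "\<epsilon> / 2 / (cmod c + 1) > 0" and e2: "\<epsilon>/2 > 0" using \<epsilon> by (simp_all add: add_nonneg_pos)
      from tensor_vanishes[OF x e1] obtain K where K: "compactin (base U) K"
        "\<forall>p\<in>T. \<forall>s\<in>N p. \<forall>t\<in>N p - K. vnorm (fibre U p) (x (p, s, t)) \<le> \<epsilon> / 2 / (cmod c + 1)"
        by (elim exE conjE)
      from tensor_vanishes[OF y e2] obtain K' where K': "compactin (base U) K'"
        "\<forall>p\<in>T. \<forall>s\<in>N p. \<forall>t\<in>N p - K'. vnorm (fibre U p) (y (p, s, t)) \<le> \<epsilon> / 2"
        by (elim exE conjE)
      show ?thesis
      proof (intro exI[of _ "K \<union> K'"] conjI ballI compactin_Un K(1) K'(1))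
        fix p s t assume pst: "p \<in> T" "s \<in> N p" "t \<in> N p - (K \<union> K')"
        then have t: "t \<in> N p" by auto
        interpret P: banach_space "fibre U p" by (rule banach_space_fibre[OF pst(1)])
        have "cmod c * vnorm (fibre U p) (x (p, s, t)) \<le> (cmod c + 1) * ((\<epsilon> / 2) / (cmod c + 1))"
          using K(2) pst P.vnorm_nonneg[OF tensor_in[OF x pst(1,2) t]] by (intro mult_mono) auto
        also have "\<dots> = \<epsilon> / 2"
        proof -
          have "cmod c + 1 \<noteq> 0" using norm_ge_zero[of c] by linarith
          then show ?thesis by (metis times_divide_eq_right nonzero_mult_div_cancel_left)
        qed
        finally have "cmod c * vnorm (fibre U p) (x (p, s, t)) \<le> \<epsilon> / 2" .
        moreover have "vnorm (fibre U p) (y (p, s, t)) \<le> \<epsilon> / 2" using K'(2) pst by auto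
        ultimately show "vnorm (fibre U p) (?z (p, s, t)) \<le> \<epsilon>" using norm[OF pst(1,2) t] by linarith
      qed
    qed
    show "continuous_into (base U) (fibre U p) (N p) (\<lambda>t. ?z (p, s, t))" if ps: "p \<in> T" "s \<in> N p" for p s
    proof -
      interpret P: banach_space "fibre U p" by (rule banach_space_fibre[OF ps(1)])
      have "continuous_into (base U) (fibre U p) (N p) (\<lambda>t. c \<odot>\<^bsub>fibre U p\<^esub> x (p, s, t) \<oplus>\<^bsub>fibre U p\<^esub> y (p, s, t))"
        using tensor_in[OF x ps] tensor_in[OF y ps]
        by (intro P.continuous_into_add P.continuous_into_smult tensor_continuous_right[OF x ps]
            tensor_continuous_right[OF y ps]) auto
      then show ?thesis by (rule continuous_into_cong) (use ps in simp)
    qed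
    show "continuous_into (base U) (fibre U p) (N p) (\<lambda>s. ?z (p, s, t))" if pt: "p \<in> T" "t \<in> N p" for p t
    proof -
      interpret P: banach_space "fibre U p" by (rule banach_space_fibre[OF pt(1)])
      have "continuous_into (base U) (fibre U p) (N p) (\<lambda>s. c \<odot>\<^bsub>fibre U p\<^esub> x (p, s, t) \<oplus>\<^bsub>fibre U p\<^esub> y (p, s, t))"
        using tensor_in[OF x pt(1) _ pt(2)] tensor_in[OF y pt(1) _ pt(2)]
        by (intro P.continuous_into_add P.continuous_into_smult tensor_continuous_left[OF x pt]
            tensor_continuous_left[OF y pt]) auto
      then show ?thesis by (rule continuous_into_cong) (use pt in simp)
    qed
  qed
qed

lemma tensor_product_eq:
  assumes "b \<in> carrier \<A>" "\<forall>p\<in>T. \<forall>s\<in>N p. y (p, s, s) = \<psi> p s (b s)"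
  shows "tensor_product y = b"
proof (rule extensionalityI[of _ T])
  show "tensor_product y \<in> extensional T" by (simp add: tensor_product_def)
  show "b \<in> extensional T" by (rule algebra_extensional[OF assms(1)])
  show "tensor_product y p = b p" if "p \<in> T" for p
    using that assms(2) N_self[OF that] \<psi>_self algebra_in[OF assms(1)] by (simp add: tensor_product_def)
qed

lemma tensor_product_in:
  assumes "y \<in> tensor_functions"
  shows "tensor_product y \<in> carrier \<A>" "p \<in> T \<Longrightarrow> s \<in> N p \<Longrightarrow> y (p, s, s) = \<psi> p s (tensor_product y s)"
proof -
  obtain b where b: "b \<in> carrier \<A>" "\<forall>p\<in>T. \<forall>s\<in>N p. y (p, s, s) = \<psi> p s (b s)" using tensor_diagonal[OF assms] ..
  show "tensor_product y \<in> carrier \<A>" "p \<in> T \<Longrightarrow> s \<in> N p \<Longrightarrow> y (p, s, s) = \<psi> p s (tensor_product y s)"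
    using b tensor_product_eq[OF b] by simp_all
qed

text \<open>Each clause survives uniform limits. For the diagonal, the products of the approximants
  converge uniformly to the product of \<open>y\<close>, which is therefore in the algebra; as
  charts are isometric, it also represents the diagonal of \<open>y\<close> in every chart.\<close>

lemma tensor_closed:
  assumes y: "y \<in> (\<Pi>\<^sub>E j\<in>triples. carrier (fibre U (fst j)))"
    and lim: "\<And>\<epsilon>. \<epsilon> > 0 \<Longrightarrow> \<exists>x\<in>tensor_functions. \<forall>j\<in>triples. ndist (fibre U (fst j)) (y j) (x j) \<le> \<epsilon>"
  shows "y \<in> tensor_functions"
proof -
  have y_in: "y (p, s, t) \<in> carrier (fibre U p)" if "p \<in> T" "s \<in> N p" "t \<in> N p" for p s t
    using PiE_mem[OF y, of "(p, s, t)"] that by simp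
  have norm: "vnorm (fibre U p) (y (p, s, t)) \<le> vnorm (fibre U p) (x (p, s, t)) + \<epsilon>"
    if x: "x \<in> tensor_functions" "\<forall>j\<in>triples. ndist (fibre U (fst j)) (y j) (x j) \<le> \<epsilon>"
      and pst: "p \<in> T" "s \<in> N p" "t \<in> N p" for x \<epsilon> p s t
  proof -
    interpret P: banach_space "fibre U p" by (rule banach_space_fibre[OF pst(1)])
    have "ndist (fibre U p) (y (p, s, t)) (x (p, s, t)) \<le> \<epsilon>" using triplesD[OF x(2) pst] by simp
    then show ?thesis using P.abs_vnorm_diff_le[OF y_in[OF pst] tensor_in[OF x(1) pst]] by linarith
  qed
  define b where "b = tensor_product y"
  have yT: "b p = y (p, p, p)" if "p \<in> T" for p using that by (simp add: b_def tensor_product_def)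
  have b_close: "\<exists>x\<in>carrier \<A>. \<forall>t\<in>T. ndist (fibre U t) (b t) (x t) \<le> \<epsilon>" if "\<epsilon> > 0" for \<epsilon>
  proof -
    from lim[OF that] obtain x where x: "x \<in> tensor_functions"
      "\<forall>j\<in>triples. ndist (fibre U (fst j)) (y j) (x j) \<le> \<epsilon>" ..
    have "ndist (fibre U t) (b t) (tensor_product x t) \<le> \<epsilon>" if t: "t \<in> T" for t
    proof -
      have "(t, t, t) \<in> triples" using N_self[OF t] t by simp
      from bspec[OF x(2) this] show ?thesis using t by (simp add: yT tensor_product_def)
    qed
    then show ?thesis using tensor_product_in(1)[OF x(1)] by (intro bexI[of _ "tensor_product x"]) auto
  qed
  have b_in: "b t \<in> carrier (fibre U t)" if "t \<in> T" for t using y_in[of t t t] N_self[OF that] that by (simp add: yT)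
  have bA: "b \<in> carrier \<A>"
  proof -
    have bs: "b \<in> sections U"
    proof (rule section_uniform_limit)
      show "b \<in> section_space (fibre U) T" using b_in by (auto simp: PiE_iff b_def tensor_product_def)
      show "\<exists>x'\<in>sections U. \<forall>s\<in>T. ndist (fibre U s) (b s) (x' s) \<le> \<epsilon>" if "\<epsilon> > 0" for \<epsilon>
        using b_close[OF that] by (auto simp: field_algebra_simps(1))
    qed
    have "vanishes_at_infinity (base U) (\<lambda>t. vnorm (fibre U t) (b t))"
      unfolding vanishes_at_infinity_def
    proof (intro allI impI)
      fix \<epsilon> :: real assume "\<epsilon> > 0"
      then have e2: "\<epsilon>/2 > 0" by simp
      from b_close[OF e2] obtain x where x: "x \<in> carrier \<A>" "\<forall>t\<in>T. ndist (fibre U t) (b t) (x t) \<le> \<epsilon>/2" ..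
      obtain K where K: "compactin (base U) K" "\<And>t. t \<in> T \<Longrightarrow> t \<notin> K \<Longrightarrow> vnorm (fibre U t) (x t) < \<epsilon>/2"
        using algebra_small[OF x(1) e2] by metis
      have "\<bar>vnorm (fibre U t) (b t)\<bar> < \<epsilon>" if t: "t \<in> T - K" for t
      proof -
        have tT: "t \<in> T" using t by auto
        interpret F: banach_space "fibre U t" using banach_space_fibre[OF tT] .
        show ?thesis
          using F.abs_vnorm_diff_le[OF b_in[OF tT] algebra_in[OF x(1) tT]] bspec[OF x(2) tT] K(2)[OF tT] t
            F.vnorm_nonneg[OF b_in[OF tT]] by auto
      qed
      then show "\<exists>K. compactin (base U) K \<and> (\<forall>t\<in>T - K. \<bar>vnorm (fibre U t) (b t)\<bar> < \<epsilon>)"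
        using K(1) by (intro exI[of _ K]) simp
    qed
    then show ?thesis using bs by (simp add: field_algebra_simps(1))
  qed
  have diag: "y (p, s, s) = \<psi> p s (b s)" if ps: "p \<in> T" "s \<in> N p" for p s
  proof -
    interpret P: banach_space "fibre U p" by (rule banach_space_fibre[OF ps(1)])
    have sT: "s \<in> T" by (rule N_T[OF ps])
    have in_P: "y (p, s, s) \<in> carrier (fibre U p)" "\<psi> p s (b s) \<in> carrier (fibre U p)"
      using y_in[OF ps ps(2)] \<psi>_in[OF ps b_in[OF sT]] .
    have "ndist (fibre U p) (y (p, s, s)) (\<psi> p s (b s)) \<le> 0"
    proof (rule field_le_epsilon)
      fix \<epsilon> :: real assume "\<epsilon> > 0"
      then have e2: "\<epsilon>/2 > 0" by simp
      from lim[OF e2] obtain x where x: "x \<in> tensor_functions"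
        "\<forall>j\<in>triples. ndist (fibre U (fst j)) (y j) (x j) \<le> \<epsilon>/2" ..
      have 1: "ndist (fibre U p) (y (p, s, s)) (x (p, s, s)) \<le> \<epsilon>/2" using triplesD[OF x(2) ps ps(2)] by simp
      have "(s, s, s) \<in> triples" using sT N_self by simp
      from bspec[OF x(2) this] have 2: "ndist (fibre U s) (b s) (tensor_product x s) \<le> \<epsilon>/2"
        using sT by (simp add: yT tensor_product_def)
      have xs: "x (p, s, s) = \<psi> p s (tensor_product x s)" by (rule tensor_product_in(2)[OF x(1) ps])
      have xs_in: "tensor_product x s \<in> carrier (fibre U s)" by (rule algebra_in[OF tensor_product_in(1)[OF x(1)] sT])
      have 3: "ndist (fibre U p) (x (p, s, s)) (\<psi> p s (b s)) = ndist (fibre U s) (tensor_product x s) (b s)"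
        unfolding xs by (rule iso_ndist[OF \<psi>_iso[OF ps] banach_space_fibre[OF sT] P.banach_space_axioms xs_in b_in[OF sT]])
      have "ndist (fibre U p) (y (p, s, s)) (\<psi> p s (b s)) \<le>
          ndist (fibre U p) (y (p, s, s)) (x (p, s, s)) + ndist (fibre U p) (x (p, s, s)) (\<psi> p s (b s))"
        using in_P tensor_in[OF x(1) ps ps(2)] by (intro P.metric.triangle)
      then show "ndist (fibre U p) (y (p, s, s)) (\<psi> p s (b s)) \<le> 0 + \<epsilon>"
        using 1 2 3 Metric_space.commute[OF Metric_space_fibre[OF sT], of "tensor_product x s"] by simp
    qed
    then show ?thesis using P.metric.zero[OF in_P] P.metric.nonneg[of "y (p, s, s)" "\<psi> p s (b s)"] by simp
  qed
  from lim[OF zero_less_one] obtain x1 where x1: "x1 \<in> tensor_functions"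
    "\<forall>j\<in>triples. ndist (fibre U (fst j)) (y j) (x1 j) \<le> 1" ..
  obtain B where B: "\<And>p s t. p \<in> T \<Longrightarrow> s \<in> N p \<Longrightarrow> t \<in> N p \<Longrightarrow> vnorm (fibre U p) (x1 (p, s, t)) \<le> B"
    using tensor_bound[OF x1(1)] by blast
  show ?thesis
  proof (rule tensor_functionsI[OF _ y_in _ bA diag])
    show "y \<in> extensional triples" using y by (simp add: PiE_iff)
    show "vnorm (fibre U p) (y (p, s, t)) \<le> B + 1" if pst: "p \<in> T" "s \<in> N p" "t \<in> N p" for p s t
      using norm[OF x1 pst] B[OF pst] by linarith
    show "\<exists>K. compactin (base U) K \<and>
      (\<forall>p\<in>T. \<forall>s\<in>N p. \<forall>t\<in>N p - K. vnorm (fibre U p) (y (p, s, t)) \<le> \<epsilon>)" if "\<epsilon> > 0" for \<epsilon>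
    proof -
      have e2: "\<epsilon>/2 > 0" using that by simp
      from lim[OF e2] obtain x where x: "x \<in> tensor_functions"
        "\<forall>j\<in>triples. ndist (fibre U (fst j)) (y j) (x j) \<le> \<epsilon>/2" ..
      from tensor_vanishes[OF x(1) e2] obtain K where K: "compactin (base U) K"
        "\<forall>p\<in>T. \<forall>s\<in>N p. \<forall>t\<in>N p - K. vnorm (fibre U p) (x (p, s, t)) \<le> \<epsilon>/2" by (elim exE conjE)
      show ?thesis
      proof (intro exI[of _ K] conjI ballI K(1))
        fix p s t assume pst: "p \<in> T" "s \<in> N p" "t \<in> N p - K"
        then have "t \<in> N p" by auto
        from norm[OF x pst(1,2) this] show "vnorm (fibre U p) (y (p, s, t)) \<le> \<epsilon>"
          using bspec[OF bspec[OF bspec[OF K(2) pst(1)] pst(2)] pst(3)] by simp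
      qed
    qed
    show "continuous_into (base U) (fibre U p) (N p) (\<lambda>t. y (p, s, t))" if ps: "p \<in> T" "s \<in> N p" for p s
    proof -
      interpret P: banach_space "fibre U p" by (rule banach_space_fibre[OF ps(1)])
      show ?thesis
      proof (rule P.continuous_into_uniform_limit[OF y_in[OF ps]])
        fix \<epsilon> :: real assume "\<epsilon> > 0"
        from lim[OF this] obtain x where x: "x \<in> tensor_functions"
          "\<forall>j\<in>triples. ndist (fibre U (fst j)) (y j) (x j) \<le> \<epsilon>" ..
        have "ndist (fibre U p) (y (p, s, t)) (x (p, s, t)) \<le> \<epsilon>" if "t \<in> N p" for t using triplesD[OF x(2) ps that] by simp
        then show "\<exists>w. continuous_into (base U) (fibre U p) (N p) w \<and>
            (\<forall>t\<in>N p. w t \<in> carrier (fibre U p) \<and> ndist (fibre U p) (y (p, s, t)) (w t) \<le> \<epsilon>)"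
          using tensor_continuous_right[OF x(1) ps] tensor_in[OF x(1) ps]
          by (intro exI[of _ "\<lambda>t. x (p, s, t)"]) simp
      qed
    qed
    show "continuous_into (base U) (fibre U p) (N p) (\<lambda>s. y (p, s, t))" if pt: "p \<in> T" "t \<in> N p" for p t
    proof -
      interpret P: banach_space "fibre U p" by (rule banach_space_fibre[OF pt(1)])
      show ?thesis
      proof (rule P.continuous_into_uniform_limit[OF y_in[OF pt(1) _ pt(2)]])
        fix \<epsilon> :: real assume "\<epsilon> > 0"
        from lim[OF this] obtain x where x: "x \<in> tensor_functions"
          "\<forall>j\<in>triples. ndist (fibre U (fst j)) (y j) (x j) \<le> \<epsilon>" ..
        have "ndist (fibre U p) (y (p, s, t)) (x (p, s, t)) \<le> \<epsilon>" if "s \<in> N p" for s using triplesD[OF x(2) pt(1) that pt(2)] by simp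
        then show "\<exists>w. continuous_into (base U) (fibre U p) (N p) w \<and>
            (\<forall>s\<in>N p. w s \<in> carrier (fibre U p) \<and> ndist (fibre U p) (y (p, s, t)) (w s) \<le> \<epsilon>)"
          using tensor_continuous_left[OF x(1) pt] tensor_in[OF x(1) pt(1) _ pt(2)]
          by (intro exI[of _ "\<lambda>s. x (p, s, t)"]) simp
      qed
    qed
  qed
qed

end

section \<open>The tensor functions as a left Banach module\<close>

context charted_field begin

text \<open>Writing zero as \<open>1 \<otimes> 0\<close> spares a separate verification of the
  clauses of \<open>tensor_functions\<close>.\<close>

lemma tensor_zero_eq: "\<zero>\<^bsub>tensor_space\<^esub> = one_tensor \<zero>\<^bsub>\<A>\<^esub>"
proof (rule extensionalityI[of _ triples])
  fix j assume "j \<in> triples"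
  then have j: "fst j \<in> T" "snd (snd j) \<in> N (fst j)" by (auto simp: triples_def)
  have "\<psi> (fst j) (snd (snd j)) \<zero>\<^bsub>fibre U (snd (snd j))\<^esub> = \<zero>\<^bsub>fibre U (fst j)\<^esub>"
    by (rule linear_map_zero[OF iso_linear[OF \<psi>_iso[OF j]] banach_space_fibre[OF N_T[OF j]] banach_space_fibre[OF j(1)]])
  then show "\<zero>\<^bsub>tensor_space\<^esub> j = one_tensor \<zero>\<^bsub>\<A>\<^esub> j"
    using \<open>j \<in> triples\<close> N_T[OF j] by (simp add: tensor_space_simps one_tensor_def algebra_apply)
qed (simp_all add: tensor_space_simps one_tensor_def)

lemma tensor_add:
  assumes "x \<in> tensor_functions" "y \<in> tensor_functions"
  shows "x \<oplus>\<^bsub>tensor_space\<^esub> y \<in> tensor_functions"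
proof -
  have "x \<oplus>\<^bsub>tensor_space\<^esub> y = (\<lambda>j\<in>triples. 1 \<odot>\<^bsub>fibre U (fst j)\<^esub> x j \<oplus>\<^bsub>fibre U (fst j)\<^esub> y j)"
    using tensor_in[OF assms(1)] banach_space.one_smult[OF banach_space_fibre]
    unfolding tensor_space_simps by (intro restrict_ext) (auto simp: triples_def)
  then show ?thesis using tensor_add_smult_in[OF assms, of 1] by simp
qed

lemma tensor_smult:
  assumes x: "x \<in> tensor_functions"
  shows "c \<odot>\<^bsub>tensor_space\<^esub> x \<in> tensor_functions"
proof -
  interpret A: banach_space \<A> by (rule banach_space_algebra)
  let ?z = "\<zero>\<^bsub>tensor_space\<^esub>"
  have z: "?z \<in> tensor_functions" unfolding tensor_zero_eq by (rule one_tensor_in) simp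
  have "c \<odot>\<^bsub>fibre U p\<^esub> x (p, s, t) = c \<odot>\<^bsub>fibre U p\<^esub> x (p, s, t) \<oplus>\<^bsub>fibre U p\<^esub> \<zero>\<^bsub>fibre U p\<^esub>"
    if pst: "p \<in> T" "s \<in> N p" "t \<in> N p" for p s t
  proof -
    interpret P: banach_space "fibre U p" by (rule banach_space_fibre[OF pst(1)])
    show ?thesis using tensor_in[OF x pst] by simp
  qed
  then have "c \<odot>\<^bsub>tensor_space\<^esub> x = (\<lambda>j\<in>triples. c \<odot>\<^bsub>fibre U (fst j)\<^esub> x j \<oplus>\<^bsub>fibre U (fst j)\<^esub> ?z j)"
    unfolding tensor_space_simps by (intro restrict_ext) (auto simp: triples_def)
  then show ?thesis using tensor_add_smult_in[OF x z, of c] by simp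
qed

lemma banach_space_tensor: "banach_space tensor_space"
proof (rule banach_space_bounded_functions[where J = triples and M = "\<lambda>j. fibre U (fst j)"])
  interpret A: banach_space \<A> by (rule banach_space_algebra)
  show "banach_space (fibre U (fst j))" if "j \<in> triples" for j
    using that by (auto simp: triples_def intro: banach_space_fibre)
  show "carrier tensor_space \<subseteq> (\<Pi>\<^sub>E j\<in>triples. carrier (fibre U (fst j)))"
    unfolding tensor_space_simps(1) tensor_functions_def by (rule Collect_restrict)
  show "\<exists>B. \<forall>j\<in>triples. vnorm (fibre U (fst j)) (y j) \<le> B" if "y \<in> carrier tensor_space" for y
    using tensor_bounded that unfolding tensor_space_simps(1) .
  show "\<zero>\<^bsub>tensor_space\<^esub> \<in> carrier tensor_space"
    unfolding tensor_zero_eq tensor_space_simps(1) by (rule one_tensor_in) simp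
  show "x \<oplus>\<^bsub>tensor_space\<^esub> y \<in> carrier tensor_space"
    if "x \<in> carrier tensor_space" "y \<in> carrier tensor_space" for x y
    using tensor_add that by (simp only: tensor_space_simps(1))
  show "c \<odot>\<^bsub>tensor_space\<^esub> x \<in> carrier tensor_space" if "x \<in> carrier tensor_space" for x c
    using tensor_smult that by (simp only: tensor_space_simps(1))
  show "y \<in> carrier tensor_space" if "y \<in> (\<Pi>\<^sub>E j\<in>triples. carrier (fibre U (fst j)))"
    "\<And>\<epsilon>. \<epsilon> > 0 \<Longrightarrow> \<exists>x\<in>carrier tensor_space. \<forall>j\<in>triples. ndist (fibre U (fst j)) (y j) (x j) \<le> \<epsilon>" for y
    using tensor_closed that by (simp only: tensor_space_simps(1))
qed (simp_all only: tensor_space_simps)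

lemma tensor_vnorm_ge:
  assumes y: "y \<in> tensor_functions" and pst: "p \<in> T" "s \<in> N p" "t \<in> N p"
  shows "vnorm (fibre U p) (y (p, s, t)) \<le> vnorm tensor_space y"
proof -
  obtain B where "\<forall>j\<in>triples. vnorm (fibre U (fst j)) (y j) \<le> B" using tensor_bounded[OF y] ..
  then show ?thesis
    using le_Sup_insert_0[of triples "\<lambda>j. vnorm (fibre U (fst j)) (y j)" B "(p, s, t)"] pst
    by (simp add: tensor_space_simps(5))
qed

lemma tensor_vnorm_le:
  assumes "\<And>p s t. p \<in> T \<Longrightarrow> s \<in> N p \<Longrightarrow> t \<in> N p \<Longrightarrow> vnorm (fibre U p) (y (p, s, t)) \<le> B" "0 \<le> B"
  shows "vnorm tensor_space y \<le> B"
  unfolding tensor_space_simps(5) by (rule Sup_insert_0_le) (use assms in \<open>auto simp: triples_def\<close>)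

text \<open>All laws are checked at one triple, in the fibre at \<open>p\<close>, where the action
  is left multiplication by the transported value of \<open>a\<close> at \<open>s\<close>. The
  action is bounded with constant 1.\<close>

lemma left_banach_module_tensor: "left_banach_module \<A> tensor_space tensor_act"
proof -
  interpret A: banach_algebra \<A> by (rule banach_algebra_algebra)
  interpret Y: banach_space tensor_space by (rule banach_space_tensor)
  note clos = tensor_act_in tensor_add tensor_smult A.add_in A.smult_in A.mult_closed
  have pt: "tensor_act (a \<oplus>\<^bsub>\<A>\<^esub> b) y (p, s, t) = (tensor_act a y \<oplus>\<^bsub>tensor_space\<^esub> tensor_act b y) (p, s, t)"
    "tensor_act a (y \<oplus>\<^bsub>tensor_space\<^esub> z) (p, s, t) = (tensor_act a y \<oplus>\<^bsub>tensor_space\<^esub> tensor_act a z) (p, s, t)"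
    "tensor_act (k \<odot>\<^bsub>\<A>\<^esub> a) y (p, s, t) = (k \<odot>\<^bsub>tensor_space\<^esub> tensor_act a y) (p, s, t)"
    "tensor_act a (k \<odot>\<^bsub>tensor_space\<^esub> y) (p, s, t) = (k \<odot>\<^bsub>tensor_space\<^esub> tensor_act a y) (p, s, t)"
    "tensor_act (a \<otimes>\<^bsub>\<A>\<^esub> b) y (p, s, t) = tensor_act a (tensor_act b y) (p, s, t)"
    "vnorm (fibre U p) (tensor_act a y (p, s, t)) \<le> vnorm (fibre U s) (a s) * vnorm (fibre U p) (y (p, s, t))"
    if ab: "a \<in> carrier \<A>" "b \<in> carrier \<A>" and yz: "y \<in> tensor_functions" "z \<in> tensor_functions"
      and pst: "p \<in> T" "s \<in> N p" "t \<in> N p" for a b y z p s t k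
  proof -
    interpret P: banach_algebra "fibre U p" using banach_fibre[OF pst(1)] .
    have sT: "s \<in> T" by (rule N_T[OF pst(1,2)])
    note v = algebra_in[OF ab(1) sT] algebra_in[OF ab(2) sT] tensor_in[OF yz(1) pst] tensor_in[OF yz(2) pst]
    note w = \<psi>_in[OF pst(1,2) v(1)] \<psi>_in[OF pst(1,2) v(2)]
    show "tensor_act (a \<oplus>\<^bsub>\<A>\<^esub> b) y (p, s, t) = (tensor_act a y \<oplus>\<^bsub>tensor_space\<^esub> tensor_act b y) (p, s, t)"
      "tensor_act a (y \<oplus>\<^bsub>tensor_space\<^esub> z) (p, s, t) = (tensor_act a y \<oplus>\<^bsub>tensor_space\<^esub> tensor_act a z) (p, s, t)"
      "tensor_act (k \<odot>\<^bsub>\<A>\<^esub> a) y (p, s, t) = (k \<odot>\<^bsub>tensor_space\<^esub> tensor_act a y) (p, s, t)"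
      "tensor_act a (k \<odot>\<^bsub>tensor_space\<^esub> y) (p, s, t) = (k \<odot>\<^bsub>tensor_space\<^esub> tensor_act a y) (p, s, t)"
      "tensor_act (a \<otimes>\<^bsub>\<A>\<^esub> b) y (p, s, t) = tensor_act a (tensor_act b y) (p, s, t)"
      using pst sT v w
      by (simp_all add: tensor_act_def tensor_space_simps(3,4) algebra_apply \<psi>_add \<psi>_smult \<psi>_mult
          P.mult_distrib_right P.mult_distrib_left P.smult_mult_left P.smult_mult_right P.mult_assoc)
    show "vnorm (fibre U p) (tensor_act a y (p, s, t)) \<le> vnorm (fibre U s) (a s) * vnorm (fibre U p) (y (p, s, t))"
      using P.vnorm_mult[OF w(1) v(3)] \<psi>_vnorm[OF pst(1,2) v(1)] pst by (simp add: tensor_act_def)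
  qed
  show ?thesis
  proof (rule left_banach_module.intro[OF banach_space_tensor], unfold_locales; unfold tensor_space_simps(1))
    show "tensor_act b y \<in> tensor_functions" if "b \<in> carrier \<A>" "y \<in> tensor_functions" for b y
      by (rule tensor_act_in[OF that])
    show "tensor_act (b \<oplus>\<^bsub>\<A>\<^esub> c) y = tensor_act b y \<oplus>\<^bsub>tensor_space\<^esub> tensor_act c y"
      if "b \<in> carrier \<A>" "c \<in> carrier \<A>" "y \<in> tensor_functions" for b c y
      by (rule tensor_eqI) (simp_all only: clos that pt(1)[OF that(1,2,3,3)])
    show "tensor_act b (y \<oplus>\<^bsub>tensor_space\<^esub> z) = tensor_act b y \<oplus>\<^bsub>tensor_space\<^esub> tensor_act b z"
      if "b \<in> carrier \<A>" "y \<in> tensor_functions" "z \<in> tensor_functions" for b y z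
      by (rule tensor_eqI) (simp_all only: clos that pt(2)[OF that(1,1,2,3)])
    show "tensor_act (k \<odot>\<^bsub>\<A>\<^esub> b) y = k \<odot>\<^bsub>tensor_space\<^esub> tensor_act b y"
      if "b \<in> carrier \<A>" "y \<in> tensor_functions" for b y k
      by (rule tensor_eqI) (simp_all only: clos that pt(3)[OF that(1,1,2,2)])
    show "tensor_act b (k \<odot>\<^bsub>tensor_space\<^esub> y) = k \<odot>\<^bsub>tensor_space\<^esub> tensor_act b y"
      if "b \<in> carrier \<A>" "y \<in> tensor_functions" for b y k
      by (rule tensor_eqI) (simp_all only: clos that pt(4)[OF that(1,1,2,2)])
    show "tensor_act (b \<otimes>\<^bsub>\<A>\<^esub> c) y = tensor_act b (tensor_act c y)"
      if "b \<in> carrier \<A>" "c \<in> carrier \<A>" "y \<in> tensor_functions" for b c y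
      by (rule tensor_eqI) (simp_all only: clos that pt(5)[OF that(1,2,3,3)])
    have "vnorm tensor_space (tensor_act b y) \<le> 1 * vnorm \<A> b * vnorm tensor_space y"
      if cy: "b \<in> carrier \<A>" "y \<in> tensor_functions" for b y
    proof (rule tensor_vnorm_le)
      have nn: "0 \<le> vnorm tensor_space y"
        using Y.vnorm_nonneg by (simp add: cy(2) tensor_space_simps(1))
      then show "0 \<le> 1 * vnorm \<A> b * vnorm tensor_space y" using A.vnorm_nonneg[OF cy(1)] by simp
      fix p s t assume pst: "p \<in> T" "s \<in> N p" "t \<in> N p"
      have "vnorm (fibre U s) (b s) * vnorm (fibre U p) (y (p, s, t)) \<le> vnorm \<A> b * vnorm tensor_space y"
        using algebra_vnorm_ge[OF cy(1) N_T[OF pst(1,2)]] tensor_vnorm_ge[OF cy(2) pst] A.vnorm_nonneg[OF cy(1)]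
          banach_space.vnorm_nonneg[OF banach_space_fibre[OF pst(1)] tensor_in[OF cy(2) pst]]
        by (intro mult_mono)
      then show "vnorm (fibre U p) (tensor_act b y (p, s, t)) \<le> 1 * vnorm \<A> b * vnorm tensor_space y"
        using pt(6)[OF cy(1,1,2,2) pst] by simp
    qed
    then show "\<exists>K. \<forall>b\<in>carrier \<A>. \<forall>y\<in>tensor_functions.
        vnorm tensor_space (tensor_act b y) \<le> K * vnorm \<A> b * vnorm tensor_space y"
      by (intro exI[of _ 1]) simp
  qed
qed

lemma tensor_product_morphism: "module_morphism \<A> tensor_space tensor_act \<A> (\<otimes>\<^bsub>\<A>\<^esub>) tensor_product"
  unfolding module_morphism_def bounded_linear_map_def
proof (intro conjI)
  show "linear_map tensor_space \<A> tensor_product"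
  proof (rule linear_mapI; unfold tensor_space_simps(1))
    show "tensor_product y \<in> carrier \<A>" if "y \<in> tensor_functions" for y by (rule tensor_product_in(1)[OF that])
    show "tensor_product (x \<oplus>\<^bsub>tensor_space\<^esub> y) = tensor_product x \<oplus>\<^bsub>\<A>\<^esub> tensor_product y"
      if "x \<in> tensor_functions" "y \<in> tensor_functions" for x y
      by (rule extensionalityI[of _ T])
        (auto simp: tensor_product_def tensor_space_simps(3) field_algebra_simps(4) N_self)
    show "tensor_product (c \<odot>\<^bsub>tensor_space\<^esub> x) = c \<odot>\<^bsub>\<A>\<^esub> tensor_product x" for c x
      by (rule extensionalityI[of _ T])
        (auto simp: tensor_product_def tensor_space_simps(4) field_algebra_simps(5) N_self)
  qed
  interpret Y: banach_space tensor_space by (rule banach_space_tensor)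
  have "vnorm \<A> (tensor_product y) \<le> 1 * vnorm tensor_space y" if y: "y \<in> tensor_functions" for y
  proof (rule algebra_vnorm_le)
    show "vnorm (fibre U t) (tensor_product y t) \<le> 1 * vnorm tensor_space y" if "t \<in> T" for t
      using tensor_vnorm_ge[OF y that N_self[OF that] N_self[OF that]] that by (simp add: tensor_product_def)
    show "0 \<le> 1 * vnorm tensor_space y" using Y.vnorm_nonneg y by (simp add: tensor_space_simps(1))
  qed
  then show "\<exists>K. \<forall>y\<in>carrier tensor_space. vnorm \<A> (tensor_product y) \<le> K * vnorm tensor_space y"
    unfolding tensor_space_simps(1) by blast
  show "\<forall>b\<in>carrier \<A>. \<forall>y\<in>carrier tensor_space. tensor_product (tensor_act b y) = b \<otimes>\<^bsub>\<A>\<^esub> tensor_product y"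
  proof (intro ballI, unfold tensor_space_simps(1))
    fix b y assume b: "b \<in> carrier \<A>" and y: "y \<in> tensor_functions"
    show "tensor_product (tensor_act b y) = b \<otimes>\<^bsub>\<A>\<^esub> tensor_product y"
    proof (rule extensionalityI[of _ T])
      show "tensor_product (tensor_act b y) p = (b \<otimes>\<^bsub>\<A>\<^esub> tensor_product y) p" if p: "p \<in> T" for p
        using p N_self[OF p] \<psi>_self[OF p algebra_in[OF b p]]
        by (simp add: tensor_product_def tensor_act_def algebra_apply)
    qed (simp_all add: tensor_product_def field_algebra_simps(2))
  qed
qed

text \<open>Projectivity lifts along epimorphisms that split as bounded linear maps; this is the
  splitting required for the product map.\<close>

lemma one_tensor_section:
  shows "bounded_linear_map \<A> tensor_space one_tensor"
    and "b \<in> carrier \<A> \<Longrightarrow> tensor_product (one_tensor b) = b"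
proof -
  interpret A: banach_space \<A> by (rule banach_space_algebra)
  have "linear_map \<A> tensor_space one_tensor"
  proof (rule linear_mapI; (unfold tensor_space_simps(1))?)
    show "one_tensor x \<in> tensor_functions" if "x \<in> carrier \<A>" for x by (rule one_tensor_in[OF that])
    show "one_tensor (x \<oplus>\<^bsub>\<A>\<^esub> y) = one_tensor x \<oplus>\<^bsub>tensor_space\<^esub> one_tensor y"
      if xy: "x \<in> carrier \<A>" "y \<in> carrier \<A>" for x y
    proof (rule tensor_eqI)
      show "one_tensor (x \<oplus>\<^bsub>\<A>\<^esub> y) \<in> tensor_functions" "one_tensor x \<oplus>\<^bsub>tensor_space\<^esub> one_tensor y \<in> tensor_functions"
        using xy by (simp_all add: one_tensor_in tensor_add)
      show "one_tensor (x \<oplus>\<^bsub>\<A>\<^esub> y) (p, s, t) = (one_tensor x \<oplus>\<^bsub>tensor_space\<^esub> one_tensor y) (p, s, t)"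
        if "p \<in> T" "s \<in> N p" "t \<in> N p" for p s t
        using that N_T[OF that(1,3)] algebra_in[OF xy(1)] algebra_in[OF xy(2)]
        by (simp add: one_tensor_def tensor_space_simps(3) algebra_apply \<psi>_add)
    qed
    show "one_tensor (c \<odot>\<^bsub>\<A>\<^esub> x) = c \<odot>\<^bsub>tensor_space\<^esub> one_tensor x" if x: "x \<in> carrier \<A>" for x c
    proof (rule tensor_eqI)
      show "one_tensor (c \<odot>\<^bsub>\<A>\<^esub> x) \<in> tensor_functions" "c \<odot>\<^bsub>tensor_space\<^esub> one_tensor x \<in> tensor_functions"
        using x by (simp_all add: one_tensor_in tensor_smult)
      show "one_tensor (c \<odot>\<^bsub>\<A>\<^esub> x) (p, s, t) = (c \<odot>\<^bsub>tensor_space\<^esub> one_tensor x) (p, s, t)"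
        if "p \<in> T" "s \<in> N p" "t \<in> N p" for p s t
        using that N_T[OF that(1,3)] algebra_in[OF x]
        by (simp add: one_tensor_def tensor_space_simps(4) algebra_apply \<psi>_smult)
    qed
  qed
  moreover have "vnorm tensor_space (one_tensor b) \<le> 1 * vnorm \<A> b" if b: "b \<in> carrier \<A>" for b
  proof (rule tensor_vnorm_le)
    show "0 \<le> 1 * vnorm \<A> b" using A.vnorm_nonneg[OF b] by simp
    fix p s t assume pst: "p \<in> T" "s \<in> N p" "t \<in> N p"
    note tT = N_T[OF pst(1,3)]
    show "vnorm (fibre U p) (one_tensor b (p, s, t)) \<le> 1 * vnorm \<A> b"
      using algebra_vnorm_ge[OF b tT] \<psi>_vnorm[OF pst(1,3) algebra_in[OF b tT]] pst by (simp add: one_tensor_def)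
  qed
  ultimately show "bounded_linear_map \<A> tensor_space one_tensor"
    unfolding bounded_linear_map_def by blast
  show "tensor_product (one_tensor b) = b" if "b \<in> carrier \<A>"
    by (rule tensor_product_eq[OF that]) (simp add: one_tensor_def)
qed

section \<open>Cutoffs and the relation defined by a splitting\<close>

definition cutoff :: "('t \<Rightarrow> real) \<Rightarrow> bool" where
  "cutoff f \<longleftrightarrow> continuous_map (base U) euclideanreal f \<and>
     (\<exists>K. compactin (base U) K \<and> (\<forall>t\<in>T - K. f t = 0))"

lemma cutoff_algebra:
  assumes "cutoff f"
  shows "scale f unit_section \<in> carrier \<A>"
proof -
  from assms obtain K where K: "continuous_map (base U) euclideanreal f" "compactin (base U) K" "\<forall>t\<in>T - K. f t = 0"
    unfolding cutoff_def by (elim exE conjE)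
  then show ?thesis
    unfolding scale_def by (intro compactly_supported_algebra[OF K(1) unit_section K(2)]) auto
qed

lemma cutoff_exists:
  assumes "compactin (base U) K"
  obtains f where "cutoff f" "\<And>t. t \<in> K \<Longrightarrow> f t = 1"
proof -
  obtain f :: "'t \<Rightarrow> real" and L where f: "continuous_map (base U) euclideanreal f"
    "\<And>x. x \<in> K \<Longrightarrow> f x = 1" "compactin (base U) L" "\<And>x. x \<notin> L \<Longrightarrow> f x = 0"
    using compact_cutoff[OF locally_compact Hausdorff assms openin_topspace compactin_subset_topspace[OF assms]]
    by metis
  then have "cutoff f" unfolding cutoff_def by (intro conjI exI[of _ L]) auto
  then show thesis using that f(2) by simp
qed

text \<open>For a splitting \<open>\<rho>\<close>, the value \<open>\<rho>(f e)(p, s, t)\<close> does not depend on the cutoff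
  \<open>f\<close> as long as \<open>f s = 1\<close>. Its norm is 1 or more for \<open>s = t\<close>, and it vanishes as \<open>t\<close> tends to
  infinity while \<open>s\<close> stays in a compact set; so it measures nearness of \<open>s\<close> and \<open>t\<close>.\<close>

lemma left_projective_imp_proper_relation:
  assumes "left_projective TYPE('u) \<A>" and j: "inj (j :: ('t \<times> 't \<times> 't \<Rightarrow> 'a) \<Rightarrow> 'u)"
  obtains E where "proper_relation (base U) E"
proof -
  have "\<exists>\<rho>. module_morphism \<A> \<A> (\<otimes>\<^bsub>\<A>\<^esub>) tensor_space tensor_act \<rho> \<and> (\<forall>b\<in>carrier \<A>. tensor_product (\<rho> b) = b)"
  proof (rule projective_module_transport[where j = j])
    show "projective_module TYPE('u) \<A> \<A> (\<otimes>\<^bsub>\<A>\<^esub>)" using assms(1) by (simp add: left_projective_def)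
    show "inj_on j (carrier tensor_space)" using j by (rule inj_on_subset) simp
    have "b \<in> tensor_product ` carrier tensor_space" if "b \<in> carrier \<A>" for b
      using one_tensor_section(2)[OF that] one_tensor_in[OF that] by (intro image_eqI[of _ _ "one_tensor b"]) (simp_all add: tensor_space_simps(1))
    then show "tensor_product ` carrier tensor_space = carrier \<A>"
      using tensor_product_in(1) by (auto simp: tensor_space_simps(1))
  qed (rule left_banach_module_tensor tensor_product_morphism one_tensor_section; assumption?)+
  then obtain \<rho> where \<rho>: "module_morphism \<A> \<A> (\<otimes>\<^bsub>\<A>\<^esub>) tensor_space tensor_act \<rho>"
    and \<rho>_product: "\<forall>b\<in>carrier \<A>. tensor_product (\<rho> b) = b" by (elim exE conjE)
  have \<rho>_in: "\<rho> b \<in> tensor_functions" if "b \<in> carrier \<A>" for b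
  proof -
    have "linear_map \<A> tensor_space \<rho>" using \<rho> by (simp add: module_morphism_def bounded_linear_map_def)
    from linear_map_closed[OF this that] show ?thesis by (simp add: tensor_space_simps(1))
  qed
  have \<rho>_act: "\<rho> (a \<otimes>\<^bsub>\<A>\<^esub> b) = tensor_act a (\<rho> b)" if "a \<in> carrier \<A>" "b \<in> carrier \<A>" for a b
    using \<rho> that by (simp add: module_morphism_def)
  define u where "u f = scale f unit_section" for f
  have u: "u f \<in> carrier \<A>" if "cutoff f" for f unfolding u_def by (rule cutoff_algebra[OF that])
  have u_apply: "u f t = complex_of_real (f t) \<odot>\<^bsub>fibre U t\<^esub> e t" if "t \<in> T" for f t
    using that by (simp add: u_def scale_apply unit_section_apply)
  have u_comm: "u f \<otimes>\<^bsub>\<A>\<^esub> u g = u g \<otimes>\<^bsub>\<A>\<^esub> u f" if fg: "cutoff f" "cutoff g" for f g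
  proof (rule algebra_eqI)
    show "u f \<otimes>\<^bsub>\<A>\<^esub> u g \<in> carrier \<A>" "u g \<otimes>\<^bsub>\<A>\<^esub> u f \<in> carrier \<A>" using u fg algebra_mult by simp_all
    fix t assume t: "t \<in> T"
    interpret F: banach_algebra "fibre U t" using banach_fibre[OF t] .
    show "(u f \<otimes>\<^bsub>\<A>\<^esub> u g) t = (u g \<otimes>\<^bsub>\<A>\<^esub> u f) t"
      using t e_in[OF t] by (simp add: algebra_apply u_apply F.smult_mult_left F.smult_mult_right F.mult_closed F.smult_smult mult.commute)
  qed
  \<comment> \<open>Since \<open>\<rho>\<close> is a morphism, the value on the left is
    \<open>\<psi> p s (u f s)\<close> times the value for \<open>u g\<close>, and
    \<open>f s = 1\<close> makes the first factor the identity of the fibre at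
    \<open>p\<close>.\<close>
  have absorb: "\<rho> (u f \<otimes>\<^bsub>\<A>\<^esub> u g) (p, s, t) = \<rho> (u g) (p, s, t)"
    if fg: "cutoff f" "cutoff g" and f1: "f s = 1" and pst: "p \<in> T" "s \<in> N p" "t \<in> N p" for f g p s t
  proof -
    have sT: "s \<in> T" by (rule N_T[OF pst(1,2)])
    interpret S: banach_space "fibre U s" by (rule banach_space_fibre[OF sT])
    have "\<psi> p s (u f s) = e p"
      using chart_identity[OF charts[OF pst(1)] pst(2)] e_in[OF sT] by (simp add: u_apply[OF sT] f1)
    then show ?thesis
      using pst e_left[OF pst(1) tensor_in[OF \<rho>_in[OF u[OF fg(2)]] pst]]
      by (simp add: \<rho>_act[OF u[OF fg(1)] u[OF fg(2)]] tensor_act_def)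
  qed
  \<comment> \<open>The product of \<open>u f\<close> and \<open>u g\<close> can absorb either
    factor, as the two commute.\<close>
  have indep: "\<rho> (u f) (p, s, t) = \<rho> (u g) (p, s, t)"
    if "cutoff f" "cutoff g" "f s = 1" "g s = 1" "p \<in> T" "s \<in> N p" "t \<in> N p" for f g p s t
    using absorb[OF that(1,2,3,5-7)] absorb[OF that(2,1,4,5-7)] u_comm[OF that(1,2)] by simp
  \<comment> \<open>Any chart and any cutoff may witness the relation; by \<open>indep\<close> the
    cutoff can be exchanged for a more convenient one. The threshold 1/2 lies strictly between 0,
    which is approached at infinity, and 1, which is a lower bound on the diagonal.\<close>
  define E0 where "E0 = {(s, t). \<exists>p f. p \<in> T \<and> s \<in> N p \<and> t \<in> N p \<and> cutoff f \<and> f s = 1 \<and>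
      1/2 < vnorm (fibre U p) (\<rho> (u f) (p, s, t))}"
  have E0I: "(s, t) \<in> E0" if "p \<in> T" "s \<in> N p" "t \<in> N p" "cutoff f" "f s = 1"
      "1/2 < vnorm (fibre U p) (\<rho> (u f) (p, s, t))" for p s t f
    using that unfolding E0_def by blast
  have E0E: "\<exists>p f. p \<in> T \<and> s \<in> N p \<and> t \<in> N p \<and> cutoff f \<and> f s = 1 \<and>
      1/2 < vnorm (fibre U p) (\<rho> (u f) (p, s, t))" if "(s, t) \<in> E0" for s t
    using that unfolding E0_def by simp
  have open_right: "\<exists>G. openin (base U) G \<and> t \<in> G \<and> G \<subseteq> {t. (s, t) \<in> E0}" if st: "(s, t) \<in> E0" for s t
  proof -
    from E0E[OF st] obtain p f where pf: "p \<in> T" "s \<in> N p" "t \<in> N p" "cutoff f" "f s = 1"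
      "1/2 < vnorm (fibre U p) (\<rho> (u f) (p, s, t))" by (elim exE conjE)
    interpret P: banach_space "fibre U p" by (rule banach_space_fibre[OF pf(1)])
    note y = \<rho>_in[OF u[OF pf(4)]]
    obtain G where "openin (base U) G" "t \<in> G" "G \<subseteq> N p" "\<forall>r\<in>G. 1/2 < vnorm (fibre U p) (\<rho> (u f) (p, s, r))"
      using P.continuous_into_vnorm_greater[OF tensor_continuous_right[OF y pf(1,2)] pf(3) tensor_in[OF y pf(1,2)] pf(6)] .
    then show ?thesis using E0I[OF pf(1,2) _ pf(4,5)] by (intro exI[of _ G]) auto
  qed
  have open_left: "\<exists>G. openin (base U) G \<and> s \<in> G \<and> G \<subseteq> {s. (s, t) \<in> E0}" if st: "(s, t) \<in> E0" for s t
  proof -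
    from E0E[OF st] obtain p f where pf: "p \<in> T" "s \<in> N p" "t \<in> N p" "cutoff f" "f s = 1"
      "1/2 < vnorm (fibre U p) (\<rho> (u f) (p, s, t))" by (elim exE conjE)
    interpret P: banach_space "fibre U p" by (rule banach_space_fibre[OF pf(1)])
    \<comment> \<open>The cutoff \<open>f\<close> is 1 at \<open>s\<close> but perhaps not nearby.
      It is exchanged for some \<open>g\<close> that is 1 on a neighbourhood of \<open>s\<close>, so
      that one tensor function tests all points near \<open>s\<close>.\<close>
    have "compactin (base U) {s}" "{s} \<subseteq> T" using N_T[OF pf(1,2)] by simp_all
    then obtain V where V: "openin (base U) V" "{s} \<subseteq> V" "compactin (base U) (base U closure_of V)"
      using regular_compact_interpolation[OF locally_compact Hausdorff _ openin_topspace] by metis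
    obtain g where g: "cutoff g" "\<And>t. t \<in> base U closure_of V \<Longrightarrow> g t = 1" using cutoff_exists[OF V(3)] by metis
    have g1: "g r = 1" if "r \<in> V" for r
      using g(2) closure_of_subset[OF openin_subset[OF V(1)]] that by auto
    have "g s = 1" using g1 V(2) by auto
    from indep[OF pf(4) g(1) pf(5) this pf(1-3)] pf(6)
    have half: "1/2 < vnorm (fibre U p) (\<rho> (u g) (p, s, t))" by simp
    note y = \<rho>_in[OF u[OF g(1)]]
    obtain G where G: "openin (base U) G" "s \<in> G" "G \<subseteq> N p" "\<forall>r\<in>G. 1/2 < vnorm (fibre U p) (\<rho> (u g) (p, r, t))"
      using P.continuous_into_vnorm_greater[OF tensor_continuous_left[OF y pf(1,3)] pf(2) tensor_in[OF y pf(1) _ pf(3)] half] .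
    have "(r, t) \<in> E0" if "r \<in> G \<inter> V" for r
      using that G(3,4) g1[of r] by (intro E0I[OF pf(1) _ pf(3) g(1)]) auto
    then show ?thesis using openin_Int[OF G(1) V(1)] G(2) V(2) by (intro exI[of _ "G \<inter> V"]) auto
  qed
  have refl: "(s, s) \<in> E0" if s: "s \<in> T" for s
  proof -
    have "compactin (base U) {s}" using s by simp
    then obtain f where f: "cutoff f" "f s = 1" using cutoff_exists by (metis singletonI)
    interpret S: banach_space "fibre U s" by (rule banach_space_fibre[OF s])
    have "\<rho> (u f) (s, s, s) = tensor_product (\<rho> (u f)) s" using s by (simp add: tensor_product_def)
    also have "\<dots> = e s" using bspec[OF \<rho>_product u[OF f(1)]] e_in[OF s] by (simp add: u_apply[OF s] f(2))
    finally have "1/2 < vnorm (fibre U s) (\<rho> (u f) (s, s, s))" using e_vnorm_ge_1[OF s] by simp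
    then show ?thesis by (rule E0I[OF s N_self[OF s] N_self[OF s] f])
  qed
  \<comment> \<open>Intersecting with the converse, instead of taking the union, keeps
    \<open>E\<close> inside \<open>E0\<close>, where images of compact sets are relatively compact.
    The decay holds in \<open>t\<close> only, so the converse offers no such control.\<close>
  define E where "E = E0 \<inter> E0\<inverse>"
  have "sym E" by (auto simp: E_def sym_def)
  moreover have "openin (base U) (E `` {x})" for x
  proof (subst openin_subopen, intro ballI)
    fix t assume "t \<in> E `` {x}"
    then have t: "(x, t) \<in> E0" "(t, x) \<in> E0" by (auto simp: E_def)
    from open_right[OF t(1)] obtain G where G: "openin (base U) G" "t \<in> G" "G \<subseteq> {t. (x, t) \<in> E0}" by (elim exE conjE)
    from open_left[OF t(2)] obtain H where H: "openin (base U) H" "t \<in> H" "H \<subseteq> {s. (s, x) \<in> E0}" by (elim exE conjE)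
    have "G \<inter> H \<subseteq> E `` {x}" using G(3) H(3) by (auto simp: E_def)
    then show "\<exists>V. openin (base U) V \<and> t \<in> V \<and> V \<subseteq> E `` {x}"
      using openin_Int[OF G(1) H(1)] G(2) H(2) by (intro exI[of _ "G \<inter> H"]) auto
  qed
  moreover have "\<exists>L. compactin (base U) L \<and> E `` K \<subseteq> L" if K: "compactin (base U) K" for K
  proof -
    \<comment> \<open>One cutoff equal to 1 on all of \<open>K\<close> serves for every
      \<open>s\<close> in \<open>K\<close>, and the decay of its tensor function in
      \<open>t\<close>, uniform in \<open>s\<close>, gives one compact set \<open>L\<close>.\<close>
    obtain f where f: "cutoff f" "\<And>t. t \<in> K \<Longrightarrow> f t = 1" using cutoff_exists[OF K] by metis
    have "(1/2 :: real) > 0" by simp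
    from tensor_vanishes[OF \<rho>_in[OF u[OF f(1)]] this] obtain L where L: "compactin (base U) L"
      "\<forall>p\<in>T. \<forall>s\<in>N p. \<forall>t\<in>N p - L. vnorm (fibre U p) (\<rho> (u f) (p, s, t)) \<le> 1/2" by (elim exE conjE)
    have "t \<in> L" if st: "(s, t) \<in> E0" and s: "s \<in> K" for s t
    proof (rule ccontr)
      assume tL: "t \<notin> L"
      from E0E[OF st] obtain p g where pg: "p \<in> T" "s \<in> N p" "t \<in> N p" "cutoff g" "g s = 1"
        "1/2 < vnorm (fibre U p) (\<rho> (u g) (p, s, t))" by (elim exE conjE)
      have "1/2 < vnorm (fibre U p) (\<rho> (u f) (p, s, t))"
        using indep[OF f(1) pg(4) f(2)[OF s] pg(5) pg(1-3)] pg(6) by simp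
      moreover have "vnorm (fibre U p) (\<rho> (u f) (p, s, t)) \<le> 1/2" using L(2) pg(1-3) tL by simp
      ultimately show False by simp
    qed
    then show ?thesis using L(1) by (intro exI[of _ L]) (auto simp: E_def)
  qed
  ultimately have "proper_relation (base U) E"
    unfolding proper_relation_def using refl by (simp add: E_def)
  then show thesis by (rule that)
qed

end

context unital_field begin

text \<open>Everything passes through a clopen exhaustion: paracompactness and left projectivity
  each produce a proper relation and hence an exhaustion, and an exhaustion gives back both, as well
  as the disjoint union.\<close>

lemma left_projective_iff_paracompact:
  "left_projective TYPE(('t, 'a, 'x) module_universe) \<A> \<longleftrightarrow> paracompact_space (base U)" (is "?L \<longleftrightarrow> ?P")
  and paracompact_imp_disjoint_union:
  "paracompact_space (base U) \<Longrightarrow> disjoint_union_of_fields sigma_locally_trivial_field U"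
proof -
  have exhausted: "\<exists>\<W> G. exhausted_space (base U) \<W> G" if rel: "proper_relation (base U) E" for E
  proof -
    obtain \<W> G where "clopen_exhaustion (base U) \<W> G"
      using proper_relation_imp_clopen_exhaustion[OF Hausdorff rel] .
    then have "exhausted_space (base U) \<W> G"
      using locally_compact Hausdorff by unfold_locales
    then show ?thesis by blast
  qed
  have P: "\<exists>\<W> G. exhausted_space (base U) \<W> G" if paracompact: ?P
  proof -
    obtain E where "proper_relation (base U) E"
      using paracompact_imp_proper_relation[OF locally_compact paracompact] .
    then show ?thesis by (rule exhausted)
  qed
  show "disjoint_union_of_fields sigma_locally_trivial_field U" if ?P
    using P[OF that] exhausted_imp_disjoint_union[OF locally_trivial] by (elim exE)
  show "?L \<longleftrightarrow> ?P"
  proof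
    show ?L if ?P using P[OF that] exhausted_imp_left_projective by (elim exE)
    assume L: ?L
    have "\<exists>N \<psi>. p \<in> T \<longrightarrow> chart U p N \<psi>" for p
      using chart_exists[OF locally_trivial, of p] by metis
    then obtain N \<psi> where "\<And>p. p \<in> T \<Longrightarrow> chart U p (N p) (\<psi> p)" by metis
    then interpret charted_field U e C N \<psi> by unfold_locales
    obtain j :: "('t \<times> 't \<times> 't \<Rightarrow> 'a) \<Rightarrow> ('t, 'a, 'x) module_universe" where "inj j"
      using ex_inj_function_universe by (elim exE)
    then obtain E where "proper_relation (base U) E"
      using left_projective_imp_proper_relation[OF L] by metis
    from exhausted[OF this] show ?P using exhausted_space.exhausted_imp_paracompact by (elim exE)
  qed
qed

end

theorem theorem4p19:
  fixes U :: "('t, 'a) alg_field" and e :: "'t \<Rightarrow> 'a" and C :: real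
  assumes "continuous_field U"
    and "locally_trivial_field U"
    and "\<And>t. t \<in> topspace (base U) \<Longrightarrow> is_identity (fibre U t) (e t)"
    and "\<And>t. t \<in> topspace (base U) \<Longrightarrow> e t \<noteq> \<zero>\<^bsub>fibre U t\<^esub>"
    and "\<And>t. t \<in> topspace (base U) \<Longrightarrow> vnorm (fibre U t) (e t) \<le> C"
  shows
    "(paracompact_space (base U) \<longleftrightarrow>
      left_projective TYPE(('t, 'a, 'x) module_universe) (field_algebra U)) \<and>
     (left_projective TYPE(('t, 'a, 'x) module_universe) (field_algebra U) \<longleftrightarrow>
      left_projective TYPE(('t, 'a, 'x) module_universe) (field_algebra U) \<and>
      disjoint_union_of_fields sigma_locally_trivial_field U) \<and>
     (left_projective TYPE(('t, 'a, 'x) module_universe) (field_algebra U) \<and>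
      disjoint_union_of_fields sigma_locally_trivial_field U \<longleftrightarrow>
      (\<forall>(X :: ('t, 'a, 'x) module_universe cnormed) lact ract.
         banach_bimodule (field_algebra U) X lact ract \<and>
         right_annihilator (field_algebra U) X ract \<longrightarrow>
         trivial_group (hochschild_cohomology (field_algebra U) X lact ract 2)))"
proof -
  let ?P = "paracompact_space (base U)" and ?D = "disjoint_union_of_fields sigma_locally_trivial_field U"
    and ?L = "left_projective TYPE(('t, 'a, 'x) module_universe) (field_algebra U)"
    and ?H = "\<forall>(X :: ('t, 'a, 'x) module_universe cnormed) lact ract.
      banach_bimodule (field_algebra U) X lact ract \<and> right_annihilator (field_algebra U) X ract \<longrightarrow>
      trivial_group (hochschild_cohomology (field_algebra U) X lact ract 2)"
  interpret unital_field U e C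
    using assms by (intro unital_field.intro unital_field_axioms.intro)
  have LP: "?L \<longleftrightarrow> ?P" by (rule left_projective_iff_paracompact)
  have PD: "?P \<Longrightarrow> ?D" by (rule paracompact_imp_disjoint_union)
  have LH: ?H if L: ?L
  proof (intro allI impI)
    fix X :: "('t, 'a, 'x) module_universe cnormed" and lact ract
    assume X: "banach_bimodule \<A> X lact ract \<and> right_annihilator \<A> X ract"
    then interpret right_annihilator_bimodule \<A> X lact ract
      using banach_algebra_algebra
      by (intro right_annihilator_bimodule.intro right_annihilator_bimodule_axioms.intro) simp_all
    show "trivial_group (hochschild_cohomology \<A> X lact ract 2)"
      by (rule projective_imp_trivial_cohomology[OF L inj_pair_universe])
  qed
  have HL: ?L if H: ?H
    by (rule trivial_cohomology_imp_projective[OF banach_algebra_algebra]) (use H in simp)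
  \<comment> \<open>The decomposition in (iii) follows from (ii) by way of (i), so adding it to (ii)
    does not strengthen it.\<close>
  show ?thesis using LP PD LH HL by argo
qed

end
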